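(* Let $u_0\in H^1(\mathbb S)$ with $h:=\int_{\mathbb S}u_{0x}^2\,dx\neq 1$, and suppose that $$\int_{\mathbb S}\big(u_0-u_0u_{0x}^2\big)\,dx=0.$$ Then the periodic single-cycle pulse problem $$u_{xt}=u+\tfrac12 u\,(u^2)_{xx}\ (t\ge0,\ x\in\mathbb R),\qquad u(0,x)=u_0(x),\qquad u(t,x+1)=u(t,x),$$ has a unique global admissible conservative weak solution, in the sense defined below.
   Context: $\mathbb S=\mathbb R/\mathbb Z$; functions on $\mathbb S$ are identified with 1-periodic functions on $\mathbb R$. For $w$ on $\mathbb S$ write - $\overline w=\int_{\mathbb S}w\,dx$; - $\mathbb Pw=w-\overline w$; - $\partial_x^{-1}w(x)=\int_0^x\mathbb Pw(y)\,dy$. $\mathcal D(\mathbb S)$ denotes smooth 1-periodic functions. A test function $\psi\in C_0^\infty(\mathbb R^+;\mathcal D(\mathbb S))$ is smooth, 1-periodic in $x$, and compactly supported in $t\in[0,\infty)$. For $u_0\in H^1(\mathbb S)$ let $h=\int_{\mathbb S}u_{0x}^2dx$. For a function $u(t,x)$ let $$f(t)=\frac{1}{1-h}\int_{\mathbb S}(1-u_x^2)\,\partial_x^{-1}(u-uu_x^2)(y)\,dy.$$ The projected problem is $$u_t-u^2u_x=\partial_x^{-1}(u-uu_x^2)-f(t),\qquad u(0,x)=u_0(x),\qquad u(t,x+1)=u(t,x).$$ A function $u\in L^\infty(\mathbb R^+;H^1(\mathbb S))$ is a global admissible conservative weak solution (of this problem, with initial datum $u_0$) if all of the following hold. (i)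 For all test functions $\psi$, $$\int_{\mathbb R^+}\!\int_{\mathbb S}(u\psi_{tx}+u^2u_x\psi_x)\,dx\,dt=\int_{\mathbb R^+}\!\int_{\mathbb S}\big(u-uu_x^2-\overline{u-uu_x^2}\big)\psi\,dx\,dt+\int_{\mathbb S}u_{0x}(x)\psi(0,x)\,dx.$$ (ii) For all test functions $\psi$, $$\int_{\mathbb R^+}\!\int_{\mathbb S}(u\psi_t-\tfrac13u^3\psi_x)\,dx\,dt=-\int_{\mathbb R^+}\!\int_{\mathbb S}\big(\partial_x^{-1}(u-uu_x^2)-f(t)\big)\psi\,dx\,dt-\int_{\mathbb S}u_0(x)\psi(0,x)\,dx.$$ (iii) The quantities $\int_{\mathbb S}u_x^2(t,x)\,dx$ and $\int_{\mathbb S}(u-uu_x^2)(t,x)\,dx$ are constant in time. (iv) For all test functions $\psi$, $$\int_{\mathbb R^+}\!\int_{\mathbb S}(u_x^2\psi_t-u^2u_x^2\psi_x)\,dz\,dt=-\int_{\mathbb R^+}\!\int_{\mathbb S}\big((u^2)_x-2u_x\overline{u-uu_x^2}\big)\psi\,dz\,dt-\int_{\mathbb S}u_{0x}^2(z)\psi(0,z)\,dz.$$ *)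

theory Defs
  imports "HOL-Analysis.Analysis"
begin

text \<open>Functions on the circle S = R/Z are 1-periodic functions on R.
  Integration over S is integration over the fundamental domain [0,1].\<close>

definition sint :: "(real \<Rightarrow> real) \<Rightarrow> real" where
  "sint w = set_lebesgue_integral lborel {0..1} w"

definition dxinv :: "(real \<Rightarrow> real) \<Rightarrow> real \<Rightarrow> real" where
  "dxinv w x = interval_lebesgue_integral lborel 0 (ereal x) (\<lambda>y. w y - sint w)"

definition stint :: "(real \<Rightarrow> real \<Rightarrow> real) \<Rightarrow> real" where
  "stint F = set_lebesgue_integral lborel {0..} (\<lambda>t. sint (F t))"

text \<open>H^1(S): f is 1-periodic and absolutely continuous with weak derivative g,
  where g is 1-periodic, measurable and square integrable over S.
  (f is the continuous representative of the H^1 class.)\<close>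
definition H1_per :: "(real \<Rightarrow> real) \<Rightarrow> (real \<Rightarrow> real) \<Rightarrow> bool" where
  "H1_per f g \<longleftrightarrow>
     (\<forall>x. f (x + 1) = f x) \<and> (\<forall>x. g (x + 1) = g x) \<and>
     g \<in> borel_measurable lborel \<and>
     set_integrable lborel {0..1} (\<lambda>x. (g x)\<^sup>2) \<and>
     (\<forall>x. f x = f 0 + interval_lebesgue_integral lborel 0 (ereal x) g)"

definition pd_t :: "(real \<Rightarrow> real \<Rightarrow> real) \<Rightarrow> real \<Rightarrow> real \<Rightarrow> real" where
  "pd_t f = (\<lambda>t x. deriv (\<lambda>s. f s x) t)"

definition pd_x :: "(real \<Rightarrow> real \<Rightarrow> real) \<Rightarrow> real \<Rightarrow> real \<Rightarrow> real" where
  "pd_x f = (\<lambda>t x. deriv (\<lambda>y. f t y) x)"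

inductive_set partials :: "(real \<Rightarrow> real \<Rightarrow> real) \<Rightarrow> (real \<Rightarrow> real \<Rightarrow> real) set"
  for f where
    self: "f \<in> partials f"
  | dt: "g \<in> partials f \<Longrightarrow> pd_t g \<in> partials f"
  | dx: "g \<in> partials f \<Longrightarrow> pd_x g \<in> partials f"

definition smooth2 :: "(real \<Rightarrow> real \<Rightarrow> real) \<Rightarrow> bool" where
  "smooth2 f \<longleftrightarrow> (\<forall>g \<in> partials f.
      continuous_on UNIV (\<lambda>p. g (fst p) (snd p)) \<and>
      (\<forall>t x. (\<lambda>s. g s x) differentiable (at t) \<and> (\<lambda>y. g t y) differentiable (at x)))"

text \<open>Test functions in C_0^infty(R^+; D(S)): smooth, 1-periodic in x,
  vanishing for all large t (restrictions to t >= 0 of such functions on R^2).\<close>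
definition test_fn :: "(real \<Rightarrow> real \<Rightarrow> real) \<Rightarrow> bool" where
  "test_fn \<psi> \<longleftrightarrow> smooth2 \<psi> \<and> (\<forall>t x. \<psi> t (x + 1) = \<psi> t x) \<and>
     (\<exists>T. \<forall>t\<ge>T. \<forall>x. \<psi> t x = 0)"

text \<open>The nonlocal term f(t), with h = int_S u0x^2.\<close>
definition fterm :: "real \<Rightarrow> (real \<Rightarrow> real \<Rightarrow> real) \<Rightarrow> (real \<Rightarrow> real \<Rightarrow> real) \<Rightarrow> real \<Rightarrow> real" where
  "fterm h u ux t = 1 / (1 - h) *
     sint (\<lambda>y. (1 - (ux t y)\<^sup>2) * dxinv (\<lambda>z. u t z - u t z * (ux t z)\<^sup>2) y)"

definition cons_weak_sol ::
  "(real \<Rightarrow> real) \<Rightarrow> (real \<Rightarrow> real) \<Rightarrow> (real \<Rightarrow> real \<Rightarrow> real) \<Rightarrow> (real \<Rightarrow> real \<Rightarrow> real) \<Rightarrow> bool" where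
  "cons_weak_sol u0 u0' u ux \<longleftrightarrow>
     (\<lambda>p. u (fst p) (snd p)) \<in> borel_measurable borel \<and>
     (\<lambda>p. ux (fst p) (snd p)) \<in> borel_measurable borel \<and>
     (\<forall>t\<ge>0. H1_per (u t) (ux t)) \<and>
     (\<exists>M. AE t in lborel. t \<ge> 0 \<longrightarrow> sint (\<lambda>x. (u t x)\<^sup>2 + (ux t x)\<^sup>2) \<le> M) \<and>
     \<comment> \<open>(i)\<close>
     (\<forall>\<psi>. test_fn \<psi> \<longrightarrow>
        stint (\<lambda>t x. u t x * pd_t (pd_x \<psi>) t x + (u t x)\<^sup>2 * ux t x * pd_x \<psi> t x) =
        stint (\<lambda>t x. (u t x - u t x * (ux t x)\<^sup>2 - sint (\<lambda>y. u t y - u t y * (ux t y)\<^sup>2)) * \<psi> t x)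
        + sint (\<lambda>x. u0' x * \<psi> 0 x)) \<and>
     \<comment> \<open>(ii)\<close>
     (\<forall>\<psi>. test_fn \<psi> \<longrightarrow>
        stint (\<lambda>t x. u t x * pd_t \<psi> t x - 1/3 * (u t x)^3 * pd_x \<psi> t x) =
        - stint (\<lambda>t x. (dxinv (\<lambda>z. u t z - u t z * (ux t z)\<^sup>2) x
                         - fterm (sint (\<lambda>x. (u0' x)\<^sup>2)) u ux t) * \<psi> t x)
        - sint (\<lambda>x. u0 x * \<psi> 0 x)) \<and>
     \<comment> \<open>(iii)\<close>
     (\<forall>t\<ge>0. sint (\<lambda>x. (ux t x)\<^sup>2) = sint (\<lambda>x. (ux 0 x)\<^sup>2) \<and>
             sint (\<lambda>x. u t x - u t x * (ux t x)\<^sup>2) = sint (\<lambda>x. u 0 x - u 0 x * (ux 0 x)\<^sup>2)) \<and>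
     \<comment> \<open>(iv), with (u^2)_x = 2 u u_x\<close>
     (\<forall>\<psi>. test_fn \<psi> \<longrightarrow>
        stint (\<lambda>t z. (ux t z)\<^sup>2 * pd_t \<psi> t z - (u t z)\<^sup>2 * (ux t z)\<^sup>2 * pd_x \<psi> t z) =
        - stint (\<lambda>t z. (2 * u t z * ux t z
                         - 2 * ux t z * sint (\<lambda>y. u t y - u t y * (ux t y)\<^sup>2)) * \<psi> t z)
        - sint (\<lambda>z. (u0' z)\<^sup>2 * \<psi> 0 z))"

end

theory Submission
  imports Defs "HOL-Complex_Analysis.Complex_Analysis"
begin

section \<open>Absolutely continuous functions, handled through their interval integrals\<close>

section \<open>Primitives of locally integrable functions\<close>

text \<open>Along the characteristics x' = -u^2 the angle \<theta> = arctan u_x satisfies \<theta>_t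
  = u as long as the charge int (u - u u_x^2) dx vanishes, and the density 1 + u_x^2 is then
  transported. Let \<xi> be the mass of this density counted from a moving origin. In this label
  X_\<xi> = cos^2 \<theta>, U_\<xi> = sin(2 \<theta>)/2 and X_t = -U^2, so that blow-up of u_x is
  only the passage of \<theta> through a zero of the cosine. A period of x becomes a period L = 1 +
  h of \<xi>. Zero charge reads int cos(2 \<theta>) U d\<xi> = 0, and int cos(2 \<theta>) d\<xi> = 1
  - h. For h \<noteq> 1 this fixes the constant of integration in U, and the problem becomes an
  ordinary differential equation \<theta>_t = U[\<theta>] with bounded Lipschitz right-hand side.

  Existence. Picard iteration in an exponentially weighted norm gives a global flow. The integrals
  of sin(2 \<theta>) and cos(2 \<theta>) keep their initial values by a Gronwall argument
  (\<open>A_zero\<close>, \<open>B_const\<close>). The iteration runs in complex time, which makes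
  \<theta> holomorphic in t. Hence for each label cos \<theta> has only countably many zeros in time
  (\<open>countable_cos_ang_zero\<close>), and by Fubini for almost every t it is nonzero at almost
  every label (\<open>AE_cos_nonzero\<close>). At those times X(t, .) is a homeomorphism, u(t, X) =
  U defines an H^1 function, and no energy sits on a null set (\<open>energy\<close>). The weak
  identities are the time derivatives of int A(t, \<xi>) \<psi>(t, X) d\<xi> for A = U cos^2
  \<theta> and A = sin^2 \<theta> (\<open>weak_identity\<close>). On the remaining null set of times
  u is reset to the datum, so the conservation laws hold at every time.

  Uniqueness. An arbitrary weak solution is regular in time only in the distributional sense.
  Testing with separated functions, and in space with countably many smooth approximations of arcs,
  gives integrated balance laws for almost every time (\<open>mass_identity\<close>,
  \<open>velocity_identity\<close>). The latter yields continuity in time, and the charge, constant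
  by (iii), must be zero (\<open>q_zero\<close>). Since u is only Hoelder continuous in x,
  characteristics are not obtained by solving x' = -u^2 but as level sets of the mass function; that
  they move with speed -u^2 is a Fubini computation of the area they sweep
  (\<open>X_characteristic\<close>). Then U_t equals the source along X
  (\<open>U_characteristic\<close>). The source is affine in X_\<xi>, so one integration by parts
  bounds the difference of two sources by the sup norms of the differences of X and U
  (\<open>source_difference\<close>). The system for (X, U) is therefore Lipschitz, and a
  contraction in an exponential weight shows that two solutions coincide
  (\<open>solutions_agree\<close>).\<close>

definition loc_int :: "(real \<Rightarrow> real) \<Rightarrow> bool" where
  "loc_int g \<longleftrightarrow> g \<in> borel_measurable borel \<and> (\<forall>a b. set_integrable lborel {a..b} g)"

text \<open>Absolute continuity of \<open>f\<close> with a chosen representative \<open>g\<close> of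
  its derivative. The integral identity replaces differentiation almost everywhere, so all calculus
  below works with equations between integrals.\<close>

definition prim :: "(real \<Rightarrow> real) \<Rightarrow> (real \<Rightarrow> real) \<Rightarrow> bool" where
  "prim f g \<longleftrightarrow> loc_int g \<and> (\<forall>a b. a \<le> b \<longrightarrow> (LBINT x:{a..b}. g x) = f b - f a)"

lemma loc_int_measurable [measurable_dest]: "loc_int g \<Longrightarrow> g \<in> borel_measurable borel"
  and loc_int_integrable: "loc_int g \<Longrightarrow> set_integrable lborel {a..b} g"
  by (auto simp: loc_int_def)

lemma prim_loc_int: "prim f g \<Longrightarrow> loc_int g"
  and prim_measurable_deriv: "prim f g \<Longrightarrow> g \<in> borel_measurable borel"
  and prim_integrable: "prim f g \<Longrightarrow> set_integrable lborel {a..b} g"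
  and prim_integral: "prim f g \<Longrightarrow> a \<le> b \<Longrightarrow> (LBINT x:{a..b}. g x) = f b - f a"
  by (auto simp: prim_def loc_int_def)

lemma set_integrable_const_Icc [simp]: "set_integrable lborel {a..b::real} (\<lambda>x. c :: 'b :: {banach, second_countable_topology})"
  by (auto simp: set_integrable_def intro!: integrable_scaleR_left integrable_real_indicator emeasure_lborel_Icc_eq[THEN ord_eq_less_trans])

lemma loc_int_add: "loc_int f \<Longrightarrow> loc_int g \<Longrightarrow> loc_int (\<lambda>x. f x + g x)"
  unfolding loc_int_def by (auto intro: borel_measurable_add set_integral_add)

lemma loc_int_diff: "loc_int f \<Longrightarrow> loc_int g \<Longrightarrow> loc_int (\<lambda>x. f x - g x)"
  unfolding loc_int_def by (auto intro: borel_measurable_diff set_integral_diff)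

lemma loc_int_cmult: "loc_int f \<Longrightarrow> loc_int (\<lambda>x. c * f x)"
  unfolding loc_int_def by (auto intro: borel_measurable_times)

lemma loc_int_const: "loc_int (\<lambda>x. c)"
  by (simp add: loc_int_def)

lemma loc_int_bound:
  assumes "loc_int f" "g \<in> borel_measurable borel" "\<And>x. \<bar>g x\<bar> \<le> \<bar>f x\<bar>"
  shows "loc_int g"
  unfolding loc_int_def
proof (intro conjI allI assms(2))
  fix a b :: real
  show "set_integrable lborel {a..b} g"
    using assms by (intro set_integrable_bound[OF loc_int_integrable[OF assms(1)]])
      (auto simp: set_borel_measurable_def)
qed

lemma loc_int_bounded:
  assumes "g \<in> borel_measurable borel" "\<And>x. \<bar>g x\<bar> \<le> C"
  shows "loc_int g"
proof (rule loc_int_bound[OF loc_int_const[of C] assms(1)])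
  show "\<bar>g x\<bar> \<le> \<bar>C\<bar>" for x using assms(2)[of x] by linarith
qed

lemma set_integrable_bounded_Icc:
  fixes f :: "real \<Rightarrow> 'b :: {banach, second_countable_topology}"
  assumes "set_borel_measurable lborel {a..b} f" "\<And>x. x \<in> {a..b} \<Longrightarrow> norm (f x) \<le> C"
  shows "set_integrable lborel {a..b} f"
  by (rule set_integrable_bound[of _ _ "\<lambda>_. \<bar>C\<bar>"])
    (use assms in \<open>auto intro!: AE_I2 order_trans[OF assms(2)]\<close>)

lemma set_integrable_off_null:
  fixes p :: "real \<Rightarrow> real"
  assumes "p \<in> borel_measurable borel" "N \<in> null_sets lborel" and C: "\<And>s. a \<le> s \<Longrightarrow> s \<le> b \<Longrightarrow> s \<notin> N \<Longrightarrow> \<bar>p s\<bar> \<le> C"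
  shows "set_integrable lborel {a..b} p"
proof (rule set_integrable_bound[of _ _ "\<lambda>_. \<bar>C\<bar>"])
  show "AE s in lborel. s \<in> {a..b} \<longrightarrow> norm (p s) \<le> norm \<bar>C\<bar>"
    using AE_not_in[OF assms(2)]
  proof eventually_elim
    case (elim s)
    show ?case using order_trans[OF C abs_ge_self, of s] elim by auto
  qed
qed (use assms(1) in \<open>simp_all add: set_borel_measurable_def\<close>)

lemma set_integral_norm_le:
  fixes f :: "real \<Rightarrow> 'b :: {banach, second_countable_topology}"
  assumes "a \<le> b" "\<And>x. x \<in> {a..b} \<Longrightarrow> norm (f x) \<le> C"
  shows "norm (LBINT x:{a..b}. f x) \<le> C * (b - a)"
proof (cases "set_integrable lborel {a..b} f")
  case True
  have "norm (LBINT x:{a..b}. f x) \<le> (LBINT x:{a..b}. norm (f x))"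
    using True by (rule set_integral_norm_bound)
  also have "\<dots> \<le> (LBINT x:{a..b}. C)"
    using True assms(2) by (intro set_integral_mono set_integrable_norm) auto
  also have "\<dots> = C * (b - a)"
    using assms(1) by (simp add: set_lebesgue_integral_def)
  finally show ?thesis .
next
  \<comment> \<open>A function that is not integrable has integral 0 by convention, so the bound
    survives without an integrability hypothesis.\<close>
  case False
  have "0 \<le> C"
    using assms(2)[of a] assms(1) norm_ge_zero[of "f a"] by (simp, linarith)
  then show ?thesis
    using False assms(1) by (simp add: set_lebesgue_integral_def set_integrable_def not_integrable_integral_eq)
qed

lemma set_integral_Icc_split:
  fixes f :: "real \<Rightarrow> 'b :: {banach, second_countable_topology}"
  assumes "a \<le> b" "b \<le> c" "set_integrable lborel {a..c} f"
  shows "(LBINT x:{a..c}. f x) = (LBINT x:{a..b}. f x) + (LBINT x:{b..c}. f x)"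
proof -
  have "(LBINT x:{a..c}. f x) = (LBINT x:{a..b} \<union> {b<..c}. f x)"
    using assms by (simp add: ivl_disj_un)
  also have "\<dots> = (LBINT x:{a..b}. f x) + (LBINT x:{b<..c}. f x)"
    using assms by (intro set_integral_Un set_integrable_subset[OF assms(3)]) auto
  also have "(LBINT x:{b<..c}. f x) = (LBINT x:{b..c}. f x)"
    by (rule set_integral_discrete_difference[where X="{b}"]) auto
  finally show ?thesis .
qed

lemma prim_add: "prim f f' \<Longrightarrow> prim g g' \<Longrightarrow> prim (\<lambda>x. f x + g x) (\<lambda>x. f' x + g' x)"
  by (simp add: prim_def loc_int_add set_integral_add loc_int_integrable)

lemma prim_diff: "prim f f' \<Longrightarrow> prim g g' \<Longrightarrow> prim (\<lambda>x. f x - g x) (\<lambda>x. f' x - g' x)"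
  by (simp add: prim_def loc_int_diff set_integral_diff loc_int_integrable)

lemma prim_cmult: "prim f f' \<Longrightarrow> prim (\<lambda>x. c * f x) (\<lambda>x. c * f' x)"
  by (simp add: prim_def loc_int_cmult right_diff_distrib)

lemma prim_const: "prim (\<lambda>x. c) (\<lambda>x. 0)"
  by (simp add: prim_def loc_int_const)

lemma prim_cong: "prim f g \<Longrightarrow> (\<And>x. f x = F x) \<Longrightarrow> (\<And>x. g x = G x) \<Longrightarrow> prim F G"
  by (subgoal_tac "f = F", subgoal_tac "g = G") auto

lemma prim_unique: "prim f h \<Longrightarrow> prim g h \<Longrightarrow> f b - f a = g b - g a"
  using prim_integral[of f h a b] prim_integral[of g h a b] prim_integral[of f h b a] prim_integral[of g h b a]
  by (cases "a \<le> b") auto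

lemma prim_exists:
  assumes "loc_int g"
  shows "prim (\<lambda>x. interval_lebesgue_integral lborel (ereal a) (ereal x) g) g"
  unfolding prim_def
proof (intro conjI allI impI assms)
  fix c d :: real assume "c \<le> d"
  have i: "interval_lebesgue_integrable lborel (ereal x) (ereal y) g" for x y
    using loc_int_integrable[OF assms]
    by (auto simp: interval_lebesgue_integrable_def intro: set_integrable_subset[of _ "{min x y..max x y}"])
  have "(LBINT x=a..c. g x) + (LBINT x=c..d. g x) = (LBINT x=a..d. g x)"
    by (rule interval_integral_sum) (simp add: i flip: ereal_min ereal_max)
  with \<open>c \<le> d\<close> show "(LBINT x:{c..d}. g x) =
      (LBINT x=a..d. g x) - (LBINT x=a..c. g x)"
    by (simp add: interval_integral_Icc)
qed

lemma prim_LBINT: "prim f g \<Longrightarrow> (LBINT x=ereal a..ereal b. g x) = f b - f a"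
  using prim_unique[OF prim_exists[OF prim_loc_int], of f g f a b a] by (simp add: interval_integral_endpoints_same)

lemma prim_continuous:
  assumes "prim f g"
  shows "continuous_on A f"
proof -
  have "isCont f x" for x
  proof -
    have "continuous_on {x-1..x+1} (\<lambda>y. f (x-1) + integral {x-1..y} g)"
      by (intro continuous_intros indefinite_integral_continuous_1 set_borel_integral_eq_integral
          prim_integrable[OF assms])
    moreover have "f (x-1) + integral {x-1..y} g = f y" if "y \<in> {x-1..x+1}" for y
      using prim_integral[OF assms, of "x-1" y] that
        set_borel_integral_eq_integral(2)[OF prim_integrable[OF assms], of "x-1" y] by simp
    ultimately have "continuous_on {x-1..x+1} f" by (subst (asm) continuous_on_cong) auto
    then show "isCont f x" by (rule continuous_on_interior) simp
  qed
  then show ?thesis by (simp add: continuous_at_imp_continuous_on)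
qed

lemma prim_measurable: "prim f g \<Longrightarrow> f \<in> borel_measurable borel"
  using prim_continuous by (rule borel_measurable_continuous_onI)

lemma prim_mono:
  assumes "prim f g" "\<And>x. 0 \<le> g x" "a \<le> b"
  shows "f a \<le> f b"
proof -
  have "0 \<le> (LBINT x:{a..b}. g x)"
    using assms(2) by (auto simp: set_lebesgue_integral_def)
  then show ?thesis using prim_integral[OF assms(1,3)] by simp
qed

lemma prim_lipschitz:
  assumes "prim f g" "\<And>x. \<bar>g x\<bar> \<le> C"
  shows "\<bar>f b - f a\<bar> \<le> C * \<bar>b - a\<bar>"
proof -
  have "\<bar>f y - f x\<bar> \<le> C * (y - x)" if "x \<le> y" for x y
    using set_integral_norm_le[OF that, of g C] prim_integral[OF assms(1) that] assms(2) by simp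
  from this[of a b] this[of b a] show ?thesis by (cases "a \<le> b") auto
qed

lemma prim_of_DERIV:
  assumes "\<And>x. (f has_real_derivative g x) (at x)" "continuous_on UNIV g"
  shows "prim f g"
  unfolding prim_def loc_int_def
proof (intro conjI allI impI)
  have c: "isCont g x" for x using assms(2) by (simp add: continuous_on_eq_continuous_at)
  show "g \<in> borel_measurable borel" using assms(2) by (rule borel_measurable_continuous_onI)
  show "set_integrable lborel {a..b} g" for a b
    using assms(2) by (intro borel_integrable_atLeastAtMost') (rule continuous_on_subset, auto)
  fix a b :: real assume "a \<le> b"
  then show "(LBINT x:{a..b}. g x) = f b - f a"
    using integral_FTC_Icc_real[of a b f g] assms(1) c
    by (simp add: set_lebesgue_integral_def mult.commute)
qed

lemma loc_int_mult_continuous: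
  assumes "continuous_on UNIV f" "loc_int g"
  shows "loc_int (\<lambda>x. f x * g x)"
  unfolding loc_int_def
proof (intro conjI allI)
  have fm [measurable]: "f \<in> borel_measurable borel"
    using assms(1) by (rule borel_measurable_continuous_onI)
  note [measurable] = loc_int_measurable[OF assms(2)]
  show "(\<lambda>x. f x * g x) \<in> borel_measurable borel" by measurable
  fix a b :: real
  have "bounded (f ` {a..b})"
    using assms(1) by (intro compact_imp_bounded compact_continuous_image) (auto intro: continuous_on_subset)
  then obtain B where B: "\<And>x. x \<in> {a..b} \<Longrightarrow> \<bar>f x\<bar> \<le> B" unfolding bounded_iff by fastforce
  show "set_integrable lborel {a..b} (\<lambda>x. f x * g x)"
  proof (rule set_integrable_bound)
    show "set_integrable lborel {a..b} (\<lambda>x. B * g x)"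
      using loc_int_integrable[OF assms(2)] by simp
    show "AE x in lborel. x \<in> {a..b} \<longrightarrow> norm (f x * g x) \<le> norm (B * g x)"
    proof (intro AE_I2 impI)
      fix x assume "x \<in> {a..b}"
      then have "\<bar>f x\<bar> \<le> \<bar>B\<bar>" using B[of x] by linarith
      then show "norm (f x * g x) \<le> norm (B * g x)" by (simp add: abs_mult mult_right_mono)
    qed
  qed (simp add: set_borel_measurable_def)
qed

subsection \<open>Change of variables along a monotone primitive\<close>

text \<open>\<open>F\<close> may have flat pieces and need not be injective. In the middle case the
  largest \<open>z\<close> in the interval with \<open>F z \<le> y\<close> takes the place of an
  inverse: by monotonicity \<open>y < F x\<close> means \<open>z < x\<close> there, and both sides
  become \<open>F d - y\<close>.\<close>

lemma emeasure_superlevel_mono: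
  assumes F: "prim F f" and f: "\<And>x. 0 \<le> f x" and cd: "c \<le> d"
  shows "(\<integral>\<^sup>+x. ennreal (f x * indicator {c..d} x) * indicator {x. y < F x} x \<partial>lborel)
    = emeasure lborel ({F c..F d} \<inter> {y<..})"
proof -
  have m: "F a \<le> F b" if "a \<le> b" for a b using prim_mono[OF F f that] .
  have int: "(\<integral>\<^sup>+x. ennreal (f x * indicator {a..b} x) \<partial>lborel) = ennreal (F b - F a)" if "a \<le> b" for a b
  proof -
    have "(\<integral>\<^sup>+x. ennreal (f x * indicator {a..b} x) \<partial>lborel) = ennreal (LBINT x:{a..b}. f x)"
      using prim_integrable[OF F] f unfolding set_lebesgue_integral_def set_integrable_def
      by (subst nn_integral_eq_integral) (auto simp: mult.commute)
    then show ?thesis using prim_integral[OF F that] by simp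
  qed
  consider "F d \<le> y" | "y < F c" | "F c \<le> y" "y < F d" by linarith
  then show ?thesis
  proof cases
    case 1
    then have "ennreal (f x * indicator {c..d} x) * indicator {x. y < F x} x = 0" for x
      using m[of x d] by (auto simp: indicator_def)
    moreover have "{F c..F d} \<inter> {y<..} = {}" using 1 by auto
    ultimately show ?thesis by (simp only:) simp
  next
    case 2
    then have "ennreal (f x * indicator {c..d} x) * indicator {x. y < F x} x =
        ennreal (f x * indicator {c..d} x)" for x
      using m[of c x] by (auto simp: indicator_def)
    moreover have "{F c..F d} \<inter> {y<..} = {F c..F d}" using 2 by auto
    ultimately show ?thesis using int[OF cd] m[OF cd] by simp
  next
    case 3
    let ?S = "{c..d} \<inter> F -` {..y}"
    have "closed ?S" by (intro continuous_closed_preimage prim_continuous[OF F]) auto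
    then have "compact ?S" by (intro compact_Int_closed[of "{c..d}" ?S, simplified Int_left_absorb]) auto
    moreover have "c \<in> ?S" using 3 cd by auto
    ultimately obtain z where z: "z \<in> ?S" "\<And>x. x \<in> ?S \<Longrightarrow> x \<le> z"
      using compact_attains_sup[of ?S] by blast
    obtain w where w: "z \<le> w" "w \<le> d" "F w = y"
      using IVT'[of F z y d] z 3 prim_continuous[OF F] by auto
    then have "w \<le> z" using z by auto
    with w have Fz: "F z = y" by simp
    have zd: "c \<le> z" "z \<le> d" using z by auto
    have "AE x in lborel. x \<noteq> z" by (rule AE_lborel_singleton)
    then have "(\<integral>\<^sup>+x. ennreal (f x * indicator {c..d} x) * indicator {x. y < F x} x \<partial>lborel)
        = (\<integral>\<^sup>+x. ennreal (f x * indicator {z..d} x) \<partial>lborel)"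
    proof (intro nn_integral_cong_AE, eventually_elim)
      case (elim x)
      have "y < F x \<longleftrightarrow> z < x" if "x \<in> {c..d}"
        using z(2)[of x] that m[of x z] Fz by fastforce
      then show ?case using elim zd by (auto simp: indicator_def)
    qed
    also have "\<dots> = ennreal (F d - y)" using int[OF zd(2)] Fz by simp
    also have "{F c..F d} \<inter> {y<..} = {y<..F d}" using 3 by auto
    then have "ennreal (F d - y) = emeasure lborel ({F c..F d} \<inter> {y<..})" using 3 by simp
    finally show ?thesis .
  qed
qed

text \<open>Change of variables as an identity of measures: \<open>F\<close> pushes \<open>f\<close>
  dx forward to Lebesgue measure on the image interval. Both measures are finite on half-lines (y,
  \<infinity>) and agree on them by \<open>emeasure_superlevel_mono\<close>, hence they are equal.
  Flat pieces of \<open>F\<close> carry no mass.\<close>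

lemma distr_prim:
  assumes F: "prim F f" and f: "\<And>x. 0 \<le> f x" and cd: "c \<le> d"
  shows "distr (density lborel (\<lambda>x. ennreal (f x * indicator {c..d} x))) borel F
    = density lborel (\<lambda>y. ennreal (indicator {F c..F d} y))"
proof (rule measure_eqI_lessThan)
  note [measurable] = prim_measurable[OF F] prim_measurable_deriv[OF F]
  let ?M = "distr (density lborel (\<lambda>x. ennreal (f x * indicator {c..d} x))) borel F"
  have 1: "emeasure ?M {y<..} = emeasure lborel ({F c..F d} \<inter> {y<..})" for y
    by (simp add: emeasure_distr emeasure_density emeasure_superlevel_mono[OF assms, symmetric]
        vimage_def)
  have 2: "emeasure (density lborel (\<lambda>y. ennreal (indicator {F c..F d} y))) {y<..} =
     emeasure lborel ({F c..F d} \<inter> {y<..})" for y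
    by (subst emeasure_density) (auto simp: ennreal_indicator simp flip: indicator_inter_arith
        intro!: nn_integral_cong)
  show "emeasure ?M {y<..} = emeasure (density lborel (\<lambda>y. ennreal (indicator {F c..F d} y))) {y<..}" for y
    unfolding 1 2 ..
  show "emeasure ?M {y<..} < \<infinity>" for y
  proof -
    have "emeasure lborel ({F c..F d} \<inter> {y<..}) \<le> emeasure lborel {F c..F d}"
      by (intro emeasure_mono) auto
    also have "\<dots> < \<infinity>" using prim_mono[OF F f cd] by simp
    finally show ?thesis unfolding 1 .
  qed
qed simp_all

lemma nn_integral_substitution_prim:
  assumes F: "prim F f" and f: "\<And>x. 0 \<le> f x" and cd: "c \<le> d" and [measurable]: "w \<in> borel_measurable borel"
  shows "(\<integral>\<^sup>+x. ennreal (f x * indicator {c..d} x) * w (F x) \<partial>lborel)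
    = (\<integral>\<^sup>+y. indicator {F c..F d} y * w y \<partial>lborel)"
proof -
  note [measurable] = prim_measurable[OF F] prim_measurable_deriv[OF F]
  have "(\<integral>\<^sup>+x. ennreal (f x * indicator {c..d} x) * w (F x) \<partial>lborel) =
    (\<integral>\<^sup>+y. w y \<partial>distr (density lborel (\<lambda>x. ennreal (f x * indicator {c..d} x))) borel F)"
    by (simp add: nn_integral_distr nn_integral_density)
  then show ?thesis unfolding distr_prim[OF F f cd]
    by (simp add: nn_integral_density ennreal_indicator)
qed

lemma integral_substitution_prim:
  fixes w :: "real \<Rightarrow> real"
  assumes F: "prim F f" and f: "\<And>x. 0 \<le> f x" and cd: "c \<le> d" and [measurable]: "w \<in> borel_measurable borel"
  shows "(LBINT x:{c..d}. w (F x) * f x) = (LBINT y:{F c..F d}. w y)"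
    and "set_integrable lborel {c..d} (\<lambda>x. w (F x) * f x) \<longleftrightarrow> set_integrable lborel {F c..F d} w"
proof -
  note [measurable] = prim_measurable[OF F] prim_measurable_deriv[OF F]
  let ?M = "density lborel (\<lambda>x. ennreal (f x * indicator {c..d} x))"
  let ?N = "density lborel (\<lambda>y. ennreal (indicator {F c..F d} y))"
  have *: "(\<lambda>x. f x * indicator {c..d} x * w (F x)) = (\<lambda>x. indicator {c..d} x *\<^sub>R (w (F x) * f x))" by auto
  have "(LBINT x:{c..d}. w (F x) * f x) = (\<integral>x. w (F x) \<partial>?M)"
    by (subst integral_real_density) (auto simp: f * set_lebesgue_integral_def)
  also have "\<dots> = (\<integral>y. w y \<partial>distr ?M borel F)" by (subst integral_distr) auto
  also have "\<dots> = (LBINT y:{F c..F d}. w y)" unfolding distr_prim[OF F f cd]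
    by (subst integral_real_density) (auto simp: set_lebesgue_integral_def)
  finally show "(LBINT x:{c..d}. w (F x) * f x) = (LBINT y:{F c..F d}. w y)" .
  have "set_integrable lborel {c..d} (\<lambda>x. w (F x) * f x) \<longleftrightarrow> integrable ?M (\<lambda>x. w (F x))"
    by (subst integrable_real_density) (auto simp: f * set_integrable_def)
  also have "\<dots> \<longleftrightarrow> integrable (distr ?M borel F) w" by (subst integrable_distr_eq) auto
  also have "\<dots> \<longleftrightarrow> set_integrable lborel {F c..F d} w" unfolding distr_prim[OF F f cd]
    by (subst integrable_real_density) (auto simp: set_integrable_def)
  finally show "set_integrable lborel {c..d} (\<lambda>x. w (F x) * f x) \<longleftrightarrow> set_integrable lborel {F c..F d} w" .
qed

text \<open>For a monotone inner function the chain rule is the substitution rule, which also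
  supplies integrability of the composite derivative.\<close>

lemma prim_compose:
  assumes F: "prim F f" and f: "\<And>x. 0 \<le> f x" and G: "prim G g"
  shows "prim (\<lambda>x. G (F x)) (\<lambda>x. g (F x) * f x)"
  unfolding prim_def loc_int_def
proof (intro conjI allI impI)
  note [measurable] = prim_measurable[OF F] prim_measurable_deriv[OF F] prim_measurable_deriv[OF G]
  show "(\<lambda>x. g (F x) * f x) \<in> borel_measurable borel" by measurable
  fix a b :: real
  show "set_integrable lborel {a..b} (\<lambda>x. g (F x) * f x)"
  proof (cases "a \<le> b")
    case True
    then show ?thesis using integral_substitution_prim(2)[OF F f True] prim_integrable[OF G] by simp
  qed (simp add: set_integrable_def)
  assume "a \<le> b"
  then show "(LBINT x:{a..b}. g (F x) * f x) = G (F b) - G (F a)"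
    using prim_mono[OF F f] by (subst integral_substitution_prim(1)[OF F f]) (auto simp: prim_integral[OF G])
qed

subsection \<open>The product rule\<close>

text \<open>By polarisation FG = ((F + G)^2 - F^2 - G^2)/2, and each square is a smooth function of
  a monotone primitive, so \<open>prim_compose\<close> applies.\<close>

lemma prim_mult_mono:
  assumes F: "prim F f" "\<And>x. 0 \<le> f x" and G: "prim G g" "\<And>x. 0 \<le> g x"
  shows "prim (\<lambda>x. F x * G x) (\<lambda>x. F x * g x + f x * G x)"
proof -
  have sq: "prim (\<lambda>x. (H x)\<^sup>2) (\<lambda>x. 2 * H x * h x)" if "prim H h" "\<And>x. 0 \<le> h x" for H h
    using that by (rule prim_compose, intro prim_of_DERIV) (auto intro!: derivative_eq_intros continuous_intros)
  have "prim (\<lambda>x. 1/2 * ((F x + G x)\<^sup>2 - (F x)\<^sup>2 - (G x)\<^sup>2))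
    (\<lambda>x. 1/2 * (2 * (F x + G x) * (f x + g x) - 2 * F x * f x - 2 * G x * g x))"
    using assms by (intro prim_cmult prim_diff sq prim_add add_nonneg_nonneg)
  then show ?thesis by (rule prim_cong) (auto simp: power2_eq_square algebra_simps)
qed

text \<open>Jordan decomposition from the positive and negative parts of the derivative. It lifts
  the product rule from monotone primitives to all of them.\<close>

lemma prim_decompose:
  assumes "prim F f"
  obtains P N p n c where "prim P p" "prim N n" "\<And>x. 0 \<le> p x" "\<And>x. 0 \<le> n x"
    "\<And>x. f x = p x - n x" "\<And>x. F x = c + P x - N x"
proof -
  note [measurable] = prim_measurable_deriv[OF assms]
  have l: "loc_int (\<lambda>x. max (f x) 0)" "loc_int (\<lambda>x. max (- f x) 0)"
    by (rule loc_int_bound[OF prim_loc_int[OF assms]]; auto)+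
  define P where "P x = interval_lebesgue_integral lborel (ereal 0) (ereal x) (\<lambda>x. max (f x) 0)" for x
  define N where "N x = interval_lebesgue_integral lborel (ereal 0) (ereal x) (\<lambda>x. max (- f x) 0)" for x
  have P: "prim P (\<lambda>x. max (f x) 0)" and N: "prim N (\<lambda>x. max (- f x) 0)"
    unfolding P_def N_def by (intro prim_exists l)+
  have *: "max (f x) 0 - max (- f x) 0 = f x" for x by auto
  have "prim (\<lambda>x. P x - N x) f" using prim_diff[OF P N] by (simp add: *)
  then have F: "F x = (F 0 - P 0 + N 0) + P x - N x" for x using prim_unique[OF assms, of _ x 0] by fastforce
  show thesis
  proof (rule that[OF P N])
    show "F x = (F 0 - P 0 + N 0) + P x - N x" for x by (rule F)
  qed (simp_all add: *)
qed

lemma prim_mult: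
  assumes F: "prim F f" and G: "prim G g"
  shows "prim (\<lambda>x. F x * G x) (\<lambda>x. F x * g x + f x * G x)"
proof -
  from F obtain P N p n c where 1: "prim P p" "prim N n" "\<And>x. 0 \<le> p x" "\<And>x. 0 \<le> n x"
    "\<And>x. f x = p x - n x" "\<And>x. F x = c + P x - N x" by (rule prim_decompose, blast)
  from G obtain P' N' p' n' c' where 2: "prim P' p'" "prim N' n'" "\<And>x. 0 \<le> p' x" "\<And>x. 0 \<le> n' x"
    "\<And>x. g x = p' x - n' x" "\<And>x. G x = c' + P' x - N' x" by (rule prim_decompose, blast)
  note m = prim_mult_mono[OF 1(1,3) 2(1,3)] prim_mult_mono[OF 1(1,3) 2(2,4)]
    prim_mult_mono[OF 1(2,4) 2(1,3)] prim_mult_mono[OF 1(2,4) 2(2,4)]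
  note l = prim_diff[OF prim_cmult[OF 1(1), of c'] prim_cmult[OF 1(2), of c']]
    prim_diff[OF prim_cmult[OF 2(1), of c] prim_cmult[OF 2(2), of c]]
  have "prim (\<lambda>x. (((P x * P' x - P x * N' x) - N x * P' x) + N x * N' x)
      + ((c' * P x - c' * N x) + (c * P' x - c * N' x)) + c * c')
    (\<lambda>x. ((((P x * p' x + p x * P' x) - (P x * n' x + p x * N' x)) - (N x * p' x + n x * P' x)) + (N x * n' x + n x * N' x))
      + ((c' * p x - c' * n x) + (c * p' x - c * n' x)) + 0)"
    by (intro prim_add[OF _ prim_const] prim_add[OF prim_add[OF prim_diff[OF prim_diff]]] m l prim_add)
  then show ?thesis by (rule prim_cong) (simp_all add: 1 2 algebra_simps)
qed

subsection \<open>Periodic functions\<close>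

lemma set_integral_shift:
  fixes g :: "real \<Rightarrow> 'b :: {banach, second_countable_topology}"
  shows "(LBINT x:{a..b}. g (x + c)) = (LBINT x:{a+c..b+c}. g x)"
    and "set_integrable lborel {a..b} (\<lambda>x. g (x + c)) \<longleftrightarrow> set_integrable lborel {a+c..b+c} g"
proof -
  have *: "indicator {a+c..b+c} (c + 1 * x) *\<^sub>R g (c + 1 * x) = indicator {a..b} x *\<^sub>R g (x + c)" for x
    by (auto simp: indicator_def add.commute)
  show "(LBINT x:{a..b}. g (x + c)) = (LBINT x:{a+c..b+c}. g x)"
    using lborel_integral_real_affine[of 1 "\<lambda>x. indicator {a+c..b+c} x *\<^sub>R g x" c]
    by (simp only: * set_lebesgue_integral_def) simp
  show "set_integrable lborel {a..b} (\<lambda>x. g (x + c)) \<longleftrightarrow> set_integrable lborel {a+c..b+c} g"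
    using lborel_integrable_real_affine_iff[of 1 "\<lambda>x. indicator {a+c..b+c} x *\<^sub>R g x" c]
    by (simp only: * set_integrable_def)
qed

lemma prim_shift:
  assumes "prim f g" shows "prim (\<lambda>x. f (x + c)) (\<lambda>x. g (x + c))"
proof -
  note [measurable] = prim_measurable_deriv[OF assms]
  show ?thesis using assms by (auto simp: prim_def loc_int_def set_integral_shift)
qed

lemma prim_period_increment:
  assumes "prim f g" "\<And>x. g (x + p) = g x"
  shows "f (x + p) - f x = f (y + p) - f y"
  using prim_unique[of "\<lambda>x. f (x + p)" g f x y] prim_shift[OF assms(1), of p] assms by (simp add: assms(2))

lemma set_integral_period:
  assumes g: "loc_int g" "\<And>x. g (x + p) = g x" and "0 \<le> p"
  shows "(LBINT x:{a..a+p}. g x) = (LBINT x:{0..p}. g x)"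
  using prim_period_increment[OF prim_exists[OF g(1), of 0] g(2), of a 0]
    prim_integral[OF prim_exists[OF g(1), of 0], of a "a+p"] prim_integral[OF prim_exists[OF g(1), of 0], of 0 p] assms(3)
  by simp

lemma periodic_int:
  fixes f :: "real \<Rightarrow> 'a"
  assumes "\<And>x. f (x + p) = f x"
  shows "f (x + of_int n * p) = f x"
proof -
  have nat: "f (x + real k * p) = f x" for k x
  proof (induction k)
    case (Suc k)
    have "f (x + real (Suc k) * p) = f ((x + real k * p) + p)" by (simp add: algebra_simps)
    then show ?case using assms Suc by simp
  qed simp
  show ?thesis
  proof (cases "n \<ge> 0")
    case True then show ?thesis using nat[of x "nat n"] by simp
  next
    case False then show ?thesis using nat[of "x + of_int n * p" "nat (- n)"] by simp
  qed
qed

lemma periodic_floor: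
  fixes f :: "real \<Rightarrow> 'a"
  assumes "\<And>x. f (x + p) = f x" "0 < p"
  obtains y where "0 \<le> y" "y < p" "f x = f y" "x = y + of_int \<lfloor>x / p\<rfloor> * p"
proof
  have "of_int \<lfloor>x / p\<rfloor> * p \<le> x" "x < (of_int \<lfloor>x / p\<rfloor> + 1) * p"
    using of_int_floor_le[of "x / p"] floor_correct[of "x / p"] assms(2)
    by (simp_all only: pos_le_divide_eq pos_divide_less_eq of_int_add of_int_1)
  then show "0 \<le> x - of_int \<lfloor>x / p\<rfloor> * p" "x - of_int \<lfloor>x / p\<rfloor> * p < p"
    by (simp_all add: algebra_simps)
  show "f x = f (x - of_int \<lfloor>x / p\<rfloor> * p)"
    using periodic_int[of f p "x - of_int \<lfloor>x / p\<rfloor> * p" "\<lfloor>x / p\<rfloor>"] assms(1) by simp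
qed simp

text \<open>The positive and the negative part of \<open>g\<close>, taken as densities on a bounded
  interval, give finite measures that agree on half-lines. The measures are equal, so their
  densities agree almost everywhere, and two parts with disjoint supports can agree only by being
  0.\<close>

lemma AE_eq_0_of_prim_0:
  assumes "loc_int g" "\<And>a b. a \<le> b \<Longrightarrow> (LBINT x:{a..b}. g x) = 0"
  shows "AE x in lborel. g x = 0"
proof -
  note [measurable] = loc_int_measurable[OF assms(1)]
  have z: "prim (\<lambda>x. 0) g" using assms by (simp add: prim_def)
  have "AE x in lborel. x \<in> {-real n..real n} \<longrightarrow> g x = 0" for n
  proof -
    let ?A = "{-real n..real n}"
    let ?p = "\<lambda>x. ennreal (max (g x) 0 * indicator ?A x)" and ?n = "\<lambda>x. ennreal (max (- g x) 0 * indicator ?A x)"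
    have l: "set_integrable lborel A (\<lambda>x. max (g x) 0)" "set_integrable lborel A (\<lambda>x. max (- g x) 0)"
       if "A \<subseteq> ?A" "A \<in> sets borel" for A
      by (rule set_integrable_subset[of _ ?A], rule set_integrable_bound[OF loc_int_integrable[OF assms(1)]];
        use that in \<open>auto simp: set_borel_measurable_def\<close>)+
    have nn: "(\<integral>\<^sup>+x. ennreal (h x * indicator ?A x) * indicator {y<..} x \<partial>lborel) =
        ennreal (LBINT x:?A \<inter> {y<..}. h x)"
      if "set_integrable lborel (?A \<inter> {y<..}) h" "\<And>x. 0 \<le> h x" for h y
    proof -
      have "(\<integral>\<^sup>+x. ennreal (h x * indicator ?A x) * indicator {y<..} x \<partial>lborel)
        = (\<integral>\<^sup>+x. ennreal (indicator (?A \<inter> {y<..}) x *\<^sub>R h x) \<partial>lborel)"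
        by (intro nn_integral_cong) (auto simp: indicator_def)
      also have "\<dots> = ennreal (LBINT x:?A \<inter> {y<..}. h x)"
        unfolding set_lebesgue_integral_def using that
        by (intro nn_integral_eq_integral) (auto simp: set_integrable_def)
      finally show ?thesis .
    qed
    have eq: "(LBINT x:?A \<inter> {y<..}. max (g x) 0) = (LBINT x:?A \<inter> {y<..}. max (- g x) 0)" for y
    proof -
      have "(LBINT x:?A \<inter> {y<..}. g x) = 0"
      proof (cases "y < real n")
        case True
        define c where "c = max y (- real n)"
        have "(LBINT x:?A \<inter> {y<..}. g x) = (LBINT x:{c..real n}. g x)"
          by (rule set_integral_discrete_difference[where X="{y}"]) (auto simp: c_def)
        also have "\<dots> = 0" using assms(2)[of c "real n"] True by (simp add: c_def)
        finally show ?thesis .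
      next
        case False
        then have "?A \<inter> {y<..} = {}" by auto
        then show ?thesis by (simp add: set_lebesgue_integral_def)
      qed
      moreover have "(LBINT x:?A \<inter> {y<..}. g x) = (LBINT x:?A \<inter> {y<..}. max (g x) 0 - max (- g x) 0)"
        by (intro set_lebesgue_integral_cong) auto
      ultimately show ?thesis by (subst (asm) set_integral_diff) (auto intro!: l)
    qed
    have "density lborel ?p = density lborel ?n"
    proof (rule measure_eqI_lessThan)
      show "emeasure (density lborel ?p) {y<..} = emeasure (density lborel ?n) {y<..}" for y
        by (simp add: emeasure_density nn l eq)
      show "emeasure (density lborel ?p) {y<..} < \<infinity>" for y
        by (simp add: emeasure_density nn l)
    qed auto
    then have "AE x in lborel. ?p x = ?n x"
      by (intro sigma_finite_measure.density_unique[OF sigma_finite_lborel]) auto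
    then show ?thesis
      by eventually_elim (auto simp: indicator_def max_def split: if_splits)
  qed
  then have "AE x in lborel. \<forall>n. x \<in> {-real n..real n} \<longrightarrow> g x = 0" unfolding AE_all_countable by blast
  then show ?thesis
  proof eventually_elim
    case (elim x)
    obtain n where "\<bar>x\<bar> \<le> real n" using real_arch_simple by blast
    then show ?case using elim[rule_format, of n] by (auto simp: abs_le_iff)
  qed
qed

section \<open>Mass coordinates attached to an H^1 function on the circle\<close>

section \<open>The Lagrangian coordinates of an \<open>H\<^sup>1\<close> function\<close>

lemma loc_int_periodic:
  assumes [measurable]: "h \<in> borel_measurable borel" and per: "\<And>x. h (x + 1) = h x"
    and int: "set_integrable lborel {0..1} h"
  shows "loc_int h"
  unfolding loc_int_def
proof (intro conjI allI assms(1))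
  have unit: "set_integrable lborel {of_int k..of_int k + 1} h" for k
    using int set_integral_shift(2)[of 0 1 h "of_int k"] periodic_int[of h 1, OF per, of _ k] by (simp add: add.commute)
  have sym: "set_integrable lborel {- real n..real n} h" for n
  proof (induction n)
    case 0
    have "set_integrable lborel {0::real} h" by (rule set_integrable_subset[OF int]) auto
    then show ?case by simp
  next
    case (Suc n)
    have "{- real (Suc n)..real (Suc n)} = {- real n..real n} \<union> {of_int (- int (Suc n))..of_int (- int (Suc n)) + 1}
      \<union> {of_int (int n)..of_int (int n) + 1}" by auto
    then show ?case using Suc unit[of "- int (Suc n)"] unit[of "int n"] by (simp only:) (intro set_integrable_Un; simp only: sets_lborel; measurable)
  qed
  fix a b :: real
  obtain n where "max \<bar>a\<bar> \<bar>b\<bar> \<le> real n" using real_arch_simple by blast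
  then have "{a..b} \<subseteq> {- real n..real n}" by auto
  then show "set_integrable lborel {a..b} h" by (intro set_integrable_subset[OF sym]) auto
qed

lemma sint_cmult: "sint (\<lambda>x. c * w x) = c * sint w"
  by (simp add: sint_def)

lemma sint_add: "loc_int v \<Longrightarrow> loc_int w \<Longrightarrow> sint (\<lambda>x. v x + w x) = sint v + sint w"
  by (simp add: sint_def set_integral_add loc_int_integrable)

lemma sint_diff: "loc_int v \<Longrightarrow> loc_int w \<Longrightarrow> sint (\<lambda>x. v x - w x) = sint v - sint w"
  by (simp add: sint_def set_integral_diff loc_int_integrable)

lemma sint_const: "sint (\<lambda>x. c) = c"
  by (simp add: sint_def set_lebesgue_integral_def)

lemma sint_prim: "prim f g \<Longrightarrow> sint g = f 1 - f 0"
  unfolding sint_def by (rule prim_integral) auto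

lemma sint_period: "loc_int w \<Longrightarrow> (\<And>x. w (x + 1) = w x) \<Longrightarrow> (LBINT x:{a..a+1}. w x) = sint w"
  unfolding sint_def by (rule set_integral_period) auto

lemma prim_dxinv: "loc_int w \<Longrightarrow> prim (dxinv w) (\<lambda>x. w x - sint w)"
  unfolding dxinv_def using prim_exists[of "\<lambda>x. w x - sint w" 0]
  by (simp add: loc_int_diff loc_int_const zero_ereal_def)

lemma dxinv_0: "dxinv w 0 = 0"
  by (simp add: dxinv_def interval_integral_endpoints_same flip: zero_ereal_def)

lemma dxinv_periodic:
  assumes w: "loc_int w" "\<And>x. w (x + 1) = w x"
  shows "dxinv w (x + 1) = dxinv w x"
  using prim_period_increment[OF prim_dxinv[OF w(1)], of 1 x 0] sint_prim[OF prim_dxinv[OF w(1)]]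
    sint_diff[OF w(1) loc_int_const[of "sint w"]] by (simp add: w sint_const)

lemma prim_eq_dxinv:
  assumes "prim F w" "sint w = 0"
  shows "F x = F 0 + dxinv w x"
  using prim_unique[OF assms(1), of "dxinv w" x 0] prim_dxinv[OF prim_loc_int[OF assms(1)]] assms(2) by (simp add: dxinv_0)

lemma
  assumes "H1_per f g"
  shows H1_per_periodic: "f (x + 1) = f x" "g (x + 1) = g x"
    and H1_per_measurable: "g \<in> borel_measurable borel"
    and H1_per_loc_int: "loc_int (\<lambda>x. (g x)\<^sup>2)" "loc_int g"
    and H1_per_prim: "prim f g"
proof -
  note a = assms[unfolded H1_per_def]
  show p: "f (x + 1) = f x" "g (x + 1) = g x" for x using a by blast+
  show [measurable]: "g \<in> borel_measurable borel" using a[THEN conjunct2, THEN conjunct2, THEN conjunct1] by simp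
  show q: "loc_int (\<lambda>x. (g x)\<^sup>2)"   proof (rule loc_int_periodic)
    show "set_integrable lborel {0..1} (\<lambda>x. (g x)\<^sup>2)" using a by blast
  qed (simp_all add: p)
  have "loc_int (\<lambda>x. 1 + (g x)\<^sup>2)" by (intro loc_int_add loc_int_const q)
  then show l: "loc_int g"
  proof (rule loc_int_bound)
    fix x
    have "2 * \<bar>g x\<bar> \<le> 1 + \<bar>g x\<bar>\<^sup>2" using sum_squares_bound[of 1 "\<bar>g x\<bar>"] by simp
    then show "\<bar>g x\<bar> \<le> \<bar>1 + (g x)\<^sup>2\<bar>" by simp
  qed simp
  have *: "f x = f 0 + interval_lebesgue_integral lborel (ereal 0) (ereal x) g" for x
    using a unfolding zero_ereal_def by blast
  show "prim f g"
    by (rule prim_cong[OF prim_add[OF prim_const[of "f 0"] prim_exists[OF l, of 0]]]) (simp_all only: *[symmetric] add_0)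
qed

lemma H1_perI:
  assumes "prim f g" "\<And>x. f (x + 1) = f x" "\<And>x. g (x + 1) = g x" "set_integrable lborel {0..1} (\<lambda>x. (g x)\<^sup>2)"
  shows "H1_per f g"
  unfolding H1_per_def using assms prim_measurable_deriv[OF assms(1)] prim_LBINT[OF assms(1), of 0]
  by (auto simp: zero_ereal_def)

text \<open>The mass coordinate \<open>R\<close> is the primitive of the density \<open>1 + g\<^sup>2\<close> (normalised by \<open>c\<close>); in it
  the inverse \<open>X\<close> is 1-Lipschitz.\<close>

locale lagrangian_coords =
  fixes f g :: "real \<Rightarrow> real" and c :: real
  assumes H1: "H1_per f g"
begin

definition "\<rho> x = 1 + (g x)\<^sup>2"
definition "R x = interval_lebesgue_integral lborel (ereal 0) (ereal x) \<rho> - c"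
definition "X = inv R"
definition "L = 1 + sint (\<lambda>x. (g x)\<^sup>2)"

lemmas f_periodic = H1_per_periodic(1)[OF H1] and g_periodic = H1_per_periodic(2)[OF H1]
  and g_measurable [measurable] = H1_per_measurable[OF H1] and prim_f = H1_per_prim[OF H1]

lemma \<rho>_pos: "0 < \<rho> x" and \<rho>_ge_1: "1 \<le> \<rho> x"
  by (simp_all add: \<rho>_def add_pos_nonneg)

lemma \<rho>_measurable [measurable]: "\<rho> \<in> borel_measurable borel"
  unfolding \<rho>_def by measurable

lemma prim_R: "prim R \<rho>"
proof -
  have "loc_int \<rho>" unfolding \<rho>_def by (intro loc_int_add loc_int_const H1_per_loc_int[OF H1])
  from prim_diff[OF prim_exists[OF this, of 0] prim_const[of c]] show ?thesis
    by (elim prim_cong) (auto simp: R_def)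
qed

lemma R_0: "R 0 = - c"
  by (simp add: R_def interval_integral_endpoints_same flip: zero_ereal_def)

lemma R_increase: "x \<le> y \<Longrightarrow> y - x \<le> R y - R x"
proof -
  assume "x \<le> y"
  have "prim (\<lambda>x. R x - x) (\<lambda>x. \<rho> x - 1)"
    by (intro prim_diff prim_R prim_of_DERIV) (auto intro!: derivative_eq_intros)
  from prim_mono[OF this _ \<open>x \<le> y\<close>] \<rho>_ge_1 show ?thesis by simp
qed

lemma R_less: "x < y \<Longrightarrow> R x < R y"
  using R_increase[of x y] by simp

lemma R_less_iff: "R x < R y \<longleftrightarrow> x < y" and R_le_iff: "R x \<le> R y \<longleftrightarrow> x \<le> y"
  using R_less[of x y] R_less[of y x] by (cases x y rule: linorder_cases; auto)+

lemma R_X: "R (X y) = y"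
proof -
  define a where "a = \<bar>y - R 0\<bar>"
  have "R (- a) \<le> y" "y \<le> R a" using R_increase[of "-a" 0] R_increase[of 0 a] by (auto simp: a_def)
  then have "\<exists>x\<ge>-a. x \<le> a \<and> R x = y"
    by (intro IVT' prim_continuous[OF prim_R]) (auto simp: a_def)
  then show ?thesis unfolding X_def by (intro f_inv_into_f) auto
qed

lemma X_R: "X (R x) = x"
  using R_X[of "R x"] R_less[of x "X (R x)"] R_less[of "X (R x)" x] by (cases x "X (R x)" rule: linorder_cases) auto

lemma X_le_iff: "X y \<le> x \<longleftrightarrow> y \<le> R x" and le_X_iff: "x \<le> X y \<longleftrightarrow> R x \<le> y"
  using R_le_iff[of "X y" x] R_le_iff[of x "X y"] by (simp_all add: R_X)

lemma X_mono: "a \<le> b \<Longrightarrow> X a \<le> X b"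
  by (simp add: X_le_iff R_X)

lemma L_pos: "0 < L" and L_ge_1: "1 \<le> L"
  by (simp_all add: L_def sint_def set_lebesgue_integral_def add_pos_nonneg)

lemma R_periodic: "R (x + 1) = R x + L"
proof -
  have "R (x + 1) - R x = R (0 + 1) - R 0"
    by (rule prim_period_increment[OF prim_R]) (simp add: \<rho>_def g_periodic)
  also have "\<dots> = sint \<rho>" using sint_prim[OF prim_R] by simp
  also have "\<dots> = L"
    unfolding \<rho>_def L_def by (simp add: sint_add loc_int_const H1_per_loc_int[OF H1] sint_const)
  finally show ?thesis by simp
qed

lemma X_periodic: "X (y + L) = X y + 1"
  using R_periodic[of "X y"] X_R[of "X y + 1"] by (simp add: R_X)

lemma X_measurable [measurable]: "X \<in> borel_measurable borel"
  by (intro borel_measurable_mono) (simp add: mono_def X_mono)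

lemma integral_X:
  assumes [measurable]: "w \<in> borel_measurable borel" and "a \<le> b"
  shows "(LBINT y:{a..b}. w (X y)) = (LBINT x:{X a..X b}. w x * \<rho> x)"
    and "set_integrable lborel {a..b} (\<lambda>y. w (X y)) \<longleftrightarrow> set_integrable lborel {X a..X b} (\<lambda>x. w x * \<rho> x)"
  using integral_substitution_prim[OF prim_R less_imp_le[OF \<rho>_pos] X_mono[OF assms(2)], of "\<lambda>y. w (X y)"]
  by (simp_all add: X_R R_X)

lemma nn_integral_X:
  assumes [measurable]: "w \<in> borel_measurable borel" and "a \<le> b"
  shows "(\<integral>\<^sup>+y. indicator {a..b} y * w (X y) \<partial>lborel) = (\<integral>\<^sup>+x. ennreal (\<rho> x * indicator {X a..X b} x) * w x \<partial>lborel)"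
  using nn_integral_substitution_prim[OF prim_R less_imp_le[OF \<rho>_pos] X_mono[OF assms(2)], of "\<lambda>y. w (X y)"]
  by (simp_all add: X_R R_X)

lemma prim_compose_X:
  assumes G: "prim G (\<lambda>x. w x * \<rho> x)" and [measurable]: "w \<in> borel_measurable borel"
  shows "prim (\<lambda>y. G (X y)) (\<lambda>y. w (X y))"
  unfolding prim_def loc_int_def
proof (intro conjI allI impI)
  fix a b :: real
  show "set_integrable lborel {a..b} (\<lambda>y. w (X y))"
  proof (cases "a \<le> b")
    case True
    then show ?thesis using prim_integrable[OF G] by (simp add: integral_X)
  qed (simp add: set_integrable_def)
  assume "a \<le> b"
  then show "(LBINT y:{a..b}. w (X y)) = G (X b) - G (X a)"
    using prim_integral[OF G X_mono] by (simp add: integral_X)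
qed simp

lemma prim_X: "prim X (\<lambda>y. 1 / \<rho> (X y))"
  using less_imp_neq[OF \<rho>_pos]
  by (intro prim_compose_X[of "\<lambda>x. x"] prim_of_DERIV[THEN prim_cong]) (auto intro!: derivative_eq_intros continuous_intros)

lemma prim_f_X: "prim (\<lambda>y. f (X y)) (\<lambda>y. g (X y) / \<rho> (X y))"
  by (intro prim_compose_X[of f "\<lambda>x. g x / \<rho> x"] prim_f[THEN prim_cong]) (auto simp: less_imp_neq[OF \<rho>_pos, symmetric])

lemma deriv_f_X_bound: "\<bar>g x / \<rho> x\<bar> \<le> 1 / 2"
proof -
  have "2 * \<bar>g x\<bar> \<le> 1 + \<bar>g x\<bar>\<^sup>2" using sum_squares_bound[of 1 "\<bar>g x\<bar>"] by simp
  then show ?thesis using \<rho>_pos[of x] by (simp add: \<rho>_def abs_of_pos pos_divide_le_eq)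
qed

text \<open>With \<theta> = arctan g, this and \<open>sin_arctan_2\<close> turn the mass-coordinate
  derivatives of \<open>X\<close> and of \<open>f \<circ> X\<close> into cos^2 \<theta> and sin(2
  \<theta>)/2. These stay bounded and analytic in \<theta> where \<open>g\<close> becomes infinite,
  which is why the flow is written for the angle.\<close>

lemma cos_arctan_sq: "(cos (arctan (g x)))\<^sup>2 = 1 / \<rho> x"
  by (simp add: cos_arctan \<rho>_def power_divide)

lemma sin_arctan_2: "sin (2 * arctan (g x)) / 2 = g x / \<rho> x"
proof -
  have "sqrt (1 + (g x)\<^sup>2) * sqrt (1 + (g x)\<^sup>2) = 1 + (g x)\<^sup>2" by (simp add: add_nonneg_nonneg)
  then have "sin (arctan (g x)) * cos (arctan (g x)) = g x / \<rho> x" by (simp add: sin_arctan cos_arctan \<rho>_def)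
  then show ?thesis by (simp add: sin_double)
qed

end

section \<open>Differentiation and holomorphy of parameter integrals\<close>

section \<open>Differentiation under the integral\<close>

text \<open>Dominated convergence for difference quotients, which the mean value inequality on the
  ball bounds by \<open>B\<close>. Measurability of \<open>g' z\<close> is obtained rather than
  assumed, as it is a limit of such quotients. The scalar field is general because the result serves
  both complex and real time.\<close>

lemma set_integral_has_field_derivative:
  fixes g :: "'a::{real_normed_field, banach, second_countable_topology} \<Rightarrow> real \<Rightarrow> 'a"
  assumes "0 < r"
    and int: "\<And>w. w \<in> ball z r \<Longrightarrow> set_integrable lborel {a..b} (g w)"
    and der: "\<And>w s. w \<in> ball z r \<Longrightarrow> s \<in> {a..b} \<Longrightarrow> ((\<lambda>w. g w s) has_field_derivative g' w s) (at w)"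
    and bd: "\<And>w s. w \<in> ball z r \<Longrightarrow> s \<in> {a..b} \<Longrightarrow> norm (g' w s) \<le> B"
  shows "((\<lambda>w. LBINT s:{a..b}. g w s) has_field_derivative (LBINT s:{a..b}. g' z s)) (at z)"
    and "set_integrable lborel {a..b} (g' z)"
proof -
  have zb: "z \<in> ball z r" using assms(1) by simp
  define q where "q w s = indicator {a..b} s *\<^sub>R ((g w s - g z s) / (w - z))" for w s
  have qint: "integrable lborel (q w)" if "w \<in> ball z r" for w
  proof -
    have "set_integrable lborel {a..b} (\<lambda>s. (g w s - g z s) / (w - z))"
      using int[OF that] int[OF zb] by (intro set_integrable_divide set_integral_diff(1)) auto
    then show ?thesis unfolding q_def set_integrable_def .
  qed
  have main: "integrable lborel (\<lambda>s. indicator {a..b} s *\<^sub>R g' z s) \<and>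
     (\<lambda>i. \<integral>s. q (X i) s \<partial>lborel) \<longlonglongrightarrow> (\<integral>s. indicator {a..b} s *\<^sub>R g' z s \<partial>lborel)"
    if X: "X \<longlonglongrightarrow> z" "\<And>i. X i \<in> ball z r" "\<And>i. X i \<noteq> z" for X
  proof -
    have lim: "(\<lambda>i. q (X i) s) \<longlonglongrightarrow> indicator {a..b} s *\<^sub>R g' z s" for s
    proof (cases "s \<in> {a..b}")
      case True
      have "((\<lambda>w. (g w s - g z s) / (w - z)) \<longlongrightarrow> g' z s) (at z)"
        using der[OF zb True] by (simp add: has_field_derivative_iff)
      then have "(\<lambda>i. (g (X i) s - g z s) / (X i - z)) \<longlonglongrightarrow> g' z s"
        using X unfolding tendsto_at_iff_sequentially comp_def by auto
      then show ?thesis using True by (simp add: q_def)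
    qed (simp add: q_def)
    have m: "q (X i) \<in> borel_measurable lborel" for i using qint[OF X(2)] by auto
    have m': "(\<lambda>s. indicator {a..b} s *\<^sub>R g' z s) \<in> borel_measurable lborel"
      by (rule borel_measurable_LIMSEQ_metric[OF m lim])
    have bnd: "norm (q (X i) s) \<le> indicator {a..b} s * B" for i s
    proof (cases "s \<in> {a..b}")
      case True
      have "norm (g (X i) s - g z s) \<le> B * norm (X i - z)"
        by (rule field_differentiable_bound[OF convex_ball[of z r]])
          (use der bd True X(2) zb in \<open>auto intro: has_field_derivative_at_within\<close>)
      then show ?thesis using X(3)[of i] True by (simp add: q_def norm_divide pos_divide_le_eq)
    qed (simp add: q_def)
    have ib: "integrable lborel (\<lambda>s. indicator {a..b} s * B)"
      using set_integrable_const_Icc[of a b B] by (simp add: set_integrable_def)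
    show ?thesis
      using integrable_dominated_convergence[OF m' m ib AE_I2[OF lim] AE_I2[OF bnd]]
        integral_dominated_convergence[OF m' m ib AE_I2[OF lim] AE_I2[OF bnd]] by blast
  qed
  have shift: "\<exists>N. \<forall>i\<ge>N. X i \<in> ball z r" if "X \<longlonglongrightarrow> z" for X
    using topological_tendstoD[OF that open_ball zb] by (simp add: eventually_sequentially)
  have "((\<lambda>w. \<integral>s. q w s \<partial>lborel) \<longlongrightarrow> (LBINT s:{a..b}. g' z s)) (at z)"
    unfolding tendsto_at_iff_sequentially comp_def
  proof (intro allI impI)
    fix X assume X: "\<forall>i. X i \<in> UNIV - {z}" "X \<longlonglongrightarrow> z"
    from shift[OF X(2)] obtain N where "\<forall>i\<ge>N. X i \<in> ball z r" ..
    then have "\<And>i. X (i + N) \<in> ball z r" by simp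
    then have "(\<lambda>i. \<integral>s. q (X (i + N)) s \<partial>lborel) \<longlonglongrightarrow> (LBINT s:{a..b}. g' z s)"
      using main[of "\<lambda>i. X (i + N)"] X LIMSEQ_ignore_initial_segment[OF X(2), of N]
      by (simp add: set_lebesgue_integral_def)
    then show "(\<lambda>i. \<integral>s. q (X i) s \<partial>lborel) \<longlonglongrightarrow> (LBINT s:{a..b}. g' z s)"
      by (rule LIMSEQ_offset)
  qed
  moreover have "eventually (\<lambda>w. (\<integral>s. q w s \<partial>lborel) =
      ((LBINT s:{a..b}. g w s) - (LBINT s:{a..b}. g z s)) / (w - z)) (at z)"
  proof -
    have "eventually (\<lambda>w. w \<in> ball z r) (at z)"
      using assms(1) by (intro eventually_at_in_open') auto
    then show ?thesis
    proof eventually_elim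
      case (elim w)
      have "(\<integral>s. q w s \<partial>lborel) = (LBINT s:{a..b}. (g w s - g z s) / (w - z))"
        unfolding q_def set_lebesgue_integral_def ..
      also have "\<dots> = ((LBINT s:{a..b}. g w s) - (LBINT s:{a..b}. g z s)) / (w - z)"
        unfolding set_integral_diff(2)[OF int[OF elim] int[OF zb], symmetric] by (rule set_integral_divide_zero)
      finally show ?case .
    qed
  qed
  ultimately show "((\<lambda>w. LBINT s:{a..b}. g w s) has_field_derivative (LBINT s:{a..b}. g' z s)) (at z)"
    unfolding has_field_derivative_iff using tendsto_cong by fast
  \<comment> \<open>A concrete sequence tending to \<open>z\<close> extracts integrability of
    \<open>g' z\<close> from \<open>main\<close>.\<close>
  define X where "X i = z + of_real (r / 2 / real (Suc i))" for i
  have "X \<longlonglongrightarrow> z + of_real 0"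
    unfolding X_def by (intro tendsto_intros LIMSEQ_Suc lim_const_over_n)
  moreover have "X i \<noteq> z" for i using assms(1) by (simp add: X_def del: of_real_divide)
  moreover have "X i \<in> ball z r" for i
  proof -
    define q where "q = r / 2 / real (Suc i)"
    have "q \<le> r / 2 / 1" unfolding q_def using assms(1) by (intro divide_left_mono) auto
    also have "\<dots> < r" using assms(1) by simp
    moreover have "0 < q" using assms(1) by (simp add: q_def)
    ultimately show ?thesis unfolding X_def q_def[symmetric] by (simp add: dist_norm)
  qed
  ultimately show "set_integrable lborel {a..b} (g' z)"
    using main[of X] by (simp add: set_integrable_def)
qed

text \<open>A bound on the functions alone suffices: Cauchy's estimate on discs of half the
  available radius turns it into a bound on the derivatives, uniform near \<open>z\<close>.\<close>

lemma holomorphic_on_set_integral: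
  fixes g :: "complex \<Rightarrow> real \<Rightarrow> complex"
  assumes "open S" and meas: "\<And>w. w \<in> S \<Longrightarrow> set_borel_measurable lborel {a..b} (g w)"
    and hol: "\<And>s. s \<in> {a..b} \<Longrightarrow> (\<lambda>w. g w s) holomorphic_on S"
    and bd: "\<And>w s. w \<in> S \<Longrightarrow> s \<in> {a..b} \<Longrightarrow> norm (g w s) \<le> M"
  shows "(\<lambda>w. LBINT s:{a..b}. g w s) holomorphic_on S"
proof -
  have "(\<lambda>w. LBINT s:{a..b}. g w s) field_differentiable (at z)" if zS: "z \<in> S" for z
  proof -
    obtain R where R: "0 < R" "cball z R \<subseteq> S" using open_contains_cball[THEN iffD1, rule_format, OF \<open>open S\<close> zS] by blast
    define r where "r = R / 2"
    have r: "0 < r" using R by (simp add: r_def)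
    have sub: "cball w r \<subseteq> S" if "w \<in> ball z r" for w
    proof
      fix y assume "y \<in> cball w r"
      then have "dist z y \<le> R" using that dist_triangle[of z y w] by (simp add: r_def)
      then show "y \<in> S" using R(2) by auto
    qed
    have wS: "w \<in> S" if "w \<in> ball z r" for w using sub[OF that] r by auto
    show ?thesis unfolding field_differentiable_def
    proof (rule exI, rule set_integral_has_field_derivative(1)[OF r])
      fix w assume w: "w \<in> ball z r"
      show "set_integrable lborel {a..b} (g w)"
        by (rule set_integrable_bounded_Icc[OF meas[OF wS[OF w]] bd[OF wS[OF w]]])
      fix s assume s: "s \<in> {a..b}"
      show "((\<lambda>w. g w s) has_field_derivative deriv (\<lambda>w. g w s) w) (at w)"
        using hol[OF s] \<open>open S\<close> wS[OF w] by (rule holomorphic_derivI)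
      have "norm ((deriv ^^ 1) (\<lambda>w. g w s) w) \<le> fact 1 * M / r ^ 1"
      proof (rule Cauchy_inequality)
        show "(\<lambda>w. g w s) holomorphic_on ball w r"
          using hol[OF s] sub[OF w] ball_subset_cball by (blast intro: holomorphic_on_subset)
        show "continuous_on (cball w r) (\<lambda>w. g w s)"
          using hol[OF s] sub[OF w] by (blast intro: holomorphic_on_imp_continuous_on holomorphic_on_subset)
        show "norm (g x s) \<le> M" if "norm (w - x) = r" for x
          using that sub[OF w] s by (intro bd) (auto simp: dist_norm)
      qed (rule r)
      then show "norm (deriv (\<lambda>w. g w s) w) \<le> M / r" by simp
    qed
  qed
  then show ?thesis by (simp add: holomorphic_on_open[OF \<open>open S\<close>] field_differentiable_def)
qed

section \<open>Global solution of the angle equation, holomorphic in time\<close>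

section \<open>The Lagrangian flow, by Picard iteration in a complex time strip\<close>

text \<open>Integration along the ray from 0 to \<open>z\<close> gains a factor 1/\<mu> in the norm
  weighted by exp(-\<mu> |z|). A large \<mu> thus makes Picard iteration contract on the whole time
  axis at once, without gluing local solutions.\<close>

lemma norm_bound_exp_weight:
  fixes D :: "complex \<Rightarrow> complex"
  assumes der: "\<And>s. 0 \<le> s \<Longrightarrow> s \<le> 1 \<Longrightarrow> (D has_field_derivative D' (of_real s * z)) (at (of_real s * z))"
    and bd: "\<And>s. 0 \<le> s \<Longrightarrow> s \<le> 1 \<Longrightarrow> norm (D' (of_real s * z)) \<le> c * exp (\<mu> * norm (of_real s * z))"
    and "D 0 = 0" "0 < \<mu>" "0 \<le> c"
  shows "norm (D z) \<le> c / \<mu> * exp (\<mu> * norm z)"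
proof -
  have d: "((\<lambda>s. D (of_real s * z)) has_vector_derivative D' (of_real s * z) * z) (at s)" if "0 \<le> s" "s \<le> 1" for s
    by (rule has_vector_derivative_real_field[where f = "\<lambda>w. D (w * z)"], rule DERIV_chain2[where f=D])
      (use der[OF that] in \<open>auto intro!: derivative_eq_intros\<close>)
  have "norm (D (of_real 1 * z) - D (of_real 0 * z)) \<le> c / \<mu> * exp (\<mu> * (1 * norm z)) - c / \<mu> * exp (\<mu> * (0 * norm z))"
  proof (rule differentiable_bound_general)
    show "continuous_on {0..1} (\<lambda>s. D (of_real s * z))"
      using d by (intro continuous_at_imp_continuous_on ballI has_vector_derivative_continuous) auto
    fix s :: real assume s: "0 < s" "s < 1"
    show "((\<lambda>s. D (of_real s * z)) has_vector_derivative D' (of_real s * z) * z) (at s)" using d s by simp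
    show "((\<lambda>s. c / \<mu> * exp (\<mu> * (s * norm z))) has_vector_derivative c * norm z * exp (\<mu> * (s * norm z))) (at s)"
      using assms(4) unfolding has_real_derivative_iff_has_vector_derivative[symmetric]
      by (auto intro!: derivative_eq_intros)
    show "norm (D' (of_real s * z) * z) \<le> c * norm z * exp (\<mu> * (s * norm z))"
      using mult_right_mono[OF bd[of s], of "norm z"] s by (simp add: norm_mult mult.assoc mult.left_commute)
         (simp add: mult.commute)
  qed (use assms(4) in \<open>auto intro!: continuous_intros\<close>)
  then have "norm (D z) \<le> c / \<mu> * exp (\<mu> * norm z) - c / \<mu>" using assms(3) by simp
  with divide_nonneg_pos[OF assms(5,4)] show ?thesis by linarith
qed

lemma complex_trig_measurable:
  fixes f :: "'a \<Rightarrow> complex"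
  assumes "f \<in> borel_measurable M"
  shows "(\<lambda>x. sin (f x)) \<in> borel_measurable M" "(\<lambda>x. cos (f x)) \<in> borel_measurable M"
  by (rule borel_measurable_continuous_on[OF _ assms]; intro continuous_intros)+

lemma cmod_sin_2_le: "\<bar>Im z\<bar> \<le> 1 \<Longrightarrow> cmod (sin (2 * z)) \<le> exp 2"
  and cmod_cos_2_le: "\<bar>Im z\<bar> \<le> 1 \<Longrightarrow> cmod (cos (2 * z)) \<le> exp 2"
  using cmod_sin_le_exp[of 1 "2 * z"] cmod_cos_le_exp[of 1 "2 * z"] by (auto elim!: order_trans)

lemma
  assumes "\<bar>Im w\<bar> \<le> 1" "\<bar>Im z\<bar> \<le> 1"
  shows cmod_sin_2_diff_le: "cmod (sin (2 * w) - sin (2 * z)) \<le> 2 * exp 2 * cmod (w - z)"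
    and cmod_cos_2_diff_le: "cmod (cos (2 * w) - cos (2 * z)) \<le> 2 * exp 2 * cmod (w - z)"
proof -
  let ?S = "{z. Im z \<le> 1} \<inter> {z. Im z \<ge> -1}"
  have S: "convex ?S" by (intro convex_Int convex_halfspace_Im_le convex_halfspace_Im_ge)
  have b: "norm (2 * cos (2 * x)) \<le> 2 * exp 2" "norm (- 2 * sin (2 * x)) \<le> 2 * exp 2" if "x \<in> ?S" for x
    using that cmod_sin_2_le[of x] cmod_cos_2_le[of x] by (auto simp: norm_mult)
  show "cmod (sin (2 * w) - sin (2 * z)) \<le> 2 * exp 2 * cmod (w - z)"
    by (rule field_differentiable_bound[OF S _ b(1), of "\<lambda>x. sin (2 * x)"]) (use assms in \<open>auto intro!: derivative_eq_intros\<close>)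
  show "cmod (cos (2 * w) - cos (2 * z)) \<le> 2 * exp 2 * cmod (w - z)"
    by (rule field_differentiable_bound[OF S _ b(2), of "\<lambda>x. cos (2 * x)"]) (use assms in \<open>auto intro!: derivative_eq_intros\<close>)
qed

locale picard =
  fixes L \<kappa> :: real and \<theta>\<^sub>0 :: "real \<Rightarrow> real"
  assumes L_pos: "0 < L" and \<theta>\<^sub>0_measurable [measurable]: "\<theta>\<^sub>0 \<in> borel_measurable borel"
begin

text \<open>For an angle \<open>w\<close>, this is the primitive of U_\<xi> = sin(2 w)/2 that
  vanishes at label 0. \<open>vel\<close> subtracts the constant that makes int cos(2 w) vel = 0 as
  soon as \<kappa> int cos(2 w) = 1. The truncation by \<open>min L \<xi>\<close> keeps everything
  bounded for arbitrary labels.\<close>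

definition "primS w \<xi> = 1/2 * (LBINT j:{0..min L \<xi>}. sin (2 * w j))" for w :: "real \<Rightarrow> complex"
definition "vel w \<xi> = primS w \<xi> - of_real \<kappa> * (LBINT j:{0..L}. primS w j * cos (2 * w j))"
text \<open>Complex sine and cosine are bounded and Lipschitz only in horizontal strips. Bounding
  the imaginary part by 1 gives the bound exp 2 for sin(2 w) and cos(2 w).\<close>

definition "adm w \<longleftrightarrow> w \<in> borel_measurable borel \<and> (\<forall>j. \<bar>Im (w j)\<bar> \<le> 1)" for w :: "real \<Rightarrow> complex"

definition "CS = exp 2 * L / 2"
definition "CV = CS + \<bar>\<kappa>\<bar> * (CS * exp 2 * L)"
definition "CK = exp 2 * L + \<bar>\<kappa>\<bar> * ((exp 2 * L * exp 2 + CS * (2 * exp 2)) * L)"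

lemma C_nonneg: "0 \<le> CS" "0 \<le> CV" "0 \<le> CK"
  using L_pos by (auto simp: CS_def CV_def CK_def)

lemma adm_measurable [measurable_dest]: "adm w \<Longrightarrow> w \<in> borel_measurable borel"
  by (simp add: adm_def)

lemma adm_Im: "adm w \<Longrightarrow> \<bar>Im (w j)\<bar> \<le> 1"
  by (simp add: adm_def)

lemma adm_sin_measurable: "adm w \<Longrightarrow> set_borel_measurable lborel {a..b} (\<lambda>j. sin (2 * w j))"
  unfolding set_borel_measurable_def by (intro borel_measurable_scaleR complex_trig_measurable) auto

lemma adm_sin_integrable: "adm w \<Longrightarrow> set_integrable lborel {a..b} (\<lambda>j. sin (2 * w j))"
  by (rule set_integrable_bounded_Icc[OF adm_sin_measurable cmod_sin_2_le[OF adm_Im]])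

lemma norm_set_integral_clamp:
  fixes h :: "real \<Rightarrow> complex"
  assumes "\<And>j. norm (h j) \<le> B"
  shows "norm (LBINT j:{0..min L \<xi>}. h j) \<le> B * L"
proof (cases "0 \<le> min L \<xi>")
  case True
  have "0 \<le> B" using assms[of 0] norm_ge_zero[of "h 0"] by linarith
  have "norm (LBINT j:{0..min L \<xi>}. h j) \<le> B * (min L \<xi> - 0)"
    by (rule set_integral_norm_le[OF True assms])
  also have "\<dots> \<le> B * L" using \<open>0 \<le> B\<close> by (intro mult_left_mono) auto
  finally show ?thesis .
next
  case False
  then have "{0..min L \<xi>} = {}" by auto
  moreover have "0 \<le> B" using assms[of 0] norm_ge_zero[of "h 0"] by linarith
  ultimately show ?thesis using L_pos by (simp add: set_lebesgue_integral_def)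
qed

lemma primS_bound: "adm w \<Longrightarrow> norm (primS w \<xi>) \<le> CS"
  using norm_set_integral_clamp[of "\<lambda>j. sin (2 * w j)" "exp 2" \<xi>]
  by (simp add: primS_def CS_def norm_divide adm_def cmod_sin_2_le)

lemma primS_lipschitz:
  assumes "adm w" shows "norm (primS w b - primS w a) \<le> exp 2 / 2 * \<bar>b - a\<bar>"
proof -
  have *: "norm (primS w b - primS w a) \<le> exp 2 / 2 * (b - a)" if "a \<le> b" for a b
  proof -
    let ?f = "\<lambda>j. sin (2 * w j)"
    define a' b' where "a' = max 0 (min L a)" and "b' = max 0 (min L b)"
    have eq: "(LBINT j:{0..min L x}. ?f j) = (LBINT j:{0..max 0 (min L x)}. ?f j)" for x
    proof (cases "0 \<le> min L x")
      case False
      then have 1: "{0..min L x} = {}" "max 0 (min L x) = 0" by auto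
      have "norm (LBINT j:{0..0}. ?f j) \<le> exp 2 * (0 - 0)"
        using assms by (intro set_integral_norm_le) (auto simp: adm_def cmod_sin_2_le)
      then show ?thesis unfolding 1 by (simp add: set_lebesgue_integral_def)
    qed (simp add: max_absorb2)
    have ab: "0 \<le> a'" "a' \<le> b'" "b' - a' \<le> b - a" using that by (auto simp: a'_def b'_def)
    have "primS w b - primS w a = 1/2 * (LBINT j:{a'..b'}. ?f j)"
      unfolding primS_def eq a'_def[symmetric] b'_def[symmetric]
      using set_integral_Icc_split[OF ab(1,2) adm_sin_integrable[OF assms]] by (simp add: algebra_simps)
    also have "norm \<dots> \<le> 1/2 * (exp 2 * (b' - a'))"
      using set_integral_norm_le[OF ab(2), of ?f "exp 2"] assms by (simp add: norm_mult adm_def cmod_sin_2_le)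
    also have "\<dots> \<le> exp 2 / 2 * (b - a)" using ab by simp
    finally show ?thesis .
  qed
  show ?thesis using *[of a b] *[of b a] by (cases "a \<le> b") (auto simp: norm_minus_commute)
qed

lemma lipschitz_continuous:
  fixes h :: "real \<Rightarrow> complex"
  assumes "\<And>a b. norm (h b - h a) \<le> C * \<bar>b - a\<bar>"
  shows "continuous_on UNIV h"
proof (rule continuous_at_imp_continuous_on, intro ballI)
  fix x
  have "((\<lambda>y. C * \<bar>y - x\<bar>) \<longlongrightarrow> C * \<bar>x - x\<bar>) (at x)" by (intro tendsto_intros)
  then have t: "((\<lambda>y. C * \<bar>y - x\<bar>) \<longlongrightarrow> 0) (at x)" by simp
  have "((\<lambda>y. h y - h x) \<longlongrightarrow> 0) (at x)"
    by (rule Lim_null_comparison[OF _ t]) (intro always_eventually allI assms)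
  then show "isCont h x" by (simp add: isCont_def LIM_zero_iff)
qed

lemma primS_measurable: "adm w \<Longrightarrow> primS w \<in> borel_measurable borel"
  by (rule borel_measurable_continuous_onI[OF lipschitz_continuous[OF primS_lipschitz]])

lemma adm_prod_measurable: "adm w \<Longrightarrow> set_borel_measurable lborel {a..b} (\<lambda>j. primS w j * cos (2 * w j))"
  using primS_measurable[of w] unfolding set_borel_measurable_def
  by (intro borel_measurable_scaleR borel_measurable_times complex_trig_measurable) auto

lemma adm_prod_bound: "adm w \<Longrightarrow> norm (primS w j * cos (2 * w j)) \<le> CS * exp 2"
  unfolding norm_mult by (intro mult_mono primS_bound cmod_cos_2_le adm_Im C_nonneg norm_ge_zero)

lemma adm_prod_integrable: "adm w \<Longrightarrow> set_integrable lborel {a..b} (\<lambda>j. primS w j * cos (2 * w j))"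
  by (rule set_integrable_bounded_Icc[OF adm_prod_measurable adm_prod_bound])

lemma vel_bound:
  assumes "adm w" shows "norm (vel w \<xi>) \<le> CV"
proof -
  have "norm (LBINT j:{0..L}. primS w j * cos (2 * w j)) \<le> CS * exp 2 * (L - 0)"
    using L_pos by (intro set_integral_norm_le adm_prod_bound assms) auto
  then have "norm (of_real \<kappa> * (LBINT j:{0..L}. primS w j * cos (2 * w j))) \<le> \<bar>\<kappa>\<bar> * (CS * exp 2 * L)"
    by (simp add: norm_mult mult_left_mono)
  with primS_bound[OF assms, of \<xi>] show ?thesis unfolding vel_def CV_def
    by (intro order_trans[OF norm_triangle_ineq4] add_mono)
qed

lemma vel_lipschitz_arg: "adm w \<Longrightarrow> norm (vel w b - vel w a) \<le> exp 2 / 2 * \<bar>b - a\<bar>"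
  using primS_lipschitz[of w b a] by (simp add: vel_def)

lemma vel_lipschitz:
  assumes w: "adm w" and v: "adm v" and d: "\<And>j. norm (w j - v j) \<le> d"
  shows "norm (vel w \<xi> - vel v \<xi>) \<le> CK * d"
proof -
  have d0: "0 \<le> d" using d[of 0] norm_ge_zero[of "w 0 - v 0"] by linarith
  have im: "\<bar>Im (w j)\<bar> \<le> 1" "\<bar>Im (v j)\<bar> \<le> 1" for j using w v by (auto simp: adm_def)
  have sb: "norm (sin (2 * w j) - sin (2 * v j)) \<le> 2 * exp 2 * d"
    and cb: "norm (cos (2 * w j) - cos (2 * v j)) \<le> 2 * exp 2 * d" for j
    by (rule order_trans[OF cmod_sin_2_diff_le[OF im]], use mult_left_mono[OF d[of j], of "2 * exp 2"] in simp)
      (rule order_trans[OF cmod_cos_2_diff_le[OF im]], use mult_left_mono[OF d[of j], of "2 * exp 2"] in simp)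
  have S: "norm (primS w \<xi> - primS v \<xi>) \<le> exp 2 * L * d" for \<xi>
  proof -
    have "primS w \<xi> - primS v \<xi> = 1/2 * (LBINT j:{0..min L \<xi>}. sin (2 * w j) - sin (2 * v j))"
      using w v by (simp add: primS_def set_integral_diff adm_sin_integrable right_diff_distrib)
    also have "norm \<dots> \<le> 1/2 * (2 * exp 2 * d * L)"
      using norm_set_integral_clamp[of "\<lambda>j. sin (2 * w j) - sin (2 * v j)", OF sb, of \<xi>] by (simp add: norm_divide mult_ac)
    finally show ?thesis by (simp add: mult_ac)
  qed
  have pt: "norm (primS w j * cos (2 * w j) - primS v j * cos (2 * v j))
      \<le> exp 2 * L * d * exp 2 + CS * (2 * exp 2 * d)" for j
  proof -
    have "primS w j * cos (2 * w j) - primS v j * cos (2 * v j)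
      = (primS w j - primS v j) * cos (2 * w j) + primS v j * (cos (2 * w j) - cos (2 * v j))"
      by (simp add: algebra_simps)
    also have "norm \<dots> \<le> exp 2 * L * d * exp 2 + CS * (2 * exp 2 * d)"
    proof (rule order_trans[OF norm_triangle_ineq], rule add_mono)
      show "norm ((primS w j - primS v j) * cos (2 * w j)) \<le> exp 2 * L * d * exp 2"
        unfolding norm_mult using L_pos d0 by (intro mult_mono S cmod_cos_2_le im) auto
      show "norm (primS v j * (cos (2 * w j) - cos (2 * v j))) \<le> CS * (2 * exp 2 * d)"
        unfolding norm_mult by (intro mult_mono primS_bound v cb C_nonneg norm_ge_zero)
    qed
    finally show ?thesis .
  qed
  let ?I = "\<lambda>w. LBINT j:{0..L}. primS w j * cos (2 * w j)"
  have "?I w - ?I v = (LBINT j:{0..L}. primS w j * cos (2 * w j) - primS v j * cos (2 * v j))"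
    using w v by (simp add: set_integral_diff adm_prod_integrable)
  also have "norm \<dots> \<le> (exp 2 * L * d * exp 2 + CS * (2 * exp 2 * d)) * (L - 0)"
    using L_pos by (intro set_integral_norm_le pt) auto
  finally have I: "norm (?I w - ?I v) \<le> (exp 2 * L * d * exp 2 + CS * (2 * exp 2 * d)) * L" by simp
  have "vel w \<xi> - vel v \<xi> = (primS w \<xi> - primS v \<xi>) - of_real \<kappa> * (?I w - ?I v)"
    by (simp add: vel_def algebra_simps)
  also have "norm \<dots> \<le> exp 2 * L * d + \<bar>\<kappa>\<bar> * ((exp 2 * L * d * exp 2 + CS * (2 * exp 2 * d)) * L)"
    using mult_left_mono[OF I, of "\<bar>\<kappa>\<bar>"]
    by (intro order_trans[OF norm_triangle_ineq4] add_mono S) (simp_all only: norm_mult norm_of_real abs_ge_zero)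
  also have "\<dots> = CK * d" by (simp add: CK_def algebra_simps)
  finally show ?thesis .
qed

text \<open>The strip is so narrow that a function with derivative bounded by \<open>CV\<close> which is real on the real axis
  satisfies the bound on imaginary parts in \<open>adm\<close>.\<close>

definition "\<delta> = 1 / (CV + 1)"
definition "strip = {z. Im z < \<delta>} \<inter> {z. Im z > - \<delta>}"

lemma \<delta>: "0 < \<delta>" "CV * \<delta> \<le> 1"
  using C_nonneg by (auto simp: \<delta>_def)

lemma strip: "open strip" "convex strip" "of_real t \<in> strip"
  using \<delta>(1) by (auto simp: strip_def open_halfspace_Im_lt open_halfspace_Im_gt
      intro!: convex_Int open_Int convex_halfspace_Im_lt convex_halfspace_Im_gt)

lemma strip_scale: "z \<in> strip \<Longrightarrow> 0 \<le> s \<Longrightarrow> s \<le> 1 \<Longrightarrow> of_real s * z \<in> strip"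
  using strip(2)[unfolded convex_alt, rule_format, of 0 z s] strip(3)[of 0] by (simp add: scaleR_conv_of_real)

text \<open>The time integral from 0, taken as a holomorphic primitive. It exists because the strip
  is convex, and it is determined on the strip by its value at 0.\<close>

definition "primitive f = (SOME g. (\<forall>z\<in>strip. (g has_field_derivative f z) (at z)) \<and> g 0 = 0)"
  for f :: "complex \<Rightarrow> complex"

lemma primitive:
  assumes "f holomorphic_on strip"
  shows "z \<in> strip \<Longrightarrow> (primitive f has_field_derivative f z) (at z)" "primitive f 0 = 0"
proof -
  obtain g where g: "\<And>x. x \<in> strip \<Longrightarrow> (g has_field_derivative f x) (at x within strip)"
    using holomorphic_convex_primitive'[OF strip(2,1) assms] by blast
  have "\<exists>g. (\<forall>z\<in>strip. (g has_field_derivative f z) (at z)) \<and> g 0 = 0"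
  proof (intro exI[of _ "\<lambda>z. g z - g 0"] conjI ballI)
    fix z assume z: "z \<in> strip"
    have "(g has_field_derivative f z) (at z)" using g[OF z] unfolding at_within_open[OF z strip(1)] .
    from DERIV_diff[OF this DERIV_const[of "g 0"]]
    show "((\<lambda>z. g z - g 0) has_field_derivative f z) (at z)" by simp
  qed simp
  from someI_ex[OF this] show "z \<in> strip \<Longrightarrow> (primitive f has_field_derivative f z) (at z)" "primitive f 0 = 0"
    unfolding primitive_def by blast+
qed

primrec iter :: "nat \<Rightarrow> complex \<Rightarrow> real \<Rightarrow> complex" where
  "iter 0 = (\<lambda>z \<xi>. of_real (\<theta>\<^sub>0 \<xi>))"
| "iter (Suc k) = (\<lambda>z \<xi>. of_real (\<theta>\<^sub>0 \<xi>) + primitive (\<lambda>w. vel (iter k w) \<xi>) z)"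

lemma vel_holomorphic:
  assumes adm: "\<And>z. z \<in> strip \<Longrightarrow> adm (w z)" and hol: "\<And>\<xi>. (\<lambda>z. w z \<xi>) holomorphic_on strip"
  shows "(\<lambda>z. vel (w z) \<xi>) holomorphic_on strip"
proof -
  have S: "(\<lambda>z. primS (w z) \<xi>) holomorphic_on strip" for \<xi>
    unfolding primS_def
    by (intro holomorphic_on_mult holomorphic_on_const holomorphic_on_set_integral[OF strip(1)])
      (use adm hol in \<open>auto intro!: holomorphic_intros intro: adm_sin_measurable cmod_sin_2_le adm_Im\<close>)
  show ?thesis unfolding vel_def
    by (intro holomorphic_on_diff S holomorphic_on_mult holomorphic_on_const holomorphic_on_set_integral[OF strip(1)])
      (use adm hol S in \<open>auto intro!: holomorphic_intros intro: adm_prod_measurable adm_prod_bound\<close>)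
qed

lemma vel_real:
  assumes "\<And>j. Im (w j) = 0" shows "Im (vel w \<xi>) = 0"
proof -
  have w: "w = (\<lambda>j. of_real (Re (w j)))" using assms by (auto simp: complex_eq_iff)
  have sin: "sin (2 * w j) = of_real (sin (2 * Re (w j)))" for j
    using sin_of_real[of "2 * Re (w j)", where 'a=complex] by (subst w) simp
  have S: "primS w \<xi> = of_real (1/2 * (LBINT j:{0..min L \<xi>}. sin (2 * Re (w j))))" for \<xi>
    unfolding primS_def sin set_integral_complex_of_real by simp
  have "vel w \<xi> = of_real (1/2 * (LBINT j:{0..min L \<xi>}. sin (2 * Re (w j)))
    - \<kappa> * (LBINT j:{0..L}. 1/2 * (LBINT j:{0..min L j}. sin (2 * Re (w j))) * cos (2 * Re (w j))))"
  proof -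
    have cos: "cos (2 * w j) = of_real (cos (2 * Re (w j)))" for j
      using cos_of_real[of "2 * Re (w j)", where 'a=complex] by (subst w) simp
    show ?thesis unfolding vel_def S cos of_real_mult[symmetric] set_integral_complex_of_real of_real_diff ..
  qed
  then show ?thesis by simp
qed

text \<open>The three invariants support one another. Admissibility and holomorphy of an iterate
  make its velocity holomorphic, so the next iterate is defined; real velocities on the real axis
  keep the next iterate real there; and since the derivative is at most \<open>CV\<close> while the
  half-width \<delta> satisfies CV \<delta> \<le> 1, imaginary parts stay at most 1.\<close>

lemma iter_invariant:
  "(\<forall>z\<in>strip. adm (iter k z)) \<and> (\<forall>\<xi>. (\<lambda>z. iter k z \<xi>) holomorphic_on strip) \<and> (\<forall>t \<xi>. Im (iter k (of_real t) \<xi>) = 0)"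
proof (induction k)
  case 0
  then show ?case by (simp add: adm_def)
next
  case (Suc k)
  then have adm: "\<And>z. z \<in> strip \<Longrightarrow> adm (iter k z)" and re: "\<And>t \<xi>. Im (iter k (of_real t) \<xi>) = 0"
    and hol: "\<And>\<xi>. (\<lambda>z. vel (iter k z) \<xi>) holomorphic_on strip" by (auto intro: vel_holomorphic)
  let ?P = "\<lambda>\<xi>. primitive (\<lambda>w. vel (iter k w) \<xi>)"
  note P = primitive[OF hol]
  have hol': "(\<lambda>z. iter (Suc k) z \<xi>) holomorphic_on strip" for \<xi>
    using P(1) by (auto simp: holomorphic_on_open[OF strip(1)] intro!: exI derivative_eq_intros)
  have re': "Im (iter (Suc k) (of_real t) \<xi>) = 0" for t \<xi>
  proof -
    have "((\<lambda>t. Im (?P \<xi> (of_real t))) has_vector_derivative Im (vel (iter k (of_real s)) \<xi>)) (at s)" for s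
      by (intro bounded_linear.has_vector_derivative[OF bounded_linear_Im] has_vector_derivative_real_field P(1) strip(3))
    then have "((\<lambda>t. Im (?P \<xi> (of_real t))) has_real_derivative 0) (at s)" for s
      unfolding vel_real[OF re] has_real_derivative_iff_has_vector_derivative .
    from DERIV_isconst_all[OF allI, OF this, of t 0] P(2) show ?thesis by simp
  qed
  have "adm (iter (Suc k) z)" if z: "z \<in> strip" for z
    unfolding adm_def
  proof (intro conjI allI)
    \<comment> \<open>The primitive is chosen separately for each label, so measurability in the
      label has to be earned: the velocity is Lipschitz in the label, and the primitive inherits
      this.\<close>
    have "norm (?P b z - ?P a z) \<le> (exp 2 / 2 * norm z) * \<bar>b - a\<bar>" for a b
    proof -
      have "norm ((?P b z - ?P a z) - (?P b 0 - ?P a 0)) \<le> (exp 2 / 2 * \<bar>b - a\<bar>) * norm (z - 0)"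
      proof (rule field_differentiable_bound[OF strip(2)])
        fix w assume w: "w \<in> strip"
        show "((\<lambda>z. ?P b z - ?P a z) has_field_derivative (vel (iter k w) b - vel (iter k w) a)) (at w within strip)"
          by (rule has_field_derivative_at_within[OF DERIV_diff[OF P(1)[OF w] P(1)[OF w]]])
        show "norm (vel (iter k w) b - vel (iter k w) a) \<le> exp 2 / 2 * \<bar>b - a\<bar>"
          by (intro vel_lipschitz_arg adm w)
      qed (use z strip(3)[of 0] in simp_all)
      then show ?thesis by (simp add: P(2) mult_ac)
    qed
    then have [measurable]: "(\<lambda>\<xi>. ?P \<xi> z) \<in> borel_measurable borel"
      by (intro borel_measurable_continuous_onI lipschitz_continuous)
    have "(\<lambda>\<xi>. of_real (\<theta>\<^sub>0 \<xi>) + ?P \<xi> z) \<in> borel_measurable borel" by measurable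
    then show "iter (Suc k) z \<in> borel_measurable borel" by simp
    fix \<xi>
    \<comment> \<open>Comparison with the real point below or above \<open>z\<close>, where the
      iterate is real; the distance is |Im z| \<le> \<delta>.\<close>
    have "norm (?P \<xi> z - ?P \<xi> (of_real (Re z))) \<le> CV * norm (z - of_real (Re z))"
      by (rule field_differentiable_bound[OF strip(2) has_field_derivative_at_within[OF P(1)] vel_bound[OF adm]])
        (simp_all only: z strip(3))
    also have "norm (z - of_real (Re z)) \<le> \<delta>" using z by (auto simp: strip_def cmod_def)
    also have "CV * \<delta> \<le> 1" by (rule \<delta>)
    finally have "norm (iter (Suc k) z \<xi> - iter (Suc k) (of_real (Re z)) \<xi>) \<le> 1"
      using C_nonneg by (simp add: mult_left_mono)
    with re'[of "Re z" \<xi>] show "\<bar>Im (iter (Suc k) z \<xi>)\<bar> \<le> 1"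
      by (smt (verit) abs_Im_le_cmod minus_complex.sel(2))
  qed
  then show ?case using hol' re' by blast
qed

lemmas iter_adm = iter_invariant[THEN conjunct1, rule_format]
lemmas iter_holomorphic = iter_invariant[THEN conjunct2, THEN conjunct1, rule_format]
lemmas iter_real = iter_invariant[THEN conjunct2, THEN conjunct2, rule_format]

lemma iter_vel_holomorphic: "(\<lambda>z. vel (iter k z) \<xi>) holomorphic_on strip"
  by (rule vel_holomorphic[OF iter_adm iter_holomorphic])

lemma iter_derivative:
  "z \<in> strip \<Longrightarrow> ((\<lambda>z. iter (Suc k) z \<xi>) has_field_derivative vel (iter k z) \<xi>) (at z)"
  using primitive(1)[OF iter_vel_holomorphic] by (auto intro!: derivative_eq_intros)

lemma iter_at_0: "iter k 0 \<xi> = of_real (\<theta>\<^sub>0 \<xi>)"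
  using primitive(2)[OF iter_vel_holomorphic] by (cases k) auto

text \<open>The weight exponent is taken so large that CK / rate \<le> 1/2, whence successive
  differences of iterates decay like 2^-k.\<close>

definition "rate = 2 * CK + 1"
definition "Cit = CV / rate"

lemma rate: "0 < rate" "CK / rate \<le> 1/2" "0 \<le> Cit"
  using C_nonneg by (auto simp: rate_def Cit_def)

lemma iter_diff:
  assumes "z \<in> strip"
  shows "norm (iter (Suc k) z \<xi> - iter k z \<xi>) \<le> Cit * (1/2)^k * exp (rate * norm z)"
  using assms
proof (induction k arbitrary: z \<xi>)
  case 0
  have "norm (iter (Suc 0) z \<xi> - iter 0 z \<xi>) \<le> CV / rate * exp (rate * norm z)"
  proof (rule norm_bound_exp_weight[where D = "\<lambda>z. iter (Suc 0) z \<xi> - iter 0 z \<xi>" and D' = "\<lambda>z. vel (iter 0 z) \<xi>"])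
    fix s :: real assume s: "0 \<le> s" "s \<le> 1"
    note st = strip_scale[OF 0 s]
    show "((\<lambda>z. iter (Suc 0) z \<xi> - iter 0 z \<xi>) has_field_derivative vel (iter 0 (of_real s * z)) \<xi>) (at (of_real s * z))"
      using DERIV_diff[OF iter_derivative[OF st, of 0 \<xi>] DERIV_const[of "of_real (\<theta>\<^sub>0 \<xi>)"]] by simp
    have "CV * 1 \<le> CV * exp (rate * norm (of_real s * z))"
      using rate(1) C_nonneg by (intro mult_left_mono) auto
    with vel_bound[OF iter_adm[OF st], of 0 \<xi>]
    show "norm (vel (iter 0 (of_real s * z)) \<xi>) \<le> CV * exp (rate * norm (of_real s * z))" by simp
  qed (simp_all only: iter_at_0 rate C_nonneg diff_self)
  then show ?case by (simp add: Cit_def)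
next
  case (Suc k)
  have "norm (iter (Suc (Suc k)) z \<xi> - iter (Suc k) z \<xi>) \<le> (CK * (Cit * (1/2)^k)) / rate * exp (rate * norm z)"
  proof (rule norm_bound_exp_weight[where D = "\<lambda>z. iter (Suc (Suc k)) z \<xi> - iter (Suc k) z \<xi>"
        and D' = "\<lambda>z. vel (iter (Suc k) z) \<xi> - vel (iter k z) \<xi>"])
    fix s :: real assume s: "0 \<le> s" "s \<le> 1"
    note st = strip_scale[OF Suc.prems s]
    show "((\<lambda>z. iter (Suc (Suc k)) z \<xi> - iter (Suc k) z \<xi>) has_field_derivative
        vel (iter (Suc k) (of_real s * z)) \<xi> - vel (iter k (of_real s * z)) \<xi>) (at (of_real s * z))"
      by (intro derivative_intros iter_derivative st)
    show "norm (vel (iter (Suc k) (of_real s * z)) \<xi> - vel (iter k (of_real s * z)) \<xi>)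
        \<le> CK * (Cit * (1/2)^k) * exp (rate * norm (of_real s * z))"
      unfolding mult.assoc[of CK]
      by (intro vel_lipschitz iter_adm st) (rule Suc.IH[OF st])
  qed (use rate C_nonneg in \<open>simp_all del: iter.simps add: iter_at_0\<close>)
  also have "\<dots> = (CK / rate) * (Cit * (1/2)^k * exp (rate * norm z))" by simp
  also have "\<dots> \<le> 1/2 * (Cit * (1/2)^k * exp (rate * norm z))"
    using rate by (intro mult_right_mono) auto
  finally show ?case by simp
qed

definition "flow z \<xi> = lim (\<lambda>k. iter k z \<xi>)"

text \<open>Weierstrass test for the telescoping series of differences. Uniformity in the label as
  well as in time is essential, since the velocity integrates over all labels.\<close>

lemma iter_uniform_limit:
  "uniform_limit ((strip \<inter> cball 0 r) \<times> UNIV) (\<lambda>k (z, \<xi>). iter k z \<xi>) (\<lambda>(z, \<xi>). flow z \<xi>) sequentially"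
proof -
  let ?A = "(strip \<inter> cball 0 r) \<times> (UNIV :: real set)"
  let ?h = "\<lambda>p. of_real (\<theta>\<^sub>0 (snd p)) + (\<Sum>i. iter (Suc i) (fst p) (snd p) - iter i (fst p) (snd p))"
  have "uniform_limit ?A (\<lambda>n p. \<Sum>i<n. iter (Suc i) (fst p) (snd p) - iter i (fst p) (snd p))
    (\<lambda>p. \<Sum>i. iter (Suc i) (fst p) (snd p) - iter i (fst p) (snd p)) sequentially"
  proof (rule Weierstrass_m_test[where M = "\<lambda>k. Cit * exp (rate * r) * (1/2)^k"])
    fix n p assume p: "p \<in> ?A"
    then have "exp (rate * norm (fst p)) \<le> exp (rate * r)" using rate(1) by auto
    then have "Cit * (1/2)^n * exp (rate * norm (fst p)) \<le> Cit * (1/2)^n * exp (rate * r)"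
      using rate(3) by (intro mult_left_mono) auto
    with iter_diff[of "fst p" n "snd p"] p
    show "norm (iter (Suc n) (fst p) (snd p) - iter n (fst p) (snd p)) \<le> Cit * exp (rate * r) * (1/2)^n"
      by (auto simp: mult_ac simp del: iter.simps)
  qed (intro summable_mult summable_geometric, simp)
  then have "uniform_limit ?A (\<lambda>n p. of_real (\<theta>\<^sub>0 (snd p)) + (\<Sum>i<n. iter (Suc i) (fst p) (snd p) - iter i (fst p) (snd p)))
    (\<lambda>p. of_real (\<theta>\<^sub>0 (snd p)) + (\<Sum>i. iter (Suc i) (fst p) (snd p) - iter i (fst p) (snd p))) sequentially"
    by (intro uniform_limit_intros)
  moreover have "of_real (\<theta>\<^sub>0 (snd p)) + (\<Sum>i<n. iter (Suc i) (fst p) (snd p) - iter i (fst p) (snd p)) = iter n (fst p) (snd p)" for n p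
    using sum_lessThan_telescope[of "\<lambda>i. iter i (fst p) (snd p)" n] by simp
  ultimately have U: "uniform_limit ?A (\<lambda>k p. iter k (fst p) (snd p)) ?h sequentially" by (simp only:)
  have eq: "?h p = flow (fst p) (snd p)" if "p \<in> ?A" for p
    using limI[OF tendsto_uniform_limitI[OF U that]] by (simp only: flow_def)
  have "uniform_limit ?A (\<lambda>k p. iter k (fst p) (snd p)) ?h sequentially
    \<longleftrightarrow> uniform_limit ?A (\<lambda>k p. iter k (fst p) (snd p)) (\<lambda>p. flow (fst p) (snd p)) sequentially"
    by (rule uniform_limit_cong'[OF refl eq])
  with U have "uniform_limit ?A (\<lambda>k p. iter k (fst p) (snd p)) (\<lambda>p. flow (fst p) (snd p)) sequentially" by blast
  then show ?thesis by (simp only: case_prod_beta')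
qed

lemma flow_tendsto: "z \<in> strip \<Longrightarrow> (\<lambda>k. iter k z \<xi>) \<longlonglongrightarrow> flow z \<xi>"
  using tendsto_uniform_limitI[OF iter_uniform_limit[of "norm z"], of "(z, \<xi>)"] by simp

lemma flow_adm:
  assumes "z \<in> strip" shows "adm (flow z)"
  unfolding adm_def
proof (intro conjI allI)
  show "flow z \<in> borel_measurable borel"
    by (rule borel_measurable_LIMSEQ_metric[where f="\<lambda>k. iter k z"])
      (use iter_adm[OF assms] flow_tendsto[OF assms] in \<open>auto simp: adm_def\<close>)
  show "\<bar>Im (flow z j)\<bar> \<le> 1" for j
  proof (rule LIMSEQ_le_const2)
    show "(\<lambda>k. \<bar>Im (iter k z j)\<bar>) \<longlonglongrightarrow> \<bar>Im (flow z j)\<bar>" by (intro tendsto_intros flow_tendsto assms)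
    show "\<exists>N. \<forall>n\<ge>N. \<bar>Im (iter n z j)\<bar> \<le> 1" using iter_adm[OF assms] by (auto simp: adm_def)
  qed
qed

text \<open>Locally uniform limits of holomorphic functions may be differentiated termwise. The
  derivatives \<open>vel (iter n z) \<xi>\<close> converge to \<open>vel (flow z) \<xi>\<close>
  because \<open>vel\<close> is Lipschitz in the sup norm over labels.\<close>

lemma flow_derivative:
  assumes z: "z \<in> strip" shows "((\<lambda>z. flow z \<xi>) has_field_derivative vel (flow z) \<xi>) (at z)"
proof -
  have "\<exists>g'. \<forall>x\<in>strip. ((\<lambda>z. flow z \<xi>) has_field_derivative g' x) (at x) \<and> (\<lambda>n. vel (iter n x) \<xi>) \<longlonglongrightarrow> g' x"
  proof (rule has_complex_derivative_uniform_sequence[OF strip(1), where f = "\<lambda>n z. iter (Suc n) z \<xi>"])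
    show "((\<lambda>z. iter (Suc n) z \<xi>) has_field_derivative vel (iter n x) \<xi>) (at x)" if "x \<in> strip" for n x
      using that by (rule iter_derivative)
    fix x assume "x \<in> strip"
    then obtain d where d: "0 < d" "cball x d \<subseteq> strip" using open_contains_cball[THEN iffD1, rule_format, OF strip(1)] by blast
    have "cball x d \<subseteq> cball 0 (norm x + d)"
    proof
      fix y assume "y \<in> cball x d"
      then show "y \<in> cball 0 (norm x + d)" using norm_triangle_sub[of y x] by (simp add: dist_norm norm_minus_commute)
    qed
    with d have sub: "(\<lambda>z. (z, \<xi>)) ` cball x d \<subseteq> (strip \<inter> cball 0 (norm x + d)) \<times> UNIV" by auto
    have "uniform_limit (cball x d) (\<lambda>n z. iter n z \<xi>) (\<lambda>z. flow z \<xi>) sequentially"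
      using uniform_limit_compose'[OF iter_uniform_limit, of "\<lambda>z. (z, \<xi>)" "cball x d" "norm x + d"] sub by (simp add: image_subset_iff)
    then have "uniform_limit (cball x d) (\<lambda>n z. iter (Suc n) z \<xi>) (\<lambda>z. flow z \<xi>) sequentially"
      by (rule filterlim_compose[OF _ filterlim_Suc])
    then show "\<exists>d>0. cball x d \<subseteq> strip \<and> uniform_limit (cball x d) (\<lambda>n z. iter (Suc n) z \<xi>) (\<lambda>z. flow z \<xi>) sequentially"
      using d by blast
  qed
  then obtain g' where g': "((\<lambda>z. flow z \<xi>) has_field_derivative g' z) (at z)" "(\<lambda>n. vel (iter n z) \<xi>) \<longlonglongrightarrow> g' z"
    using z by blast
  have "(\<lambda>n. vel (iter n z) \<xi>) \<longlonglongrightarrow> vel (flow z) \<xi>"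
  proof (rule LIMSEQ_I)
    fix e :: real assume "0 < e"
    then have e: "0 < e / (CK + 1)" using C_nonneg by simp
    from uniform_limitD[OF iter_uniform_limit this, of "norm z"] z
    have "\<forall>\<^sub>F n in sequentially. \<forall>\<xi>. norm (iter n z \<xi> - flow z \<xi>) < e / (CK + 1)"
      by (auto elim!: eventually_mono simp: dist_norm)
    then have "\<forall>\<^sub>F n in sequentially. norm (vel (iter n z) \<xi> - vel (flow z) \<xi>) < e"
    proof eventually_elim
      case (elim n)
      have "norm (vel (iter n z) \<xi> - vel (flow z) \<xi>) \<le> CK * (e / (CK + 1))"
        using elim by (intro vel_lipschitz iter_adm flow_adm z less_imp_le) auto
      also have "\<dots> < e" using C_nonneg \<open>0 < e\<close> by (simp add: field_simps add_nonneg_pos)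
      finally show ?case .
    qed
    then show "\<exists>N. \<forall>n\<ge>N. norm (vel (iter n z) \<xi> - vel (flow z) \<xi>) < e" by (simp add: eventually_sequentially)
  qed
  from LIMSEQ_unique[OF g'(2) this] g'(1) show ?thesis by simp
qed

lemma flow_real: "Im (flow (of_real t) \<xi>) = 0"
  using tendsto_Im[OF flow_tendsto[OF strip(3)], of t \<xi>] by (simp only: iter_real LIMSEQ_const_iff)

lemma flow_0: "flow 0 \<xi> = of_real (\<theta>\<^sub>0 \<xi>)"
  using flow_tendsto[OF strip(3), of 0 \<xi>] by (simp add: iter_at_0 LIMSEQ_const_iff)

subsection \<open>The real flow\<close>

definition "ang t \<xi> = Re (flow (of_real t) \<xi>)"
definition "S t \<xi> = 1/2 * (LBINT j:{0..min L \<xi>}. sin (2 * ang t j))"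
definition "V t \<xi> = S t \<xi> - \<kappa> * (LBINT j:{0..L}. S t j * cos (2 * ang t j))"

lemma flow_eq_ang: "flow (of_real t) = (\<lambda>\<xi>. of_real (ang t \<xi>))"
  using flow_real by (auto simp: ang_def complex_eq_iff)

lemma primS_eq: "primS (flow (of_real t)) \<xi> = of_real (S t \<xi>)"
proof -
  have sin: "sin (2 * flow (of_real t) j) = of_real (sin (2 * ang t j))" for j
    using sin_of_real[of "2 * ang t j", where 'a=complex] by (simp add: flow_eq_ang)
  show ?thesis unfolding primS_def S_def sin set_integral_complex_of_real by simp
qed

lemma vel_eq: "vel (flow (of_real t)) \<xi> = of_real (V t \<xi>)"
proof -
  have cos: "cos (2 * flow (of_real t) j) = of_real (cos (2 * ang t j))" for j
    using cos_of_real[of "2 * ang t j", where 'a=complex] by (simp add: flow_eq_ang)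
  show ?thesis unfolding vel_def V_def primS_eq cos of_real_mult[symmetric] set_integral_complex_of_real of_real_diff ..
qed

lemma ang_0: "ang 0 \<xi> = \<theta>\<^sub>0 \<xi>"
  using flow_0 by (simp add: ang_def)

lemma ang_derivative: "((\<lambda>t. ang t \<xi>) has_real_derivative V t \<xi>) (at t)"
  using bounded_linear.has_vector_derivative[OF bounded_linear_Re has_vector_derivative_real_field[OF flow_derivative[OF strip(3)]], of \<xi> t UNIV]
  by (simp add: ang_def[symmetric] vel_eq has_real_derivative_iff_has_vector_derivative)

lemma ang_measurable [measurable]: "ang t \<in> borel_measurable borel"
  using flow_adm[OF strip(3), of t] unfolding adm_def ang_def[abs_def] borel_measurable_complex_iff[of "flow _"] by blast

text \<open>This is the reason for complex time: cos of the flow is holomorphic on the connected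
  strip and nonzero at time 0, so it is not identically zero and its zeros are countable.\<close>

lemma countable_cos_ang_zero:
  assumes "cos (\<theta>\<^sub>0 \<xi>) \<noteq> 0"
  shows "countable {t. cos (ang t \<xi>) = 0}"
proof -
  let ?f = "\<lambda>z. cos (flow z \<xi>)"
  have hol: "?f holomorphic_on strip"
    using flow_derivative by (intro holomorphic_intros) (auto simp: holomorphic_on_open[OF strip(1)])
  have "countable {z\<in>strip. ?f z = 0}"
  proof (cases "?f constant_on strip")
    case True
    then have "?f z = ?f 0" if "z \<in> strip" for z
      using that strip(3)[of 0] unfolding constant_on_def by (metis of_real_0)
    then have "{z\<in>strip. ?f z = 0} = {}" using assms by (auto simp: flow_0 cos_of_real)
    then show ?thesis by (simp only: countable_empty)
  next
    case False
    have "fsigma strip"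
      using open_Union_compact_subsets[OF strip(1)] unfolding fsigma_Union_compact
      by (metis image_subsetI mem_Collect_eq)
    then show ?thesis using hol strip False by (intro holomorphic_countable_zeros convex_connected)
  qed
  moreover have "of_real ` {t. cos (ang t \<xi>) = 0} \<subseteq> {z\<in>strip. ?f z = 0}"
    using strip(3) by (auto simp: flow_eq_ang cos_of_real)
  ultimately have "countable (complex_of_real ` {t. cos (ang t \<xi>) = 0})" by (rule countable_subset[rotated])
  then show ?thesis by (rule countable_image_inj_on) (simp add: inj_on_def)
qed

end

section \<open>Conservation laws of the flow and its Lagrangian derivatives\<close>

section \<open>Conserved quantities and Lagrangian derivatives\<close>

text \<open>E(t) exp(-K t) is nonincreasing forward in time; negative times follow by reflection,
  since the hypothesis bounds the absolute value of the derivative.\<close>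

lemma DERIV_Gronwall_zero:
  fixes E :: "real \<Rightarrow> real"
  assumes der: "\<And>t. (E has_real_derivative E' t) (at t)" and le: "\<And>t. \<bar>E' t\<bar> \<le> K * E t"
    and "E 0 = 0" "\<And>t. 0 \<le> E t"
  shows "E t = 0"
proof -
  have *: "E t = 0"
    if "0 \<le> t" "E 0 = 0" "\<And>t. 0 \<le> E t" and der: "\<And>t. (E has_real_derivative E' t) (at t)" and le: "\<And>t. E' t \<le> K * E t"
    for E E' :: "real \<Rightarrow> real" and t
  proof -
    have "E t * exp (- K * t) \<le> E 0 * exp (- K * 0)"
    proof (rule DERIV_nonpos_imp_nonincreasing[OF \<open>0 \<le> t\<close>])
      fix s
      have "((\<lambda>s. E s * exp (- K * s)) has_real_derivative (E' s - K * E s) * exp (- K * s)) (at s)"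
        by (rule derivative_eq_intros der refl)+ (simp add: algebra_simps)
      moreover have "(E' s - K * E s) * exp (- K * s) \<le> 0" using le[of s] by (simp add: mult_nonpos_nonneg)
      ultimately show "\<exists>y. ((\<lambda>s. E s * exp (- K * s)) has_real_derivative y) (at s) \<and> y \<le> 0" by blast
    qed
    then show ?thesis using that(2) that(3)[of t] by (simp add: mult_le_0_iff)
  qed
  show ?thesis
  proof (cases "0 \<le> t")
    case True
    then show ?thesis by (rule *[OF _ assms(3,4) der]) (use le in \<open>simp add: abs_le_iff\<close>)
  next
    case False
    have "E (- (- t)) = 0"
    proof (rule *[of "- t" "\<lambda>s. E (- s)" "\<lambda>s. - E' (- s)"])
      show "((\<lambda>s. E (- s)) has_real_derivative - E' (- s)) (at s)" for s
        using DERIV_chain2[OF der[of "- s"] DERIV_minus[OF DERIV_ident]] by simp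
      show "- E' (- s) \<le> K * E (- s)" for s using le[of "- s"] by linarith
    qed (use False assms(3,4) in auto)
    then show ?thesis by simp
  qed
qed

text \<open>The difference between \<open>f\<close> and a primitive of \<open>g\<close> is
  L-periodic, because both grow by the same amount over a period, and it is constant on one period
  by hypothesis. It passes identities on the fundamental interval to the whole line; the increment
  \<open>m\<close> is 1 for the position and 0 for periodic quantities.\<close>

lemma prim_of_quasiperiodic:
  assumes "0 < L" and g: "loc_int g" "\<And>x. g (x + L) = g x" and f: "\<And>x. f (x + L) = f x + m"
    and int: "\<And>x. 0 \<le> x \<Longrightarrow> x \<le> L \<Longrightarrow> (LBINT y:{0..x}. g y) = f x - f 0"
  shows "prim f g"
proof -
  define F where "F x = interval_lebesgue_integral lborel (ereal 0) (ereal x) g" for x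
  have F: "prim F g" unfolding F_def by (rule prim_exists[OF g(1)])
  define d where "d x = F x - f x" for x
  have F0: "F x - F 0 = f x - f 0" if "0 \<le> x" "x \<le> L" for x using prim_integral[OF F that(1)] int[OF that] by simp
  have "f L = f 0 + m" using f[of 0] by simp
  then have "d (x + L) = d x" for x
    using prim_period_increment[OF F g(2), of x 0] F0[of L] assms(1) f[of x] by (simp add: d_def)
  then have "d x = d 0" for x
  proof -
    assume "\<And>x. d (x + L) = d x"
    then obtain z where "0 \<le> z" "z < L" "d x = d z" using periodic_floor[of d L x] assms(1) by metis
    then show ?thesis using F0[of z] by (simp add: d_def)
  qed
  then have "F x - (F 0 - f 0) = f x" for x by (simp add: d_def algebra_simps)
  with prim_diff[OF F prim_const[of "F 0 - f 0"]] show ?thesis by simp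
qed

text \<open>The datum in angle form: \<open>sin_balanced\<close> is periodicity of u,
  \<open>cos_balanced\<close> is int (1 - u_x^2) dx = 1/\<kappa>, and together with
  \<open>mass\<close> it makes int cos^2 \<theta> equal to 1, so that a period L of labels covers
  exactly one period of x.\<close>

locale balanced_flow = picard +
  assumes sin_balanced: "(LBINT j:{0..L}. sin (2 * \<theta>\<^sub>0 j)) = 0"
    and cos_balanced: "\<kappa> * (LBINT j:{0..L}. cos (2 * \<theta>\<^sub>0 j)) = 1"
    and end_points: "\<theta>\<^sub>0 L = \<theta>\<^sub>0 0" and mass: "\<kappa> * (2 - L) = 1"
begin

definition "P t \<xi> = interval_lebesgue_integral lborel (ereal 0) (ereal \<xi>) (\<lambda>j. sin (2 * ang t j) / 2)"
definition "A t = (LBINT j:{0..L}. sin (2 * ang t j))"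
definition "B t = (LBINT j:{0..L}. cos (2 * ang t j))"
definition "I t = (LBINT j:{0..L}. S t j * cos (2 * ang t j))"

lemma prim_P: "prim (P t) (\<lambda>j. sin (2 * ang t j) / 2)"
proof -
  have "loc_int (\<lambda>j. sin (2 * ang t j) / 2)"
    by (rule loc_int_bounded[where C=1]) (auto intro: order_trans[OF abs_sin_le_one])
  then show ?thesis unfolding P_def[abs_def] by (rule prim_exists)
qed

lemma P_0: "P t 0 = 0"
  by (simp add: P_def interval_integral_endpoints_same flip: zero_ereal_def)

lemma S_eq_P: "0 \<le> \<xi> \<Longrightarrow> \<xi> \<le> L \<Longrightarrow> S t \<xi> = P t \<xi>"
  using prim_integral[OF prim_P, of 0 \<xi> t] by (simp add: S_def P_0 min_absorb2)

lemma V_eq: "V t \<xi> = S t \<xi> - \<kappa> * I t"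
  by (simp add: V_def I_def)

lemma A_eq: "A t = 2 * P t L"
  using prim_integral[OF prim_P less_imp_le[OF L_pos], of t] by (simp add: A_def P_0)

lemma V_bound: "\<bar>V t \<xi>\<bar> \<le> CV"
  using vel_bound[OF flow_adm[OF strip(3)], of t \<xi>] by (simp add: vel_eq)

lemma S_bound: "\<bar>S t \<xi>\<bar> \<le> CS"
  using primS_bound[OF flow_adm[OF strip(3)], of t \<xi>] by (simp add: primS_eq)

lemma S_measurable [measurable]: "S t \<in> borel_measurable borel"
  using primS_measurable[OF flow_adm[OF strip(3)], of t]
  by (simp add: primS_eq[abs_def] borel_measurable_complex_iff)

lemma V_measurable [measurable]: "V t \<in> borel_measurable borel"
  unfolding V_def[abs_def] by measurable

lemma bounded_integrable:
  fixes f :: "real \<Rightarrow> real"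
  assumes "f \<in> borel_measurable borel" "\<And>x. \<bar>f x\<bar> \<le> C"
  shows "set_integrable lborel {a..b} f"
  using loc_int_bounded[OF assms] by (rule loc_int_integrable)

lemma DERIV_integral:
  fixes g :: "real \<Rightarrow> real \<Rightarrow> real"
  assumes "\<And>t. g t \<in> borel_measurable borel" "\<And>t j. \<bar>g t j\<bar> \<le> C"
    "\<And>t j. ((\<lambda>t. g t j) has_real_derivative g' t j) (at t)" "\<And>t j. \<bar>g' t j\<bar> \<le> C'"
  shows "((\<lambda>t. LBINT j:{a..b}. g t j) has_real_derivative (LBINT j:{a..b}. g' t j)) (at t)"
  using assms by (intro set_integral_has_field_derivative(1)[of 1 t a b g g' C'] bounded_integrable[where C=C]) auto

lemma abs_mult_le: "\<bar>x\<bar> \<le> a \<Longrightarrow> \<bar>y\<bar> \<le> b \<Longrightarrow> \<bar>x * y\<bar> \<le> a * (b::real)"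
  unfolding abs_mult by (rule mult_mono) auto

lemma trig_derivative:
  "((\<lambda>t. sin (2 * ang t j)) has_real_derivative 2 * (cos (2 * ang t j) * V t j)) (at t)"
  "((\<lambda>t. cos (2 * ang t j)) has_real_derivative - 2 * (sin (2 * ang t j) * V t j)) (at t)"
  by (rule derivative_eq_intros ang_derivative refl | simp)+

lemma trig_V_bound: "\<bar>cos x * V t j\<bar> \<le> CV" "\<bar>sin x * V t j\<bar> \<le> CV"
  using abs_mult_le[OF abs_cos_le_one[of x] V_bound[of t j]] abs_mult_le[OF abs_sin_le_one[of x] V_bound[of t j]] by auto

lemma cos_V_integral: "(LBINT j:{0..L}. cos (2 * ang t j) * V t j) = I t - \<kappa> * I t * B t"
proof -
  have 1: "set_integrable lborel {0..L} (\<lambda>j. S t j * cos (2 * ang t j))"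
    by (rule bounded_integrable[where C="CS * 1"]) (measurable, intro abs_mult_le S_bound abs_cos_le_one)
  have 2: "set_integrable lborel {0..L} (\<lambda>j. cos (2 * ang t j))"
    by (rule bounded_integrable[where C=1]) auto
  have "(LBINT j:{0..L}. cos (2 * ang t j) * V t j)
    = (LBINT j:{0..L}. S t j * cos (2 * ang t j) - \<kappa> * I t * cos (2 * ang t j))"
    by (simp add: V_eq algebra_simps)
  also have "\<dots> = I t - \<kappa> * I t * B t"
    unfolding set_integral_diff(2)[OF 1 set_integrable_mult_right[OF 2]] by (simp add: I_def B_def)
  finally show ?thesis .
qed

lemma A_derivative: "(A has_real_derivative 2 * (1 - \<kappa> * B t) * I t) (at t)"
proof -
  have "(A has_real_derivative (LBINT j:{0..L}. 2 * (cos (2 * ang t j) * V t j))) (at t)"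
    unfolding A_def[abs_def] using trig_V_bound
    by (intro DERIV_integral[where C=1 and C'="2 * CV"] trig_derivative) (auto simp: abs_mult)
  also have "(LBINT j:{0..L}. 2 * (cos (2 * ang t j) * V t j))
    = 2 * (I t - \<kappa> * I t * B t)"
    unfolding cos_V_integral[symmetric] by simp
  finally show ?thesis by (simp add: algebra_simps)
qed

text \<open>sin(2 \<theta>) P is the \<xi>-derivative of P^2, so its integral sees only the end
  value P(L) = A/2. This is how the factor \<open>A t\<close> arises.\<close>

lemma B_derivative: "(B has_real_derivative - A t * (A t / 2 - 2 * \<kappa> * I t)) (at t)"
proof -
  have "(B has_real_derivative (LBINT j:{0..L}. - 2 * (sin (2 * ang t j) * V t j))) (at t)"
    unfolding B_def[abs_def] using trig_V_bound
    by (intro DERIV_integral[where C=1 and C'="2 * CV"] trig_derivative) (auto simp: abs_mult)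
  also have "(LBINT j:{0..L}. - 2 * (sin (2 * ang t j) * V t j))
    = - 2 * (LBINT j:{0..L}. (P t j * (sin (2 * ang t j) / 2) + sin (2 * ang t j) / 2 * P t j)
        - 2 * \<kappa> * I t * (sin (2 * ang t j) / 2))"
    unfolding set_integral_mult_right
    by (intro arg_cong[where f = "\<lambda>x. - 2 * x"] set_lebesgue_integral_cong) (auto simp: V_eq S_eq_P algebra_simps)
  also have "\<dots> = - 2 * (P t L * P t L - 2 * \<kappa> * I t * P t L)"
    using prim_integral[OF prim_diff[OF prim_mult[OF prim_P prim_P] prim_cmult[OF prim_P, of "2 * \<kappa> * I t"]], of 0 L t t t] L_pos
    by (simp add: P_0)
  finally show ?thesis by (simp add: A_eq algebra_simps)
qed

text \<open>By the two derivative formulas, \<open>A\<close> and \<open>\<kappa> * B - 1\<close>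
  solve a homogeneous linear system with bounded coefficients, and both vanish at time 0. Gronwall
  is applied to the sum of their squares.\<close>

lemma A_zero: "A t = 0" and B_const: "\<kappa> * B t = 1"
proof -
  let ?E = "\<lambda>t. (A t)\<^sup>2 + (\<kappa> * B t - 1)\<^sup>2"
  let ?q = "\<lambda>t. - 2 * I t - \<kappa> * (A t / 2 - 2 * \<kappa> * I t)"
  have Ib: "\<bar>I t\<bar> \<le> CS * L" for t
    using set_integral_norm_le[of 0 L "\<lambda>j. S t j * cos (2 * ang t j)" "CS * 1"] L_pos
    by (simp add: I_def abs_mult_le S_bound del: mult_1_right)
  have Ab: "\<bar>A t\<bar> \<le> L" for t
    using set_integral_norm_le[of 0 L "\<lambda>j. sin (2 * ang t j)" 1] L_pos by (simp add: A_def)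
  define K where "K = 2 * (CS * L) + \<bar>\<kappa>\<bar> * (L / 2 + 2 * \<bar>\<kappa>\<bar> * (CS * L))"
  have qb: "\<bar>?q t\<bar> \<le> K" for t
  proof -
    have "\<bar>\<kappa> * I t\<bar> \<le> \<bar>\<kappa>\<bar> * (CS * L)" by (intro abs_mult_le Ib) simp
    then have "\<bar>A t / 2 - 2 * \<kappa> * I t\<bar> \<le> L / 2 + 2 * \<bar>\<kappa>\<bar> * (CS * L)" using Ab[of t] by (simp add: abs_le_iff)
    then have "\<bar>\<kappa> * (A t / 2 - 2 * \<kappa> * I t)\<bar> \<le> \<bar>\<kappa>\<bar> * (L / 2 + 2 * \<bar>\<kappa>\<bar> * (CS * L))" by (intro abs_mult_le) simp
    then show ?thesis using Ib[of t] by (simp add: K_def abs_le_iff)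
  qed
  have "?E t = 0"
  proof (rule DERIV_Gronwall_zero[where E = ?E and E' = "\<lambda>t. 2 * A t * (\<kappa> * B t - 1) * ?q t" and K=K])
    show "(?E has_real_derivative 2 * A t * (\<kappa> * B t - 1) * ?q t) (at t)" for t
      by (rule derivative_eq_intros A_derivative B_derivative refl)+ (simp add: field_simps power2_eq_square)
    show "\<bar>2 * A t * (\<kappa> * B t - 1) * ?q t\<bar> \<le> K * ?E t" for t
    proof -
      have "\<bar>2 * A t * (\<kappa> * B t - 1) * ?q t\<bar> \<le> \<bar>2 * A t * (\<kappa> * B t - 1)\<bar> * \<bar>?q t\<bar>"
        by (simp only: abs_mult)
      also have "\<dots> \<le> ?E t * K"
      proof (rule mult_mono[OF _ qb])
        show "\<bar>2 * A t * (\<kappa> * B t - 1)\<bar> \<le> ?E t"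
          using sum_squares_bound[of "\<bar>A t\<bar>" "\<bar>\<kappa> * B t - 1\<bar>"] by (simp add: abs_mult)
      qed auto
      finally show ?thesis by (simp only: mult.commute[of K])
    qed
    show "?E 0 = 0" using sin_balanced cos_balanced by (simp add: A_def B_def ang_0)
  qed auto
  then show "A t = 0" "\<kappa> * B t = 1" by (simp_all add: sum_power2_eq_zero_iff)
qed

lemma S_ends: "S t 0 = 0" "S t L = 0"
  using S_eq_P[of 0 t] S_eq_P[of L t] L_pos A_zero[of t] by (simp_all add: P_0 A_eq)

lemma V_ends: "V t L = V t 0"
  by (simp add: V_eq S_ends)

lemma ang_ends: "ang t L = ang t 0"
proof -
  have "((\<lambda>s. ang s L - ang s 0) has_real_derivative 0) (at s)" for s
    using DERIV_diff[OF ang_derivative[of L s] ang_derivative[of 0 s]] by (simp add: V_ends)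
  from DERIV_isconst_all[OF allI, OF this, of t 0] show ?thesis using end_points by (simp add: ang_0)
qed

subsection \<open>Time derivative of the velocity\<close>

definition "G t \<xi> = (LBINT j:{0..min L \<xi>}. cos (2 * ang t j) * V t j)"
definition "H t \<xi> = G t \<xi> - \<kappa> * (LBINT j:{0..L}. G t j * cos (2 * ang t j))"

lemma S_derivative: "((\<lambda>t. S t \<xi>) has_real_derivative G t \<xi>) (at t)"
proof -
  have "((\<lambda>t. S t \<xi>) has_real_derivative 1/2 * (LBINT j:{0..min L \<xi>}. 2 * (cos (2 * ang t j) * V t j))) (at t)"
    unfolding S_def using trig_V_bound
    by (intro DERIV_cmult DERIV_integral[where C=1 and C'="2 * CV"] trig_derivative) (auto simp: abs_mult)
  then show ?thesis by (simp add: G_def)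
qed

lemma prim_cos_V: "prim (\<lambda>\<xi>. interval_lebesgue_integral lborel (ereal 0) (ereal \<xi>) (\<lambda>j. cos (2 * ang t j) * V t j))
    (\<lambda>j. cos (2 * ang t j) * V t j)"
  by (intro prim_exists loc_int_bounded[where C=CV] trig_V_bound) measurable

lemma G_eq: "G t \<xi> = interval_lebesgue_integral lborel (ereal 0) (ereal (max 0 (min L \<xi>))) (\<lambda>j. cos (2 * ang t j) * V t j)"
proof (cases "0 \<le> min L \<xi>")
  case True then show ?thesis by (simp only: G_def max_absorb2[OF True] interval_integral_Icc[OF True])
next
  case False
  then have "{0..min L \<xi>} = {}" "max 0 (min L \<xi>) = 0" by auto
  then show ?thesis by (simp add: G_def set_lebesgue_integral_def interval_integral_endpoints_same)
qed

lemma G_measurable [measurable]: "G t \<in> borel_measurable borel"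
  unfolding G_eq[abs_def] using prim_measurable[OF prim_cos_V[of t]] by (rule measurable_compose[rotated]) measurable

lemma G_bound: "\<bar>G t \<xi>\<bar> \<le> CV * L"
proof (cases "0 \<le> min L \<xi>")
  case True
  have "\<bar>G t \<xi>\<bar> \<le> CV * (min L \<xi> - 0)"
    using set_integral_norm_le[OF True, of "\<lambda>j. cos (2 * ang t j) * V t j" CV] trig_V_bound by (simp add: G_def)
  also have "\<dots> \<le> CV * L" using C_nonneg by (intro mult_left_mono) auto
  finally show ?thesis .
next
  case False
  then have "{0..min L \<xi>} = {}" by auto
  then show ?thesis using C_nonneg L_pos by (simp add: G_def set_lebesgue_integral_def)
qed

text \<open>The integrand is the \<xi>-derivative of (2/3) P^3 - \<kappa> I P^2, and P vanishes at
  both ends because \<open>A t = 0\<close>. It removes the extra term in the time derivative of the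
  normalising constant, leaving \<open>H\<close> in the same form as \<open>V\<close>.\<close>

lemma S_sin_V_zero: "(LBINT j:{0..L}. S t j * (sin (2 * ang t j) * V t j)) = 0"
proof -
  let ?s = "\<lambda>j. sin (2 * ang t j) / 2"
  have sq: "prim (\<lambda>j. P t j * P t j) (\<lambda>j. P t j * ?s j + ?s j * P t j)" by (rule prim_mult[OF prim_P prim_P])
  have "prim (\<lambda>j. 2/3 * (P t j * P t j * P t j) + (- \<kappa> * I t) * (P t j * P t j))
    (\<lambda>j. 2/3 * ((P t j * P t j) * ?s j + (P t j * ?s j + ?s j * P t j) * P t j) + (- \<kappa> * I t) * (P t j * ?s j + ?s j * P t j))"
    by (intro prim_add prim_cmult prim_mult[OF sq prim_P] sq)
  from prim_integral[OF this, of 0 L] L_pos A_zero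
  have "(LBINT j:{0..L}. 2/3 * ((P t j * P t j) * ?s j + (P t j * ?s j + ?s j * P t j) * P t j)
      + (- \<kappa> * I t) * (P t j * ?s j + ?s j * P t j)) = 0"
    by (simp add: A_eq P_0)
  moreover have "(LBINT j:{0..L}. S t j * (sin (2 * ang t j) * V t j))
      = (LBINT j:{0..L}. 2/3 * ((P t j * P t j) * ?s j + (P t j * ?s j + ?s j * P t j) * P t j)
      + (- \<kappa> * I t) * (P t j * ?s j + ?s j * P t j))"
    by (intro set_lebesgue_integral_cong) (auto simp: V_eq S_eq_P algebra_simps)
  ultimately show ?thesis by simp
qed

lemma I_derivative:
  "(I has_real_derivative (LBINT j:{0..L}. G t j * cos (2 * ang t j) - 2 * (S t j * (sin (2 * ang t j) * V t j)))) (at t)"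
  unfolding I_def[abs_def]
proof -
  let ?g' = "\<lambda>t j. G t j * cos (2 * ang t j) - 2 * (S t j * (sin (2 * ang t j) * V t j))"
  show "((\<lambda>t. LBINT j:{0..L}. S t j * cos (2 * ang t j)) has_real_derivative (LBINT j:{0..L}. ?g' t j)) (at t)"
  proof (rule DERIV_integral[where C="CS * 1" and C'="CV * L * 1 + 2 * (CS * CV)"])
    show "((\<lambda>t. S t j * cos (2 * ang t j)) has_real_derivative ?g' t j) (at t)" for t j
      using DERIV_mult[OF S_derivative trig_derivative(2)] by (rule DERIV_cong) (simp add: algebra_simps)
    fix t j
    have "\<bar>G t j * cos (2 * ang t j)\<bar> \<le> CV * L * 1" by (intro abs_mult_le G_bound) simp
    moreover have "\<bar>S t j * (sin (2 * ang t j) * V t j)\<bar> \<le> CS * CV" by (intro abs_mult_le S_bound trig_V_bound)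
    ultimately show "\<bar>?g' t j\<bar> \<le> CV * L * 1 + 2 * (CS * CV)" by linarith
    show "\<bar>S t j * cos (2 * ang t j)\<bar> \<le> CS * 1" by (intro abs_mult_le S_bound) simp
  qed measurable
qed

lemma V_isCont: "isCont (\<lambda>t. V t \<xi>) t"
  unfolding V_eq by (rule DERIV_isCont[OF DERIV_diff[OF S_derivative DERIV_cmult[OF I_derivative]]])

lemma V_derivative: "((\<lambda>t. V t \<xi>) has_real_derivative H t \<xi>) (at t)"
proof -
  let ?g' = "\<lambda>t j. G t j * cos (2 * ang t j) - 2 * (S t j * (sin (2 * ang t j) * V t j))"
  have "((\<lambda>t. LBINT j:{0..L}. S t j * cos (2 * ang t j)) has_real_derivative (LBINT j:{0..L}. ?g' t j)) (at t)"
    using I_derivative[of t] unfolding I_def[abs_def] .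
  also have "(LBINT j:{0..L}. ?g' t j) = (LBINT j:{0..L}. G t j * cos (2 * ang t j))"
  proof -
    have 1: "set_integrable lborel {0..L} (\<lambda>j. G t j * cos (2 * ang t j))"
      by (rule bounded_integrable[where C="CV * L * 1"]) (measurable, intro abs_mult_le G_bound abs_cos_le_one)
    have 2: "set_integrable lborel {0..L} (\<lambda>j. S t j * (sin (2 * ang t j) * V t j))"
      by (rule bounded_integrable[where C="CS * CV"]) (measurable, intro abs_mult_le S_bound trig_V_bound)
    show ?thesis using set_integral_diff(2)[OF 1 set_integrable_mult_right[of 2, OF 2]] S_sin_V_zero by simp
  qed
  finally show ?thesis unfolding V_def H_def by (intro DERIV_diff DERIV_cmult S_derivative)
qed

text \<open>The Lagrangian form of zero charge; the constant \<kappa> I was subtracted for this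
  purpose, and \<kappa> B = 1 makes it fit.\<close>

lemma V_cos_zero: "(LBINT j:{0..L}. cos (2 * ang t j) * V t j) = 0"
proof -
  have "I t - \<kappa> * I t * B t = I t * (1 - \<kappa> * B t)" by (simp add: algebra_simps)
  then show ?thesis using B_const by (simp add: cos_V_integral)
qed

lemma G_ends: "G t 0 = 0" "G t L = 0"
  using L_pos V_cos_zero[of t] by (simp_all add: G_eq interval_integral_endpoints_same) (simp add: interval_integral_Icc)

subsection \<open>Periodic extension of the flow\<close>

definition "red \<xi> = \<xi> - of_int \<lfloor>\<xi> / L\<rfloor> * L"
definition "\<theta> t \<xi> = ang t (red \<xi>)"
definition "U t \<xi> = V t (red \<xi>)"
definition "Ut t \<xi> = H t (red \<xi>)"
text \<open>Minus \<open>y\<close> is the position of the label 0, which moves with velocity -V(t,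
  0)^2. The other positions follow by integrating cos^2 \<theta> in the label.\<close>

definition "y = (SOME y. y 0 = 0 \<and> (\<forall>t. (y has_real_derivative (V t 0)\<^sup>2) (at t)))"
definition "Xr t \<xi> = (LBINT j:{0..\<xi>}. (cos (ang t j))\<^sup>2) - y t"
definition "X t \<xi> = Xr t (red \<xi>) + of_int \<lfloor>\<xi> / L\<rfloor>"

lemma red: "0 \<le> red \<xi>" "red \<xi> < L"
proof -
  have "of_int \<lfloor>\<xi> / L\<rfloor> * L \<le> \<xi>" "\<xi> < (of_int \<lfloor>\<xi> / L\<rfloor> + 1) * L"
    using of_int_floor_le[of "\<xi> / L"] floor_correct[of "\<xi> / L"] L_pos
    by (simp_all only: pos_le_divide_eq pos_divide_less_eq of_int_add of_int_1)
  then show "0 \<le> red \<xi>" "red \<xi> < L" by (simp_all add: red_def algebra_simps)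
qed

lemma floor_add_period: "\<lfloor>(\<xi> + L) / L\<rfloor> = \<lfloor>\<xi> / L\<rfloor> + 1"
  using L_pos by (simp add: add_divide_distrib)

lemma red_periodic: "red (\<xi> + L) = red \<xi>"
  unfolding red_def floor_add_period by (simp add: algebra_simps)

lemma red_id: assumes "0 \<le> \<xi>" "\<xi> < L" shows "red \<xi> = \<xi>" "\<lfloor>\<xi> / L\<rfloor> = 0"
proof -
  show "\<lfloor>\<xi> / L\<rfloor> = 0" using assms by (intro floor_unique) (auto simp: divide_less_eq)
  then show "red \<xi> = \<xi>" by (simp add: red_def)
qed

lemma red_measurable [measurable]: "red \<in> borel_measurable borel"
  unfolding red_def[abs_def] by measurable

lemma red_L: "red L = 0" "\<lfloor>L / L\<rfloor> = 1"
  using L_pos by (simp_all add: red_def)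

lemma at_red:
  assumes "0 \<le> \<xi>" "\<xi> \<le> L"
  shows "\<theta> t \<xi> = ang t \<xi>" "U t \<xi> = V t \<xi>" "Ut t \<xi> = H t \<xi>"
  using assms red_id[of \<xi>] ang_ends[of t] V_ends[of t] G_ends[of t]
  by (cases "\<xi> = L"; simp add: \<theta>_def U_def Ut_def H_def red_L)+

lemma y: "y 0 = 0" "(y has_real_derivative (V t 0)\<^sup>2) (at t)"
proof -
  have cont: "isCont (\<lambda>t. (V t 0)\<^sup>2) t" for t using V_isCont by (rule isCont_power)
  obtain F where F: "\<And>t. (F has_vector_derivative (V t 0)\<^sup>2) (at t)"
    using einterval_antiderivative[of "-\<infinity>" "\<infinity>" "\<lambda>t. (V t 0)\<^sup>2"] cont by auto
  have "\<exists>y. y 0 = 0 \<and> (\<forall>t. (y has_real_derivative (V t 0)\<^sup>2) (at t))"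
  proof (intro exI[of _ "\<lambda>t. F t - F 0"] conjI allI)
    show "((\<lambda>t. F t - F 0) has_real_derivative (V t 0)\<^sup>2) (at t)" for t
      using DERIV_diff[OF F[of t, folded has_real_derivative_iff_has_vector_derivative] DERIV_const] by simp
  qed simp
  from someI_ex[OF this] show "y 0 = 0" "(y has_real_derivative (V t 0)\<^sup>2) (at t)" unfolding y_def by blast+
qed

lemma cos_sq_integral: "\<kappa> * (2 * (LBINT j:{0..L}. (cos (ang t j))\<^sup>2) - L) = 1"
proof -
  have "2 * (LBINT j:{0..L}. (cos (ang t j))\<^sup>2) - L = (LBINT j:{0..L}. 2 * (cos (ang t j))\<^sup>2 - 1)"
    using L_pos by (subst set_integral_diff(2))
      (auto intro!: bounded_integrable[where C=1] set_integrable_mult_right simp: abs_square_le_1 set_lebesgue_integral_def)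
  also have "\<dots> = B t" by (simp add: B_def cos_double_cos)
  finally show ?thesis using B_const[of t] by simp
qed

text \<open>Since V_\<xi> = sin(2 \<theta>)/2, differentiating cos^2 \<theta> in time yields -sin(2
  \<theta>) V = -(V^2)_\<xi>. Integration gives V(t, 0)^2 - V(t, \<xi>)^2, and \<open>y\<close>
  contributes the missing -V(t, 0)^2.\<close>

lemma Xr_derivative:
  assumes "0 \<le> \<xi>" "\<xi> \<le> L" shows "((\<lambda>t. Xr t \<xi>) has_real_derivative - (V t \<xi>)\<^sup>2) (at t)"
proof -
  have "((\<lambda>t. (cos (ang t j))\<^sup>2) has_real_derivative - (sin (2 * ang t j) * V t j)) (at t)" for t j
    by (rule derivative_eq_intros ang_derivative refl)+ (simp add: sin_double)
  then have "((\<lambda>t. LBINT j:{0..\<xi>}. (cos (ang t j))\<^sup>2) has_real_derivative (LBINT j:{0..\<xi>}. - (sin (2 * ang t j) * V t j))) (at t)"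
    using trig_V_bound by (intro DERIV_integral[where C=1 and C'=CV]) (auto simp: abs_square_le_1)
  from DERIV_diff[OF this y(2)]
  have "((\<lambda>t. Xr t \<xi>) has_real_derivative (LBINT j:{0..\<xi>}. - (sin (2 * ang t j) * V t j)) - (V t 0)\<^sup>2) (at t)"
    unfolding Xr_def .
  moreover have "(LBINT j:{0..\<xi>}. - (sin (2 * ang t j) * V t j)) = - ((V t \<xi>)\<^sup>2 - (V t 0)\<^sup>2)"
  proof -
    let ?s = "\<lambda>j. sin (2 * ang t j) / 2"
    have "prim (\<lambda>j. P t j + - \<kappa> * I t) (\<lambda>j. ?s j + 0)" by (intro prim_add prim_P prim_const)
    from prim_mult[OF this this]
    have "(LBINT j:{0..\<xi>}. (P t j + - \<kappa> * I t) * (?s j + 0) + (?s j + 0) * (P t j + - \<kappa> * I t)) = (V t \<xi>)\<^sup>2 - (V t 0)\<^sup>2"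
      using assms S_eq_P[of 0 t] L_pos by (subst prim_integral) (auto simp: V_eq S_eq_P power2_eq_square)
    moreover have "(LBINT j:{0..\<xi>}. - (sin (2 * ang t j) * V t j))
       = - (LBINT j:{0..\<xi>}. (P t j + - \<kappa> * I t) * (?s j + 0) + (?s j + 0) * (P t j + - \<kappa> * I t))"
    proof -
      have "(LBINT j:{0..\<xi>}. sin (2 * ang t j) * V t j)
       = (LBINT j:{0..\<xi>}. (P t j + - \<kappa> * I t) * (?s j + 0) + (?s j + 0) * (P t j + - \<kappa> * I t))"
        using assms by (intro set_lebesgue_integral_cong) (auto simp: V_eq S_eq_P algebra_simps)
      then show ?thesis by (simp add: set_lebesgue_integral_def)
    qed
    ultimately show ?thesis by simp
  qed
  ultimately show ?thesis by simp
qed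

end

abbreviation joint_measurable :: "(real \<Rightarrow> real \<Rightarrow> 'a :: topological_space) \<Rightarrow> bool" where
  "joint_measurable f \<equiv> (\<lambda>p. f (fst p) (snd p)) \<in> borel_measurable borel"

lemma borel_fst_snd: "(fst :: real \<times> real \<Rightarrow> real) \<in> borel \<rightarrow>\<^sub>M borel" "(snd :: real \<times> real \<Rightarrow> real) \<in> borel \<rightarrow>\<^sub>M borel"
  unfolding borel_prod[symmetric] by (rule measurable_fst, rule measurable_snd)

text \<open>Rounding t down to the grid with mesh 1/(n+1) gives functions that are countable
  patchworks of slices; continuity in t lets them converge pointwise.\<close>

lemma borel_measurable_Caratheodory:
  fixes f :: "real \<Rightarrow> real \<Rightarrow> real"
  assumes cont: "\<And>t x. isCont (\<lambda>t. f t x) t" and meas: "\<And>t. f t \<in> borel_measurable borel"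
  shows "joint_measurable f"
proof (rule borel_measurable_LIMSEQ_metric)
  let ?r = "\<lambda>n t. of_int \<lfloor>real (Suc n) * t\<rfloor> / real (Suc n)"
  show "(\<lambda>p. f (?r n (fst p)) (snd p)) \<in> borel_measurable borel" for n
  proof (rule measurable_compose_countable[where f = "\<lambda>i p. f (of_int i / real (Suc n)) (snd p)"
        and g = "\<lambda>p. \<lfloor>real (Suc n) * fst p\<rfloor>"])
    show "(\<lambda>p :: real \<times> real. f (of_int i / real (Suc n)) (snd p)) \<in> borel_measurable borel" for i :: int
    proof -
      have "(snd :: real \<times> real \<Rightarrow> real) \<in> borel \<rightarrow>\<^sub>M borel" unfolding borel_prod[symmetric] by (rule measurable_snd)
      from measurable_compose[OF this meas[of "of_int i / real (Suc n)"]] show ?thesis .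
    qed
    show "(\<lambda>p::real \<times> real. \<lfloor>real (Suc n) * fst p\<rfloor>) \<in> borel \<rightarrow>\<^sub>M count_space UNIV"
      unfolding borel_prod[symmetric] by measurable
  qed
  fix p :: "real \<times> real"
  have "(\<lambda>n. ?r n (fst p)) \<longlonglongrightarrow> fst p"
  proof (rule real_tendsto_sandwich)
    have l: "of_int \<lfloor>real (Suc n) * fst p\<rfloor> \<le> real (Suc n) * fst p" "real (Suc n) * fst p - 1 \<le> of_int \<lfloor>real (Suc n) * fst p\<rfloor>" for n
      by linarith+
    show "\<forall>\<^sub>F n in sequentially. fst p - 1 / real (Suc n) \<le> ?r n (fst p)"
    proof (intro always_eventually allI)
      fix n
      have "fst p - 1 / real (Suc n) = (real (Suc n) * fst p - 1) / real (Suc n)" by (simp add: field_simps)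
      also have "\<dots> \<le> ?r n (fst p)" by (rule divide_right_mono[OF l(2)]) simp
      finally show "fst p - 1 / real (Suc n) \<le> ?r n (fst p)" .
    qed
    show "\<forall>\<^sub>F n in sequentially. ?r n (fst p) \<le> fst p"
    proof (intro always_eventually allI)
      fix n
      have "?r n (fst p) \<le> real (Suc n) * fst p / real (Suc n)" by (rule divide_right_mono[OF l(1)]) simp
      also have "\<dots> = fst p" by simp
      finally show "?r n (fst p) \<le> fst p" .
    qed
    have "(\<lambda>n. fst p - 1 / real (Suc n)) \<longlonglongrightarrow> fst p - 0"
      by (intro tendsto_diff tendsto_const LIMSEQ_Suc lim_const_over_n)
    then show "(\<lambda>n. fst p - 1 / real (Suc n)) \<longlonglongrightarrow> fst p" by simp
  qed simp
  then show "(\<lambda>n. f (?r n (fst p)) (snd p)) \<longlonglongrightarrow> f (fst p) (snd p)"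
    by (rule isCont_tendsto_compose[OF cont])
qed

context balanced_flow
begin

lemma periodicity:
  "\<theta> t (\<xi> + L) = \<theta> t \<xi>" "U t (\<xi> + L) = U t \<xi>" "Ut t (\<xi> + L) = Ut t \<xi>" "X t (\<xi> + L) = X t \<xi> + 1"
  unfolding \<theta>_def U_def Ut_def X_def red_periodic floor_add_period by simp_all

lemma flow_measurable [measurable]:
  "\<theta> t \<in> borel_measurable borel" "U t \<in> borel_measurable borel" "Ut t \<in> borel_measurable borel"
proof -
  have [measurable]: "H t \<in> borel_measurable borel" unfolding H_def[abs_def] by measurable
  show "\<theta> t \<in> borel_measurable borel" "U t \<in> borel_measurable borel" "Ut t \<in> borel_measurable borel"
    unfolding \<theta>_def[abs_def] U_def[abs_def] Ut_def[abs_def] by measurable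
qed

lemma U_bound: "\<bar>U t \<xi>\<bar> \<le> CV"
  by (simp add: U_def V_bound)

definition "CU = CV * L + \<bar>\<kappa>\<bar> * (CV * L * L)"

lemma Ut_bound: "\<bar>Ut t \<xi>\<bar> \<le> CU"
proof -
  have "\<bar>LBINT j:{0..L}. G t j * cos (2 * ang t j)\<bar> \<le> CV * L * 1 * (L - 0)"
    unfolding real_norm_def[symmetric] using L_pos
    by (intro set_integral_norm_le) (auto simp only: real_norm_def intro!: abs_mult_le G_bound abs_cos_le_one)
  then have "\<bar>\<kappa> * (LBINT j:{0..L}. G t j * cos (2 * ang t j))\<bar> \<le> \<bar>\<kappa>\<bar> * (CV * L * L)"
    by (intro abs_mult_le) auto
  then show ?thesis using G_bound[of t "red \<xi>"] by (simp add: Ut_def H_def CU_def abs_le_iff)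
qed

lemma prim_U: "prim (U t) (\<lambda>\<xi>. sin (2 * \<theta> t \<xi>) / 2)"
proof (rule prim_of_quasiperiodic[OF L_pos])
  show "loc_int (\<lambda>\<xi>. sin (2 * \<theta> t \<xi>) / 2)"
    by (rule loc_int_bounded[where C=1]) (auto intro: order_trans[OF abs_sin_le_one])
  show "U t (\<xi> + L) = U t \<xi> + 0" for \<xi> by (simp add: periodicity)
  fix x assume x: "0 \<le> x" "x \<le> L"
  have "(LBINT j:{0..x}. sin (2 * \<theta> t j) / 2) = (LBINT j:{0..x}. sin (2 * ang t j) / 2)"
    using x by (intro set_lebesgue_integral_cong) (auto simp: at_red)
  also have "\<dots> = P t x - P t 0" using x(1) by (rule prim_integral[OF prim_P])
  also have "\<dots> = U t x - U t 0" using x by (simp add: at_red V_eq S_eq_P)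
  finally show "(LBINT j:{0..x}. sin (2 * \<theta> t j) / 2) = U t x - U t 0" .
qed (simp add: periodicity)

lemma cos_sq_mass: "(LBINT j:{0..L}. (cos (ang t j))\<^sup>2) = 1"
proof -
  have "\<kappa> * (2 * (LBINT j:{0..L}. (cos (ang t j))\<^sup>2) - L) = \<kappa> * (2 - L)"
    using cos_sq_integral[of t] mass by simp
  moreover have "\<kappa> \<noteq> 0" using mass by auto
  ultimately show ?thesis by simp
qed

lemma X_at_red: assumes "0 \<le> \<xi>" "\<xi> \<le> L" shows "X t \<xi> = Xr t \<xi>"
proof (cases "\<xi> = L")
  case True
  have "(LBINT j:{0..0}. (cos (ang t j))\<^sup>2) = 0"
    using set_integral_norm_le[of 0 0 "\<lambda>j. (cos (ang t j))\<^sup>2" 1] by (simp add: abs_square_le_1)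
  then show ?thesis using True cos_sq_mass[of t] L_pos by (simp add: X_def red_L Xr_def)
next
  case False
  then show ?thesis using assms by (simp add: X_def red_id)
qed

lemma prim_X: "prim (X t) (\<lambda>\<xi>. (cos (\<theta> t \<xi>))\<^sup>2)"
proof (rule prim_of_quasiperiodic[OF L_pos])
  show "loc_int (\<lambda>\<xi>. (cos (\<theta> t \<xi>))\<^sup>2)"
    by (rule loc_int_bounded[where C=1]) (auto simp: abs_square_le_1)
  show "X t (\<xi> + L) = X t \<xi> + 1" for \<xi> by (simp add: periodicity)
  fix x assume x: "0 \<le> x" "x \<le> L"
  have 0: "(LBINT j:{0..0}. (cos (ang t j))\<^sup>2) = 0"
    using set_integral_norm_le[of 0 0 "\<lambda>j. (cos (ang t j))\<^sup>2" 1] by (simp add: abs_square_le_1)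
  have "(LBINT j:{0..x}. (cos (\<theta> t j))\<^sup>2) = (LBINT j:{0..x}. (cos (ang t j))\<^sup>2)"
    using x by (intro set_lebesgue_integral_cong) (auto simp: at_red)
  also have "\<dots> = X t x - X t 0" using x L_pos 0 by (simp add: X_at_red Xr_def)
  finally show "(LBINT j:{0..x}. (cos (\<theta> t j))\<^sup>2) = X t x - X t 0" .
qed (simp add: periodicity)

lemma prim_Ut: "prim (Ut t) (\<lambda>\<xi>. cos (2 * \<theta> t \<xi>) * U t \<xi>)"
proof (rule prim_of_quasiperiodic[OF L_pos])
  show "loc_int (\<lambda>\<xi>. cos (2 * \<theta> t \<xi>) * U t \<xi>)"
    by (rule loc_int_bounded[where C="1 * CV"]) (measurable, intro abs_mult_le abs_cos_le_one U_bound)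
  show "Ut t (\<xi> + L) = Ut t \<xi> + 0" for \<xi> by (simp add: periodicity)
  fix x assume x: "0 \<le> x" "x \<le> L"
  have "(LBINT j:{0..x}. cos (2 * \<theta> t j) * U t j) = (LBINT j:{0..x}. cos (2 * ang t j) * V t j)"
    using x by (intro set_lebesgue_integral_cong) (auto simp: at_red)
  also have "\<dots> = G t x - G t 0" using x by (simp add: G_ends) (simp add: G_def min_absorb2)
  also have "\<dots> = Ut t x - Ut t 0" using x by (simp add: at_red H_def)
  finally show "(LBINT j:{0..x}. cos (2 * \<theta> t j) * U t j) = Ut t x - Ut t 0" .
qed (simp add: periodicity)

text \<open>The acceleration obeys the same normalisation as the velocity. It is what later
  identifies the additive constant f(t) in the Eulerian source.\<close>

lemma Ut_cos_zero: "(LBINT j:{0..L}. Ut t j * cos (2 * \<theta> t j)) = 0"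
proof -
  let ?J = "LBINT j:{0..L}. G t j * cos (2 * ang t j)"
  have 1: "set_integrable lborel {0..L} (\<lambda>j. G t j * cos (2 * ang t j))"
    by (rule bounded_integrable[where C="CV * L * 1"]) (measurable, intro abs_mult_le G_bound abs_cos_le_one)
  have 2: "set_integrable lborel {0..L} (\<lambda>j. cos (2 * ang t j))"
    by (rule bounded_integrable[where C=1]) auto
  have "(LBINT j:{0..L}. Ut t j * cos (2 * \<theta> t j))
    = (LBINT j:{0..L}. G t j * cos (2 * ang t j) - \<kappa> * ?J * cos (2 * ang t j))"
    by (intro set_lebesgue_integral_cong) (auto simp: at_red H_def algebra_simps)
  also have "\<dots> = ?J - \<kappa> * ?J * B t"
    unfolding set_integral_diff(2)[OF 1 set_integrable_mult_right[OF 2]] by (simp add: B_def)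
  also have "\<dots> = ?J * (1 - \<kappa> * B t)" by (simp add: algebra_simps)
  finally show ?thesis using B_const[of t] by simp
qed

lemma flow_derivatives:
  "((\<lambda>t. \<theta> t \<xi>) has_real_derivative U t \<xi>) (at t)"
  "((\<lambda>t. X t \<xi>) has_real_derivative - (U t \<xi>)\<^sup>2) (at t)"
  "((\<lambda>t. U t \<xi>) has_real_derivative Ut t \<xi>) (at t)"
proof -
  show "((\<lambda>t. \<theta> t \<xi>) has_real_derivative U t \<xi>) (at t)" unfolding \<theta>_def U_def by (rule ang_derivative)
  show "((\<lambda>t. X t \<xi>) has_real_derivative - (U t \<xi>)\<^sup>2) (at t)"
    using DERIV_add[OF Xr_derivative[OF red(1) less_imp_le[OF red(2)]] DERIV_const] unfolding X_def U_def by simp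
  show "((\<lambda>t. U t \<xi>) has_real_derivative Ut t \<xi>) (at t)" unfolding U_def Ut_def by (rule V_derivative)
qed

lemma flow_jointly_measurable:
  "joint_measurable \<theta>" "joint_measurable U"
  "joint_measurable X" "joint_measurable Ut"
proof -
  have Xm: "X t \<in> borel_measurable borel" for t
  proof -
    have "loc_int (\<lambda>j. (cos (ang t j))\<^sup>2)"
      by (rule loc_int_bounded[where C=1]) (auto simp: abs_square_le_1)
    from prim_measurable[OF prim_exists[OF this, of 0]]
    have [measurable]: "(\<lambda>\<xi>. interval_lebesgue_integral lborel (ereal 0) (ereal \<xi>) (\<lambda>j. (cos (ang t j))\<^sup>2)) \<in> borel_measurable borel" .
    have eq: "X t \<xi> = interval_lebesgue_integral lborel (ereal 0) (ereal (red \<xi>)) (\<lambda>j. (cos (ang t j))\<^sup>2) - y t + of_int \<lfloor>\<xi> / L\<rfloor>" for \<xi>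
      using red(1)[of \<xi>] by (simp add: X_def Xr_def interval_integral_Icc del: ereal_less_eq)
    have [measurable]: "(\<lambda>\<xi>. interval_lebesgue_integral lborel (ereal 0) (ereal (red \<xi>)) (\<lambda>j. (cos (ang t j))\<^sup>2)) \<in> borel_measurable borel"
      by (rule measurable_compose[of red]) measurable
    show ?thesis unfolding eq[abs_def] by measurable
  qed
  have Ucont: "isCont (\<lambda>t. U t \<xi>) t" for t \<xi> unfolding U_def by (rule V_isCont)
  show "joint_measurable \<theta>"
    by (rule borel_measurable_Caratheodory[OF DERIV_isCont[OF flow_derivatives(1)]]) measurable
  show Um: "joint_measurable U"
    by (rule borel_measurable_Caratheodory[OF Ucont]) measurable
  show "joint_measurable X"
    by (rule borel_measurable_Caratheodory[OF DERIV_isCont[OF flow_derivatives(2)] Xm])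
  \<comment> \<open>Continuity of \<open>Ut\<close> in time has not been established, so it is
    obtained as a pointwise limit of difference quotients of \<open>U\<close>.\<close>
  show "joint_measurable Ut"
  proof (rule borel_measurable_LIMSEQ_metric)
    fix n
    have "(\<lambda>p. (fst p + 1 / real (Suc n), snd p)) \<in> borel \<rightarrow>\<^sub>M (borel :: (real \<times> real) measure)"
      unfolding borel_prod[symmetric] by measurable
    from measurable_compose[OF this Um]
    have [measurable]: "(\<lambda>p. U (fst p + 1 / real (Suc n)) (snd p)) \<in> borel_measurable borel" by simp
    note [measurable] = Um
    show "(\<lambda>p. (U (fst p + 1 / real (Suc n)) (snd p) - U (fst p) (snd p)) / (1 / real (Suc n))) \<in> borel_measurable borel"
      by measurable
  next
    fix p :: "real \<times> real"
    have "((\<lambda>h. (U (fst p + h) (snd p) - U (fst p) (snd p)) / h) \<longlongrightarrow> Ut (fst p) (snd p)) (at 0)"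
      using flow_derivatives(3) by (simp add: DERIV_def)
    moreover have "filterlim (\<lambda>n. 1 / real (Suc n)) (at 0) sequentially"
      unfolding filterlim_at
    proof
      show "(\<lambda>n. 1 / real (Suc n)) \<longlonglongrightarrow> 0" by (rule LIMSEQ_Suc[OF lim_const_over_n])
    qed (auto intro!: always_eventually)
    ultimately show "(\<lambda>n. (U (fst p + 1 / real (Suc n)) (snd p) - U (fst p) (snd p)) / (1 / real (Suc n))) \<longlonglongrightarrow> Ut (fst p) (snd p)"
      by (rule filterlim_compose)
  qed
qed

end

section \<open>Calculus of test functions and the fundamental theorem for space-time
  integrals\<close>

section \<open>Test functions\<close>

lemma partials_trans: "h \<in> partials g \<Longrightarrow> g \<in> partials f \<Longrightarrow> h \<in> partials f"
  by (induction rule: partials.induct) (auto intro: partials.intros)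

lemma smooth2_pd: "smooth2 f \<Longrightarrow> smooth2 (pd_t f)" "smooth2 f \<Longrightarrow> smooth2 (pd_x f)"
  unfolding smooth2_def using partials_trans partials.intros by blast+

lemma smooth2_continuous: "smooth2 f \<Longrightarrow> continuous_on UNIV (\<lambda>p. f (fst p) (snd p))"
  unfolding smooth2_def using partials.self by blast

lemma smooth2_derivative:
  assumes "smooth2 f"
  shows "((\<lambda>s. f s x) has_real_derivative pd_t f t x) (at t)" "((\<lambda>y. f t y) has_real_derivative pd_x f t x) (at x)"
proof -
  have "(\<lambda>s. f s x) differentiable (at t)" "(\<lambda>y. f t y) differentiable (at x)"
    using assms partials.self unfolding smooth2_def by blast+
  then show "((\<lambda>s. f s x) has_real_derivative pd_t f t x) (at t)" "((\<lambda>y. f t y) has_real_derivative pd_x f t x) (at x)"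
    unfolding pd_t_def pd_x_def by (simp_all add: DERIV_deriv_iff_real_differentiable)
qed

lemma smooth2_measurable: "smooth2 f \<Longrightarrow> joint_measurable f"
  by (rule borel_measurable_continuous_onI[OF smooth2_continuous])

lemma smooth2_continuous_slice: "smooth2 f \<Longrightarrow> continuous_on A (f t)"
  by (rule continuous_on_subset[of UNIV])
     (auto intro!: continuous_at_imp_continuous_on intro: DERIV_isCont smooth2_derivative(2))

lemma smooth2_prim: "smooth2 f \<Longrightarrow> prim (f t) (pd_x f t)"
  by (rule prim_of_DERIV) (rule smooth2_derivative, assumption, rule smooth2_continuous_slice, rule smooth2_pd)

text \<open>Smoothness is encoded by iterated partial derivatives only; total differentiability
  comes from one partial derivative at the point together with continuity of the other.\<close>

lemma smooth2_chain:
  assumes f: "smooth2 f" and x: "(x has_real_derivative x') (at t)"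
  shows "((\<lambda>t. f t (x t)) has_real_derivative pd_t f t (x t) + pd_x f t (x t) * x') (at t)"
proof -
  have "((\<lambda>(t, y). f t y) has_derivative (\<lambda>(a, b). pd_t f t (x t) * a + blinfun_apply (blinfun_scaleR_left (pd_x f t (x t))) b))
     (at (t, x t) within UNIV \<times> UNIV)"
  proof (rule has_derivative_partialsI)
    show "((\<lambda>s. f s (x t)) has_derivative (*) (pd_t f t (x t))) (at t within UNIV)"
      using smooth2_derivative(1)[OF f] unfolding has_field_derivative_def .
    show "((\<lambda>y. f s y) has_derivative blinfun_apply (blinfun_scaleR_left (pd_x f s y))) (at y within UNIV)" for s y
      using smooth2_derivative(2)[OF f, of s y] unfolding has_field_derivative_def by (simp add: mult_commute_abs)
    have c: "continuous_on UNIV (\<lambda>p. blinfun_scaleR_left (pd_x f (fst p) (snd p)))"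
      by (rule bounded_linear.continuous_on[OF bounded_linear_blinfun_scaleR_left smooth2_continuous[OF smooth2_pd(2)[OF f]]])
    show "continuous (at (t, x t) within UNIV \<times> UNIV) (\<lambda>(s, y). blinfun_scaleR_left (pd_x f s y))"
      using c by (simp add: continuous_on_eq_continuous_at case_prod_beta')
  qed auto
  then have D: "((\<lambda>p. f (fst p) (snd p)) has_derivative (\<lambda>p. pd_t f t (x t) * fst p + pd_x f t (x t) * snd p)) (at (t, x t))"
    by (simp add: case_prod_beta' mult.commute)
  have P: "((\<lambda>t. (t, x t)) has_derivative (\<lambda>h. (h, x' * h))) (at t)"
    using x unfolding has_field_derivative_def by (intro has_derivative_Pair has_derivative_ident)
  from has_derivative_compose[OF P D]
  have "((\<lambda>t. f t (x t)) has_derivative (\<lambda>h. pd_t f t (x t) * h + pd_x f t (x t) * (x' * h))) (at t)" by simp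
  then show ?thesis
    unfolding has_field_derivative_def by (rule has_derivative_eq_rhs) (auto simp: fun_eq_iff algebra_simps)
qed

lemma test_fn_smooth2: "test_fn \<psi> \<Longrightarrow> smooth2 \<psi>"
  and test_fn_periodic: "test_fn \<psi> \<Longrightarrow> \<psi> t (x + 1) = \<psi> t x"
  by (simp_all add: test_fn_def)

lemma test_fn_pd:
  assumes "test_fn \<psi>" shows "test_fn (pd_t \<psi>)" "test_fn (pd_x \<psi>)"
proof -
  note s = test_fn_smooth2[OF assms]
  obtain T where T: "\<And>t x. T \<le> t \<Longrightarrow> \<psi> t x = 0" using assms unfolding test_fn_def by blast
  have px: "\<psi> t x = \<psi> t (x + 1)" for t x using assms by (simp add: test_fn_def)
  have "pd_t \<psi> t (x + 1) = pd_t \<psi> t x" for t x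
    unfolding pd_t_def by (simp add: test_fn_periodic[OF assms])
  moreover have "pd_t \<psi> t x = 0" if "T + 1 \<le> t" for t x
  proof -
    have "((\<lambda>s. \<psi> s x) has_real_derivative 0) (at t)"
      by (rule has_field_derivative_transform_within_open[OF DERIV_const[of 0] open_greaterThan[of T]]) (use that T in auto)
    then show ?thesis using smooth2_derivative(1)[OF s] DERIV_unique by blast
  qed
  ultimately show "test_fn (pd_t \<psi>)" unfolding test_fn_def using smooth2_pd(1)[OF s] by blast
  have "pd_x \<psi> t (x + 1) = pd_x \<psi> t x" for t x
  proof -
    have "((\<lambda>y. \<psi> t (y + 1)) has_real_derivative pd_x \<psi> t (x + 1)) (at x)"
      using smooth2_derivative(2)[OF s, of t "x + 1"] by (simp add: DERIV_shift)
    then have "((\<lambda>y. \<psi> t y) has_real_derivative pd_x \<psi> t (x + 1)) (at x)" by (simp only: px[symmetric])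
    then show ?thesis using smooth2_derivative(2)[OF s] DERIV_unique by blast
  qed
  moreover have "pd_x \<psi> t x = 0" if "T \<le> t" for t x
  proof -
    have "\<psi> t = (\<lambda>x. 0)" using T[OF that] by auto
    then show ?thesis by (simp add: pd_x_def)
  qed
  ultimately show "test_fn (pd_x \<psi>)" unfolding test_fn_def using smooth2_pd(2)[OF s] by blast
qed

text \<open>The bound reaches back to time -1 because the two-sided time derivative at t = 0 is
  taken in a ball of radius 1. Periodicity and the support condition reduce it to a compact
  rectangle.\<close>

lemma test_fn_bounded:
  assumes "test_fn \<psi>" obtains C where "\<And>t x. - 1 \<le> t \<Longrightarrow> \<bar>\<psi> t x\<bar> \<le> C"
proof -
  obtain T where T: "\<And>t x. T \<le> t \<Longrightarrow> \<psi> t x = 0" using assms unfolding test_fn_def by blast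
  have "compact ((\<lambda>p. \<psi> (fst p) (snd p)) ` ({-1..T} \<times> {0..1}))"
    by (intro compact_continuous_image compact_Times compact_Icc continuous_on_subset[OF smooth2_continuous[OF test_fn_smooth2[OF assms]]]) auto
  from compact_imp_bounded[OF this] obtain C where C: "\<And>p. p \<in> {-1..T} \<times> {0..1} \<Longrightarrow> \<bar>\<psi> (fst p) (snd p)\<bar> \<le> C"
    unfolding bounded_iff by fastforce
  have "\<bar>\<psi> t x\<bar> \<le> max C 0" if "-1 \<le> t" for t x
  proof (cases "T \<le> t")
    case False
    obtain y where "0 \<le> y" "y < 1" "\<psi> t x = \<psi> t y"
      using periodic_floor[of "\<psi> t" 1 x] test_fn_periodic[OF assms] by (metis zero_less_one)
    then show ?thesis using C[of "(t, y)"] that False by auto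
  qed (simp add: T)
  then show thesis by (rule that)
qed

lemma test_fn_support:
  assumes "test_fn \<psi>"
  obtains T where "0 \<le> T" "\<And>t x. T \<le> t \<Longrightarrow> \<psi> t x = 0" "\<And>t x. T \<le> t \<Longrightarrow> pd_t \<psi> t x = 0" "\<And>t x. T \<le> t \<Longrightarrow> pd_x \<psi> t x = 0"
proof -
  have ex: "\<exists>T. \<forall>t x. T \<le> t \<longrightarrow> g t x = 0" if "test_fn g" for g using that unfolding test_fn_def by blast
  obtain T1 where T1: "\<And>t x. T1 \<le> t \<Longrightarrow> \<psi> t x = 0" using ex[OF assms] by blast
  obtain T2 where T2: "\<And>t x. T2 \<le> t \<Longrightarrow> pd_t \<psi> t x = 0" using ex[OF test_fn_pd(1)[OF assms]] by blast
  obtain T3 where T3: "\<And>t x. T3 \<le> t \<Longrightarrow> pd_x \<psi> t x = 0" using ex[OF test_fn_pd(2)[OF assms]] by blast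
  note T = T1 T2 T3
  show thesis by (rule that[of "Max {0, T1, T2, T3}"]) (auto intro: T)
qed

lemma borel_measurable_sint:
  fixes F :: "real \<Rightarrow> real \<Rightarrow> real"
  assumes "joint_measurable F"
  shows "(\<lambda>t. sint (F t)) \<in> borel_measurable borel"
proof -
  have sets_eq: "sets (borel \<Otimes>\<^sub>M (lborel :: real measure)) = sets (borel \<Otimes>\<^sub>M borel)"
    by (rule sets_pair_measure_cong) simp_all
  have [measurable]: "(\<lambda>p. F (fst p) (snd p)) \<in> borel_measurable (borel \<Otimes>\<^sub>M borel)"
    using assms unfolding borel_prod .
  have "(\<lambda>p. indicator {0..1} (snd p) *\<^sub>R F (fst p) (snd p)) \<in> borel_measurable (borel \<Otimes>\<^sub>M borel)"
    by measurable
  then have "(\<lambda>(t, x). indicator {0..1} x *\<^sub>R F t x) \<in> borel_measurable (borel \<Otimes>\<^sub>M lborel)"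
    unfolding measurable_cong_sets[OF sets_eq refl] by (simp only: case_prod_beta')
  from lborel.borel_measurable_lebesgue_integral[OF this] show ?thesis
    by (simp add: sint_def set_lebesgue_integral_def)
qed

lemma negligible_null_sets_lborel: "N \<in> null_sets (lborel :: real measure) \<Longrightarrow> negligible N"
  using null_sets_completionI negligible_iff_null_sets by blast

text \<open>The functional \<open>J\<close> is differentiable at every time, while the spatial
  integrals match its derivative only off the null set \<open>N\<close>, which the time integral
  ignores. The value of \<open>J\<close> at 0 becomes the initial term of a weak identity.\<close>

lemma stint_FTC:
  assumes T: "0 \<le> T" and N: "N \<in> null_sets lborel"
    and J: "\<And>t. 0 \<le> t \<Longrightarrow> t \<le> T \<Longrightarrow> (J has_real_derivative j t) (at t)"
    and eq: "\<And>t. 0 \<le> t \<Longrightarrow> t \<notin> N \<Longrightarrow> sint (F t) + sint (G t) = j t"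
    and m: "joint_measurable F" "joint_measurable G"
    and zero: "\<And>t x. T \<le> t \<Longrightarrow> F t x = 0" "\<And>t x. T \<le> t \<Longrightarrow> G t x = 0"
    and bd: "\<And>t. 0 \<le> t \<Longrightarrow> t \<notin> N \<Longrightarrow> \<bar>sint (F t)\<bar> \<le> C" "\<And>t. 0 \<le> t \<Longrightarrow> t \<notin> N \<Longrightarrow> \<bar>sint (G t)\<bar> \<le> C'"
    and JT: "J T = 0"
  shows "stint F = - stint G - J 0"
proof -
  have meas: "(\<lambda>t. sint (F t)) \<in> borel_measurable borel" "(\<lambda>t. sint (G t)) \<in> borel_measurable borel"
    by (rule borel_measurable_sint[OF m(1)], rule borel_measurable_sint[OF m(2)])
  have int: "set_integrable lborel {0..T} (\<lambda>t. sint (F t))" if "(\<lambda>t. sint (F t)) \<in> borel_measurable borel"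
    "\<And>t. 0 \<le> t \<Longrightarrow> t \<notin> N \<Longrightarrow> \<bar>sint (F t)\<bar> \<le> C" for F C
    by (rule set_integrable_off_null[OF that(1) N that(2)]) auto
  note iF = int[OF meas(1) bd(1)] and iG = int[OF meas(2) bd(2)]
  have st: "stint F = (LBINT t:{0..T}. sint (F t))" if z: "\<And>t x. T \<le> t \<Longrightarrow> F t x = 0" for F
  proof -
    have z': "sint (F t) = 0" if "T \<le> t" for t
    proof -
      have "F t = (\<lambda>x. 0)" using z[OF that] by auto
      then show ?thesis by (simp add: sint_const)
    qed
    then have "indicator {0..} t *\<^sub>R sint (F t) = indicator {0..T} t *\<^sub>R sint (F t)" for t
      by (cases "T \<le> t") (auto simp: indicator_def)
    then show ?thesis unfolding stint_def set_lebesgue_integral_def by (simp only:)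
  qed
  have "stint F + stint G = (LBINT t:{0..T}. sint (F t) + sint (G t))"
    using st[of F] st[of G] zero set_integral_add(2)[OF iF iG] by simp
  also have "\<dots> = integral {0..T} (\<lambda>t. sint (F t) + sint (G t))"
    by (rule set_borel_integral_eq_integral(2)[OF set_integral_add(1)[OF iF iG]])
  also have "\<dots> = J T - J 0"
  proof (rule integral_unique, rule has_integral_spike[OF negligible_null_sets_lborel[OF N]])
    show "(j has_integral J T - J 0) {0..T}"
      using J T by (intro fundamental_theorem_of_calculus)
        (auto simp: has_real_derivative_iff_has_vector_derivative intro: has_vector_derivative_at_within)
  qed (use eq in auto)
  finally show ?thesis using JT by simp
qed

lemma sint_by_parts:
  assumes F: "prim F f" "\<And>x. F (x + 1) = F x" and G: "prim G g" "\<And>x. G (x + 1) = G x"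
  shows "sint (\<lambda>x. F x * g x) = - sint (\<lambda>x. f x * G x)"
proof -
  have l: "loc_int (\<lambda>x. F x * g x)" "loc_int (\<lambda>x. f x * G x)"
    using loc_int_mult_continuous[OF prim_continuous[OF F(1)] prim_loc_int[OF G(1)]]
      loc_int_mult_continuous[OF prim_continuous[OF G(1)] prim_loc_int[OF F(1)]] by (simp_all add: mult.commute)
  have "sint (\<lambda>x. F x * g x) + sint (\<lambda>x. f x * G x) = F 1 * G 1 - F 0 * G 0"
    using sint_prim[OF prim_mult[OF F(1) G(1)]] sint_add[OF l] by simp
  also have "\<dots> = 0" using F(2)[of 0] G(2)[of 0] by simp
  finally show ?thesis by simp
qed

section \<open>Construction of the solution from the Lagrangian flow\<close>

section \<open>Existence\<close>

context lagrangian_coords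
begin

lemma X_L: "X L = X 0 + 1"
  using X_periodic[of 0] by simp

lemma integral_sin_arctan: "(LBINT y:{0..L}. sin (2 * arctan (g (X y)))) = 0"
proof -
  have "(LBINT y:{0..L}. sin (2 * arctan (g (X y)))) = (LBINT y:{0..L}. 2 * (g (X y) / \<rho> (X y)))"
    by (intro set_lebesgue_integral_cong) (auto simp flip: sin_arctan_2)
  also have "\<dots> = 2 * (f (X L) - f (X 0))"
    unfolding set_integral_mult_right using L_pos by (subst prim_integral[OF prim_f_X]) auto
  finally show ?thesis by (simp add: X_L f_periodic)
qed

lemma integral_cos_arctan: "(LBINT y:{0..L}. cos (2 * arctan (g (X y)))) = 2 - L"
proof -
  have "(LBINT y:{0..L}. cos (2 * arctan (g (X y)))) = (LBINT y:{0..L}. 2 * (1 / \<rho> (X y)) - 1)"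
    by (intro set_lebesgue_integral_cong) (auto simp: cos_double_cos cos_arctan_sq)
  also have "\<dots> = (2 * X L - L) - (2 * X 0 - 0)"
    using L_pos by (intro prim_integral prim_diff prim_cmult prim_X prim_of_DERIV) (auto intro!: derivative_eq_intros)
  finally show ?thesis by (simp add: X_L)
qed

end

locale pulse_datum = ini: lagrangian_coords u0 u0' 0 for u0 u0' +
  assumes h_ne_1: "sint (\<lambda>x. (u0' x)\<^sup>2) \<noteq> 1"
    and mean_zero: "sint (\<lambda>x. u0 x - u0 x * (u0' x)\<^sup>2) = 0"
begin

abbreviation "h \<equiv> sint (\<lambda>x. (u0' x)\<^sup>2)"

text \<open>Here h \<noteq> 1 enters: \<kappa> = 1/(1 - h) has to invert int cos(2 \<theta>) d\<xi>
  = 2 - L = 1 - h.\<close>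

sublocale fl: balanced_flow ini.L "1 / (1 - h)" "\<lambda>\<xi>. arctan (u0' (ini.X \<xi>))"
proof
  have h: "2 - ini.L = 1 - h" "1 - h \<noteq> 0" using h_ne_1 by (auto simp: ini.L_def)
  show "1 / (1 - h) * (LBINT \<eta>:{0..ini.L}. cos (2 * arctan (u0' (ini.X \<eta>)))) = 1"
    using h by (simp add: ini.integral_cos_arctan)
  show "1 / (1 - h) * (2 - ini.L) = 1" using h by simp
qed (simp_all add: ini.L_pos ini.integral_sin_arctan ini.X_L ini.g_periodic)

lemma \<theta>_initial: "fl.\<theta> 0 \<xi> = arctan (u0' (ini.X \<xi>))"
proof -
  have "u0' (ini.X (\<xi> + ini.L)) = u0' (ini.X \<xi>)" for \<xi> by (simp add: ini.X_periodic ini.g_periodic)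
  from periodic_int[of "\<lambda>\<xi>. u0' (ini.X \<xi>)", OF this, of \<xi> "- \<lfloor>\<xi> / ini.L\<rfloor>"]
  show ?thesis by (simp add: fl.\<theta>_def fl.ang_0 fl.red_def)
qed

lemma X_initial: "fl.X 0 \<xi> = ini.X \<xi>"
proof -
  have "fl.X 0 0 = 0"
    using ini.L_pos fl.cos_sq_mass[of 0] set_integral_norm_le[of 0 0 "\<lambda>\<eta>. (cos (fl.ang 0 \<eta>))\<^sup>2" 1]
    by (simp add: fl.X_at_red fl.Xr_def fl.y abs_square_le_1)
  moreover have "ini.X 0 = 0" using ini.X_R[of 0] by (simp add: ini.R_0)
  moreover have "fl.X 0 \<xi> - fl.X 0 0 = ini.X \<xi> - ini.X 0"
    using fl.prim_X[of 0] ini.prim_X by (intro prim_unique[of _ "\<lambda>y. 1 / ini.\<rho> (ini.X y)"]) (simp_all add: \<theta>_initial ini.cos_arctan_sq)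
  ultimately show ?thesis by simp
qed

lemma integral_u_cos: "(LBINT \<xi>:{0..ini.L}. cos (2 * arctan (u0' (ini.X \<xi>))) * u0 (ini.X \<xi>)) = 0"
proof -
  note [measurable] = prim_measurable[OF ini.prim_f]
  have per: "(\<lambda>x. u0 x - u0 x * (u0' x)\<^sup>2) (x + 1) = (\<lambda>x. u0 x - u0 x * (u0' x)\<^sup>2) x" for x by (simp add: ini.f_periodic ini.g_periodic)
  have l: "loc_int (\<lambda>x. u0 x - u0 x * (u0' x)\<^sup>2)"
    using loc_int_mult_continuous[OF prim_continuous[OF ini.prim_f] loc_int_const[of 1]]
    by (intro loc_int_diff loc_int_mult_continuous H1_per_loc_int[OF ini.H1] prim_continuous[OF ini.prim_f]) simp
  have "(LBINT \<xi>:{0..ini.L}. cos (2 * arctan (u0' (ini.X \<xi>))) * u0 (ini.X \<xi>))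
    = (LBINT x:{ini.X 0..ini.X ini.L}. cos (2 * arctan (u0' x)) * u0 x * ini.\<rho> x)"
    using ini.L_pos by (intro ini.integral_X(1)) auto
  also have "\<dots> = (LBINT x:{ini.X 0..ini.X ini.L}. u0 x - u0 x * (u0' x)\<^sup>2)"
  proof (rule set_lebesgue_integral_cong, simp, intro allI impI)
    fix x
    have "cos (2 * arctan (u0' x)) = 2 * (1 / ini.\<rho> x) - 1" by (simp add: cos_double_cos ini.cos_arctan_sq)
    then have "cos (2 * arctan (u0' x)) * ini.\<rho> x = 2 - ini.\<rho> x"
      using ini.\<rho>_pos[of x] by (simp add: left_diff_distrib)
    moreover have "cos (2 * arctan (u0' x)) * u0 x * ini.\<rho> x = u0 x * (cos (2 * arctan (u0' x)) * ini.\<rho> x)" by simp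
    ultimately have "cos (2 * arctan (u0' x)) * u0 x * ini.\<rho> x = u0 x * (2 - ini.\<rho> x)" by (simp only:)
    then show "cos (2 * arctan (u0' x)) * u0 x * ini.\<rho> x = u0 x - u0 x * (u0' x)\<^sup>2" by (simp add: ini.\<rho>_def algebra_simps)
  qed
  also have "(LBINT x:{ini.X 0..ini.X ini.L}. u0 x - u0 x * (u0' x)\<^sup>2) = 0"
    unfolding ini.X_L using sint_period[OF l per] mean_zero by simp
  finally show ?thesis .
qed

text \<open>Both sides have the same \<xi>-derivative, so they differ by a constant c. Both have
  zero integral against cos(2 \<theta>), the flow by construction and the datum by its zero charge;
  hence c (1 - h) = 0.\<close>

lemma U_initial: "fl.U 0 \<xi> = u0 (ini.X \<xi>)"
proof -
  have p: "prim (fl.U 0) (\<lambda>y. u0' (ini.X y) / ini.\<rho> (ini.X y))"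
    using fl.prim_U[of 0] by (simp add: \<theta>_initial ini.sin_arctan_2)
  define c where "c = fl.U 0 0 - u0 (ini.X 0)"
  have c: "fl.U 0 \<xi> = u0 (ini.X \<xi>) + c" for \<xi>
    using prim_unique[OF p ini.prim_f_X, of \<xi> 0] by (simp add: c_def)
  let ?c = "\<lambda>\<xi>. cos (2 * arctan (u0' (ini.X \<xi>)))"
  have "0 = (LBINT \<xi>:{0..ini.L}. cos (2 * fl.ang 0 \<xi>) * fl.V 0 \<xi>)" by (simp add: fl.V_cos_zero)
  also have "\<dots> = (LBINT \<xi>:{0..ini.L}. ?c \<xi> * u0 (ini.X \<xi>) + c * ?c \<xi>)"
    by (intro set_lebesgue_integral_cong) (auto simp: fl.at_red(2)[symmetric] c fl.ang_0 algebra_simps)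
  also have "\<dots> = 0 + c * (2 - ini.L)"
  proof (subst set_integral_add(2))
    note [measurable] = prim_measurable[OF ini.prim_f]
    show "set_integrable lborel {0..ini.L} (\<lambda>\<xi>. c * ?c \<xi>)"
      by (rule fl.bounded_integrable[where C="\<bar>c\<bar> * 1"]) (measurable, intro fl.abs_mult_le abs_cos_le_one order_refl)
    show "set_integrable lborel {0..ini.L} (\<lambda>\<xi>. ?c \<xi> * u0 (ini.X \<xi>))"
    proof (rule fl.bounded_integrable[where C="1 * (fl.CV + \<bar>c\<bar>)"])
      show "\<bar>?c \<xi> * u0 (ini.X \<xi>)\<bar> \<le> 1 * (fl.CV + \<bar>c\<bar>)" for \<xi>
        using fl.U_bound[of 0 \<xi>] c[of \<xi>] by (intro fl.abs_mult_le abs_cos_le_one) linarith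
    qed measurable
  qed (simp add: integral_u_cos ini.integral_cos_arctan)
  finally have "c = 0" using h_ne_1 by (auto simp: ini.L_def)
  then show ?thesis using c by simp
qed

text \<open>Countable sets of times are null for every fixed label; Fubini exchanges the order of
  "almost every label" and "almost every time".\<close>

lemma AE_cos_nonzero: "AE t in lborel. AE \<xi> in lborel. cos (fl.\<theta> t \<xi>) \<noteq> 0"
proof -
  have "countable {t. cos (fl.\<theta> t \<xi>) = 0}" for \<xi>
    unfolding fl.\<theta>_def by (rule fl.countable_cos_ang_zero) (simp add: cos_arctan_not_zero)
  then have "AE t in lborel. cos (fl.\<theta> t \<xi>) \<noteq> 0" for \<xi>
    using AE_not_in[OF countable_imp_null_set_lborel, of "{t. cos (fl.\<theta> t \<xi>) = 0}"] by simp
  then have "AE \<xi> in lborel. AE t in lborel. cos (fl.\<theta> t \<xi>) \<noteq> 0" by simp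
  moreover have "{p \<in> space (lborel \<Otimes>\<^sub>M lborel). cos (fl.\<theta> (fst p) (snd p)) \<noteq> 0} \<in> sets (lborel \<Otimes>\<^sub>M lborel)"
  proof -
    have "(\<lambda>p. cos (fl.\<theta> (fst p) (snd p))) \<in> borel_measurable borel"
      using fl.flow_jointly_measurable(1) by measurable
    then have "{p. cos (fl.\<theta> (fst p) (snd p)) \<noteq> 0} \<in> sets borel" by measurable
    then show ?thesis by (simp add: borel_prod[symmetric] space_pair_measure cong: sets_pair_measure_cong)
  qed
  ultimately show ?thesis using lborel_pair.AE_commute[of "\<lambda>t \<xi>. cos (fl.\<theta> t \<xi>) \<noteq> 0"] by simp
qed

end

text \<open>Away from a null set \<open>N\<close> of times the Lagrangian map is strictly monotone. At the exceptional times the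
  solution is redefined to be the datum, since there part of the energy is concentrated on a null set.\<close>

locale pulse_solution = pulse_datum +
  fixes N :: "real set"
  assumes N_null: "N \<in> null_sets lborel"
    and cos_nonzero: "\<And>t. t \<notin> N \<Longrightarrow> AE \<xi> in lborel. cos (fl.\<theta> t \<xi>) \<noteq> 0"
begin

definition "good t \<longleftrightarrow> 0 \<le> t \<and> t \<notin> N"

text \<open>If X did not increase between two labels, cos^2 \<theta> would integrate to 0 over an
  interval of positive length, although cos \<theta> is nonzero almost everywhere at such
  times.\<close>

lemma X_strict: assumes "good t" "a < b" shows "fl.X t a < fl.X t b"
proof (rule ccontr)
  assume "\<not> fl.X t a < fl.X t b"
  then have z: "(LBINT \<xi>:{a..b}. (cos (fl.\<theta> t \<xi>))\<^sup>2) = 0"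
    using prim_mono[OF fl.prim_X zero_le_power2, of a b t] prim_integral[OF fl.prim_X, of a b t] assms(2) by simp
  have "AE \<xi> in lborel. indicator {a..b} \<xi> *\<^sub>R (cos (fl.\<theta> t \<xi>))\<^sup>2 = 0"
    using z prim_integrable[OF fl.prim_X[of t], of a b] unfolding set_lebesgue_integral_def set_integrable_def
    by (subst (asm) integral_nonneg_eq_0_iff_AE) auto
  moreover have "AE \<xi> in lborel. cos (fl.\<theta> t \<xi>) \<noteq> 0" using assms(1) by (intro cos_nonzero) (simp add: good_def)
  ultimately have "AE \<xi> in lborel. \<xi> \<notin> {a..b}" by eventually_elim (auto simp: indicator_def)
  then have "{a..b} \<in> null_sets lborel" by (subst AE_iff_null_sets) auto
  then show False using assms(2) by (simp add: null_sets_def)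
qed

lemma X_less_iff: "good t \<Longrightarrow> fl.X t a < fl.X t b \<longleftrightarrow> a < b" and X_le_iff: "good t \<Longrightarrow> fl.X t a \<le> fl.X t b \<longleftrightarrow> a \<le> b"
  using X_strict[of t a b] X_strict[of t b a] by (cases a b rule: linorder_cases; auto)+

lemma X_surj: "\<exists>\<xi>. fl.X t \<xi> = x"
proof -
  let ?f = "\<lambda>\<xi>. fl.X t \<xi> - \<xi> / ini.L"
  have "?f (\<xi> + ini.L) = ?f \<xi>" for \<xi> using ini.L_pos by (simp add: fl.periodicity add_divide_distrib)
  then have n: "fl.X t (of_int n * ini.L) = fl.X t 0 + of_int n" for n
    using periodic_int[of ?f ini.L 0 n] ini.L_pos by (simp add: diff_eq_eq)
  let ?n = "\<lfloor>x - fl.X t 0\<rfloor>"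
  have "\<exists>\<xi>. of_int ?n * ini.L \<le> \<xi> \<and> \<xi> \<le> of_int (?n + 1) * ini.L \<and> fl.X t \<xi> = x"
  proof (rule IVT')
    show "fl.X t (of_int ?n * ini.L) \<le> x" unfolding n by linarith
    show "x \<le> fl.X t (of_int (?n + 1) * ini.L)" unfolding n by linarith
    show "of_int ?n * ini.L \<le> of_int (?n + 1) * ini.L" using ini.L_pos by (intro mult_right_mono) auto
  qed (rule prim_continuous[OF fl.prim_X])
  then show ?thesis by blast
qed

definition "Y t x = (if good t then inv (fl.X t) x else 0)"

lemma X_Y: "good t \<Longrightarrow> fl.X t (Y t x) = x"
  unfolding Y_def using X_surj[of t x] by (simp add: f_inv_into_f) (metis f_inv_into_f rangeI)

lemma Y_X: assumes "good t" shows "Y t (fl.X t \<xi>) = \<xi>"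
  using X_Y[OF assms, of "fl.X t \<xi>"] X_less_iff[OF assms, of \<xi> "Y t (fl.X t \<xi>)"] X_less_iff[OF assms, of "Y t (fl.X t \<xi>)" \<xi>]
  by (cases \<xi> "Y t (fl.X t \<xi>)" rule: linorder_cases) auto

lemma Y_le_iff: "good t \<Longrightarrow> Y t x \<le> a \<longleftrightarrow> x \<le> fl.X t a"
  using X_le_iff[of t "Y t x" a] by (simp add: X_Y)

lemma Y_mono: "good t \<Longrightarrow> x \<le> y \<Longrightarrow> Y t x \<le> Y t y"
  by (simp add: Y_le_iff X_Y)

lemma Y_periodic: "good t \<Longrightarrow> Y t (x + 1) = Y t x + ini.L"
  using Y_X[of t "Y t x + ini.L"] by (simp add: fl.periodicity X_Y)

definition "u t x = (if good t then fl.U t (Y t x) else u0 x)"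
definition "ux t x = (if good t then tan (fl.\<theta> t (Y t x)) else u0' x)"

lemma good_measurable: "Measurable.pred borel good"
  using N_null unfolding good_def by (intro pred_intros_logic) (auto simp: null_sets_def pred_def)

lemma good_fst_measurable: "Measurable.pred borel (\<lambda>p :: real \<times> real. good (fst p))"
proof -
  have "(fst :: real \<times> real \<Rightarrow> real) \<in> borel \<rightarrow>\<^sub>M borel" unfolding borel_prod[symmetric] by (rule measurable_fst)
  from measurable_compose[OF this good_measurable] show ?thesis .
qed

text \<open>Sublevel sets of the inverse are described by \<open>x \<le> fl.X t a\<close> with a
  fixed label \<open>a\<close>, and X is continuous in time at a fixed label.\<close>

lemma Y_measurable: "joint_measurable Y"
proof (subst borel_measurable_iff_le, intro allI)
  fix a
  note [measurable] = good_fst_measurable borel_fst_snd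
  have "continuous_on UNIV (\<lambda>t. fl.X t a)"
    by (intro continuous_at_imp_continuous_on ballI DERIV_isCont[OF fl.flow_derivatives(2)])
  from measurable_compose[OF borel_fst_snd(1) borel_measurable_continuous_onI[OF this]]
  have [measurable]: "(\<lambda>p :: real \<times> real. fl.X (fst p) a) \<in> borel_measurable borel" .
  have eq: "{p \<in> space borel. Y (fst p) (snd p) \<le> a} = {p \<in> space borel. if good (fst p) then snd p \<le> fl.X (fst p) a else 0 \<le> a}"
    using Y_le_iff by (auto simp: Y_def)
  show "{p \<in> space borel. Y (fst p) (snd p) \<le> a} \<in> sets borel"
    unfolding eq by measurable
qed

lemma compose_Y_measurable:
  fixes f :: "real \<Rightarrow> real \<Rightarrow> real"
  assumes "joint_measurable f"
  shows "(\<lambda>p. f (fst p) (Y (fst p) (snd p))) \<in> borel_measurable borel"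
proof -
  have "(\<lambda>p. (fst p, Y (fst p) (snd p))) \<in> borel \<rightarrow>\<^sub>M borel \<Otimes>\<^sub>M borel"
    by (rule measurable_Pair[OF borel_fst_snd(1) Y_measurable])
  from measurable_compose[OF this[unfolded borel_prod] assms] show ?thesis by simp
qed

lemma solution_measurable:
  "joint_measurable u" "joint_measurable ux"
proof -
  note [measurable] = good_fst_measurable compose_Y_measurable[OF fl.flow_jointly_measurable(1)]
    compose_Y_measurable[OF fl.flow_jointly_measurable(2)] measurable_compose[OF borel_fst_snd(2) prim_measurable[OF ini.prim_f]]
    measurable_compose[OF borel_fst_snd(2) ini.g_measurable]
  show "joint_measurable u" unfolding u_def by measurable
  show "joint_measurable ux" unfolding ux_def tan_def by measurable
qed

lemma slice_measurable:
  fixes f :: "real \<Rightarrow> real \<Rightarrow> real"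
  assumes "joint_measurable f" shows "f t \<in> borel_measurable borel"
proof -
  have "(\<lambda>x. (t, x)) \<in> borel \<rightarrow>\<^sub>M borel \<Otimes>\<^sub>M (borel :: real measure)" by measurable
  from measurable_compose[OF this[unfolded borel_prod] assms] show ?thesis by simp
qed

lemmas u_measurable [measurable] = slice_measurable[OF solution_measurable(1)]
lemmas ux_measurable [measurable] = slice_measurable[OF solution_measurable(2)]

lemma change_of_variables:
  assumes g: "good t" and w: "w \<in> borel_measurable borel" and "a \<le> b"
  shows "(LBINT x:{a..b}. w x) = (LBINT \<xi>:{Y t a..Y t b}. w (fl.X t \<xi>) * (cos (fl.\<theta> t \<xi>))\<^sup>2)"
    and "set_integrable lborel {a..b} w \<longleftrightarrow> set_integrable lborel {Y t a..Y t b} (\<lambda>\<xi>. w (fl.X t \<xi>) * (cos (fl.\<theta> t \<xi>))\<^sup>2)"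
  using integral_substitution_prim[OF fl.prim_X zero_le_power2 Y_mono[OF g \<open>a \<le> b\<close>] w] by (simp_all add: X_Y[OF g])

lemma u_X: "good t \<Longrightarrow> u t (fl.X t \<xi>) = fl.U t \<xi>" and ux_X: "good t \<Longrightarrow> ux t (fl.X t \<xi>) = tan (fl.\<theta> t \<xi>)"
  by (simp_all add: u_def ux_def Y_X)

text \<open>Valid also where the cosine vanishes: division by zero makes the tangent 0 there, and
  sin(2 x) is 0 as well.\<close>

lemma tan_cos_sq: "tan x * (cos x)\<^sup>2 = sin (2 * x) / 2"
  by (simp add: tan_def sin_double power2_eq_square)

lemma H1: "H1_per (u t) (ux t)"
proof (cases "good t")
  case g: True
  have "prim (u t) (ux t)"
    unfolding prim_def loc_int_def
  proof (intro conjI allI impI)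
    fix a b :: real
    show "set_integrable lborel {a..b} (ux t)"
    proof (cases "a \<le> b")
      case True
      show ?thesis unfolding change_of_variables(2)[OF g ux_measurable True]
        using prim_integrable[OF fl.prim_U] by (simp add: ux_X[OF g] tan_cos_sq)
    qed (simp add: set_integrable_def)
    assume "a \<le> b"
    then show "(LBINT x:{a..b}. ux t x) = u t b - u t a"
      using prim_integral[OF fl.prim_U Y_mono[OF g], of a b t] g
      by (simp add: change_of_variables(1)[OF g] ux_X[OF g] tan_cos_sq u_def)
  qed (rule ux_measurable)
  moreover have "set_integrable lborel {0..1} (\<lambda>x. (ux t x)\<^sup>2)"
  proof (subst change_of_variables(2)[OF g])
    have "\<bar>(tan y)\<^sup>2 * (cos y)\<^sup>2\<bar> \<le> 1" for y :: real
      by (cases "cos y = 0") (simp_all add: tan_def power_divide abs_square_le_1)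
    then show "set_integrable lborel {Y t 0..Y t 1} (\<lambda>\<xi>. (ux t (fl.X t \<xi>))\<^sup>2 * (cos (fl.\<theta> t \<xi>))\<^sup>2)"
      unfolding ux_X[OF g] by (intro fl.bounded_integrable[where C=1]) (auto simp: tan_def)
  qed auto
  ultimately show ?thesis using g by (intro H1_perI) (simp_all add: u_def ux_def Y_periodic fl.periodicity)
next
  case False
  then have "u t = u0" "ux t = u0'" by (auto simp: u_def ux_def)
  then show ?thesis using ini.H1 by simp
qed

lemma loc_int_energy:
  assumes "w \<in> borel_measurable borel" "\<And>x. \<bar>w x\<bar> \<le> C * (1 + (ux t x)\<^sup>2)"
  shows "loc_int w"
proof (rule loc_int_bound[OF loc_int_cmult[of "\<lambda>x. 1 + (ux t x)\<^sup>2" C] assms(1)])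
  show "loc_int (\<lambda>x. 1 + (ux t x)\<^sup>2)" by (intro loc_int_add loc_int_const H1_per_loc_int[OF H1])
  show "\<bar>w x\<bar> \<le> \<bar>C * (1 + (ux t x)\<^sup>2)\<bar>" for x using assms(2)[of x] by linarith
qed

lemma sint_good:
  assumes g: "good t" and w: "loc_int w" "\<And>x. w (x + 1) = w x"
  shows "sint w = (LBINT \<xi>:{0..ini.L}. w (fl.X t \<xi>) * (cos (fl.\<theta> t \<xi>))\<^sup>2)"
proof -
  have "(LBINT \<xi>:{0..ini.L}. w (fl.X t \<xi>) * (cos (fl.\<theta> t \<xi>))\<^sup>2) = (LBINT x:{fl.X t 0..fl.X t ini.L}. w x)"
    using ini.L_pos by (intro integral_substitution_prim(1)[OF fl.prim_X]) (auto intro: loc_int_measurable[OF w(1)])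
  also have "fl.X t ini.L = fl.X t 0 + 1" using fl.periodicity(4)[of t 0] by simp
  also have "(LBINT x:{fl.X t 0..fl.X t 0 + 1}. w x) = sint w" by (rule sint_period[OF w])
  finally show ?thesis ..
qed

text \<open>Expressions such as tan^2 cos^2 agree with sin^2 only where the cosine is nonzero; at
  good times this is almost every label, so the singular Eulerian integrand may be exchanged for a
  trigonometric one.\<close>

lemma sint_good_AE:
  assumes g: "good t" and w: "w \<in> borel_measurable borel" "\<And>x. \<bar>w x\<bar> \<le> C * (1 + (ux t x)\<^sup>2)" "\<And>x. w (x + 1) = w x"
    and v: "v \<in> borel_measurable borel"
      "\<And>\<xi>. cos (fl.\<theta> t \<xi>) \<noteq> 0 \<Longrightarrow> w (fl.X t \<xi>) * (cos (fl.\<theta> t \<xi>))\<^sup>2 = v \<xi>"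
  shows "sint w = (LBINT \<xi>:{0..ini.L}. v \<xi>)"
proof -
  note [measurable] = w(1) v(1) prim_measurable[OF fl.prim_X]
  have "AE \<xi> in lborel. cos (fl.\<theta> t \<xi>) \<noteq> 0" using g by (intro cos_nonzero) (simp add: good_def)
  then have "AE \<xi> \<in> {0..ini.L} in lborel. w (fl.X t \<xi>) * (cos (fl.\<theta> t \<xi>))\<^sup>2 = v \<xi>"
    by eventually_elim (simp add: v(2))
  then show ?thesis unfolding sint_good[OF g loc_int_energy[OF w(1,2)] w(3)]
    by (intro set_lebesgue_integral_cong_AE) auto
qed

lemma u_bound: "\<bar>u t x\<bar> \<le> fl.CV"
proof (cases "good t")
  case False
  have "u0 x = fl.U 0 (ini.R x)" by (simp add: U_initial ini.X_R)
  then show ?thesis using False fl.U_bound[of 0 "ini.R x"] by (simp add: u_def)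
qed (simp add: u_def fl.U_bound)

lemma uu_bound: "\<bar>u t x - u t x * (ux t x)\<^sup>2\<bar> \<le> fl.CV * (1 + (ux t x)\<^sup>2)"
proof -
  have "\<bar>1 - (ux t x)\<^sup>2\<bar> \<le> 1 + (ux t x)\<^sup>2" by (simp add: abs_le_iff)
  from fl.abs_mult_le[OF u_bound this] show ?thesis by (simp add: right_diff_distrib)
qed

lemma solution_periodic: "u t (x + 1) = u t x" "ux t (x + 1) = ux t x"
  using H1_per_periodic[OF H1] by auto

lemma cos_2: "cos (fl.\<theta> t \<xi>) \<noteq> 0 \<Longrightarrow> (1 - (tan (fl.\<theta> t \<xi>))\<^sup>2) * (cos (fl.\<theta> t \<xi>))\<^sup>2 = cos (2 * fl.\<theta> t \<xi>)"
  by (simp add: tan_def power_divide cos_double left_diff_distrib)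

lemma cos_2_mult:
  assumes "cos (fl.\<theta> t \<xi>) \<noteq> 0"
  shows "(v - v * (tan (fl.\<theta> t \<xi>))\<^sup>2) * (cos (fl.\<theta> t \<xi>))\<^sup>2 = cos (2 * fl.\<theta> t \<xi>) * v"
proof -
  have "(v - v * (tan (fl.\<theta> t \<xi>))\<^sup>2) * (cos (fl.\<theta> t \<xi>))\<^sup>2 = v * ((1 - (tan (fl.\<theta> t \<xi>))\<^sup>2) * (cos (fl.\<theta> t \<xi>))\<^sup>2)"
    by (simp add: algebra_simps)
  then show ?thesis unfolding cos_2[OF assms] by (simp only: mult.commute)
qed

text \<open>At good times the energy is the integral of sin^2 \<theta> = 1 - cos^2 \<theta> over a
  label period, i.e. L minus the unit increment of X. At the other times u is the datum, so equality
  holds for every t.\<close>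

lemma energy: "sint (\<lambda>x. (ux t x)\<^sup>2) = h"
proof (cases "good t")
  case g: True
  have "sint (\<lambda>x. (ux t x)\<^sup>2) = (LBINT \<xi>:{0..ini.L}. 1 - (cos (fl.\<theta> t \<xi>))\<^sup>2)"
    by (rule sint_good_AE[OF g, where C=1]) (auto simp: solution_periodic ux_X[OF g] tan_def power_divide sin_squared_eq)
  also have "\<dots> = (ini.L - fl.X t ini.L) - (0 - fl.X t 0)"
    using ini.L_pos by (intro prim_integral prim_diff fl.prim_X prim_of_DERIV) (auto intro!: derivative_eq_intros)
  finally show ?thesis using fl.periodicity(4)[of t 0] by (simp add: ini.L_def)
next
  case False
  then have "ux t = u0'" by (auto simp: ux_def)
  then show ?thesis by simp
qed

lemma mean: "sint (\<lambda>x. u t x - u t x * (ux t x)\<^sup>2) = 0"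
proof (cases "good t")
  case g: True
  have "sint (\<lambda>x. u t x - u t x * (ux t x)\<^sup>2) = (LBINT \<xi>:{0..ini.L}. cos (2 * fl.\<theta> t \<xi>) * fl.U t \<xi>)"
  proof (rule sint_good_AE[OF g _ uu_bound])
    fix \<xi> assume "cos (fl.\<theta> t \<xi>) \<noteq> 0"
    then show "(u t (fl.X t \<xi>) - u t (fl.X t \<xi>) * (ux t (fl.X t \<xi>))\<^sup>2) * (cos (fl.\<theta> t \<xi>))\<^sup>2 = cos (2 * fl.\<theta> t \<xi>) * fl.U t \<xi>"
      unfolding u_X[OF g] ux_X[OF g] by (rule cos_2_mult)
  qed (auto simp: solution_periodic)
  also have "\<dots> = fl.Ut t ini.L - fl.Ut t 0"
    using ini.L_pos by (intro prim_integral fl.prim_Ut) auto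
  finally show ?thesis using fl.periodicity(3)[of t 0] by simp
next
  case False
  then have "u t = u0" "ux t = u0'" by (auto simp: u_def ux_def)
  then show ?thesis using mean_zero by simp
qed

lemma loc_int_uu: "loc_int (\<lambda>x. u t x - u t x * (ux t x)\<^sup>2)"
  by (rule loc_int_energy[OF _ uu_bound]) measurable

definition "src t x = dxinv (\<lambda>z. u t z - u t z * (ux t z)\<^sup>2) x - fterm h u ux t"

lemma prim_src: "prim (src t) (\<lambda>x. u t x - u t x * (ux t x)\<^sup>2)"
  unfolding src_def[abs_def] using prim_diff[OF prim_dxinv[OF loc_int_uu[of t]] prim_const[of "fterm h u ux t"]] by (simp add: mean)

text \<open>\<open>fl.Ut t (Y t x)\<close> has the x-derivative of the source, so it differs from
  the zero-based primitive by a constant k. Inserting this into f(t) and using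
  \<open>fl.Ut_cos_zero\<close> and \<kappa> B = 1 gives f(t) = -k, which cancels the
  constant.\<close>

lemma src_good: assumes g: "good t" shows "src t x = fl.Ut t (Y t x)"
proof -
  note [measurable] = prim_measurable[OF prim_src]
  have p: "prim (\<lambda>x. fl.Ut t (Y t x)) (\<lambda>x. u t x - u t x * (ux t x)\<^sup>2)"
    unfolding prim_def
  proof (intro conjI allI impI loc_int_uu)
    fix a b :: real assume ab: "a \<le> b"
    note [measurable] = prim_measurable[OF fl.prim_X]
    have "(LBINT x:{a..b}. u t x - u t x * (ux t x)\<^sup>2)
      = (LBINT \<xi>:{Y t a..Y t b}. cos (2 * fl.\<theta> t \<xi>) * fl.U t \<xi>)"
    proof (subst change_of_variables(1)[OF g _ ab], measurable, rule set_lebesgue_integral_cong_AE)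
      have "AE \<xi> in lborel. cos (fl.\<theta> t \<xi>) \<noteq> 0" using g by (intro cos_nonzero) (simp add: good_def)
      then show "AE \<xi> \<in> {Y t a..Y t b} in lborel. (u t (fl.X t \<xi>) - u t (fl.X t \<xi>) * (ux t (fl.X t \<xi>))\<^sup>2) * (cos (fl.\<theta> t \<xi>))\<^sup>2
          = cos (2 * fl.\<theta> t \<xi>) * fl.U t \<xi>"
      proof eventually_elim
        case (elim \<xi>)
        then show ?case unfolding u_X[OF g] ux_X[OF g] using cos_2_mult by blast
      qed
    qed measurable
    also have "\<dots> = fl.Ut t (Y t b) - fl.Ut t (Y t a)" by (rule prim_integral[OF fl.prim_Ut Y_mono[OF g ab]])
    finally show "(LBINT x:{a..b}. u t x - u t x * (ux t x)\<^sup>2) = fl.Ut t (Y t b) - fl.Ut t (Y t a)" .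
  qed
  define k where "k = fl.Ut t (Y t 0)"
  have k: "dxinv (\<lambda>z. u t z - u t z * (ux t z)\<^sup>2) x = fl.Ut t (Y t x) - k" for x
    using prim_eq_dxinv[OF p mean, of x] by (simp add: k_def)
  have per: "fl.Ut t (Y t (x + 1)) = fl.Ut t (Y t x)" for x by (simp add: Y_periodic[OF g] fl.periodicity)
  note [measurable] = prim_measurable[OF p]
  have b: "\<bar>1 - (ux t x)\<^sup>2\<bar> \<le> 1 + (ux t x)\<^sup>2" for x by (simp add: abs_le_iff)
  have "sint (\<lambda>x. (1 - (ux t x)\<^sup>2) * (fl.Ut t (Y t x) - k))
    = (LBINT \<xi>:{0..ini.L}. fl.Ut t \<xi> * cos (2 * fl.\<theta> t \<xi>) - k * cos (2 * fl.\<theta> t \<xi>))"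
  proof (rule sint_good_AE[OF g])
    show "\<bar>(1 - (ux t x)\<^sup>2) * (fl.Ut t (Y t x) - k)\<bar> \<le> (fl.CU + \<bar>k\<bar>) * (1 + (ux t x)\<^sup>2)" for x
      unfolding mult.commute[of "fl.CU + \<bar>k\<bar>"] using fl.Ut_bound[of t "Y t x"] by (intro fl.abs_mult_le b) linarith
    fix \<xi> assume "cos (fl.\<theta> t \<xi>) \<noteq> 0"
    then have c: "((fl.Ut t \<xi> - k) - (fl.Ut t \<xi> - k) * (tan (fl.\<theta> t \<xi>))\<^sup>2) * (cos (fl.\<theta> t \<xi>))\<^sup>2 = cos (2 * fl.\<theta> t \<xi>) * (fl.Ut t \<xi> - k)"
      by (rule cos_2_mult)
    have "(1 - (ux t (fl.X t \<xi>))\<^sup>2) * (fl.Ut t (Y t (fl.X t \<xi>)) - k) * (cos (fl.\<theta> t \<xi>))\<^sup>2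
      = ((fl.Ut t \<xi> - k) - (fl.Ut t \<xi> - k) * (tan (fl.\<theta> t \<xi>))\<^sup>2) * (cos (fl.\<theta> t \<xi>))\<^sup>2"
      unfolding ux_X[OF g] Y_X[OF g] by (simp add: algebra_simps)
    also note c
    finally show "(1 - (ux t (fl.X t \<xi>))\<^sup>2) * (fl.Ut t (Y t (fl.X t \<xi>)) - k) * (cos (fl.\<theta> t \<xi>))\<^sup>2
      = fl.Ut t \<xi> * cos (2 * fl.\<theta> t \<xi>) - k * cos (2 * fl.\<theta> t \<xi>)"
      by (simp add: algebra_simps)
  qed (auto simp: solution_periodic per)
  also have "\<dots> = - k * (LBINT \<xi>:{0..ini.L}. cos (2 * fl.\<theta> t \<xi>))"
  proof -
    have 1: "set_integrable lborel {0..ini.L} (\<lambda>\<xi>. fl.Ut t \<xi> * cos (2 * fl.\<theta> t \<xi>))"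
      by (rule fl.bounded_integrable[where C="fl.CU * 1"]) (measurable, intro fl.abs_mult_le fl.Ut_bound abs_cos_le_one)
    have 2: "set_integrable lborel {0..ini.L} (\<lambda>\<xi>. cos (2 * fl.\<theta> t \<xi>))"
      by (rule fl.bounded_integrable[where C=1]) auto
    show ?thesis using set_integral_diff(2)[OF 1 set_integrable_mult_right[of k, OF 2]] fl.Ut_cos_zero by simp
  qed
  also have "(LBINT \<xi>:{0..ini.L}. cos (2 * fl.\<theta> t \<xi>)) = fl.B t"
    unfolding fl.B_def by (intro set_lebesgue_integral_cong) (auto simp: fl.at_red)
  finally have "sint (\<lambda>x. (1 - (ux t x)\<^sup>2) * (fl.Ut t (Y t x) - k)) = - k * fl.B t" .
  then have "fterm h u ux t = - k * (1 / (1 - h) * fl.B t)" unfolding fterm_def k by simp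
  then show ?thesis using fl.B_const[of t] by (simp add: src_def k)
qed

end

context pulse_solution
begin

lemma sint_energy_bound:
  assumes w: "w \<in> borel_measurable borel" "\<And>x. \<bar>w x\<bar> \<le> C * (1 + (ux t x)\<^sup>2)"
  shows "\<bar>sint w\<bar> \<le> C * (1 + h)"
proof -
  have e: "loc_int (\<lambda>x. 1 + (ux t x)\<^sup>2)" by (intro loc_int_add loc_int_const H1_per_loc_int[OF H1])
  have "\<bar>sint w\<bar> \<le> (LBINT x:{0..1}. norm (w x))"
    using set_integral_norm_bound[OF loc_int_integrable[OF loc_int_energy[OF w]]] by (simp add: sint_def)
  also have "\<dots> \<le> (LBINT x:{0..1}. C * (1 + (ux t x)\<^sup>2))"
    using w(2) by (intro set_integral_mono set_integrable_norm loc_int_integrable[OF loc_int_energy[OF w]]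
        loc_int_integrable[OF loc_int_cmult[OF e]]) simp
  also have "\<dots> = C * (1 + h)"
    using sint_add[OF loc_int_const[of 1] H1_per_loc_int(1)[OF H1[of t]]] energy[of t] by (simp add: sint_def[symmetric] sint_const sint_cmult)
  finally show ?thesis .
qed

lemma integrand_good:
  assumes g: "good t" and w: "loc_int w"
  shows "set_integrable lborel {0..ini.L} (\<lambda>\<xi>. w (fl.X t \<xi>) * (cos (fl.\<theta> t \<xi>))\<^sup>2)"
  using ini.L_pos integral_substitution_prim(2)[OF fl.prim_X zero_le_power2, of 0 ini.L w t]
    loc_int_measurable[OF w] loc_int_integrable[OF w] by simp

lemma J_derivative:
  assumes \<psi>: "test_fn \<psi>" and A: "\<And>t. A t \<in> borel_measurable borel" "\<And>t \<xi>. \<bar>A t \<xi>\<bar> \<le> a"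
    "\<And>t \<xi>. ((\<lambda>t. A t \<xi>) has_real_derivative A' t \<xi>) (at t)" "\<And>t \<xi>. \<bar>A' t \<xi>\<bar> \<le> a'" and t: "0 \<le> t"
  shows "((\<lambda>t. LBINT \<xi>:{0..ini.L}. A t \<xi> * \<psi> t (fl.X t \<xi>)) has_real_derivative
    (LBINT \<xi>:{0..ini.L}. A' t \<xi> * \<psi> t (fl.X t \<xi>) + A t \<xi> * (pd_t \<psi> t (fl.X t \<xi>) - (fl.U t \<xi>)\<^sup>2 * pd_x \<psi> t (fl.X t \<xi>)))) (at t)"
proof -
  note s = test_fn_smooth2[OF \<psi>]
  obtain C0 where C0: "\<And>t x. -1 \<le> t \<Longrightarrow> \<bar>\<psi> t x\<bar> \<le> C0" using test_fn_bounded[OF \<psi>] by blast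
  obtain C1 where C1: "\<And>t x. -1 \<le> t \<Longrightarrow> \<bar>pd_t \<psi> t x\<bar> \<le> C1" using test_fn_bounded[OF test_fn_pd(1)[OF \<psi>]] by blast
  obtain C2 where C2: "\<And>t x. -1 \<le> t \<Longrightarrow> \<bar>pd_x \<psi> t x\<bar> \<le> C2" using test_fn_bounded[OF test_fn_pd(2)[OF \<psi>]] by blast
  show ?thesis
  proof (rule set_integral_has_field_derivative(1)[of 1])
    fix w assume "w \<in> ball t 1"
    then have w: "-1 \<le> w" using t by (simp add: dist_norm)
    have [measurable]: "(\<lambda>\<xi>. \<psi> w (fl.X w \<xi>)) \<in> borel_measurable borel"
      by (rule measurable_compose[OF prim_measurable[OF fl.prim_X] prim_measurable[OF smooth2_prim[OF s]]])
    note [measurable] = A(1)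
    show "set_integrable lborel {0..ini.L} (\<lambda>\<xi>. A w \<xi> * \<psi> w (fl.X w \<xi>))"
      by (rule fl.bounded_integrable[where C="a * C0"]) (measurable, intro fl.abs_mult_le A C0 w)
    fix \<xi>
    show "((\<lambda>w. A w \<xi> * \<psi> w (fl.X w \<xi>)) has_real_derivative
       A' w \<xi> * \<psi> w (fl.X w \<xi>) + A w \<xi> * (pd_t \<psi> w (fl.X w \<xi>) - (fl.U w \<xi>)\<^sup>2 * pd_x \<psi> w (fl.X w \<xi>))) (at w)"
      using DERIV_mult[OF A(3) smooth2_chain[OF s fl.flow_derivatives(2)]]
      by (rule DERIV_cong) (simp add: algebra_simps)
    have 1: "\<bar>A' w \<xi> * \<psi> w (fl.X w \<xi>)\<bar> \<le> a' * C0" by (intro fl.abs_mult_le A C0 w)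
    have 2: "\<bar>(fl.U w \<xi>)\<^sup>2 * pd_x \<psi> w (fl.X w \<xi>)\<bar> \<le> fl.CV * fl.CV * C2"
      using fl.abs_mult_le[OF fl.abs_mult_le[OF fl.U_bound fl.U_bound] C2[OF w]] by (simp only: power2_eq_square[of "fl.U w \<xi>"])
    have "\<bar>A w \<xi> * (pd_t \<psi> w (fl.X w \<xi>) - (fl.U w \<xi>)\<^sup>2 * pd_x \<psi> w (fl.X w \<xi>))\<bar> \<le> a * (C1 + fl.CV * fl.CV * C2)"
      using 2 C1[OF w, of "fl.X w \<xi>"] by (intro fl.abs_mult_le A) linarith
    then show "norm (A' w \<xi> * \<psi> w (fl.X w \<xi>) + A w \<xi> * (pd_t \<psi> w (fl.X w \<xi>) - (fl.U w \<xi>)\<^sup>2 * pd_x \<psi> w (fl.X w \<xi>)))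
      \<le> a' * C0 + a * (C1 + fl.CV * fl.CV * C2)" using 1 unfolding real_norm_def by linarith
  qed simp
qed

lemma integral_initial:
  assumes "loc_int w" "\<And>x. w (x + 1) = w x"
  shows "(LBINT \<xi>:{0..ini.L}. w (ini.X \<xi>) / ini.\<rho> (ini.X \<xi>)) = sint w"
proof -
  note [measurable] = loc_int_measurable[OF assms(1)]
  have "w x / ini.\<rho> x * ini.\<rho> x = w x" for x using ini.\<rho>_pos[of x] by simp
  then show ?thesis
    using ini.integral_X(1)[of "\<lambda>x. w x / ini.\<rho> x" 0 ini.L] ini.L_pos sint_period[OF assms, of "ini.X 0"] by (simp add: ini.X_L)
qed

text \<open>The weak identities follow by integrating the time derivative of \<open>\<integral> A \<psi>(t, X) d\<xi>\<close>.\<close>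

lemma weak_identity:
  assumes \<psi>: "test_fn \<psi>" and A: "\<And>t. A t \<in> borel_measurable borel" "\<And>t \<xi>. \<bar>A t \<xi>\<bar> \<le> a"
    "\<And>t \<xi>. ((\<lambda>t. A t \<xi>) has_real_derivative A' t \<xi>) (at t)" "\<And>t \<xi>. \<bar>A' t \<xi>\<bar> \<le> a'"
    and m: "joint_measurable F" "joint_measurable G"
    and zero: "\<And>t x. \<psi> t x = 0 \<Longrightarrow> pd_t \<psi> t x = 0 \<Longrightarrow> pd_x \<psi> t x = 0 \<Longrightarrow> F t x = 0 \<and> G t x = 0"
    and bd: "\<And>t x. 0 \<le> t \<Longrightarrow> \<bar>F t x\<bar> \<le> C * (1 + (ux t x)\<^sup>2)" "\<And>t x. good t \<Longrightarrow> \<bar>G t x\<bar> \<le> C' * (1 + (ux t x)\<^sup>2)"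
    and eq: "\<And>t. good t \<Longrightarrow> sint (F t) + sint (G t)
      = (LBINT \<xi>:{0..ini.L}. A' t \<xi> * \<psi> t (fl.X t \<xi>) + A t \<xi> * (pd_t \<psi> t (fl.X t \<xi>) - (fl.U t \<xi>)\<^sup>2 * pd_x \<psi> t (fl.X t \<xi>)))"
    and init: "\<And>\<xi>. A 0 \<xi> = w (ini.X \<xi>) / ini.\<rho> (ini.X \<xi>)" "loc_int w" "\<And>x. w (x + 1) = w x"
  shows "stint F = - stint G - sint (\<lambda>x. w x * \<psi> 0 x)"
proof -
  obtain T where T: "0 \<le> T" "\<And>t x. T \<le> t \<Longrightarrow> \<psi> t x = 0" "\<And>t x. T \<le> t \<Longrightarrow> pd_t \<psi> t x = 0" "\<And>t x. T \<le> t \<Longrightarrow> pd_x \<psi> t x = 0"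
    using test_fn_support[OF \<psi>] by blast
  have "stint F = - stint G - (LBINT \<xi>:{0..ini.L}. A 0 \<xi> * \<psi> 0 (fl.X 0 \<xi>))"
  proof (rule stint_FTC[OF T(1) N_null J_derivative[OF \<psi> A] eq m])
    show "F t x = 0" "G t x = 0" if "T \<le> t" for t x using zero T that by blast+
    show "\<bar>sint (F t)\<bar> \<le> C * (1 + h)" if "0 \<le> t" for t
      by (rule sint_energy_bound[OF slice_measurable[OF m(1)] bd(1)[OF that]])
    show "\<bar>sint (G t)\<bar> \<le> C' * (1 + h)" if "0 \<le> t" "t \<notin> N" for t
      using that by (intro sint_energy_bound[OF slice_measurable[OF m(2)] bd(2)]) (simp add: good_def)
    show "(LBINT \<xi>:{0..ini.L}. A T \<xi> * \<psi> T (fl.X T \<xi>)) = 0" by (simp add: T set_lebesgue_integral_def)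
  qed (auto simp: good_def)
  also have "(LBINT \<xi>:{0..ini.L}. A 0 \<xi> * \<psi> 0 (fl.X 0 \<xi>))
    = (LBINT \<xi>:{0..ini.L}. (\<lambda>x. w x * \<psi> 0 x) (ini.X \<xi>) / ini.\<rho> (ini.X \<xi>))"
    by (simp add: init X_initial)
  also have "\<dots> = sint (\<lambda>x. w x * \<psi> 0 x)"
    using loc_int_mult_continuous[OF smooth2_continuous_slice[OF test_fn_smooth2[OF \<psi>]] init(2)]
    by (intro integral_initial) (simp_all add: init(3) test_fn_periodic[OF \<psi>] mult.commute)
  finally show ?thesis .
qed

lemma src_measurable: "joint_measurable src"
proof -
  define D where "D x = dxinv (\<lambda>z. u0 z - u0 z * (u0' z)\<^sup>2) x - fterm h (\<lambda>_. u0) (\<lambda>_. u0') 0" for x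
  have bad: "src t x = D x" if "\<not> good t" for t x
  proof -
    have "u t = u0" "ux t = u0'" using that by (auto simp: u_def ux_def)
    then show ?thesis by (simp add: src_def D_def fterm_def)
  qed
  \<comment> \<open>Negative times are never good, so time -1 exhibits \<open>D\<close> as a slice
    of \<open>src\<close>.\<close>
  have "src (-1) = D" using bad[of "-1"] by (auto simp: good_def)
  then have "D \<in> borel_measurable borel" using prim_measurable[OF prim_src[of "-1"]] by simp
  note [measurable] = good_fst_measurable compose_Y_measurable[OF fl.flow_jointly_measurable(4)]
    measurable_compose[OF borel_fst_snd(2) this]
  have "(\<lambda>p. if good (fst p) then fl.Ut (fst p) (Y (fst p) (snd p)) else D (snd p)) \<in> borel_measurable borel" by measurable
  also have "(\<lambda>p. if good (fst p) then fl.Ut (fst p) (Y (fst p) (snd p)) else D (snd p)) = (\<lambda>p. src (fst p) (snd p))"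
    using bad src_good by auto
  finally show ?thesis .
qed

lemma le_energy: "\<bar>y\<bar> \<le> C \<Longrightarrow> \<bar>y\<bar> \<le> C * (1 + (ux t x)\<^sup>2)"
proof -
  assume "\<bar>y\<bar> \<le> C"
  moreover from this have "C * 1 \<le> C * (1 + (ux t x)\<^sup>2)" by (intro mult_left_mono) auto
  ultimately show ?thesis by linarith
qed

text \<open>The weight U cos^2 \<theta> is u dx in labels. Differentiating \<open>\<psi>\<close>
  along X produces -u^3 \<psi>_x with coefficient 1 where the identity has 1/3; the discrepancy is
  2/3 of the total \<xi>-derivative of U^3 \<psi>(t, X), which integrates to 0 over a
  period.\<close>

lemma weak_u:
  assumes \<psi>: "test_fn \<psi>"
  shows "stint (\<lambda>t x. u t x * pd_t \<psi> t x - 1/3 * (u t x)^3 * pd_x \<psi> t x)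
    = - stint (\<lambda>t x. src t x * \<psi> t x) - sint (\<lambda>x. u0 x * \<psi> 0 x)"
proof -
  note s = test_fn_smooth2[OF \<psi>]
  note [measurable] = solution_measurable src_measurable smooth2_measurable[OF s] smooth2_measurable[OF smooth2_pd(1)[OF s]] smooth2_measurable[OF smooth2_pd(2)[OF s]]
  obtain C0 where C0: "\<And>t x. -1 \<le> t \<Longrightarrow> \<bar>\<psi> t x\<bar> \<le> C0" using test_fn_bounded[OF \<psi>] by blast
  obtain C1 where C1: "\<And>t x. -1 \<le> t \<Longrightarrow> \<bar>pd_t \<psi> t x\<bar> \<le> C1" using test_fn_bounded[OF test_fn_pd(1)[OF \<psi>]] by blast
  obtain C2 where C2: "\<And>t x. -1 \<le> t \<Longrightarrow> \<bar>pd_x \<psi> t x\<bar> \<le> C2" using test_fn_bounded[OF test_fn_pd(2)[OF \<psi>]] by blast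
  let ?A = "\<lambda>t \<xi>. fl.U t \<xi> * (cos (fl.\<theta> t \<xi>))\<^sup>2"
  let ?A' = "\<lambda>t \<xi>. fl.Ut t \<xi> * (cos (fl.\<theta> t \<xi>))\<^sup>2 - fl.U t \<xi> * (sin (2 * fl.\<theta> t \<xi>) * fl.U t \<xi>)"
  have c2: "\<bar>(cos y)\<^sup>2\<bar> \<le> 1" for y :: real by (simp add: abs_square_le_1)
  have Fb: "\<bar>u t x * pd_t \<psi> t x - 1/3 * (u t x)^3 * pd_x \<psi> t x\<bar> \<le> fl.CV * C1 + 1/3 * (fl.CV * fl.CV * fl.CV) * C2" if "0 \<le> t" for t x
  proof -
    have "\<bar>u t x * pd_t \<psi> t x\<bar> \<le> fl.CV * C1" using that by (intro fl.abs_mult_le u_bound C1) simp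
    moreover have "\<bar>1/3 * (u t x * u t x * u t x) * pd_x \<psi> t x\<bar> \<le> 1/3 * (fl.CV * fl.CV * fl.CV) * C2"
      using that by (intro fl.abs_mult_le u_bound C2) auto
    ultimately show ?thesis unfolding power3_eq_cube by linarith
  qed
  have Gb: "\<bar>src t x * \<psi> t x\<bar> \<le> fl.CU * C0" if g: "good t" for t x
    using g unfolding src_good[OF g] by (intro fl.abs_mult_le fl.Ut_bound C0) (simp add: good_def)
  show ?thesis
  proof (rule weak_identity[OF \<psi>, where A = ?A and A' = ?A' and w = u0])
    show "?A t \<in> borel_measurable borel" for t by measurable
    show "\<bar>?A t \<xi>\<bar> \<le> fl.CV * 1" for t \<xi> by (intro fl.abs_mult_le fl.U_bound c2)
    show "((\<lambda>t. ?A t \<xi>) has_real_derivative ?A' t \<xi>) (at t)" for t \<xi>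
      by (rule derivative_eq_intros fl.flow_derivatives refl)+ (simp add: sin_double algebra_simps)
    show "\<bar>?A' t \<xi>\<bar> \<le> fl.CU * 1 + fl.CV * (1 * fl.CV)" for t \<xi>
    proof -
      have "\<bar>fl.Ut t \<xi> * (cos (fl.\<theta> t \<xi>))\<^sup>2\<bar> \<le> fl.CU * 1" by (intro fl.abs_mult_le fl.Ut_bound c2)
      moreover have "\<bar>fl.U t \<xi> * (sin (2 * fl.\<theta> t \<xi>) * fl.U t \<xi>)\<bar> \<le> fl.CV * (1 * fl.CV)"
        by (intro fl.abs_mult_le fl.U_bound abs_sin_le_one)
      ultimately show ?thesis by linarith
    qed
    show "\<bar>u t x * pd_t \<psi> t x - 1/3 * (u t x)^3 * pd_x \<psi> t x\<bar> \<le> (fl.CV * C1 + 1/3 * (fl.CV * fl.CV * fl.CV) * C2) * (1 + (ux t x)\<^sup>2)" if "0 \<le> t" for t x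
      by (rule le_energy[OF Fb[OF that]])
    show "\<bar>src t x * \<psi> t x\<bar> \<le> fl.CU * C0 * (1 + (ux t x)\<^sup>2)" if "good t" for t x
      by (rule le_energy[OF Gb[OF that]])
    fix t assume g: "good t"
    then have t0: "0 \<le> t" by (simp add: good_def)
    let ?F = "\<lambda>x. u t x * pd_t \<psi> t x - 1/3 * (u t x)^3 * pd_x \<psi> t x" and ?G = "\<lambda>x. src t x * \<psi> t x"
    have Fm: "?F \<in> borel_measurable borel" by (rule slice_measurable[of "\<lambda>t x. u t x * pd_t \<psi> t x - 1/3 * (u t x)^3 * pd_x \<psi> t x"]) measurable
    have Gm: "?G \<in> borel_measurable borel" by (rule slice_measurable[of "\<lambda>t x. src t x * \<psi> t x"]) measurable
    have lF: "loc_int ?F" by (rule loc_int_bounded[OF Fm Fb[OF t0]])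
    have lG: "loc_int ?G" by (rule loc_int_bounded[OF Gm Gb[OF g]])
    have sper: "src t (x + 1) = src t x" for x by (simp add: src_good[OF g] Y_periodic[OF g] fl.periodicity)
    have per: "?F (x + 1) = ?F x" "?G (x + 1) = ?G x" for x
      by (simp_all add: solution_periodic sper test_fn_periodic[OF \<psi>] test_fn_periodic[OF test_fn_pd(1)[OF \<psi>]] test_fn_periodic[OF test_fn_pd(2)[OF \<psi>]])
    let ?sn = "\<lambda>\<xi>. sin (2 * fl.\<theta> t \<xi>) / 2" and ?U = "fl.U t" and ?c = "\<lambda>\<xi>. (cos (fl.\<theta> t \<xi>))\<^sup>2"
    let ?p = "\<lambda>\<xi>. (?U \<xi> * ?U \<xi> * ?U \<xi>) * (pd_x \<psi> t (fl.X t \<xi>) * ?c \<xi>)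
      + ((?U \<xi> * ?U \<xi>) * ?sn \<xi> + (?U \<xi> * ?sn \<xi> + ?sn \<xi> * ?U \<xi>) * ?U \<xi>) * \<psi> t (fl.X t \<xi>)"
    have "prim (\<lambda>\<xi>. (?U \<xi> * ?U \<xi> * ?U \<xi>) * \<psi> t (fl.X t \<xi>)) ?p"
      by (intro prim_mult fl.prim_U prim_compose[OF fl.prim_X zero_le_power2 smooth2_prim[OF s]])
    from prim_integral[OF this, of 0 ini.L] prim_integrable[OF this, of 0 ini.L]
    have p: "(LBINT \<xi>:{0..ini.L}. ?p \<xi>) = 0" "set_integrable lborel {0..ini.L} ?p"
      using ini.L_pos fl.periodicity(2,4)[of t 0] test_fn_periodic[OF \<psi>] by simp_all
    have iF: "set_integrable lborel {0..ini.L} (\<lambda>\<xi>. ?F (fl.X t \<xi>) * ?c \<xi>)" by (rule integrand_good[OF g lF])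
    have iG: "set_integrable lborel {0..ini.L} (\<lambda>\<xi>. ?G (fl.X t \<xi>) * ?c \<xi>)" by (rule integrand_good[OF g lG])
    have sq: "(fl.U t \<xi>)\<^sup>2 = fl.U t \<xi> * fl.U t \<xi>" for \<xi> by (rule power2_eq_square)
    have "sint ?F + sint ?G = (LBINT \<xi>:{0..ini.L}. ?F (fl.X t \<xi>) * ?c \<xi> + ?G (fl.X t \<xi>) * ?c \<xi>)"
      unfolding sint_good[OF g lF per(1)] sint_good[OF g lG per(2)] set_integral_add(2)[OF iF iG] ..
    also have "\<dots> = (LBINT \<xi>:{0..ini.L}. (?F (fl.X t \<xi>) * ?c \<xi> + ?G (fl.X t \<xi>) * ?c \<xi>) - 2/3 * ?p \<xi>)"
      unfolding set_integral_diff(2)[OF set_integral_add(1)[OF iF iG] set_integrable_mult_right[OF p(2), of "2/3"]]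
        set_integral_mult_right p(1) by simp
    also have "\<dots> = (LBINT \<xi>:{0..ini.L}. ?A' t \<xi> * \<psi> t (fl.X t \<xi>)
        + ?A t \<xi> * (pd_t \<psi> t (fl.X t \<xi>) - (fl.U t \<xi>)\<^sup>2 * pd_x \<psi> t (fl.X t \<xi>)))"
      by (rule set_lebesgue_integral_cong)
        (auto simp: u_X[OF g] src_good[OF g] Y_X[OF g] sq power3_eq_cube field_simps)
    finally show "sint ?F + sint ?G = \<dots>" .
  next
    show "?A 0 \<xi> = u0 (ini.X \<xi>) / ini.\<rho> (ini.X \<xi>)" for \<xi> by (simp add: U_initial \<theta>_initial ini.cos_arctan_sq)
    show "loc_int u0" using loc_int_mult_continuous[OF prim_continuous[OF ini.prim_f] loc_int_const[of 1]] by simp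
    show "(\<lambda>p. u (fst p) (snd p) * pd_t \<psi> (fst p) (snd p) - 1/3 * (u (fst p) (snd p))^3 * pd_x \<psi> (fst p) (snd p)) \<in> borel_measurable borel"
      "(\<lambda>p. src (fst p) (snd p) * \<psi> (fst p) (snd p)) \<in> borel_measurable borel" by measurable
  qed (simp_all add: ini.f_periodic)
qed

text \<open>The weight sin^2 \<theta> is u_x^2 dx in labels. Its time derivative sin(2 \<theta>) U
  is 2 u u_x dx, the source in (iv) when the charge is zero.\<close>

lemma weak_energy:
  assumes \<psi>: "test_fn \<psi>"
  shows "stint (\<lambda>t z. (ux t z)\<^sup>2 * pd_t \<psi> t z - (u t z)\<^sup>2 * (ux t z)\<^sup>2 * pd_x \<psi> t z)
    = - stint (\<lambda>t z. (2 * u t z * ux t z) * \<psi> t z) - sint (\<lambda>z. (u0' z)\<^sup>2 * \<psi> 0 z)"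
proof -
  note s = test_fn_smooth2[OF \<psi>]
  note [measurable] = solution_measurable smooth2_measurable[OF s] smooth2_measurable[OF smooth2_pd(1)[OF s]] smooth2_measurable[OF smooth2_pd(2)[OF s]]
  obtain C0 where C0: "\<And>t x. -1 \<le> t \<Longrightarrow> \<bar>\<psi> t x\<bar> \<le> C0" using test_fn_bounded[OF \<psi>] by blast
  obtain C1 where C1: "\<And>t x. -1 \<le> t \<Longrightarrow> \<bar>pd_t \<psi> t x\<bar> \<le> C1" using test_fn_bounded[OF test_fn_pd(1)[OF \<psi>]] by blast
  obtain C2 where C2: "\<And>t x. -1 \<le> t \<Longrightarrow> \<bar>pd_x \<psi> t x\<bar> \<le> C2" using test_fn_bounded[OF test_fn_pd(2)[OF \<psi>]] by blast
  let ?A = "\<lambda>t \<xi>. (sin (fl.\<theta> t \<xi>))\<^sup>2"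
  let ?A' = "\<lambda>t \<xi>. sin (2 * fl.\<theta> t \<xi>) * fl.U t \<xi>"
  have e: "\<bar>(ux t x)\<^sup>2\<bar> \<le> 1 + (ux t x)\<^sup>2" "\<bar>2 * ux t x\<bar> \<le> 1 + (ux t x)\<^sup>2" for t x
    using sum_squares_bound[of 1 "\<bar>ux t x\<bar>"] by simp_all
  have Fb: "\<bar>(ux t x)\<^sup>2 * pd_t \<psi> t x - (u t x)\<^sup>2 * (ux t x)\<^sup>2 * pd_x \<psi> t x\<bar> \<le> (C1 + fl.CV * fl.CV * C2) * (1 + (ux t x)\<^sup>2)" if "0 \<le> t" for t x
  proof -
    have "\<bar>u t x * u t x * pd_x \<psi> t x\<bar> \<le> fl.CV * fl.CV * C2" using that by (intro fl.abs_mult_le u_bound C2) simp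
    moreover have "\<bar>pd_t \<psi> t x\<bar> \<le> C1" using that by (intro C1) simp
    ultimately have "\<bar>pd_t \<psi> t x - u t x * u t x * pd_x \<psi> t x\<bar> \<le> C1 + fl.CV * fl.CV * C2" by linarith
    from fl.abs_mult_le[OF this e(1)[of t x]] show ?thesis by (simp add: power2_eq_square algebra_simps)
  qed
  have Gb: "\<bar>2 * u t x * ux t x * \<psi> t x\<bar> \<le> (fl.CV * C0) * (1 + (ux t x)\<^sup>2)" if "0 \<le> t" for t x
  proof -
    have "\<bar>u t x * \<psi> t x\<bar> \<le> fl.CV * C0" using that by (intro fl.abs_mult_le u_bound C0) simp
    from fl.abs_mult_le[OF this e(2)[of t x]] show ?thesis by (simp add: algebra_simps)
  qed
  show ?thesis
  proof (rule weak_identity[OF \<psi>, where A = ?A and A' = ?A' and w = "\<lambda>x. (u0' x)\<^sup>2"])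
    show "?A t \<in> borel_measurable borel" for t by measurable
    show "\<bar>?A t \<xi>\<bar> \<le> 1" for t \<xi> by (simp add: abs_square_le_1)
    show "((\<lambda>t. ?A t \<xi>) has_real_derivative ?A' t \<xi>) (at t)" for t \<xi>
      by (rule derivative_eq_intros fl.flow_derivatives refl)+ (simp add: sin_double algebra_simps)
    show "\<bar>?A' t \<xi>\<bar> \<le> 1 * fl.CV" for t \<xi> by (intro fl.abs_mult_le fl.U_bound abs_sin_le_one)
    show "\<bar>(ux t x)\<^sup>2 * pd_t \<psi> t x - (u t x)\<^sup>2 * (ux t x)\<^sup>2 * pd_x \<psi> t x\<bar> \<le> (C1 + fl.CV * fl.CV * C2) * (1 + (ux t x)\<^sup>2)" if "0 \<le> t" for t x
      by (rule Fb[OF that])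
    show "\<bar>2 * u t x * ux t x * \<psi> t x\<bar> \<le> (fl.CV * C0) * (1 + (ux t x)\<^sup>2)" if "good t" for t x
      using that by (intro Gb) (simp add: good_def)
    fix t assume g: "good t"
    then have t0: "0 \<le> t" by (simp add: good_def)
    let ?F = "\<lambda>x. (ux t x)\<^sup>2 * pd_t \<psi> t x - (u t x)\<^sup>2 * (ux t x)\<^sup>2 * pd_x \<psi> t x" and ?G = "\<lambda>x. 2 * u t x * ux t x * \<psi> t x"
    let ?f = "\<lambda>\<xi>. ?A t \<xi> * (pd_t \<psi> t (fl.X t \<xi>) - (fl.U t \<xi>)\<^sup>2 * pd_x \<psi> t (fl.X t \<xi>))"
    let ?g = "\<lambda>\<xi>. ?A' t \<xi> * \<psi> t (fl.X t \<xi>)"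
    note sl = slice_measurable[OF smooth2_measurable[OF s]] slice_measurable[OF smooth2_measurable[OF smooth2_pd(1)[OF s]]]
      slice_measurable[OF smooth2_measurable[OF smooth2_pd(2)[OF s]]]
    note [measurable] = sl prim_measurable[OF fl.prim_X]
    have F: "sint ?F = (LBINT \<xi>:{0..ini.L}. ?f \<xi>)"
    proof (rule sint_good_AE[OF g _ Fb[OF t0]])
      fix \<xi> assume "cos (fl.\<theta> t \<xi>) \<noteq> 0"
      then have "(tan (fl.\<theta> t \<xi>))\<^sup>2 * (cos (fl.\<theta> t \<xi>))\<^sup>2 = ?A t \<xi>" by (simp add: tan_def power_divide)
      moreover have "?F (fl.X t \<xi>) * (cos (fl.\<theta> t \<xi>))\<^sup>2 = ((tan (fl.\<theta> t \<xi>))\<^sup>2 * (cos (fl.\<theta> t \<xi>))\<^sup>2) * (pd_t \<psi> t (fl.X t \<xi>) - (fl.U t \<xi>)\<^sup>2 * pd_x \<psi> t (fl.X t \<xi>))"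
        by (simp add: u_X[OF g] ux_X[OF g] algebra_simps)
      ultimately show "?F (fl.X t \<xi>) * (cos (fl.\<theta> t \<xi>))\<^sup>2 = ?f \<xi>" by (simp only:)
    qed (simp_all add: solution_periodic test_fn_periodic[OF test_fn_pd(1)[OF \<psi>]] test_fn_periodic[OF test_fn_pd(2)[OF \<psi>]])
    have G: "sint ?G = (LBINT \<xi>:{0..ini.L}. ?g \<xi>)"
    proof (rule sint_good_AE[OF g _ Gb[OF t0]])
      fix \<xi>
      have "?G (fl.X t \<xi>) * (cos (fl.\<theta> t \<xi>))\<^sup>2 = 2 * fl.U t \<xi> * (tan (fl.\<theta> t \<xi>) * (cos (fl.\<theta> t \<xi>))\<^sup>2) * \<psi> t (fl.X t \<xi>)"
        by (simp add: u_X[OF g] ux_X[OF g])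
      also have "\<dots> = ?g \<xi>" unfolding tan_cos_sq by simp
      finally show "?G (fl.X t \<xi>) * (cos (fl.\<theta> t \<xi>))\<^sup>2 = ?g \<xi>" .
    qed (simp_all add: solution_periodic test_fn_periodic[OF \<psi>])
    have "set_integrable lborel {0..ini.L} ?f"
    proof (rule fl.bounded_integrable[where C="1 * (C1 + fl.CV * fl.CV * C2)"])
      fix \<xi>
      have "\<bar>fl.U t \<xi> * fl.U t \<xi> * pd_x \<psi> t (fl.X t \<xi>)\<bar> \<le> fl.CV * fl.CV * C2" using t0 by (intro fl.abs_mult_le fl.U_bound C2) simp
      moreover have "\<bar>pd_t \<psi> t (fl.X t \<xi>)\<bar> \<le> C1" using t0 by (intro C1) simp
      ultimately have "\<bar>pd_t \<psi> t (fl.X t \<xi>) - (fl.U t \<xi>)\<^sup>2 * pd_x \<psi> t (fl.X t \<xi>)\<bar> \<le> C1 + fl.CV * fl.CV * C2"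
        unfolding power2_eq_square by linarith
      then show "\<bar>?f \<xi>\<bar> \<le> 1 * (C1 + fl.CV * fl.CV * C2)" by (intro fl.abs_mult_le) (simp_all add: abs_square_le_1)
    qed measurable
    moreover have "set_integrable lborel {0..ini.L} ?g"
      by (rule fl.bounded_integrable[where C="1 * fl.CV * C0"]) (measurable, intro fl.abs_mult_le fl.U_bound abs_sin_le_one C0, use t0 in simp)
    ultimately show "sint ?F + sint ?G = (LBINT \<xi>:{0..ini.L}. ?g \<xi> + ?f \<xi>)"
      unfolding F G using set_integral_add(2)[of lborel "{0..ini.L}" ?g ?f] by simp
  next
    show "?A 0 \<xi> = (u0' (ini.X \<xi>))\<^sup>2 / ini.\<rho> (ini.X \<xi>)" for \<xi>
      by (simp add: \<theta>_initial sin_squared_eq ini.cos_arctan_sq) (simp add: ini.\<rho>_def field_simps add_nonneg_eq_0_iff)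
    show "(\<lambda>p. (ux (fst p) (snd p))\<^sup>2 * pd_t \<psi> (fst p) (snd p) - (u (fst p) (snd p))\<^sup>2 * (ux (fst p) (snd p))\<^sup>2 * pd_x \<psi> (fst p) (snd p)) \<in> borel_measurable borel"
      "(\<lambda>p. 2 * u (fst p) (snd p) * ux (fst p) (snd p) * \<psi> (fst p) (snd p)) \<in> borel_measurable borel" by measurable
  qed (simp_all add: ini.g_periodic H1_per_loc_int[OF ini.H1])
qed

lemma prim_cube: "prim (\<lambda>x. 1/3 * (u t x)^3) (\<lambda>x. (u t x)\<^sup>2 * ux t x)"
  by (rule prim_cong[OF prim_cmult[OF prim_mult[OF prim_mult[OF H1_per_prim[OF H1] H1_per_prim[OF H1]] H1_per_prim[OF H1]], of "1/3" t t t]])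
    (simp_all add: power2_eq_square power3_eq_cube algebra_simps)

lemma src_periodic: "src t (x + 1) = src t x"
  unfolding src_def by (simp add: dxinv_periodic[OF loc_int_uu] solution_periodic)

text \<open>Identity (i) is the x-derivative of (ii): test (ii) with \<psi>_x and integrate by parts
  in x at each fixed time.\<close>

lemma weak_derivative:
  assumes \<psi>: "test_fn \<psi>"
  shows "stint (\<lambda>t x. u t x * pd_t (pd_x \<psi>) t x + (u t x)\<^sup>2 * ux t x * pd_x \<psi> t x)
    = stint (\<lambda>t x. (u t x - u t x * (ux t x)\<^sup>2) * \<psi> t x) + sint (\<lambda>x. u0' x * \<psi> 0 x)"
proof -
  note s = test_fn_smooth2[OF \<psi>] and \<psi>x = test_fn_pd(2)[OF \<psi>]
  note sx = test_fn_smooth2[OF \<psi>x]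
  have l1: "loc_int (\<lambda>x. u t x * pd_t (pd_x \<psi>) t x)" for t
    by (intro loc_int_mult_continuous prim_continuous[OF H1_per_prim[OF H1]] prim_loc_int[OF smooth2_prim] smooth2_pd sx)
       (use loc_int_mult_continuous[OF smooth2_continuous_slice[OF smooth2_pd(1)[OF sx]] loc_int_const[of 1]] in simp)
  have l2: "loc_int (\<lambda>x. 1/3 * (u t x)^3 * pd_x (pd_x \<psi>) t x)" for t
    by (intro loc_int_mult_continuous prim_continuous[OF prim_cube] prim_loc_int[OF smooth2_prim[OF sx]])
  have l3: "loc_int (\<lambda>x. (u t x)\<^sup>2 * ux t x * pd_x \<psi> t x)" for t
    using loc_int_mult_continuous[OF smooth2_continuous_slice[OF sx] prim_loc_int[OF prim_cube[of t]], of t] by (simp add: mult_ac)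
  have 1: "sint (\<lambda>x. u t x * pd_t (pd_x \<psi>) t x - 1/3 * (u t x)^3 * pd_x (pd_x \<psi>) t x)
      = sint (\<lambda>x. u t x * pd_t (pd_x \<psi>) t x + (u t x)\<^sup>2 * ux t x * pd_x \<psi> t x)" for t
    using sint_by_parts[OF prim_cube _ smooth2_prim[OF sx] test_fn_periodic[OF \<psi>x], of t t]
    unfolding sint_diff[OF l1 l2] sint_add[OF l1 l3] by (simp add: solution_periodic)
  have 2: "sint (\<lambda>x. src t x * pd_x \<psi> t x) = - sint (\<lambda>x. (u t x - u t x * (ux t x)\<^sup>2) * \<psi> t x)" for t
    by (rule sint_by_parts[OF prim_src src_periodic smooth2_prim[OF s] test_fn_periodic[OF \<psi>]])
  have 3: "sint (\<lambda>x. u0 x * pd_x \<psi> 0 x) = - sint (\<lambda>x. u0' x * \<psi> 0 x)"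
    by (rule sint_by_parts[OF ini.prim_f ini.f_periodic smooth2_prim[OF s] test_fn_periodic[OF \<psi>]])
  have 4: "stint (\<lambda>t x. src t x * pd_x \<psi> t x) = - stint (\<lambda>t x. (u t x - u t x * (ux t x)\<^sup>2) * \<psi> t x)"
    unfolding stint_def 2 by (simp add: set_lebesgue_integral_def)
  show ?thesis using weak_u[OF \<psi>x] unfolding 3 4 unfolding stint_def 1 by simp
qed

lemma solution: "cons_weak_sol u0 u0' u ux"
  unfolding cons_weak_sol_def
proof (intro conjI allI impI)
  show "\<exists>M. AE t in lborel. t \<ge> 0 \<longrightarrow> sint (\<lambda>x. (u t x)\<^sup>2 + (ux t x)\<^sup>2) \<le> M"
  proof (intro exI AE_I2 impI)
    fix t :: real
    have "\<bar>sint (\<lambda>x. (u t x)\<^sup>2 + (ux t x)\<^sup>2)\<bar> \<le> (fl.CV * fl.CV + 1) * (1 + h)"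
    proof (rule sint_energy_bound)
      fix x
      have "\<bar>u t x * u t x\<bar> \<le> fl.CV * fl.CV" by (intro fl.abs_mult_le u_bound)
      from le_energy[OF this, of t x] show "\<bar>(u t x)\<^sup>2 + (ux t x)\<^sup>2\<bar> \<le> (fl.CV * fl.CV + 1) * (1 + (ux t x)\<^sup>2)"
        by (simp add: power2_eq_square algebra_simps)
    qed measurable
    then show "sint (\<lambda>x. (u t x)\<^sup>2 + (ux t x)\<^sup>2) \<le> (fl.CV * fl.CV + 1) * (1 + h)" by linarith
  qed
qed (simp_all only: solution_measurable H1 energy mean diff_zero mult_zero_right weak_derivative weak_energy weak_u[unfolded src_def])

end

lemma (in pulse_datum) existence: "\<exists>u ux. cons_weak_sol u0 u0' u ux"
proof -
  obtain N where N: "N \<in> null_sets lborel" "{t. \<not> (AE \<xi> in lborel. cos (fl.\<theta> t \<xi>) \<noteq> 0)} \<subseteq> N"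
    using AE_E[OF AE_cos_nonzero] by (metis (mono_tags, lifting) Collect_cong UNIV_I null_setsI space_borel space_lborel)
  interpret pulse_solution u0 u0' N
    by unfold_locales (use N in auto)
  show ?thesis using solution by blast
qed

section \<open>Smooth cut-offs and separated test functions\<close>

section \<open>Smooth cut-offs\<close>

primrec Ck :: "nat \<Rightarrow> (real \<Rightarrow> real) \<Rightarrow> bool" where
  "Ck 0 f \<longleftrightarrow> continuous_on UNIV f"
| "Ck (Suc n) f \<longleftrightarrow> (\<exists>f'. (\<forall>x. (f has_real_derivative f' x) (at x)) \<and> Ck n f')"

definition smooth :: "(real \<Rightarrow> real) \<Rightarrow> bool" where "smooth f \<longleftrightarrow> (\<forall>n. Ck n f)"

lemma Ck_SucI: "(\<And>x. (f has_real_derivative f' x) (at x)) \<Longrightarrow> Ck n f' \<Longrightarrow> Ck (Suc n) f"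
  by auto

lemma Ck_Suc_imp: "Ck (Suc n) f \<Longrightarrow> Ck n f"
proof (induction n arbitrary: f)
  case 0
  then obtain f' where "\<And>x. (f has_real_derivative f' x) (at x)" by auto
  then show ?case by (auto intro: continuous_at_imp_continuous_on DERIV_isCont)
next
  case (Suc n)
  then obtain f' where "\<And>x. (f has_real_derivative f' x) (at x)" "Ck (Suc n) f'" by auto
  then show ?case using Suc.IH by (intro Ck_SucI[of f f']) auto
qed

lemma Ck_const: "Ck n (\<lambda>x. c)"
proof (induction n arbitrary: c)
  case (Suc n)
  show ?case by (rule Ck_SucI[OF DERIV_const Suc])
qed simp

lemma Ck_ident: "Ck n (\<lambda>x. x)"
  by (cases n) (auto intro!: exI[of _ "\<lambda>x. 1"] Ck_const)

lemma Ck_add: "Ck n f \<Longrightarrow> Ck n g \<Longrightarrow> Ck n (\<lambda>x. f x + g x)"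
proof (induction n arbitrary: f g)
  case 0
  then show ?case by (auto intro: continuous_on_add)
next
  case (Suc n)
  then obtain f' g' where "\<And>x. (f has_real_derivative f' x) (at x)" "Ck n f'"
    "\<And>x. (g has_real_derivative g' x) (at x)" "Ck n g'" by auto
  then show ?case by (intro Ck_SucI[OF DERIV_add] Suc.IH)
qed

lemma Ck_mult: "Ck n f \<Longrightarrow> Ck n g \<Longrightarrow> Ck n (\<lambda>x. f x * g x)"
proof (induction n arbitrary: f g)
  case 0
  then show ?case by (auto intro: continuous_on_mult)
next
  case (Suc n)
  then obtain f' g' where d: "\<And>x. (f has_real_derivative f' x) (at x)" "Ck n f'"
    "\<And>x. (g has_real_derivative g' x) (at x)" "Ck n g'" by auto
  show ?case by (rule Ck_SucI[OF DERIV_mult[OF d(1,3)]])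
    (intro Ck_add Suc.IH d Suc.prems[THEN Ck_Suc_imp])
qed

lemma Ck_compose: "Ck n f \<Longrightarrow> Ck n g \<Longrightarrow> Ck n (\<lambda>x. f (g x))"
proof (induction n arbitrary: f g)
  case 0
  then show ?case by (auto intro: continuous_on_compose2)
next
  case (Suc n)
  then obtain f' g' where d: "\<And>x. (f has_real_derivative f' x) (at x)" "Ck n f'"
    "\<And>x. (g has_real_derivative g' x) (at x)" "Ck n g'" by auto
  show ?case by (rule Ck_SucI[OF DERIV_chain2[OF d(1,3)]])
    (rule Ck_mult[OF Suc.IH[OF d(2) Suc.prems(2)[THEN Ck_Suc_imp]] d(4)])
qed

lemma Ck_trig: "Ck n (\<lambda>x. cos (x + c))"
proof (induction n arbitrary: c)
  case 0
  show ?case by (auto intro!: continuous_intros)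
next
  case (Suc n)
  have "((\<lambda>x. cos (x + c)) has_real_derivative cos (x + (c + pi / 2))) (at x)" for x
    by (rule derivative_eq_intros refl)+ (simp add: cos_add sin_add algebra_simps)
  then show ?case by (rule Ck_SucI) (rule Suc)
qed

lemma smooth_const: "smooth (\<lambda>x. c)" and smooth_ident: "smooth (\<lambda>x. x)"
  and smooth_add: "smooth f \<Longrightarrow> smooth g \<Longrightarrow> smooth (\<lambda>x. f x + g x)"
  and smooth_mult: "smooth f \<Longrightarrow> smooth g \<Longrightarrow> smooth (\<lambda>x. f x * g x)"
  and smooth_compose: "smooth f \<Longrightarrow> smooth g \<Longrightarrow> smooth (\<lambda>x. f (g x))"
  and smooth_cos: "smooth cos"
  using Ck_trig[of _ 0] by (auto simp: smooth_def Ck_const Ck_ident Ck_add Ck_mult Ck_compose)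

lemma smooth_diff: "smooth f \<Longrightarrow> smooth g \<Longrightarrow> smooth (\<lambda>x. f x - g x)"
  using smooth_add[of f "\<lambda>x. - 1 * g x"] smooth_mult[OF smooth_const[of "-1"], of g] by simp

lemma smoothD:
  assumes "smooth f"
  shows "(f has_real_derivative deriv f x) (at x)" "smooth (deriv f)" "continuous_on A f"
proof -
  have ex: "\<exists>f'. (\<forall>x. (f has_real_derivative f' x) (at x)) \<and> Ck n f'" for n using assms unfolding smooth_def by (metis Ck.simps(2))
  then have d: "(f has_real_derivative deriv f x) (at x)" for x by (metis DERIV_imp_deriv)
  then show "(f has_real_derivative deriv f x) (at x)" .
  have "Ck n (deriv f)" for n
  proof -
    obtain f' where f': "\<And>x. (f has_real_derivative f' x) (at x)" "Ck n f'" using ex by blast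
    then have "f' = deriv f" using DERIV_imp_deriv[OF f'(1)] by (intro ext) simp
    then show ?thesis using f' by simp
  qed
  then show "smooth (deriv f)" by (simp add: smooth_def)
  show "continuous_on A f" using d by (auto intro: continuous_at_imp_continuous_on DERIV_isCont)
qed

lemma smooth_antiderivative:
  assumes "smooth f" "\<And>x. (F has_real_derivative f x) (at x)" shows "smooth F"
  unfolding smooth_def
proof
  fix n
  show "Ck n F" using assms Ck_SucI[of F f n] Ck_Suc_imp unfolding smooth_def by blast
qed

lemma poly_exp_decay: "((\<lambda>y. poly p y * exp (- y)) \<longlongrightarrow> 0) at_top" for p :: "real poly"
proof -
  have "((\<lambda>y. (\<Sum>i\<le>degree p. coeff p i * (y ^ i / exp y))) \<longlongrightarrow> (\<Sum>i\<le>degree p. coeff p i * 0)) at_top"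
    by (intro tendsto_intros tendsto_power_div_exp_0)
  moreover have "(\<Sum>i\<le>degree p. coeff p i * (y ^ i / exp y)) = poly p y * exp (- y)" for y
    by (simp add: poly_altdef exp_minus sum_distrib_right divide_inverse mult.assoc)
  ultimately show ?thesis by simp
qed

text \<open>The class of functions \<open>p(1/x) exp(-1/x)\<close> on the positive half-line, extended by zero, is closed under differentiation.\<close>

definition "bump_poly p x = (if 0 < x then poly p (1 / x) * exp (- (1 / x)) else 0)" for x :: real

lemma bump_poly_derivative: "(bump_poly p has_real_derivative bump_poly (monom 1 2 * (p - pderiv p)) x) (at x)"
proof -
  consider "0 < x" | "x < 0" | "x = 0" by linarith
  then show ?thesis
  proof cases
    case 1
    have d: "((\<lambda>x. poly p (1 / x) * exp (- (1 / x))) has_real_derivative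
      poly (pderiv p) (1 / x) * (- (1 / x\<^sup>2)) * exp (- (1 / x)) + poly p (1 / x) * (exp (- (1 / x)) * (1 / x\<^sup>2))) (at x)"
      using 1 by (auto intro!: derivative_eq_intros DERIV_chain2[OF poly_DERIV] simp: power2_eq_square field_simps)
    have e: "poly (pderiv p) (1 / x) * (- (1 / x\<^sup>2)) * exp (- (1 / x)) + poly p (1 / x) * (exp (- (1 / x)) * (1 / x\<^sup>2))
      = bump_poly (monom 1 2 * (p - pderiv p)) x"
      using 1 by (simp add: bump_poly_def poly_monom power_divide algebra_simps)
    show ?thesis
      by (rule has_field_derivative_transform_within_open[OF d[unfolded e] open_greaterThan[of 0]]) (use 1 in \<open>auto simp: bump_poly_def\<close>)
  next
    case 2
    have "(bump_poly p has_real_derivative 0) (at x)"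
      by (rule has_field_derivative_transform_within_open[OF DERIV_const[of 0] open_lessThan[of 0]]) (use 2 in \<open>auto simp: bump_poly_def\<close>)
    then show ?thesis using 2 by (simp add: bump_poly_def)
  next
    case 3
    have "((\<lambda>h. bump_poly p h / h) \<longlongrightarrow> 0) (at 0)"
    proof (rule filterlim_split_at)
      show "((\<lambda>h. bump_poly p h / h) \<longlongrightarrow> 0) (at_left 0)"
        by (rule tendsto_eventually) (auto simp: bump_poly_def eventually_at_left_field intro!: exI[of _ "-1"])
      have "((\<lambda>h. poly (pCons 0 p) (inverse h) * exp (- inverse h)) \<longlongrightarrow> 0) (at_right (0::real))"
        by (rule filterlim_compose[OF poly_exp_decay filterlim_inverse_at_top_right])
      then show "((\<lambda>h. bump_poly p h / h) \<longlongrightarrow> 0) (at_right 0)"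
        by (rule Lim_transform_eventually) (auto simp: bump_poly_def eventually_at_right_field field_simps intro!: exI[of _ 1])
    qed
    then show ?thesis using 3 by (simp add: DERIV_def bump_poly_def)
  qed
qed

definition "bump = bump_poly 1"

lemma smooth_bump: "smooth bump"
proof -
  have "Ck n (bump_poly p)" for n p
  proof (induction n arbitrary: p)
    case 0
    show ?case by (auto intro: continuous_at_imp_continuous_on DERIV_isCont bump_poly_derivative)
  next
    case (Suc n)
    show ?case by (rule Ck_SucI[OF bump_poly_derivative Suc])
  qed
  then show ?thesis by (simp add: smooth_def bump_def)
qed

lemma bump_props: "0 \<le> bump x" "bump x \<le> 1" "x \<le> 0 \<Longrightarrow> bump x = 0"
  by (auto simp: bump_def bump_poly_def)

text \<open>For a smooth g the functions bump(n g) are smooth, lie between 0 and 1, and converge to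
  the indicator of {g > 0}; indicators of intervals and of arcs are approximated this way.\<close>

lemma bump_tendsto: "(\<lambda>n. bump (real n * c)) \<longlonglongrightarrow> (if 0 < c then 1 else 0)"
proof (cases "0 < c")
  case True
  have "(\<lambda>n. exp (- (1 / (real (Suc n) * c)))) \<longlonglongrightarrow> exp (- (0 * (1 / c)))"
  proof (intro tendsto_intros)
    have "(\<lambda>n. 1 / real (Suc n) * (1 / c)) \<longlonglongrightarrow> 0 * (1 / c)"
      by (intro tendsto_intros LIMSEQ_Suc[OF lim_const_over_n])
    then show "(\<lambda>n. 1 / (real (Suc n) * c)) \<longlonglongrightarrow> 0 * (1 / c)" by simp
  qed
  then have "(\<lambda>n. bump (real (Suc n) * c)) \<longlonglongrightarrow> 1" using True by (simp add: bump_def bump_poly_def)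
  then show ?thesis using True filterlim_sequentially_Suc[of "\<lambda>n. bump (real n * c)"] by simp
next
  case False
  then have "bump (real n * c) = 0" for n by (intro bump_props) (simp add: mult_nonneg_nonpos)
  then show ?thesis using False by simp
qed

text \<open>The functions f(t) k(x) with smooth factors are closed under both partial derivatives,
  so all elements of \<open>partials\<close> have this form.\<close>

lemma test_fn_product:
  assumes \<phi>: "smooth \<phi>" and g: "smooth g" "\<And>x. g (x + 1) = g x" and T: "\<And>t. T \<le> t \<Longrightarrow> \<phi> t = 0"
  shows "test_fn (\<lambda>t x. \<phi> t * g x)" "pd_t (\<lambda>t x. \<phi> t * g x) t x = deriv \<phi> t * g x"
    "pd_x (\<lambda>t x. \<phi> t * g x) t x = \<phi> t * deriv g x"
proof -
  have pt: "pd_t (\<lambda>t x. f t * k x) = (\<lambda>t x. deriv f t * k x)" and px: "pd_x (\<lambda>t x. f t * k x) = (\<lambda>t x. f t * deriv k x)"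
    if "smooth f" "smooth k" for f k
    unfolding pd_t_def pd_x_def using DERIV_cmult_right[OF smoothD(1)[OF that(1)]] DERIV_cmult[OF smoothD(1)[OF that(2)]]
    by (auto intro!: ext DERIV_imp_deriv)
  then show "pd_t (\<lambda>t x. \<phi> t * g x) t x = deriv \<phi> t * g x" "pd_x (\<lambda>t x. \<phi> t * g x) t x = \<phi> t * deriv g x"
    using \<phi> g by auto
  have "\<exists>f k. smooth f \<and> smooth k \<and> p = (\<lambda>t x. f t * k x)" if "p \<in> partials (\<lambda>t x. \<phi> t * g x)" for p
    using that
  proof (induction rule: partials.induct)
    case self
    show ?case using \<phi> g by blast
  next
    case (dt p)
    then obtain f k where "smooth f" "smooth k" "p = (\<lambda>t x. f t * k x)" by blast
    then show ?case using pt smoothD(2) by metis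
  next
    case (dx p)
    then obtain f k where "smooth f" "smooth k" "p = (\<lambda>t x. f t * k x)" by blast
    then show ?case using px smoothD(2) by metis
  qed
  moreover have "continuous_on UNIV (\<lambda>p. f (fst p) * k (snd p)) \<and>
      (\<forall>t x. (\<lambda>s. f s * k x) differentiable (at t) \<and> (\<lambda>y. f t * k y) differentiable (at x))" if "smooth f" "smooth k" for f k
  proof (intro conjI allI)
    show "continuous_on UNIV (\<lambda>p. f (fst p) * k (snd p))"
      by (intro continuous_on_mult continuous_on_compose2[OF smoothD(3)[OF that(1), of UNIV]]
          continuous_on_compose2[OF smoothD(3)[OF that(2), of UNIV]] continuous_intros) auto
    show "(\<lambda>s. f s * k x) differentiable (at t)" for t x
      using DERIV_cmult_right[OF smoothD(1)[OF that(1)]] real_differentiable_def by blast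
    show "(\<lambda>y. f t * k y) differentiable (at x)" for t x
      using DERIV_cmult[OF smoothD(1)[OF that(2)]] real_differentiable_def by blast
  qed
  ultimately have "smooth2 (\<lambda>t x. \<phi> t * g x)" unfolding smooth2_def by fastforce
  then show "test_fn (\<lambda>t x. \<phi> t * g x)" unfolding test_fn_def using g(2) T by (auto intro!: exI[of _ T])
qed

section \<open>From weak identities to integrated balance laws at almost every time\<close>

section \<open>Localisation of weak identities\<close>

text \<open>The lemma of du Bois-Reymond with an initial value. Every smooth \<eta> vanishing after
  T is the derivative of an admissible test function, so a minus the candidate primitive \<Phi> is
  orthogonal to all such \<eta>, hence to indicators of intervals, and vanishes almost everywhere.
  Test functions need not vanish at t = 0, and this is how \<open>a0\<close> is recovered.\<close>

lemma AE_eq_of_weak_derivative: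
  assumes a: "a \<in> borel_measurable borel" and b: "b \<in> borel_measurable borel"
    and N: "N \<in> null_sets lborel" and bd: "\<And>t. 0 \<le> t \<Longrightarrow> t \<notin> N \<Longrightarrow> \<bar>a t\<bar> \<le> K \<and> \<bar>b t\<bar> \<le> K"
    and weak: "\<And>\<phi> T. smooth \<phi> \<Longrightarrow> (\<And>t. T \<le> t \<Longrightarrow> \<phi> t = 0) \<Longrightarrow>
      (LBINT t:{0..}. a t * deriv \<phi> t + b t * \<phi> t) = - a0 * \<phi> 0"
  shows "AE t in lborel. 0 \<le> t \<longrightarrow> a t = a0 + (LBINT s:{0..t}. b s)"
proof -
  have Nb: "N \<in> sets borel" using N by (auto simp: null_sets_def)
  \<comment> \<open>Cutting both functions off at negative times and on \<open>N\<close> makes them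
    bounded everywhere and leaves integrals over [0, T] unchanged.\<close>
  define I :: "real \<Rightarrow> real" where "I = indicator ({0..} - N)"
  have [measurable]: "I \<in> borel_measurable borel" unfolding I_def using Nb by measurable
  note [measurable] = a b
  define a' b' where "a' t = I t * a t" and "b' t = I t * b t" for t
  have [measurable]: "a' \<in> borel_measurable borel" "b' \<in> borel_measurable borel" unfolding a'_def[abs_def] b'_def[abs_def] by measurable
  have bd': "\<bar>a' t\<bar> \<le> \<bar>K\<bar>" "\<bar>b' t\<bar> \<le> \<bar>K\<bar>" for t
    using bd[of t] by (auto simp: a'_def b'_def I_def indicator_def)
  have la: "loc_int a'" and lb: "loc_int b'" by (rule loc_int_bounded[OF _ bd'(1)], measurable, rule loc_int_bounded[OF _ bd'(2)], measurable)
  have nN: "AE t in lborel. t \<notin> N" by (rule AE_not_in[OF N])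
  define \<Phi> where "\<Phi> t = a0 + interval_lebesgue_integral lborel (ereal 0) (ereal t) b'" for t
  have P: "prim \<Phi> b'" unfolding \<Phi>_def[abs_def] using prim_add[OF prim_const[of a0] prim_exists[OF lb, of 0]] by simp
  have \<Phi>0: "\<Phi> 0 = a0" by (simp add: \<Phi>_def interval_integral_endpoints_same)
  define w where "w t = indicator {0..} t * (a' t - \<Phi> t)" for t
  note [measurable] = prim_measurable[OF P]
  have lw: "loc_int w"
  proof (rule loc_int_bound)
    show "loc_int (\<lambda>t. a' t - \<Phi> t)" using loc_int_mult_continuous[OF prim_continuous[OF P] loc_int_const[of 1]] by (intro loc_int_diff la) simp
  qed (unfold w_def[abs_def], measurable, auto simp: indicator_def)
  have main: "(LBINT t:{0..T}. (a' t - \<Phi> t) * \<eta> t) = 0" if \<eta>: "smooth \<eta>" "\<And>t. T \<le> t \<Longrightarrow> \<eta> t = 0" and T: "0 \<le> T" for \<eta> T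
  proof -
    have c\<eta>: "isCont \<eta> t" for t using smoothD(1)[OF \<eta>(1)] by (rule DERIV_isCont)
    obtain F where F: "\<And>t. (F has_vector_derivative \<eta> t) (at t)"
      using einterval_antiderivative[of "-\<infinity>" "\<infinity>" \<eta>] c\<eta> by auto
    \<comment> \<open>The antiderivative is normalised at T rather than at 0, so that it vanishes
      from T on.\<close>
    define \<phi> where "\<phi> t = F t - F T" for t
    have d\<phi>: "(\<phi> has_real_derivative \<eta> t) (at t)" for t
      using DERIV_diff[OF F[of t, folded has_real_derivative_iff_has_vector_derivative] DERIV_const[of "F T"]] unfolding \<phi>_def[abs_def] by simp
    have \<phi>: "smooth \<phi>" by (rule smooth_antiderivative[OF \<eta>(1) d\<phi>])
    have deriv\<phi>: "deriv \<phi> = \<eta>" using DERIV_imp_deriv[OF d\<phi>] by blast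
    have p\<phi>: "prim \<phi> \<eta>" by (rule prim_of_DERIV[OF d\<phi> smoothD(3)[OF \<eta>(1)]])
    have zero: "\<phi> t = 0" if "T \<le> t" for t
    proof -
      have "(LBINT s:{T..t}. \<eta> s) = (LBINT s:{T..t}. 0)" by (rule set_lebesgue_integral_cong) (use \<eta>(2) in auto)
      then show ?thesis using prim_integral[OF p\<phi> that] by (simp add: \<phi>_def set_lebesgue_integral_def)
    qed
    have [measurable]: "\<phi> \<in> borel_measurable borel" "\<eta> \<in> borel_measurable borel"
      using prim_measurable[OF p\<phi>] prim_measurable_deriv[OF p\<phi>] .
    have "(LBINT t:{0..T}. a' t * \<eta> t + b' t * \<phi> t) = (LBINT t:{0..}. a t * deriv \<phi> t + b t * \<phi> t)"
      unfolding set_lebesgue_integral_def deriv\<phi>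
    proof (intro integral_cong_AE)
      show "AE t in lborel. indicator {0..T} t *\<^sub>R (a' t * \<eta> t + b' t * \<phi> t) = indicator {0..} t *\<^sub>R (a t * \<eta> t + b t * \<phi> t)"
        using nN
      proof eventually_elim
        case (elim t)
        then show ?case using zero[of t] \<eta>(2)[of t] by (cases "T \<le> t") (auto simp: a'_def b'_def I_def indicator_def)
      qed
    qed measurable
    also have "\<dots> = - a0 * \<phi> 0" by (rule weak[OF \<phi> zero])
    also have "\<dots> = (LBINT t:{0..T}. \<Phi> t * \<eta> t + b' t * \<phi> t)"
      using prim_integral[OF prim_mult[OF P p\<phi>] T] zero[of T] by (simp add: \<Phi>0)
    finally have *: "(LBINT t:{0..T}. a' t * \<eta> t + b' t * \<phi> t) = (LBINT t:{0..T}. \<Phi> t * \<eta> t + b' t * \<phi> t)" .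
    have i1: "set_integrable lborel {0..T} (\<lambda>t. a' t * \<eta> t + b' t * \<phi> t)"
      using loc_int_mult_continuous[OF smoothD(3)[OF \<eta>(1)] la] loc_int_mult_continuous[OF smoothD(3)[OF \<phi>] lb]
      by (intro set_integral_add(1) loc_int_integrable) (simp_all add: mult.commute)
    have i2: "set_integrable lborel {0..T} (\<lambda>t. \<Phi> t * \<eta> t + b' t * \<phi> t)"
      by (rule prim_integrable[OF prim_mult[OF P p\<phi>]])
    have "(LBINT t:{0..T}. (a' t * \<eta> t + b' t * \<phi> t) - (\<Phi> t * \<eta> t + b' t * \<phi> t)) = 0"
      unfolding set_integral_diff(2)[OF i1 i2] * by simp
    then show ?thesis by (simp add: left_diff_distrib)
  qed
  have iv: "(LBINT t:{c..d}. w t) = 0" if cd: "0 \<le> c" "c < d" for c d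
  proof -
    \<comment> \<open>The polynomial (t - c)(d - t) is positive exactly on (c, d), so these smooth
      functions tend to the indicator of that interval.\<close>
    have "(\<lambda>n. LBINT t:{0..d}. (a' t - \<Phi> t) * bump (real n * ((t - c) * (d - t)))) \<longlonglongrightarrow> (LBINT t:{0..d}. w t * indicator {c<..<d} t)"
      unfolding set_lebesgue_integral_def
    proof (rule integral_dominated_convergence[where w = "\<lambda>t. indicator {0..d} t *\<^sub>R \<bar>a' t - \<Phi> t\<bar>"])
      have mb: "bump \<in> borel_measurable borel" by (rule borel_measurable_continuous_onI[OF smoothD(3)[OF smooth_bump]])
      note [measurable] = mb loc_int_measurable[OF lw]
      show "(\<lambda>t. indicator {0..d} t *\<^sub>R (w t * indicator {c<..<d} t)) \<in> borel_measurable lborel" by measurable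
      show "(\<lambda>t. indicator {0..d} t *\<^sub>R ((a' t - \<Phi> t) * bump (real n * ((t - c) * (d - t))))) \<in> borel_measurable lborel" for n by measurable
      have "loc_int (\<lambda>t. a' t - \<Phi> t)" using loc_int_mult_continuous[OF prim_continuous[OF P] loc_int_const[of 1]] by (intro loc_int_diff la) simp
      from set_integrable_abs[OF loc_int_integrable[OF this]]
      show "integrable lborel (\<lambda>t. indicator {0..d} t *\<^sub>R \<bar>a' t - \<Phi> t\<bar>)" unfolding set_integrable_def .
      show "AE t in lborel. (\<lambda>n. indicator {0..d} t *\<^sub>R ((a' t - \<Phi> t) * bump (real n * ((t - c) * (d - t)))))
        \<longlonglongrightarrow> indicator {0..d} t *\<^sub>R (w t * indicator {c<..<d} t)"
      proof (rule AE_I2)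
        fix t
        have ind: "w t * indicator {c<..<d} t = (a' t - \<Phi> t) * indicator {c<..<d} t"
          using cd by (auto simp: w_def indicator_def)
        have "(if 0 < (t - c) * (d - t) then 1 else 0) = (indicator {c<..<d} t :: real)"
          using cd by (auto simp: zero_less_mult_iff)
        then have "(\<lambda>n. bump (real n * ((t - c) * (d - t)))) \<longlonglongrightarrow> indicator {c<..<d} t"
          using bump_tendsto[of "(t - c) * (d - t)"] by simp
        then have "(\<lambda>n. indicator {0..d} t *\<^sub>R ((a' t - \<Phi> t) * bump (real n * ((t - c) * (d - t)))))
           \<longlonglongrightarrow> indicator {0..d} t *\<^sub>R ((a' t - \<Phi> t) * indicator {c<..<d} t)" by (intro tendsto_intros)
        then show "(\<lambda>n. indicator {0..d} t *\<^sub>R ((a' t - \<Phi> t) * bump (real n * ((t - c) * (d - t)))))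
           \<longlonglongrightarrow> indicator {0..d} t *\<^sub>R (w t * indicator {c<..<d} t)" by (simp only: ind)
      qed
      show "AE t in lborel. norm (indicator {0..d} t *\<^sub>R ((a' t - \<Phi> t) * bump (real n * ((t - c) * (d - t)))))
        \<le> indicator {0..d} t *\<^sub>R \<bar>a' t - \<Phi> t\<bar>" for n
        using bump_props(1,2) by (intro AE_I2) (simp add: abs_mult mult_left_le indicator_def)
    qed
    moreover have "(LBINT t:{0..d}. (a' t - \<Phi> t) * bump (real n * ((t - c) * (d - t)))) = 0" for n
    proof (rule main)
      show "smooth (\<lambda>t. bump (real n * ((t - c) * (d - t))))"
        by (intro smooth_compose[OF smooth_bump] smooth_mult smooth_diff smooth_const smooth_ident)
      show "bump (real n * ((t - c) * (d - t))) = 0" if "d \<le> t" for t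
        using that cd by (intro bump_props(3) mult_nonneg_nonpos) (auto intro: mult_nonneg_nonpos)
    qed (use cd in simp)
    ultimately have "(LBINT t:{0..d}. w t * indicator {c<..<d} t) = 0" by (simp add: LIMSEQ_const_iff)
    also have "(LBINT t:{0..d}. w t * indicator {c<..<d} t) = (LBINT t:{c<..<d}. w t)"
      unfolding set_lebesgue_integral_def using cd by (intro Bochner_Integration.integral_cong) (auto simp: indicator_def)
    also have "\<dots> = (LBINT t:{c..d}. w t)"
      by (rule set_integral_discrete_difference[where X="{c, d}"]) (use cd in auto)
    finally show ?thesis .
  qed
  have "AE t in lborel. w t = 0"
  proof (rule AE_eq_0_of_prim_0[OF lw])
    fix c d :: real assume "c \<le> d"
    have "(LBINT t:{c..d}. w t) = (LBINT t:{max 0 c..d}. w t)"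
      unfolding set_lebesgue_integral_def by (intro Bochner_Integration.integral_cong) (auto simp: indicator_def w_def)
    also have "\<dots> = 0"
    proof (cases "max 0 c < d")
      case False
      then have "(LBINT t:{max 0 c..d}. w t) = (LBINT t:({}::real set). w t)"
        by (intro set_integral_discrete_difference[where X="{d}"]) auto
      then show ?thesis by (simp add: set_lebesgue_integral_def)
    qed (intro iv, auto)
    finally show "(LBINT t:{c..d}. w t) = 0" .
  qed
  then show ?thesis using nN
  proof eventually_elim
    case (elim t)
    show ?case
    proof
      assume t: "0 \<le> t"
      have "(LBINT s:{0..t}. b' s) = (LBINT s:{0..t}. b s)"
      proof (rule set_lebesgue_integral_cong_AE)
        show "AE s \<in> {0..t} in lborel. b' s = b s" using nN by eventually_elim (auto simp: b'_def I_def)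
      qed measurable
      then show "a t = a0 + (LBINT s:{0..t}. b s)"
        using elim t prim_integral[OF P t] by (simp add: w_def a'_def I_def \<Phi>0)
    qed
  qed
qed

lemma abs_sint_le: "loc_int w \<Longrightarrow> \<bar>sint w\<bar> \<le> sint (\<lambda>x. \<bar>w x\<bar>)"
  using set_integral_norm_bound[OF loc_int_integrable, of w 0 1] by (simp add: sint_def)

lemma loc_int_abs: "loc_int w \<Longrightarrow> loc_int (\<lambda>x. \<bar>w x\<bar>)"
  by (rule loc_int_bound[of w]) auto

lemma sint_mono: "loc_int v \<Longrightarrow> loc_int w \<Longrightarrow> (\<And>x. v x \<le> w x) \<Longrightarrow> sint v \<le> sint w"
  unfolding sint_def by (intro set_integral_mono loc_int_integrable)

lemma loc_int_mult_right: "loc_int w \<Longrightarrow> continuous_on UNIV g \<Longrightarrow> loc_int (\<lambda>x. w x * g x)"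
  using loc_int_mult_continuous[of g w] by (simp add: mult.commute)

lemma sint_mult_bound:
  assumes w: "loc_int w" and g: "continuous_on UNIV g" "\<And>x. \<bar>g x\<bar> \<le> G" and K: "sint (\<lambda>x. \<bar>w x\<bar>) \<le> K"
  shows "\<bar>sint (\<lambda>x. w x * g x)\<bar> \<le> G * K"
proof -
  have "0 \<le> G" using g(2)[of 0] abs_ge_zero[of "g 0"] by linarith
  have "\<bar>sint (\<lambda>x. w x * g x)\<bar> \<le> sint (\<lambda>x. \<bar>w x * g x\<bar>)" by (rule abs_sint_le[OF loc_int_mult_right[OF w g(1)]])
  also have "\<dots> \<le> sint (\<lambda>x. G * \<bar>w x\<bar>)"
  proof (rule sint_mono[OF loc_int_abs[OF loc_int_mult_right[OF w g(1)]] loc_int_cmult[OF loc_int_abs[OF w]]])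
    show "\<bar>w x * g x\<bar> \<le> G * \<bar>w x\<bar>" for x using mult_right_mono[OF g(2)[of x], of "\<bar>w x\<bar>"] by (simp add: abs_mult mult.commute)
  qed
  also have "\<dots> \<le> G * K" unfolding sint_cmult using K \<open>0 \<le> G\<close> by (rule mult_left_mono)
  finally show ?thesis .
qed

lemma periodic_bounded:
  fixes g :: "real \<Rightarrow> real"
  assumes "continuous_on UNIV g" "\<And>x. g (x + 1) = g x" obtains G where "\<And>x. \<bar>g x\<bar> \<le> G"
proof -
  have "compact (g ` {0..1})" using assms(1) by (intro compact_continuous_image) (auto intro: continuous_on_subset)
  from compact_imp_bounded[OF this] obtain G where G: "\<And>x. x \<in> {0..1} \<Longrightarrow> \<bar>g x\<bar> \<le> G" unfolding bounded_iff by fastforce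
  have "\<bar>g x\<bar> \<le> G" for x
  proof -
    obtain y where "0 \<le> y" "y < 1" "g x = g y" using periodic_floor[of g 1 x] assms(2) by (metis zero_less_one)
    then show ?thesis using G[of y] by simp
  qed
  then show thesis by (rule that)
qed

lemma periodic_deriv:
  assumes "smooth g" "\<And>x. g (x + 1) = g x" shows "deriv g (x + 1) = deriv g x"
proof -
  have "((\<lambda>y. g (y + 1)) has_real_derivative deriv g (x + 1)) (at x)"
    using smoothD(1)[OF assms(1), of "x + 1"] by (simp add: DERIV_shift)
  then have "(g has_real_derivative deriv g (x + 1)) (at x)" using assms(2) by simp
  then show ?thesis using DERIV_imp_deriv by fastforce
qed

lemma joint_mult_measurable:
  fixes m :: "real \<Rightarrow> real \<Rightarrow> real"
  assumes "joint_measurable m" "continuous_on UNIV g"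
  shows "(\<lambda>p. m (fst p) (snd p) * g (snd p)) \<in> borel_measurable borel"
proof -
  have "(snd :: real \<times> real \<Rightarrow> real) \<in> borel \<rightarrow>\<^sub>M borel" unfolding borel_prod[symmetric] by (rule measurable_snd)
  from measurable_compose[OF this borel_measurable_continuous_onI[OF assms(2)]] assms(1) show ?thesis by measurable
qed

lemma set_integrable_compact_support:
  fixes p \<eta> :: "real \<Rightarrow> real"
  assumes [measurable]: "p \<in> borel_measurable borel" and N: "N \<in> null_sets lborel" "\<And>t. 0 \<le> t \<Longrightarrow> t \<notin> N \<Longrightarrow> \<bar>p t\<bar> \<le> K"
    and \<eta>: "continuous_on UNIV \<eta>" "\<And>t. T \<le> t \<Longrightarrow> \<eta> t = 0"
  shows "set_integrable lborel {0..} (\<lambda>t. p t * \<eta> t)"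
proof -
  have [measurable]: "\<eta> \<in> borel_measurable borel" by (rule borel_measurable_continuous_onI[OF \<eta>(1)])
  have "set_integrable lborel {0..T} (\<lambda>t. K * \<eta> t)"
    using loc_int_integrable[OF loc_int_cmult[OF loc_int_mult_continuous[OF \<eta>(1) loc_int_const[of 1]]]] by simp
  then have "set_integrable lborel {0..T} (\<lambda>t. p t * \<eta> t)"
  proof (rule set_integrable_bound)
    show "AE t in lborel. t \<in> {0..T} \<longrightarrow> norm (p t * \<eta> t) \<le> norm (K * \<eta> t)"
      using AE_not_in[OF N(1)]
    proof eventually_elim
      case (elim t)
      show ?case
      proof
        assume "t \<in> {0..T}"
        then have "\<bar>p t\<bar> \<le> \<bar>K\<bar>" using N(2)[of t] elim by auto
        then show "norm (p t * \<eta> t) \<le> norm (K * \<eta> t)" by (simp add: abs_mult mult_right_mono)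
      qed
    qed
  qed (simp add: set_borel_measurable_def)
  moreover have "(\<lambda>t. indicator {0..T} t *\<^sub>R (p t * \<eta> t)) = (\<lambda>t. indicator {0..} t *\<^sub>R (p t * \<eta> t))"
  proof
    fix t show "indicator {0..T} t *\<^sub>R (p t * \<eta> t) = indicator {0..} t *\<^sub>R (p t * \<eta> t)"
      using \<eta>(2)[of t] by (cases "T \<le> t") (auto simp: indicator_def)
  qed
  ultimately show ?thesis unfolding set_integrable_def by (simp only:)
qed

text \<open>Test functions \<phi>(t) g(x) turn the space-time identity into a weak ordinary
  differential equation for the moment int m g dx. The exceptional set of times may depend on
  \<open>g\<close>, which is why only countably many \<open>g\<close> are used afterwards.\<close>

lemma localize:
  assumes m: "joint_measurable m" "joint_measurable F"
      "joint_measurable S"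
    and l: "\<And>t. 0 \<le> t \<Longrightarrow> loc_int (m t)" "\<And>t. 0 \<le> t \<Longrightarrow> loc_int (F t)" "\<And>t. 0 \<le> t \<Longrightarrow> loc_int (S t)"
    and N: "N \<in> null_sets lborel" and bd: "\<And>t. 0 \<le> t \<Longrightarrow> t \<notin> N \<Longrightarrow> sint (\<lambda>x. \<bar>m t x\<bar>) \<le> K"
      "\<And>t. 0 \<le> t \<Longrightarrow> t \<notin> N \<Longrightarrow> sint (\<lambda>x. \<bar>F t x\<bar>) \<le> K" "\<And>t. 0 \<le> t \<Longrightarrow> t \<notin> N \<Longrightarrow> sint (\<lambda>x. \<bar>S t x\<bar>) \<le> K"
    and weak: "\<And>\<psi>. test_fn \<psi> \<Longrightarrow> stint (\<lambda>t x. m t x * pd_t \<psi> t x - F t x * pd_x \<psi> t x)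
      = - stint (\<lambda>t x. S t x * \<psi> t x) - sint (\<lambda>x. m0 x * \<psi> 0 x)"
    and g: "smooth g" "\<And>x. g (x + 1) = g x"
  shows "AE t in lborel. 0 \<le> t \<longrightarrow> sint (\<lambda>x. m t x * g x) = sint (\<lambda>x. m0 x * g x)
    + (LBINT s:{0..t}. sint (\<lambda>x. S s x * g x) - sint (\<lambda>x. F s x * deriv g x))"
proof -
  note gc = smoothD(3)[OF g(1), of UNIV] and g'c = smoothD(3)[OF smoothD(2)[OF g(1)], of UNIV]
  obtain G where G: "\<And>x. \<bar>g x\<bar> \<le> G" using periodic_bounded[OF gc g(2)] by blast
  obtain G' where G': "\<And>x. \<bar>deriv g x\<bar> \<le> G'" using periodic_bounded[OF g'c periodic_deriv[OF g]] by blast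
  define a where "a t = sint (\<lambda>x. m t x * g x)" for t
  define f where "f t = sint (\<lambda>x. F t x * deriv g x)" for t
  define s where "s t = sint (\<lambda>x. S t x * g x)" for t
  have mm: "a \<in> borel_measurable borel" "f \<in> borel_measurable borel" "s \<in> borel_measurable borel"
    unfolding a_def[abs_def] f_def[abs_def] s_def[abs_def]
    by (rule borel_measurable_sint, rule joint_mult_measurable, rule m, rule gc g'c)+
  have ab: "\<bar>a t\<bar> \<le> G * K" "\<bar>f t\<bar> \<le> G' * K" "\<bar>s t\<bar> \<le> G * K" if "0 \<le> t" "t \<notin> N" for t
    unfolding a_def f_def s_def using that l bd G G' gc g'c by (auto intro!: sint_mult_bound)
  have "AE t in lborel. 0 \<le> t \<longrightarrow> a t = sint (\<lambda>x. m0 x * g x) + (LBINT u:{0..t}. s u - f u)"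
  proof (rule AE_eq_of_weak_derivative[OF _ _ N, where K = "\<bar>G * K\<bar> + \<bar>G' * K\<bar>"])
    show "a \<in> borel_measurable borel" "(\<lambda>u. s u - f u) \<in> borel_measurable borel" using mm by measurable
    show "\<bar>a t\<bar> \<le> \<bar>G * K\<bar> + \<bar>G' * K\<bar> \<and> \<bar>s t - f t\<bar> \<le> \<bar>G * K\<bar> + \<bar>G' * K\<bar>" if "0 \<le> t" "t \<notin> N" for t
      using ab[OF that] by linarith
    fix \<phi> T assume \<phi>: "smooth \<phi>" and z: "\<And>t. T \<le> t \<Longrightarrow> \<phi> t = (0::real)"
    define T' where "T' = T + 1"
    have z': "deriv \<phi> t = 0" if "T' \<le> t" for t
    proof -
      have "(\<phi> has_real_derivative 0) (at t)"
        by (rule has_field_derivative_transform_within_open[OF DERIV_const[of 0] open_greaterThan[of T]]) (use that z in \<open>auto simp: T'_def\<close>)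
      then show ?thesis by (rule DERIV_imp_deriv)
    qed
    note tf = test_fn_product[where T = T, OF \<phi> g z]
    note \<phi>c = smoothD(3)[OF \<phi>, of UNIV] and \<phi>'c = smoothD(3)[OF smoothD(2)[OF \<phi>], of UNIV]
    have i1: "set_integrable lborel {0..} (\<lambda>t. a t * deriv \<phi> t)" by (rule set_integrable_compact_support[OF mm(1) N ab(1) \<phi>'c z'])
    have i2: "set_integrable lborel {0..} (\<lambda>t. f t * \<phi> t)" by (rule set_integrable_compact_support[OF mm(2) N ab(2) \<phi>c z])
    have i3: "set_integrable lborel {0..} (\<lambda>t. s t * \<phi> t)" by (rule set_integrable_compact_support[OF mm(3) N ab(3) \<phi>c z])
    have "stint (\<lambda>t x. m t x * (deriv \<phi> t * g x) - F t x * (\<phi> t * deriv g x)) = (LBINT t:{0..}. a t * deriv \<phi> t - f t * \<phi> t)"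
      unfolding stint_def
    proof (rule set_lebesgue_integral_cong, simp, intro allI impI)
      fix t :: real assume "t \<in> {0..}"
      then have t: "0 \<le> t" by simp
      have "sint (\<lambda>x. m t x * (deriv \<phi> t * g x) - F t x * (\<phi> t * deriv g x))
        = sint (\<lambda>x. deriv \<phi> t * (m t x * g x) - \<phi> t * (F t x * deriv g x))" by (simp add: mult_ac)
      also have "\<dots> = deriv \<phi> t * a t - \<phi> t * f t"
        unfolding a_def f_def by (subst sint_diff) (auto intro!: loc_int_cmult loc_int_mult_right l t gc g'c simp: sint_cmult)
      finally show "sint (\<lambda>x. m t x * (deriv \<phi> t * g x) - F t x * (\<phi> t * deriv g x)) = a t * deriv \<phi> t - f t * \<phi> t"
        by (simp add: mult.commute)
    qed
    also have "\<dots> = (LBINT t:{0..}. a t * deriv \<phi> t) - (LBINT t:{0..}. f t * \<phi> t)"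
      by (rule set_integral_diff(2)[OF i1 i2])
    finally have 1: "stint (\<lambda>t x. m t x * (deriv \<phi> t * g x) - F t x * (\<phi> t * deriv g x))
      = (LBINT t:{0..}. a t * deriv \<phi> t) - (LBINT t:{0..}. f t * \<phi> t)" .
    have 2: "stint (\<lambda>t x. S t x * (\<phi> t * g x)) = (LBINT t:{0..}. s t * \<phi> t)"
    proof -
      have "sint (\<lambda>x. S t x * (\<phi> t * g x)) = s t * \<phi> t" for t
        using sint_cmult[of "\<phi> t" "\<lambda>x. S t x * g x"] by (simp add: s_def mult_ac)
      then show ?thesis by (simp add: stint_def)
    qed
    have 3: "sint (\<lambda>x. m0 x * (\<phi> 0 * g x)) = sint (\<lambda>x. m0 x * g x) * \<phi> 0"
      using sint_cmult[of "\<phi> 0" "\<lambda>x. m0 x * g x"] by (simp add: mult_ac)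
    have "(LBINT t:{0..}. a t * deriv \<phi> t + (s t - f t) * \<phi> t) = (LBINT t:{0..}. a t * deriv \<phi> t)
      + ((LBINT t:{0..}. s t * \<phi> t) - (LBINT t:{0..}. f t * \<phi> t))"
      unfolding left_diff_distrib set_integral_add(2)[OF i1 set_integral_diff(1)[OF i3 i2]] set_integral_diff(2)[OF i3 i2] ..
    note assm = this
    show "(LBINT t:{0..}. a t * deriv \<phi> t + (s t - f t) * \<phi> t) = - sint (\<lambda>x. m0 x * g x) * \<phi> 0"
    proof -
      have tt: "pd_t (\<lambda>t x. \<phi> t * g x) = (\<lambda>t x. deriv \<phi> t * g x)" "pd_x (\<lambda>t x. \<phi> t * g x) = (\<lambda>t x. \<phi> t * deriv g x)"
        by (intro ext test_fn_product(2)[where T = T, OF \<phi> g z], assumption)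
          (intro ext test_fn_product(3)[where T = T, OF \<phi> g z], assumption)
      from weak[OF tf(1), unfolded tt 1 2 3] assm show ?thesis by simp
    qed
  qed
  then show ?thesis by (simp add: a_def f_def s_def)
qed

subsection \<open>Indicators of arcs as limits of smooth periodic functions\<close>

text \<open>Modulo 1, cos(2 pi (x - b/2)) exceeds cos(pi b) exactly when x is closer than b/2 to
  b/2. These are therefore smooth periodic approximations of the indicator of the arc (0,
  b).\<close>

definition "arcf n b x = bump (real n * (cos (2 * pi * (x - b / 2)) - cos (pi * b)))"

lemma arcf_smooth: "smooth (arcf n b)" and arcf_periodic: "arcf n b (x + 1) = arcf n b x"
proof -
  have s: "smooth (\<lambda>x. 2 * pi * (x - b / 2))" by (intro smooth_mult smooth_const smooth_diff smooth_ident)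
  show "smooth (arcf n b)" unfolding arcf_def[abs_def]
    by (intro smooth_compose[OF smooth_bump] smooth_mult smooth_diff smooth_const smooth_compose[OF smooth_cos s])
  have "cos (2 * pi * (x + 1 - b / 2)) = cos (2 * pi * (x - b / 2) + 2 * pi)" by (simp add: algebra_simps)
  then show "arcf n b (x + 1) = arcf n b x" unfolding arcf_def by simp
qed

lemma arcf_tendsto:
  assumes b: "0 < b" "b < 1" and x: "0 \<le> x" "x \<le> 1"
  shows "(\<lambda>n. arcf n b x) \<longlonglongrightarrow> indicator {0<..<b} x"
proof -
  have "0 < cos (2 * pi * (x - b / 2)) - cos (pi * b) \<longleftrightarrow> 0 < x \<and> x < b"
  proof
    assume "0 < x \<and> x < b"
    then have "\<bar>2 * (x - b / 2)\<bar> < b" by (auto simp: abs_less_iff)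
    then have "pi * \<bar>2 * (x - b / 2)\<bar> < pi * b" by simp
    then have "\<bar>2 * pi * (x - b / 2)\<bar> < pi * b" by (simp add: abs_mult mult_ac)
    then have "cos (pi * b) < cos \<bar>2 * pi * (x - b / 2)\<bar>" using b by (intro cos_monotone_0_pi) auto
    then show "0 < cos (2 * pi * (x - b / 2)) - cos (pi * b)" by simp
  next
    assume pos: "0 < cos (2 * pi * (x - b / 2)) - cos (pi * b)"
    show "0 < x \<and> x < b"
    proof (rule ccontr)
      assume "\<not> (0 < x \<and> x < b)"
      then consider "x = 0" | "b \<le> x" using x by linarith
      then show False
      proof cases
        case 1
        then show False using pos by (simp add: mult.commute)
      next
        case 2
        define z where "z = 2 * (x - b / 2)"
        have z: "b \<le> z" "z \<le> 2 - b" using 2 x by (auto simp: z_def)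
        have eq: "2 * pi * (x - b / 2) = pi * z" by (simp add: z_def)
        have "cos (pi * z) \<le> cos (pi * b)"
        proof (cases "z \<le> 1")
          case True
          then show ?thesis using z b by (intro cos_monotone_0_pi_le) (auto intro: mult_left_mono simp: mult_le_cancel_left1)
        next
          case False
          have "cos (pi * z) = cos (2 * pi - pi * z)" by (simp add: cos_diff)
          also have "2 * pi - pi * z = pi * (2 - z)" by (simp add: algebra_simps)
          also have "cos (pi * (2 - z)) \<le> cos (pi * b)"
            using False z b by (intro cos_monotone_0_pi_le) (auto intro: mult_left_mono simp: mult_le_cancel_left1)
          finally show ?thesis .
        qed
        then show False using pos unfolding eq by simp
      qed
    qed
  qed
  then have "(if 0 < cos (2 * pi * (x - b / 2)) - cos (pi * b) then 1 else 0) = (indicator {0<..<b} x :: real)"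
    by (simp only: indicator_def greaterThanLessThan_iff) simp
  then show ?thesis using bump_tendsto[of "cos (2 * pi * (x - b / 2)) - cos (pi * b)"] by (simp only: arcf_def)
qed

lemma sint_arc_limit:
  assumes P: "loc_int P" and b: "0 < b" "b < 1"
  shows "(\<lambda>n. sint (\<lambda>x. P x * arcf n b x)) \<longlonglongrightarrow> (LBINT x:{0..b}. P x)"
proof -
  have "(\<lambda>n. sint (\<lambda>x. P x * arcf n b x)) \<longlonglongrightarrow> sint (\<lambda>x. P x * indicator {0<..<b} x)"
    unfolding sint_def set_lebesgue_integral_def
  proof (rule integral_dominated_convergence[where w = "\<lambda>x. indicator {0..1} x *\<^sub>R \<bar>P x\<bar>"])
    note [measurable] = loc_int_measurable[OF P] borel_measurable_continuous_onI[OF smoothD(3)[OF arcf_smooth]]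
    show "(\<lambda>x. indicator {0..1} x *\<^sub>R (P x * indicator {0<..<b} x)) \<in> borel_measurable lborel" by measurable
    show "(\<lambda>x. indicator {0..1} x *\<^sub>R (P x * arcf n b x)) \<in> borel_measurable lborel" for n by measurable
    show "integrable lborel (\<lambda>x. indicator {0..1} x *\<^sub>R \<bar>P x\<bar>)"
      using set_integrable_abs[OF loc_int_integrable[OF P]] unfolding set_integrable_def .
    show "AE x in lborel. (\<lambda>n. indicator {0..1} x *\<^sub>R (P x * arcf n b x)) \<longlonglongrightarrow> indicator {0..1} x *\<^sub>R (P x * indicator {0<..<b} x)"
    proof (rule AE_I2)
      show "(\<lambda>n. indicator {0..1} x *\<^sub>R (P x * arcf n b x)) \<longlonglongrightarrow> indicator {0..1} x *\<^sub>R (P x * indicator {0<..<b} x)" for x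
        by (cases "x \<in> {0..1}") (auto intro!: tendsto_intros arcf_tendsto[OF b] simp: indicator_def[of "{0..1}"])
    qed
    show "AE x in lborel. norm (indicator {0..1} x *\<^sub>R (P x * arcf n b x)) \<le> indicator {0..1} x *\<^sub>R \<bar>P x\<bar>" for n
      using bump_props(1,2) by (intro AE_I2) (simp add: abs_mult mult_left_le indicator_def arcf_def)
  qed
  also have "sint (\<lambda>x. P x * indicator {0<..<b} x) = (LBINT x:{0<..<b}. P x)"
    unfolding sint_def set_lebesgue_integral_def using b by (intro Bochner_Integration.integral_cong) (auto simp: indicator_def)
  also have "\<dots> = (LBINT x:{0..b}. P x)"
    by (rule set_integral_discrete_difference[where X="{0, b}"]) (use b in auto)
  finally show ?thesis .
qed

text \<open>Passing to the limit in n, the primitive of P minus its mean vanishes at every rational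
  b in (0, 1), hence on [0, 1] by continuity. Rational end points keep the family of test functions
  countable.\<close>

lemma AE_const_of_arcs:
  assumes P: "loc_int P" and arcs: "\<And>n b. b \<in> \<rat> \<Longrightarrow> 0 < b \<Longrightarrow> b < 1 \<Longrightarrow> sint (\<lambda>x. P x * arcf n b x) = sint P * sint (arcf n b)"
  shows "AE x in lborel. x \<in> {0..1} \<longrightarrow> P x = sint P"
proof -
  define w where "w x = P x - sint P" for x
  have lw: "loc_int w" unfolding w_def[abs_def] by (intro loc_int_diff P loc_int_const)
  define Q where "Q x = interval_lebesgue_integral lborel (ereal 0) (ereal x) w" for x
  have Q: "prim Q w" unfolding Q_def[abs_def] by (rule prim_exists[OF lw])
  have Q0: "Q 0 = 0" by (simp add: Q_def interval_integral_endpoints_same)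
  have rat: "Q b = 0" if "b \<in> \<rat>" "0 < b" "b < 1" for b
  proof -
    have "(\<lambda>n. sint (\<lambda>x. w x * arcf n b x)) \<longlonglongrightarrow> (LBINT x:{0..b}. w x)" by (rule sint_arc_limit[OF lw that(2,3)])
    moreover have "sint (\<lambda>x. w x * arcf n b x) = 0" for n
    proof -
      have c: "continuous_on UNIV (arcf n b)" by (rule smoothD(3)[OF arcf_smooth])
      have "loc_int (arcf n b)" using loc_int_mult_continuous[OF c loc_int_const[of 1]] by simp
      then have "sint (\<lambda>x. w x * arcf n b x) = sint (\<lambda>x. P x * arcf n b x) - sint P * sint (arcf n b)"
        unfolding w_def left_diff_distrib
        by (subst sint_diff) (auto simp: sint_cmult intro!: loc_int_mult_right[OF P c] loc_int_cmult)
      then show ?thesis using arcs[OF that] by simp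
    qed
    ultimately have "(LBINT x:{0..b}. w x) = 0" by (simp add: LIMSEQ_const_iff)
    then show ?thesis using prim_integral[OF Q, of 0 b] that Q0 by simp
  qed
  have all: "Q b = 0" if b: "0 \<le> b" "b \<le> 1" for b
  proof (rule ccontr)
    assume nz: "Q b \<noteq> 0"
    have "isCont Q b" using prim_continuous[OF Q, of UNIV] by (simp add: continuous_on_eq_continuous_at)
    then have "(Q \<longlongrightarrow> Q b) (at b)" by (simp add: isCont_def)
    then have "\<forall>\<^sub>F x in at b. Q x \<noteq> 0" using nz by (intro tendsto_imp_eventually_ne)
    then obtain d where d: "0 < d" "\<And>x. x \<noteq> b \<Longrightarrow> dist x b < d \<Longrightarrow> Q x \<noteq> 0" unfolding eventually_at by auto
    have "max 0 (b - d) < min 1 (b + d)" using d(1) b by auto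
    then obtain r where r: "r \<in> \<rat>" "max 0 (b - d) < r" "r < min 1 (b + d)" using Rats_dense_in_real by blast
    then have "Q r = 0" by (intro rat) auto
    moreover have "dist r b < d" using r by (auto simp: dist_real_def abs_less_iff)
    ultimately show False using d(2)[of r] nz by auto
  qed
  define v where "v x = indicator {0..1} x * w x" for x
  have "AE x in lborel. v x = 0"
  proof (rule AE_eq_0_of_prim_0)
    note [measurable] = loc_int_measurable[OF lw]
    show "loc_int v" by (rule loc_int_bound[OF lw]) (unfold v_def[abs_def], measurable, simp add: indicator_def)
    fix c d :: real assume "c \<le> d"
    have "(LBINT x:{c..d}. v x) = (LBINT x:{max 0 c..min 1 d}. w x)"
      unfolding set_lebesgue_integral_def v_def by (intro Bochner_Integration.integral_cong) (auto simp: indicator_def)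
    also have "\<dots> = 0"
    proof (cases "max 0 c \<le> min 1 d")
      case True
      then show ?thesis using prim_integral[OF Q True] all[of "max 0 c"] all[of "min 1 d"] by auto
    next
      case False
      then have "{max 0 c..min 1 d} = {}" by auto
      then show ?thesis by (simp add: set_lebesgue_integral_def)
    qed
    finally show "(LBINT x:{c..d}. v x) = 0" .
  qed
  then show ?thesis by eventually_elim (auto simp: v_def w_def indicator_def)
qed

lemma prim_DERIV:
  assumes "prim F f" "continuous_on UNIV f" shows "(F has_real_derivative f x) (at x)"
proof -
  have c: "isCont f x" for x using assms(2) by (simp add: continuous_on_eq_continuous_at)
  obtain K where K: "\<And>t. (K has_vector_derivative f t) (at t)"
    using einterval_antiderivative[of "-\<infinity>" "\<infinity>" f] c by auto
  then have K': "(K has_real_derivative f t) (at t)" for t by (simp add: has_real_derivative_iff_has_vector_derivative)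
  define k where "k = F 0 - K 0"
  have "F t = K t + k" for t using prim_unique[OF assms(1) prim_of_DERIV[OF K' assms(2)], of t 0] by (simp add: k_def)
  then have "F = (\<lambda>t. K t + k)" by (rule ext)
  moreover have "((\<lambda>t. K t + k) has_real_derivative f x + 0) (at x)" by (intro DERIV_add K' DERIV_const)
  ultimately show ?thesis by simp
qed

text \<open>Balance laws pair the flux with the derivative of a test function. Testing with these
  antiderivatives pairs it with an arc minus the mean of the arc, the form that
  \<open>AE_const_of_arcs\<close> requires.\<close>

lemma arcf_antiderivative:
  shows "smooth (dxinv (arcf n b))" "dxinv (arcf n b) (x + 1) = dxinv (arcf n b) x"
    "deriv (dxinv (arcf n b)) x = arcf n b x - sint (arcf n b)"
proof -
  have c: "continuous_on UNIV (arcf n b)" by (rule smoothD(3)[OF arcf_smooth])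
  have l: "loc_int (arcf n b)" using loc_int_mult_continuous[OF c loc_int_const[of 1]] by simp
  have D: "(dxinv (arcf n b) has_real_derivative arcf n b x - sint (arcf n b)) (at x)" for x
    by (rule prim_DERIV[OF prim_dxinv[OF l]]) (intro continuous_intros c)
  show "smooth (dxinv (arcf n b))" by (rule smooth_antiderivative[OF _ D]) (intro smooth_diff arcf_smooth smooth_const)
  show "deriv (dxinv (arcf n b)) x = arcf n b x - sint (arcf n b)" by (rule DERIV_imp_deriv[OF D])
  show "dxinv (arcf n b) (x + 1) = dxinv (arcf n b) x" by (rule dxinv_periodic[OF l arcf_periodic])
qed

section \<open>Balance laws for spatial primitives of weak solutions\<close>

section \<open>Potentials of weak solutions\<close>

lemma swap_measurable_borel:
  fixes f :: "real \<Rightarrow> real \<Rightarrow> real"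
  assumes "joint_measurable f" shows "(\<lambda>p. f (snd p) (fst p)) \<in> borel_measurable borel"
proof -
  have "(\<lambda>p. (snd p, fst p)) \<in> borel \<rightarrow>\<^sub>M (borel :: real measure) \<Otimes>\<^sub>M (borel :: real measure)"
    by (intro measurable_Pair borel_fst_snd)
  from measurable_compose[OF this[unfolded borel_prod] assms] show ?thesis by simp
qed

lemma lborel_pair_measurable:
  fixes f :: "real \<times> real \<Rightarrow> real"
  assumes "f \<in> borel_measurable borel" shows "f \<in> borel_measurable (lborel \<Otimes>\<^sub>M lborel)" "f \<in> borel_measurable (borel \<Otimes>\<^sub>M lborel)"
proof -
  have "sets ((lborel :: real measure) \<Otimes>\<^sub>M (lborel :: real measure)) = sets (borel \<Otimes>\<^sub>M borel)" by (rule sets_pair_measure_cong) simp_all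
  from measurable_cong_sets[OF this refl] assms show "f \<in> borel_measurable (lborel \<Otimes>\<^sub>M lborel)" unfolding borel_prod by blast
  have "sets ((borel :: real measure) \<Otimes>\<^sub>M (lborel :: real measure)) = sets (borel \<Otimes>\<^sub>M borel)" by (rule sets_pair_measure_cong) simp_all
  from measurable_cong_sets[OF this refl] assms show "f \<in> borel_measurable (borel \<Otimes>\<^sub>M lborel)" unfolding borel_prod by blast
qed

lemma borel_measurable_time_integral:
  fixes F :: "real \<Rightarrow> real \<Rightarrow> real"
  assumes "joint_measurable F"
  shows "(\<lambda>y. LBINT s:{a..b}. F s y) \<in> borel_measurable borel"
proof -
  note [measurable] = swap_measurable_borel[OF assms] borel_fst_snd
  have "(\<lambda>p. indicator {a..b} (snd p) *\<^sub>R F (snd p) (fst p)) \<in> borel_measurable borel" by measurable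
  then have "(\<lambda>(y, s). indicator {a..b} s *\<^sub>R F s y) \<in> borel_measurable (borel \<Otimes>\<^sub>M lborel)"
    unfolding case_prod_beta' by (rule lborel_pair_measurable(2))
  from lborel.borel_measurable_lebesgue_integral[OF this] show ?thesis by (simp add: set_lebesgue_integral_def)
qed

lemma AE_lborel_shift: "AE y in lborel. P y \<Longrightarrow> AE y in lborel. P (c + y :: real)"
proof -
  assume "AE y in lborel. P y"
  then have "AE y in distr lborel borel ((+) c). P y" by (subst lborel_distr_plus)
  from AE_distrD[OF _ this] show ?thesis by simp
qed

lemma AE_periodic:
  assumes "AE y in lborel. y \<in> {0..1} \<longrightarrow> P y" "\<And>y. P (y + 1) \<longleftrightarrow> P (y :: real)"
  shows "AE y in lborel. P y"
proof -
  have "AE y in lborel. y \<in> {of_int k..of_int k + 1} \<longrightarrow> P y" for k :: int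
    using AE_lborel_shift[OF assms(1), of "- of_int k"]
  proof eventually_elim
    case (elim y)
    show ?case
    proof
      assume "y \<in> {of_int k..of_int k + 1}"
      then have "P (- of_int k + y)" using elim by auto
      then show "P y" using periodic_int[of P 1, OF assms(2), of "- of_int k + y" k] by simp
    qed
  qed
  then have "AE y in lborel. \<forall>k::int. y \<in> {of_int k..of_int k + 1} \<longrightarrow> P y" unfolding AE_all_countable by blast
  then show ?thesis
  proof eventually_elim
    case (elim y)
    have "y \<in> {of_int \<lfloor>y\<rfloor>..of_int \<lfloor>y\<rfloor> + 1}" using floor_correct[of y] by simp
    then show ?case using elim by blast
  qed
qed

lemma AE_dense:
  assumes "AE t in lborel. P (t :: real)" "a < b" obtains t where "a < t" "t < b" "P t"
proof -
  have "\<exists>t. a < t \<and> t < b \<and> P t"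
  proof (rule ccontr)
    assume "\<not> ?thesis"
    then have "AE t in lborel. t \<notin> {a<..<b}" using assms(1) by (auto elim!: eventually_mono)
    then have "{a<..<b} \<in> null_sets lborel" by (subst AE_iff_null_sets) auto
    then show False using assms(2) by (simp add: null_sets_def)
  qed
  then show thesis using that by blast
qed

lemma AE_continuous_eq:
  fixes f g :: "real \<Rightarrow> real"
  assumes "AE y in lborel. f y = g y" "continuous_on UNIV f" "continuous_on UNIV g" shows "f y = g y"
proof (rule ccontr)
  assume ne: "f y \<noteq> g y"
  have "isCont (\<lambda>y. f y - g y) y" using assms(2,3) by (intro continuous_diff) (simp_all add: continuous_on_eq_continuous_at)
  then have "((\<lambda>y. f y - g y) \<longlongrightarrow> f y - g y) (at y)" by (simp add: isCont_def)
  then have "\<forall>\<^sub>F x in at y. f x - g x \<noteq> 0" using ne by (intro tendsto_imp_eventually_ne) auto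
  then obtain d where d: "0 < d" "\<And>x. x \<noteq> y \<Longrightarrow> dist x y < d \<Longrightarrow> f x \<noteq> g x" unfolding eventually_at by auto
  obtain t where "y < t" "t < y + d" "f t = g t" using AE_dense[OF assms(1), of y "y + d"] d(1) by auto
  then show False using d(2)[of t] by (auto simp: dist_real_def)
qed

text \<open>Fubini on the rectangle [0, t] x [0, 1], where the integrand is integrable because its
  spatial L^1 norm is bounded off a null set of times. Periodicity then extends the
  almost-everywhere statement from [0, 1] to the line.\<close>

lemma
  fixes \<Phi> :: "real \<Rightarrow> real \<Rightarrow> real"
  assumes \<Phi>: "joint_measurable \<Phi>"
    and l: "\<And>s. loc_int (\<Phi> s)" and per: "\<And>s x. \<Phi> s (x + 1) = \<Phi> s x"
    and N: "N \<in> null_sets lborel" and bd: "\<And>s. 0 \<le> s \<Longrightarrow> s \<notin> N \<Longrightarrow> sint (\<lambda>x. \<bar>\<Phi> s x\<bar>) \<le> K"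
  shows time_integral_loc_int: "loc_int (\<lambda>y. LBINT s:{0..t}. \<Phi> s y)"
    and time_integral_swap: "continuous_on UNIV k \<Longrightarrow> (\<And>x. \<bar>k x\<bar> \<le> G) \<Longrightarrow>
      (LBINT s:{0..t}. sint (\<lambda>y. \<Phi> s y * k y)) = sint (\<lambda>y. (LBINT s:{0..t}. \<Phi> s y) * k y)"
    and time_integral_AE: "AE y in lborel. set_integrable lborel {0..t} (\<lambda>s. \<Phi> s y)"
proof -
  note [measurable] = borel_fst_snd
  define f where "f k s y = indicator {0..t} s *\<^sub>R (indicator {0..1} y *\<^sub>R (\<Phi> s y * k y))" for k :: "real \<Rightarrow> real" and s y
  have int: "integrable (lborel \<Otimes>\<^sub>M lborel) (case_prod (f k))" if k: "continuous_on UNIV k" "\<And>x. \<bar>k x\<bar> \<le> G" for k G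
  proof (rule lborel_pair.Fubini_integrable)
    note [measurable] = joint_mult_measurable[OF \<Phi> k(1)]
    have "(\<lambda>p. f k (fst p) (snd p)) \<in> borel_measurable borel" unfolding f_def by measurable
    from lborel_pair_measurable(1)[OF this] show "case_prod (f k) \<in> borel_measurable (lborel \<Otimes>\<^sub>M lborel)" by (simp add: case_prod_beta')
    have "loc_int (\<lambda>y. \<Phi> s y * k y)" for s by (rule loc_int_mult_right[OF l k(1)])
    from loc_int_integrable[OF this] have "integrable lborel (\<lambda>y. f k s y)" for s
      unfolding f_def set_integrable_def by (rule integrable_scaleR_right)
    then show "AE s in lborel. integrable lborel (\<lambda>y. case_prod (f k) (s, y))" by simp
    have n: "(\<integral>y. norm (case_prod (f k) (s, y)) \<partial>lborel) = indicator {0..t} s *\<^sub>R sint (\<lambda>y. \<bar>\<Phi> s y * k y\<bar>)" for s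
      unfolding f_def sint_def set_lebesgue_integral_def by (cases "s \<in> {0..t}") (auto simp: abs_mult intro!: Bochner_Integration.integral_cong)
    have "(\<lambda>p. \<bar>\<Phi> (fst p) (snd p) * k (snd p)\<bar>) \<in> borel_measurable borel" by measurable
    from borel_measurable_sint[OF this]
    have sm: "(\<lambda>s. sint (\<lambda>y. \<bar>\<Phi> s y * k y\<bar>)) \<in> borel_measurable borel" .
    have "set_integrable lborel {0..t} (\<lambda>s. sint (\<lambda>y. \<bar>\<Phi> s y * k y\<bar>))"
    proof (rule set_integrable_off_null[OF sm N])
      fix s assume s: "0 \<le> s" "s \<notin> N"
      have "\<bar>sint (\<lambda>y. \<bar>\<Phi> s y\<bar> * \<bar>k y\<bar>)\<bar> \<le> G * K"
        using k bd[OF s] by (intro sint_mult_bound loc_int_abs l continuous_intros) auto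
      then show "\<bar>sint (\<lambda>y. \<bar>\<Phi> s y * k y\<bar>)\<bar> \<le> G * K" by (simp only: abs_mult)
    qed
    then show "integrable lborel (\<lambda>s. \<integral>y. norm (case_prod (f k) (s, y)) \<partial>lborel)" unfolding n set_integrable_def .
  qed
  have swap_f: "(\<integral>s. f k s y \<partial>lborel) = indicator {0..1} y *\<^sub>R ((LBINT s:{0..t}. \<Phi> s y) * k y)" for k y
    unfolding f_def set_lebesgue_integral_def by (cases "y \<in> {0..1}") (auto simp: mult.assoc[symmetric] simp del: mult.assoc)
  have one: "continuous_on UNIV (\<lambda>x. 1 :: real)" "\<And>x. \<bar>(\<lambda>x. 1 :: real) x\<bar> \<le> 1" by auto
  show "loc_int (\<lambda>y. LBINT s:{0..t}. \<Phi> s y)"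
  proof (rule loc_int_periodic[OF borel_measurable_time_integral[OF \<Phi>]])
    show "set_integrable lborel {0..1} (\<lambda>y. LBINT s:{0..t}. \<Phi> s y)"
      using lborel_pair.integrable_snd[OF int[OF one]] unfolding swap_f set_integrable_def by simp
  qed (simp add: per)
  show "(LBINT s:{0..t}. sint (\<lambda>y. \<Phi> s y * k y)) = sint (\<lambda>y. (LBINT s:{0..t}. \<Phi> s y) * k y)"
    if k: "continuous_on UNIV k" "\<And>x. \<bar>k x\<bar> \<le> G"
  proof -
    have "(\<integral>y. f k s y \<partial>lborel) = indicator {0..t} s *\<^sub>R sint (\<lambda>y. \<Phi> s y * k y)" for s
      unfolding f_def sint_def set_lebesgue_integral_def by simp
    with lborel_pair.Fubini_integral[OF int[OF k]] show ?thesis unfolding swap_f by (simp add: sint_def set_lebesgue_integral_def)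
  qed
  have "AE y in lborel. integrable lborel (\<lambda>s. f (\<lambda>x. 1) s y)" by (rule lborel_pair.AE_integrable_snd[OF int[OF one]])
  then have "AE y in lborel. y \<in> {0..1} \<longrightarrow> set_integrable lborel {0..t} (\<lambda>s. \<Phi> s y)"
  proof eventually_elim
    case (elim y)
    show ?case
    proof
      assume "y \<in> {0..1}"
      then have "(\<lambda>s. f (\<lambda>x. 1) s y) = (\<lambda>s. indicat_real {0..t} s *\<^sub>R \<Phi> s y)" by (auto simp: f_def)
      with elim show "set_integrable lborel {0..t} (\<lambda>s. \<Phi> s y)" unfolding set_integrable_def by simp
    qed
  qed
  then show "AE y in lborel. set_integrable lborel {0..t} (\<lambda>s. \<Phi> s y)" by (rule AE_periodic) (simp add: per)
qed

definition "pr w y = interval_lebesgue_integral lborel (ereal 0) (ereal y) w" for w :: "real \<Rightarrow> real" and y :: real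

lemma prim_pr: "loc_int w \<Longrightarrow> prim (pr w) w" and pr_0: "pr w 0 = 0"
  unfolding pr_def[abs_def] by (rule prim_exists) (simp_all add: interval_integral_endpoints_same)

text \<open>Testing a localised balance law with antiderivatives of arcs gives, by du Bois-Reymond's argument, its integrated form.\<close>

lemma potential:
  fixes m \<Phi> :: "real \<Rightarrow> real \<Rightarrow> real"
  assumes m: "\<And>t. loc_int (m t)" "\<And>t x. m t (x + 1) = m t x" and m0: "loc_int m0" "\<And>x. m0 (x + 1) = m0 x"
    and \<Phi>: "joint_measurable \<Phi>"
    and l: "\<And>s. loc_int (\<Phi> s)" and per: "\<And>s x. \<Phi> s (x + 1) = \<Phi> s x"
    and N: "N \<in> null_sets lborel" and bd: "\<And>s. 0 \<le> s \<Longrightarrow> s \<notin> N \<Longrightarrow> sint (\<lambda>x. \<bar>\<Phi> s x\<bar>) \<le> K"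
    and \<sigma>: "\<And>t. set_integrable lborel {0..t} \<sigma>"
    and loc: "\<And>g. smooth g \<Longrightarrow> (\<And>x. g (x + 1) = g x) \<Longrightarrow> AE t in lborel. 0 \<le> t \<longrightarrow>
      sint (\<lambda>x. m t x * g x) = sint (\<lambda>x. m0 x * g x) + (LBINT s:{0..t}. \<sigma> s * sint g - sint (\<lambda>x. \<Phi> s x * deriv g x))"
  shows "AE t in lborel. 0 \<le> t \<longrightarrow> sint (m t) = sint m0 + (LBINT s:{0..t}. \<sigma> s) \<and>
     (\<exists>c. AE y in lborel. pr (m t) y = pr m0 y + y * (LBINT s:{0..t}. \<sigma> s) + (LBINT s:{0..t}. \<Phi> s y) + c)"
proof -
  let ?id = "\<lambda>g t. sint (\<lambda>x. m t x * g x) = sint (\<lambda>x. m0 x * g x) + (LBINT s:{0..t}. \<sigma> s * sint g - sint (\<lambda>x. \<Phi> s x * deriv g x))"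
  have "AE t in lborel. 0 \<le> t \<longrightarrow> ?id (\<lambda>x. 1) t" by (rule loc) (simp_all add: smooth_const)
  \<comment> \<open>Countably many test functions, so one null set of times serves all of
    them.\<close>
  moreover have "AE t in lborel. \<forall>n. \<forall>b\<in>\<rat>. 0 \<le> t \<longrightarrow> ?id (dxinv (arcf n b)) t"
    unfolding AE_all_countable AE_ball_countable[OF countable_rat] by (intro allI ballI loc arcf_antiderivative)
  ultimately show ?thesis
  proof eventually_elim
    case (elim t)
    show ?case
    proof (intro impI conjI)
      assume t: "0 \<le> t"
      let ?\<sigma> = "LBINT s:{0..t}. \<sigma> s"
      show s: "sint (m t) = sint m0 + ?\<sigma>" using elim(1) t by (simp add: sint_const)
      define D where "D y = pr (m t) y - pr m0 y - y * ?\<sigma>" for y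
      define I where "I y = (LBINT s:{0..t}. \<Phi> s y)" for y
      have lI: "loc_int I" unfolding I_def[abs_def] by (rule time_integral_loc_int[OF \<Phi> l per N bd])
      have Ip: "I (y + 1) = I y" for y by (simp add: I_def per)
      have pD: "prim D (\<lambda>y. m t y - m0 y - ?\<sigma>)" unfolding D_def[abs_def]
        by (intro prim_diff prim_pr m m0 prim_of_DERIV) (auto intro!: derivative_eq_intros)
      have Dp: "D (y + 1) = D y" for y
      proof -
        have "D (y + 1) - D y = D (0 + 1) - D 0" by (rule prim_period_increment[OF pD]) (simp add: m m0)
        also have "\<dots> = sint (\<lambda>y. m t y - m0 y - ?\<sigma>)" using sint_prim[OF pD] by simp
        also have "\<dots> = 0" using s by (simp add: sint_diff loc_int_diff m m0 loc_int_const sint_const)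
        finally show ?thesis by simp
      qed
      \<comment> \<open>The claim is that \<open>P\<close> is constant almost everywhere, the
        constant being \<open>c\<close>. The balance law shows that \<open>P\<close> pairs with
        every arc as its mean does.\<close>
      define P where "P y = D y - I y" for y
      have lD: "loc_int D" using loc_int_mult_continuous[OF prim_continuous[OF pD] loc_int_const[of 1]] by simp
      have lP: "loc_int P" unfolding P_def[abs_def] by (intro loc_int_diff lD lI)
      have "AE y in lborel. y \<in> {0..1} \<longrightarrow> P y = sint P"
      proof (rule AE_const_of_arcs[OF lP])
        fix n and b :: real assume b: "b \<in> \<rat>" "0 < b" "b < 1"
        let ?g = "dxinv (arcf n b)"
        note sg = arcf_antiderivative(1)[of n b] and gp = arcf_antiderivative(2)[of n b]
        note gc = smoothD(3)[OF sg, of UNIV] and g'c = smoothD(3)[OF smoothD(2)[OF sg], of UNIV]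
        obtain G where G: "\<And>x. \<bar>deriv ?g x\<bar> \<le> G" using periodic_bounded[OF g'c periodic_deriv[OF sg gp]] by blast
        have pg: "prim ?g (deriv ?g)" by (rule prim_of_DERIV[OF smoothD(1)[OF sg] g'c])
        have mg: "(\<lambda>s. sint (\<lambda>x. \<Phi> s x * deriv ?g x)) \<in> borel_measurable borel"
          by (rule borel_measurable_sint[OF joint_mult_measurable[OF \<Phi> g'c]])
        have ig: "set_integrable lborel {0..t} (\<lambda>s. sint (\<lambda>x. \<Phi> s x * deriv ?g x))"
          by (rule set_integrable_off_null[OF mg N sint_mult_bound[OF l g'c G bd]])
        have "?id ?g t" using elim(2) b t by blast
        also have "(LBINT s:{0..t}. \<sigma> s * sint ?g - sint (\<lambda>x. \<Phi> s x * deriv ?g x))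
            = ?\<sigma> * sint ?g - (LBINT s:{0..t}. sint (\<lambda>x. \<Phi> s x * deriv ?g x))"
          using set_integral_diff(2)[OF set_integrable_mult_left[of "sint ?g", OF \<sigma>[of t]] ig] by simp
        also have "(LBINT s:{0..t}. sint (\<lambda>x. \<Phi> s x * deriv ?g x)) = sint (\<lambda>x. I x * deriv ?g x)"
          unfolding I_def by (rule time_integral_swap[OF \<Phi> l per N bd g'c G])
        finally have id: "sint (\<lambda>x. m t x * ?g x) = sint (\<lambda>x. m0 x * ?g x) + (?\<sigma> * sint ?g - sint (\<lambda>x. I x * deriv ?g x))" .
        have lg: "loc_int ?g" using loc_int_mult_continuous[OF gc loc_int_const[of 1]] by simp
        have "sint (\<lambda>x. D x * deriv ?g x) = - sint (\<lambda>x. (m t x - m0 x - ?\<sigma>) * ?g x)"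
          by (rule sint_by_parts[OF pD Dp pg gp])
        also have "sint (\<lambda>x. (m t x - m0 x - ?\<sigma>) * ?g x) = sint (\<lambda>x. m t x * ?g x) - sint (\<lambda>x. m0 x * ?g x) - ?\<sigma> * sint ?g"
          unfolding left_diff_distrib
          by (simp add: sint_diff sint_cmult loc_int_diff loc_int_cmult loc_int_mult_right[OF m(1) gc] loc_int_mult_right[OF m0(1) gc] lg)
        finally have "sint (\<lambda>x. P x * deriv ?g x) = 0" unfolding P_def left_diff_distrib
          using id by (simp add: sint_diff loc_int_mult_right[OF lD g'c] loc_int_mult_right[OF lI g'c])
        moreover have ac: "continuous_on UNIV (arcf n b)" by (rule smoothD(3)[OF arcf_smooth])
        have "sint (\<lambda>x. P x * deriv ?g x) = sint (\<lambda>x. P x * arcf n b x) - sint (arcf n b) * sint P"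
        proof -
          have "P x * deriv ?g x = P x * arcf n b x - sint (arcf n b) * P x" for x
            unfolding arcf_antiderivative(3) by (simp add: algebra_simps)
          then show ?thesis by (simp only: sint_diff[OF loc_int_mult_right[OF lP ac] loc_int_cmult[OF lP]] sint_cmult)
        qed
        ultimately show "sint (\<lambda>x. P x * arcf n b x) = sint P * sint (arcf n b)" by (simp add: mult.commute)
      qed
      then have "AE y in lborel. P y = sint P" by (rule AE_periodic) (simp add: P_def Dp Ip)
      then have "AE y in lborel. pr (m t) y = pr m0 y + y * ?\<sigma> + (LBINT s:{0..t}. \<Phi> s y) + sint P"
        by eventually_elim (simp add: P_def D_def I_def)
      then show "\<exists>c. AE y in lborel. pr (m t) y = pr m0 y + y * ?\<sigma> + (LBINT s:{0..t}. \<Phi> s y) + c" by blast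
    qed
  qed
qed

text \<open>The Caratheodory criterion with the roles of the variables exchanged: the primitive is
  continuous in x and measurable in t.\<close>

lemma dxinv_measurable:
  fixes W :: "real \<Rightarrow> real \<Rightarrow> real"
  assumes W: "joint_measurable W" and l: "\<And>t. loc_int (W t)"
  shows "(\<lambda>p. dxinv (W (fst p)) (snd p)) \<in> borel_measurable borel"
proof -
  have "(\<lambda>p. (\<lambda>x t. dxinv (W t) x) (fst p) (snd p)) \<in> borel_measurable borel"
  proof (rule borel_measurable_Caratheodory)
    show "isCont (\<lambda>x. dxinv (W t) x) x" for x t
      using prim_continuous[OF prim_dxinv[OF l], of UNIV t] by (simp add: continuous_on_eq_continuous_at)
    fix x
    note [measurable] = measurable_compose[OF borel_fst_snd(1) borel_measurable_sint[OF W]] W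
    have "(\<lambda>p. W (fst p) (snd p) - sint (W (fst p))) \<in> borel_measurable borel" by measurable
    from borel_measurable_time_integral[OF swap_measurable_borel[OF this]]
    have m: "(\<lambda>t. LBINT y:{a..b}. W t y - sint (W t)) \<in> borel_measurable borel" for a b by simp
    show "(\<lambda>t. dxinv (W t) x) \<in> borel_measurable borel"
    proof (cases "0 \<le> x")
      case True
      then have "dxinv (W t) x = (LBINT y:{0..x}. W t y - sint (W t))" for t
        using prim_integral[OF prim_dxinv[OF l] True] by (simp add: dxinv_0)
      then show ?thesis using m by simp
    next
      case False
      then have "dxinv (W t) x = - (LBINT y:{x..0}. W t y - sint (W t))" for t
        using prim_integral[OF prim_dxinv[OF l], of x 0] by (simp add: dxinv_0)
      then show ?thesis using m by simp
    qed
  qed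
  from swap_measurable_borel[OF this] show ?thesis by simp
qed

section \<open>A representative of a weak solution that obeys the integrated laws at every retained
  time\<close>

section \<open>Regular representatives of weak solutions\<close>

lemma stint_cong: "(\<And>t. 0 \<le> t \<Longrightarrow> F t = F' t) \<Longrightarrow> stint F = stint F'"
  unfolding stint_def by (intro set_lebesgue_integral_cong) auto

text \<open>H^1 regularity is prescribed for t \<ge> 0 only. Freezing the solution at negative times
  makes it available at all times, and the weak identities see nonnegative times alone.\<close>

lemma cons_weak_sol_max:
  assumes "cons_weak_sol u0 u0' u ux"
  shows "cons_weak_sol u0 u0' (\<lambda>t. u (max 0 t)) (\<lambda>t. ux (max 0 t))"
proof -
  have m: "(\<lambda>p. F (max 0 (fst p)) (snd p)) \<in> borel_measurable borel"
    if [measurable]: "joint_measurable F" for F :: "real \<Rightarrow> real \<Rightarrow> real"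
  proof -
    note [measurable] = borel_fst_snd
    have "(\<lambda>p :: real \<times> real. (max 0 (fst p), snd p)) \<in> borel_measurable borel"
      by (intro borel_measurable_Pair) measurable
    from measurable_compose[OF this that] show ?thesis by simp
  qed
  have e: "AE t in lborel. 0 \<le> t \<longrightarrow> P (max 0 t)" if "AE t in lborel. 0 \<le> t \<longrightarrow> P t" for P :: "real \<Rightarrow> bool"
    using that by eventually_elim (simp add: max_def)
  have st: "stint (\<lambda>t. G (max 0 t) t) = stint (\<lambda>t. G t t)" for G :: "real \<Rightarrow> real \<Rightarrow> real \<Rightarrow> real"
    by (rule stint_cong) simp
  have ft: "fterm c (\<lambda>t. u (max 0 t)) (\<lambda>t. ux (max 0 t)) t = fterm c u ux (max 0 t)" for c t
    by (simp add: fterm_def)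
  show ?thesis using assms unfolding cons_weak_sol_def ft
    apply (elim conjE; intro conjI)
    subgoal premises p by (rule m[OF p(1)])
    subgoal premises p by (rule m[OF p(2)])
    subgoal premises p using p(3) by simp
    subgoal premises p
    proof -
      from p(4) obtain M where "AE t in lborel. 0 \<le> t \<longrightarrow> sint (\<lambda>x. (u t x)\<^sup>2 + (ux t x)\<^sup>2) \<le> M" by blast
      from e[OF this] show ?thesis by blast
    qed
    subgoal premises p
      using p(5)
      apply (intro allI impI)
      subgoal premises q for \<psi> using q(1)[rule_format, OF q(2)] st[of "\<lambda>s t x. u s x * pd_t (pd_x \<psi>) t x + (u s x)\<^sup>2 * ux s x * pd_x \<psi> t x"]
        st[of "\<lambda>s t x. (u s x - u s x * (ux s x)\<^sup>2 - sint (\<lambda>y. u s y - u s y * (ux s y)\<^sup>2)) * \<psi> t x"]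
        by (simp only:)
      done
    subgoal premises p
      using p(6)
      apply (intro allI impI)
      subgoal premises q for \<psi> using q(1)[rule_format, OF q(2)] st[of "\<lambda>s t x. u s x * pd_t \<psi> t x - 1/3 * (u s x)^3 * pd_x \<psi> t x"]
        st[of "\<lambda>s t x. (dxinv (\<lambda>z. u s z - u s z * (ux s z)\<^sup>2) x - fterm (sint (\<lambda>x. (u0' x)\<^sup>2)) u ux s) * \<psi> t x"]
        by (simp only:)
      done
    subgoal premises p
      using p(7)
      apply (intro allI impI)
      subgoal premises q for t using q(1)[rule_format, OF q(2)] unfolding max_absorb2[OF q(2)] max.idem .
      done
    subgoal premises p
      using p(8)
      apply (intro allI impI)
      subgoal premises q for \<psi> using q(1)[rule_format, OF q(2)] st[of "\<lambda>s t z. (ux s z)\<^sup>2 * pd_t \<psi> t z - (u s z)\<^sup>2 * (ux s z)\<^sup>2 * pd_x \<psi> t z"]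
        st[of "\<lambda>s t z. (2 * u s z * ux s z - 2 * ux s z * sint (\<lambda>y. u s y - u s y * (ux s y)\<^sup>2)) * \<psi> t z"]
        by (simp only:)
      done
    done
qed

lemma null_set_of_AE:
  assumes "AE t in lborel. P (t :: real)" obtains N where "N \<in> null_sets lborel" "\<And>t. t \<notin> N \<Longrightarrow> P t"
proof -
  from assms obtain N where "N \<in> null_sets lborel" "{t \<in> space lborel. \<not> P t} \<subseteq> N"
    unfolding eventually_ae_filter by blast
  then show thesis by (intro that[of N]) auto
qed

lemma set_integral_AE_cong:
  assumes "AE s in lborel. s \<in> A \<longrightarrow> f s = g s" "set_borel_measurable lborel A f" "set_borel_measurable lborel A g"
  shows "(LBINT s:A. f s) = (LBINT s:A. g s :: real)"
  unfolding set_lebesgue_integral_def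
proof (rule integral_cong_AE)
  show "AE s in lborel. indicat_real A s *\<^sub>R f s = indicat_real A s *\<^sub>R g s"
    using assms(1) by eventually_elim (auto simp: indicator_def)
qed (use assms(2,3) in \<open>simp_all add: set_borel_measurable_def\<close>)

lemma prim_bound:
  assumes F: "prim F f" and K: "\<And>x. f (x + 1) = f x" "sint (\<lambda>x. \<bar>f x\<bar>) \<le> K" and xy: "x \<le> y" "y \<le> x + 1"
  shows "\<bar>F y - F x\<bar> \<le> K"
proof -
  note l = prim_loc_int[OF F]
  have "\<bar>F y - F x\<bar> = \<bar>LBINT z:{x..y}. f z\<bar>" using prim_integral[OF F xy(1)] by simp
  also have "\<dots> \<le> (LBINT z:{x..y}. \<bar>f z\<bar>)"
    using set_integral_norm_bound[OF loc_int_integrable[OF l], of x y] by simp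
  also have "\<dots> \<le> (LBINT z:{x..x+1}. \<bar>f z\<bar>)"
    unfolding set_lebesgue_integral_def
    using loc_int_integrable[OF loc_int_abs[OF l]] xy
    by (intro integral_mono) (auto simp: set_integrable_def indicator_def)
  also have "\<dots> = sint (\<lambda>z. \<bar>f z\<bar>)" by (rule sint_period) (simp_all add: loc_int_abs[OF l] K)
  finally show ?thesis using K by simp
qed

lemma loc_int_continuous: "continuous_on UNIV f \<Longrightarrow> loc_int f"
  using loc_int_mult_continuous[OF _ loc_int_const[of 1], of f] by simp

lemma H1_per_continuous: "H1_per f g \<Longrightarrow> continuous_on A f"
  by (rule prim_continuous[OF H1_per_prim])

text \<open>The value at a point exceeds the values over the following period by at most the L^1
  norm of the derivative; averaging over the period gives the bound.\<close>

lemma sup_bound_of_L1: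
  assumes F: "prim F f" and per: "\<And>x. F (x + 1) = F x" "\<And>x. f (x + 1) = f x"
    and A: "sint (\<lambda>x. \<bar>f x\<bar>) \<le> A" and B: "sint (\<lambda>x. \<bar>F x\<bar>) \<le> B"
  shows "\<bar>F x\<bar> \<le> B + A"
proof -
  have l: "loc_int (\<lambda>y. \<bar>F y\<bar>)" by (intro loc_int_continuous continuous_intros prim_continuous[OF F])
  have "\<bar>F x\<bar> = (LBINT y:{x..x+1}. \<bar>F x\<bar>)" by (simp add: set_lebesgue_integral_def)
  also have "\<dots> \<le> (LBINT y:{x..x+1}. \<bar>F y\<bar> + A)"
  proof (rule set_integral_mono)
    fix y assume "y \<in> {x..x+1}"
    then have "\<bar>F y - F x\<bar> \<le> A" by (intro prim_bound[OF F per(2) A]) auto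
    then show "\<bar>F x\<bar> \<le> \<bar>F y\<bar> + A" by linarith
  qed (auto intro!: loc_int_integrable loc_int_add loc_int_const l)
  also have "\<dots> = sint (\<lambda>y. \<bar>F y\<bar> + A)"
    by (rule sint_period) (auto intro!: loc_int_add loc_int_const l simp: per)
  also have "\<dots> = sint (\<lambda>y. \<bar>F y\<bar>) + A" by (simp add: sint_add sint_const loc_int_const l)
  finally show ?thesis using B by linarith
qed

lemma H1_sup_bound:
  assumes H: "H1_per f g" and M: "sint (\<lambda>x. (f x)\<^sup>2 + (g x)\<^sup>2) \<le> M"
  shows "\<bar>f x\<bar> \<le> 1 + M" "sint (\<lambda>x. (g x)\<^sup>2) \<le> M"
proof -
  have fc: "continuous_on UNIV f" by (rule H1_per_continuous[OF H])
  have lf: "loc_int f" "loc_int (\<lambda>x. (f x)\<^sup>2)" by (intro loc_int_continuous continuous_intros fc)+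
  note lg = H1_per_loc_int[OF H]
  have M': "sint (\<lambda>x. (f x)\<^sup>2) + sint (\<lambda>x. (g x)\<^sup>2) \<le> M" using M sint_add[OF lf(2) lg(1)] by simp
  have nn: "0 \<le> sint (\<lambda>x. (f x)\<^sup>2)" "0 \<le> sint (\<lambda>x. (g x)\<^sup>2)"
    by (simp_all add: sint_def set_lebesgue_integral_def)
  show "sint (\<lambda>x. (g x)\<^sup>2) \<le> M" using M' nn by simp
  have am: "sint (\<lambda>x. \<bar>w x\<bar>) \<le> (1 + sint (\<lambda>x. (w x)\<^sup>2)) / 2" if w: "loc_int w" "loc_int (\<lambda>x. (w x)\<^sup>2)" for w
  proof -
    have "sint (\<lambda>x. \<bar>w x\<bar>) \<le> sint (\<lambda>x. 1 / 2 * (1 + (w x)\<^sup>2))"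
    proof (rule sint_mono)
      fix x
      have "2 * \<bar>w x\<bar> \<le> 1 + \<bar>w x\<bar>\<^sup>2" using sum_squares_bound[of 1 "\<bar>w x\<bar>"] by simp
      then show "\<bar>w x\<bar> \<le> 1 / 2 * (1 + (w x)\<^sup>2)" by simp
    qed (intro loc_int_abs loc_int_cmult loc_int_add loc_int_const w)+
    then show ?thesis unfolding sint_cmult by (simp add: sint_add loc_int_const w sint_const)
  qed
  have *: "\<bar>f x\<bar> \<le> sint (\<lambda>y. \<bar>f y\<bar>) + sint (\<lambda>x. \<bar>g x\<bar>)"
    by (rule sup_bound_of_L1[OF H1_per_prim[OF H] H1_per_periodic[OF H] order_refl order_refl])
  have "a \<le> 1 + M" if "a \<le> p + q" "p \<le> (1 + A) / 2" "q \<le> (1 + B) / 2" "A + B \<le> M" "0 \<le> A" "0 \<le> B" for a p q A B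
    using that by (simp add: field_simps)
  from this[OF * am[OF lf] am[OF lg(2) lg(1)] M' nn] show "\<bar>f x\<bar> \<le> 1 + M" .
qed

lemma sint_one_minus_sq:
  assumes "H1_per f g" shows "sint (\<lambda>y. \<bar>1 - (g y)\<^sup>2\<bar>) \<le> 1 + sint (\<lambda>y. (g y)\<^sup>2)"
proof -
  note lg = H1_per_loc_int(1)[OF assms]
  have "sint (\<lambda>y. \<bar>1 - (g y)\<^sup>2\<bar>) \<le> sint (\<lambda>y. 1 + (g y)\<^sup>2)"
  proof (rule sint_mono)
    show "\<bar>1 - (g y)\<^sup>2\<bar> \<le> 1 + (g y)\<^sup>2" for y using zero_le_power2[of "g y"] by linarith
  qed (intro loc_int_abs loc_int_diff loc_int_add loc_int_const lg)+
  then show ?thesis by (simp add: sint_add loc_int_const lg sint_const)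
qed

text \<open>Cauchy-Schwarz, by expanding the integral of (g - c)^2 with c the mean slope. The local
  energy is kept on the right, since its smallness on short intervals is needed in
  \<open>U_characteristic\<close>.\<close>

lemma H1_osc:
  assumes H: "H1_per f g" and k: "0 \<le> k"
  shows "(f (x + k) - f x)\<^sup>2 \<le> k * (LBINT z:{x..x+k}. (g z)\<^sup>2)"
proof (cases "k = 0")
  case False
  note lg = H1_per_loc_int[OF H]
  define D where "D = f (x + k) - f x"
  define c where "c = D / k"
  have D: "(LBINT z:{x..x+k}. g z) = D" unfolding D_def using k by (intro prim_integral[OF H1_per_prim[OF H]]) auto
  have "0 \<le> (LBINT z:{x..x+k}. (g z - c)\<^sup>2)" by (simp add: set_lebesgue_integral_def)
  also have "\<dots> = (LBINT z:{x..x+k}. (g z)\<^sup>2 - 2 * c * g z + c\<^sup>2)" by (simp add: power2_diff algebra_simps)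
  also have "\<dots> = (LBINT z:{x..x+k}. (g z)\<^sup>2) - 2 * c * D + c\<^sup>2 * k"
    using set_integral_add(2)[OF loc_int_integrable[OF loc_int_diff[OF lg(1) loc_int_cmult[OF lg(2), of "2 * c"]]] loc_int_integrable[OF loc_int_const[of "c\<^sup>2"]], of x "x + k"]
      set_integral_diff(2)[OF loc_int_integrable[OF lg(1)] loc_int_integrable[OF loc_int_cmult[OF lg(2), of "2 * c"]], of x "x + k"] D k
    by (simp add: set_lebesgue_integral_def)
  also have "2 * c * D = 2 * (D\<^sup>2 / k)" by (simp add: c_def power2_eq_square)
  also have "c\<^sup>2 * k = D\<^sup>2 / k" using False by (simp add: c_def power_divide power2_eq_square)
  finally have "D\<^sup>2 / k \<le> (LBINT z:{x..x+k}. (g z)\<^sup>2)" by simp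
  then show ?thesis using k False by (simp add: D_def pos_divide_le_eq mult.commute)
qed simp

lemma H1_Holder:
  assumes H: "H1_per f g" and k: "0 \<le> k" "k \<le> 1" and M: "sint (\<lambda>x. (g x)\<^sup>2) \<le> M"
  shows "\<bar>f (x + k) - f x\<bar> \<le> sqrt (k * M)"
proof (rule real_le_rsqrt)
  note l = H1_per_loc_int(1)[OF H]
  have P: "prim (pr (\<lambda>x. (g x)\<^sup>2)) (\<lambda>x. (g x)\<^sup>2)" by (rule prim_pr[OF l])
  have "(LBINT z:{x..x+k}. (g z)\<^sup>2) \<le> M"
    using prim_bound[OF P, of "M" x "x + k"] prim_integral[OF P, of x "x + k"] k M by (simp add: H1_per_periodic[OF H])
  with H1_osc[OF H k(1), of x] mult_left_mono[OF this k(1)] show "\<bar>f (x + k) - f x\<bar>\<^sup>2 \<le> k * M" by simp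
qed

definition "source c u ux t x = dxinv (\<lambda>z. u t z - u t z * (ux t z)\<^sup>2) x - fterm c u ux t"
  for u ux :: "real \<Rightarrow> real \<Rightarrow> real"

lemma loc_int_charge:
  assumes H: "H1_per f g" shows "loc_int (\<lambda>z. f z - f z * (g z)\<^sup>2)"
  by (intro loc_int_diff loc_int_mult_continuous[OF H1_per_continuous[OF H]] H1_per_loc_int(1)[OF H])
    (rule loc_int_continuous[OF H1_per_continuous[OF H]])

lemma
  assumes H: "H1_per (u t) (ux t)"
  shows prim_source: "prim (source c u ux t) (\<lambda>z. u t z - u t z * (ux t z)\<^sup>2 - sint (\<lambda>z. u t z - u t z * (ux t z)\<^sup>2))"
    and source_periodic: "source c u ux t (x + 1) = source c u ux t x"
proof -
  note l = loc_int_charge[OF H]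
  show "prim (source c u ux t) (\<lambda>z. u t z - u t z * (ux t z)\<^sup>2 - sint (\<lambda>z. u t z - u t z * (ux t z)\<^sup>2))"
    by (rule prim_cong[OF prim_diff[OF prim_dxinv[OF l] prim_const[of "fterm c u ux t"]]]) (simp_all add: source_def)
  show "source c u ux t (x + 1) = source c u ux t x"
    unfolding source_def by (subst dxinv_periodic[OF l]) (simp_all add: H1_per_periodic[OF H])
qed

lemma source_bound:
  assumes H: "H1_per (u t) (ux t)" and K: "\<And>x. \<bar>u t x\<bar> \<le> K" "sint (\<lambda>x. (ux t x)\<^sup>2) \<le> K"
  shows "\<bar>source c u ux t x\<bar> \<le> 2 * K * (1 + K) * (1 + \<bar>1 / (1 - c)\<bar> * (1 + K))"
proof -
  define w where "w z = u t z - u t z * (ux t z)\<^sup>2" for z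
  have l: "loc_int w" unfolding w_def[abs_def] by (rule loc_int_charge[OF H])
  note lg = H1_per_loc_int(1)[OF H]
  have wp: "w (z + 1) = w z" for z by (simp add: w_def H1_per_periodic[OF H])
  have K0: "0 \<le> K" using K(1)[of 0] abs_ge_zero[of "u t 0"] by linarith
  have "sint (\<lambda>z. \<bar>w z\<bar>) \<le> sint (\<lambda>z. K * (1 + (ux t z)\<^sup>2))"
  proof (rule sint_mono[OF loc_int_abs[OF l]])
    fix z
    have "\<bar>w z\<bar> \<le> \<bar>u t z\<bar> + \<bar>u t z * (ux t z)\<^sup>2\<bar>" unfolding w_def by linarith
    also have "\<dots> = \<bar>u t z\<bar> * (1 + (ux t z)\<^sup>2)" by (simp add: abs_mult algebra_simps)
    also have "\<dots> \<le> K * (1 + (ux t z)\<^sup>2)" using K(1) by (intro mult_right_mono) auto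
    finally show "\<bar>w z\<bar> \<le> K * (1 + (ux t z)\<^sup>2)" .
  qed (intro loc_int_cmult loc_int_add loc_int_const lg)
  also have "\<dots> \<le> K * (1 + K)"
    unfolding sint_cmult using K K0 by (simp add: sint_add loc_int_const lg sint_const mult_left_mono)
  finally have w1: "sint (\<lambda>z. \<bar>w z\<bar>) \<le> K * (1 + K)" .
  have sw: "\<bar>sint w\<bar> \<le> K * (1 + K)" using abs_sint_le[OF l] w1 by linarith
  have "sint (\<lambda>z. \<bar>w z - sint w\<bar>) \<le> sint (\<lambda>z. \<bar>w z\<bar> + \<bar>sint w\<bar>)"
    by (intro sint_mono loc_int_abs loc_int_diff loc_int_add loc_int_const l) linarith
  also have "\<dots> \<le> 2 * K * (1 + K)" using w1 sw by (simp add: sint_add loc_int_abs l loc_int_const sint_const)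
  finally have w2: "sint (\<lambda>z. \<bar>w z - sint w\<bar>) \<le> 2 * K * (1 + K)" .
  have D01: "\<bar>dxinv w x\<bar> \<le> 2 * K * (1 + K)" if "0 \<le> x" "x \<le> 1" for x
    using prim_bound[OF prim_dxinv[OF l] _ w2, of 0 x] that by (simp add: wp dxinv_0)
  have D: "\<bar>dxinv w x\<bar> \<le> 2 * K * (1 + K)" for x
  proof -
    obtain y where "0 \<le> y" "y < 1" "dxinv w x = dxinv w y"
      using periodic_floor[of "dxinv w" 1 x] dxinv_periodic[OF l wp] by (metis zero_less_one)
    then show ?thesis using D01[of y] by simp
  qed
  have dc: "continuous_on UNIV (dxinv w)" by (rule prim_continuous[OF prim_dxinv[OF l]])
  have lq: "loc_int (\<lambda>y. 1 - (ux t y)\<^sup>2)" by (intro loc_int_diff loc_int_const lg)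
  have "sint (\<lambda>y. \<bar>1 - (ux t y)\<^sup>2\<bar>) \<le> 1 + K" using sint_one_minus_sq[OF H] K by linarith
  then have "\<bar>sint (\<lambda>y. (1 - (ux t y)\<^sup>2) * dxinv w y)\<bar> \<le> 2 * K * (1 + K) * (1 + K)"
    by (intro sint_mult_bound lq dc D)
  then have "\<bar>fterm c u ux t\<bar> \<le> \<bar>1 / (1 - c)\<bar> * (2 * K * (1 + K) * (1 + K))"
    unfolding fterm_def w_def[symmetric] abs_mult by (rule mult_left_mono) simp
  moreover have "\<bar>source c u ux t x\<bar> \<le> \<bar>dxinv w x\<bar> + \<bar>fterm c u ux t\<bar>"
    unfolding source_def w_def[abs_def] by linarith
  ultimately have "\<bar>source c u ux t x\<bar> \<le> 2 * K * (1 + K) + \<bar>1 / (1 - c)\<bar> * (2 * K * (1 + K) * (1 + K))"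
    using D[of x] by linarith
  also have "2 * K * (1 + K) + d * (2 * K * (1 + K) * (1 + K)) = 2 * K * (1 + K) * (1 + d * (1 + K))" for d by (simp add: algebra_simps)
  finally show ?thesis .
qed

lemma source_measurable:
  assumes m: "joint_measurable u" "joint_measurable ux"
    and H: "\<And>t. H1_per (u t) (ux t)"
  shows "(\<lambda>p. source c u ux (fst p) (snd p)) \<in> borel_measurable borel"
proof -
  note [measurable] = m borel_fst_snd
  have w: "(\<lambda>p. u (fst p) (snd p) - u (fst p) (snd p) * (ux (fst p) (snd p))\<^sup>2) \<in> borel_measurable borel" by measurable
  note D [measurable] = dxinv_measurable[OF w loc_int_charge[OF H]]
  have "(\<lambda>p. (1 - (ux (fst p) (snd p))\<^sup>2) * dxinv (\<lambda>z. u (fst p) z - u (fst p) z * (ux (fst p) z)\<^sup>2) (snd p)) \<in> borel_measurable borel"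
    by measurable
  from borel_measurable_sint[OF this] have "fterm c u ux \<in> borel_measurable borel" unfolding fterm_def[abs_def] by measurable
  from measurable_compose[OF borel_fst_snd(1) this] show ?thesis unfolding source_def by measurable
qed

lemma time_integral_continuous:
  fixes \<Psi> :: "real \<Rightarrow> real \<Rightarrow> real"
  assumes \<Psi>: "joint_measurable \<Psi>" and N: "N \<in> null_sets lborel"
    and c: "\<And>s. 0 \<le> s \<Longrightarrow> s \<notin> N \<Longrightarrow> continuous_on UNIV (\<Psi> s)" and b: "\<And>s y. 0 \<le> s \<Longrightarrow> s \<notin> N \<Longrightarrow> \<bar>\<Psi> s y\<bar> \<le> K"
  shows "continuous_on UNIV (\<lambda>y. LBINT s:{0..t}. \<Psi> s y)"
proof -
  have sl: "(\<lambda>s. \<Psi> s y) \<in> borel_measurable borel" for y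
    using measurable_compose[of "\<lambda>s. (s, y)" borel borel, OF borel_measurable_Pair \<Psi>] by simp
  have "isCont (\<lambda>y. LBINT s:{0..t}. \<Psi> s y) y" for y
    unfolding continuous_at_sequentially
  proof (intro allI impI)
    fix x assume x: "x \<longlonglongrightarrow> y"
    show "((\<lambda>y. LBINT s:{0..t}. \<Psi> s y) \<circ> x) \<longlonglongrightarrow> (LBINT s:{0..t}. \<Psi> s y)"
      unfolding comp_def set_lebesgue_integral_def
    proof (rule integral_dominated_convergence[where w = "\<lambda>s. indicator {0..t} s *\<^sub>R \<bar>K\<bar>"])
      show "integrable lborel (\<lambda>s. indicat_real {0..t} s *\<^sub>R \<bar>K\<bar>)"
        using set_integrable_const_Icc[of 0 t "\<bar>K\<bar>"] by (simp add: set_integrable_def)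
      show "AE s in lborel. (\<lambda>i. indicat_real {0..t} s *\<^sub>R \<Psi> s (x i)) \<longlonglongrightarrow> indicat_real {0..t} s *\<^sub>R \<Psi> s y"
        using AE_not_in[OF N]
      proof eventually_elim
        case (elim s)
        show ?case
        proof (cases "s \<in> {0..t}")
          case True
          with elim c have "isCont (\<Psi> s) y" by (auto simp: continuous_on_eq_continuous_at)
          from isCont_tendsto_compose[OF this x] show ?thesis by (intro tendsto_intros)
        qed simp
      qed
      show "AE s in lborel. norm (indicat_real {0..t} s *\<^sub>R \<Psi> s (x i)) \<le> indicat_real {0..t} s *\<^sub>R \<bar>K\<bar>" for i
        using AE_not_in[OF N]
      proof eventually_elim
        case (elim s)
        show ?case using b[of s "x i"] elim by (cases "s \<in> {0..t}") auto
      qed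
    qed (use sl in measurable)
  qed
  then show ?thesis by (simp add: continuous_on_eq_continuous_at)
qed

lemma measurable_slice:
  fixes F :: "real \<Rightarrow> real \<Rightarrow> real"
  assumes "joint_measurable F" shows "(\<lambda>s. F s y) \<in> borel_measurable borel"
  using measurable_compose[of "\<lambda>s. (s, y)" borel borel, OF borel_measurable_Pair assms] by simp

lemma measurable_shift:
  fixes F :: "real \<Rightarrow> real \<Rightarrow> real"
  assumes "joint_measurable F"
  shows "(\<lambda>p. F (fst p) (snd p + k)) \<in> borel_measurable borel"
proof -
  note [measurable] = borel_fst_snd
  have "(\<lambda>p :: real \<times> real. (fst p, snd p + k)) \<in> borel_measurable borel" by (intro borel_measurable_Pair) measurable
  from measurable_compose[OF this assms] show ?thesis by simp
qed

text \<open>Identity (ii) is u_t = (u^3/3)_x + source; this is the resulting rate of change of the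
  integral of u over the window from y to y + k.\<close>

definition "flux c u ux k s y = (u s (y + k))^3 / 3 - (u s y)^3 / 3 + (LBINT x:{y..y+k}. source c u ux s x)"
  for u ux :: "real \<Rightarrow> real \<Rightarrow> real"

text \<open>With the charge q constant in time, the source 2 u u_x - 2 q u_x of (iv) is the
  x-derivative of u^2 - 2 q u. It is absorbed into the flux, and the energy balance becomes a pure
  divergence.\<close>

definition "mass_flux u ux s y = (u s y)\<^sup>2 * (ux s y)\<^sup>2 + (u s y)\<^sup>2 - 2 * sint (\<lambda>y. u s y - u s y * (ux s y)\<^sup>2) * u s y"
  for u ux :: "real \<Rightarrow> real \<Rightarrow> real"

lemma flux_measurable:
  assumes m: "joint_measurable u" "joint_measurable ux"
    and H: "\<And>t. H1_per (u t) (ux t)"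
  shows "(\<lambda>s. flux c u ux k s y) \<in> borel_measurable borel"
proof -
  note [measurable] = borel_measurable_time_integral[OF swap_measurable_borel[OF source_measurable[OF m H]]] measurable_slice[OF m(1)]
  show ?thesis unfolding flux_def by simp
qed

lemma mass_flux_measurable:
  assumes m: "joint_measurable u" "joint_measurable ux"
  shows "(\<lambda>p. mass_flux u ux (fst p) (snd p)) \<in> borel_measurable borel"
proof -
  note [measurable] = m borel_fst_snd
  have "(\<lambda>p. u (fst p) (snd p) - u (fst p) (snd p) * (ux (fst p) (snd p))\<^sup>2) \<in> borel_measurable borel" by measurable
  note [measurable] = measurable_compose[OF borel_fst_snd(1) borel_measurable_sint[OF this]]
  show ?thesis unfolding mass_flux_def by measurable
qed

text \<open>The exceptional times of the a.e. identities are removed by resetting the solution to \<open>u0\<close> there; \<open>G\<close> is the set of remaining times.\<close>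

locale regular_solution = pulse_datum u0 u0' for u0 u0' +
  fixes v vx :: "real \<Rightarrow> real \<Rightarrow> real" and G :: "real set" and K q :: real
  assumes v_measurable: "joint_measurable v"
    and vx_measurable: "joint_measurable vx"
    and v_H1: "H1_per (v t) (vx t)" and v_energy: "sint (\<lambda>x. (vx t x)\<^sup>2) = h" and v_bound: "\<bar>v t x\<bar> \<le> K"
    and G_pos: "t \<in> G \<Longrightarrow> 0 < t" and G_AE: "AE t in lborel. 0 \<le> t \<longrightarrow> t \<in> G"
    and v_off: "t \<notin> G \<Longrightarrow> v t = u0" and vx_off: "t \<notin> G \<Longrightarrow> vx t = u0'"
    and v_charge: "t \<in> G \<Longrightarrow> sint (\<lambda>y. v t y - v t y * (vx t y)\<^sup>2) = q"
    and window: "t \<in> G \<Longrightarrow> 0 \<le> k \<Longrightarrow> (LBINT x:{y..y+k}. v t x) = (LBINT x:{y..y+k}. u0 x) + (LBINT s:{0..t}. flux h v vx k s y)"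
    and mass: "t \<in> G \<Longrightarrow> \<exists>c. AE y in lborel. pr (\<lambda>x. (vx t x)\<^sup>2) y = pr (\<lambda>x. (u0' x)\<^sup>2) y + (LBINT s:{0..t}. mass_flux v vx s y) + c"

locale weak_solution = pulse_datum u0 u0' for u0 u0' +
  fixes u ux :: "real \<Rightarrow> real \<Rightarrow> real"
  assumes sol: "cons_weak_sol u0 u0' u ux" and u_H1: "H1_per (u t) (ux t)"
begin

abbreviation "charge t \<equiv> sint (\<lambda>y. u t y - u t y * (ux t y)\<^sup>2)"
abbreviation "src \<equiv> source h u ux"

lemma u_measurable: "joint_measurable u" "joint_measurable ux"
  using sol unfolding cons_weak_sol_def by blast+

lemma u_weak:
  assumes "test_fn \<psi>"
  shows "stint (\<lambda>t x. u t x * pd_t \<psi> t x - 1/3 * (u t x)^3 * pd_x \<psi> t x) = - stint (\<lambda>t x. src t x * \<psi> t x) - sint (\<lambda>x. u0 x * \<psi> 0 x)"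
    and "stint (\<lambda>t z. (ux t z)\<^sup>2 * pd_t \<psi> t z - (u t z)\<^sup>2 * (ux t z)\<^sup>2 * pd_x \<psi> t z) =
        - stint (\<lambda>t z. (2 * u t z * ux t z - 2 * ux t z * charge t) * \<psi> t z) - sint (\<lambda>z. (u0' z)\<^sup>2 * \<psi> 0 z)"
  using sol assms unfolding cons_weak_sol_def source_def by blast+

lemma u_const: assumes "0 \<le> t" shows "charge t = charge 0"
  using sol assms unfolding cons_weak_sol_def by blast

lemma u_bounds:
  obtains N K where "N \<in> null_sets lborel" "1 \<le> K" "\<And>t x. 0 \<le> t \<Longrightarrow> t \<notin> N \<Longrightarrow> \<bar>u t x\<bar> \<le> K"
    "\<And>t. 0 \<le> t \<Longrightarrow> t \<notin> N \<Longrightarrow> sint (\<lambda>x. (ux t x)\<^sup>2) \<le> K"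
proof -
  have "\<exists>M. AE t in lborel. 0 \<le> t \<longrightarrow> sint (\<lambda>x. (u t x)\<^sup>2 + (ux t x)\<^sup>2) \<le> M"
    using sol unfolding cons_weak_sol_def by blast
  then obtain M where "AE t in lborel. 0 \<le> t \<longrightarrow> sint (\<lambda>x. (u t x)\<^sup>2 + (ux t x)\<^sup>2) \<le> M" by blast
  from null_set_of_AE[OF this] obtain N where N: "N \<in> null_sets lborel"
    "\<And>t. t \<notin> N \<Longrightarrow> 0 \<le> t \<longrightarrow> sint (\<lambda>x. (u t x)\<^sup>2 + (ux t x)\<^sup>2) \<le> M" by blast
  show thesis
  proof (rule that[of N "1 + \<bar>M\<bar>"])
    fix t :: real and x assume "0 \<le> t" "t \<notin> N"
    then have "sint (\<lambda>x. (u t x)\<^sup>2 + (ux t x)\<^sup>2) \<le> M" using N by blast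
    note b = H1_sup_bound[OF u_H1 this]
    show "\<bar>u t x\<bar> \<le> 1 + \<bar>M\<bar>" by (rule order_trans[OF b(1)]) simp
    show "sint (\<lambda>x. (ux t x)\<^sup>2) \<le> 1 + \<bar>M\<bar>" by (rule order_trans[OF b(2)]) simp
  qed (use N in auto)
qed

lemma u_loc_int:
  shows "loc_int (\<lambda>x. (u t x)^n)" "loc_int (\<lambda>x. (ux t x)\<^sup>2)" "loc_int (ux t)"
    "loc_int (\<lambda>x. (u t x)^n * (ux t x)\<^sup>2)" "loc_int (\<lambda>x. (u t x)^n * ux t x)" "loc_int (src t)" "continuous_on A (\<lambda>x. (u t x)^n)"
proof -
  have c: "continuous_on B (\<lambda>x. (u t x)^n)" for n B by (intro continuous_intros H1_per_continuous[OF u_H1])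
  show "continuous_on A (\<lambda>x. (u t x)^n)" by (rule c)
  show "loc_int (\<lambda>x. (u t x)^n)" by (rule loc_int_continuous[OF c])
  note l = H1_per_loc_int[OF u_H1, of t]
  show "loc_int (\<lambda>x. (ux t x)\<^sup>2)" "loc_int (ux t)" by (rule l)+
  show "loc_int (\<lambda>x. (u t x)^n * (ux t x)\<^sup>2)" "loc_int (\<lambda>x. (u t x)^n * ux t x)"
    by (rule loc_int_mult_continuous[OF c], rule l)+
  show "loc_int (src t)" by (rule loc_int_continuous[OF prim_continuous[OF prim_source[OF u_H1]]])
qed

text \<open>Localise (iv), move the source into the flux by parts, and apply
  \<open>potential\<close> with \<sigma> = 0. The constant test function yields the energy h of the
  datum for almost every t; condition (iii) by itself compares only with the value of
  \<open>ux\<close> at time 0.\<close>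

lemma mass_identity:
  "AE t in lborel. 0 \<le> t \<longrightarrow> sint (\<lambda>x. (ux t x)\<^sup>2) = h \<and>
     (\<exists>c. AE y in lborel. pr (\<lambda>x. (ux t x)\<^sup>2) y = pr (\<lambda>x. (u0' x)\<^sup>2) y + (LBINT s:{0..t}. mass_flux u ux s y) + c)"
proof -
  obtain N K where N: "N \<in> null_sets lborel" and K: "1 \<le> K" "\<And>t x. 0 \<le> t \<Longrightarrow> t \<notin> N \<Longrightarrow> \<bar>u t x\<bar> \<le> K"
    "\<And>t. 0 \<le> t \<Longrightarrow> t \<notin> N \<Longrightarrow> sint (\<lambda>x. (ux t x)\<^sup>2) \<le> K" by (rule u_bounds) blast
  define B where "B = K\<^sup>2 * K + K\<^sup>2 + 2 * \<bar>charge 0\<bar> * K + (K + \<bar>charge 0\<bar>) * (1 + K) + K"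
  have B: "K \<le> B" "K\<^sup>2 * K \<le> B" "(K + \<bar>charge 0\<bar>) * (1 + K) \<le> B" "K\<^sup>2 * K + K\<^sup>2 + 2 * \<bar>charge 0\<bar> * K \<le> B"
    using K(1) unfolding B_def by (simp_all add: add_nonneg_nonneg)
  note [measurable] = u_measurable borel_fst_snd
  have "(\<lambda>p. u (fst p) (snd p) - u (fst p) (snd p) * (ux (fst p) (snd p))\<^sup>2) \<in> borel_measurable borel" by measurable
  note qm [measurable] = measurable_compose[OF borel_fst_snd(1) borel_measurable_sint[OF this]]
  have m: "(\<lambda>p. (ux (fst p) (snd p))\<^sup>2) \<in> borel_measurable borel"
    "(\<lambda>p. (u (fst p) (snd p))\<^sup>2 * (ux (fst p) (snd p))\<^sup>2) \<in> borel_measurable borel"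
    "(\<lambda>p. 2 * u (fst p) (snd p) * ux (fst p) (snd p) - 2 * ux (fst p) (snd p) * charge (fst p)) \<in> borel_measurable borel"
    by measurable
  have lS: "loc_int (\<lambda>z. 2 * u t z * ux t z - 2 * ux t z * charge t)" for t
    using loc_int_diff[OF loc_int_cmult[OF u_loc_int(5)[of t 1], of 2] loc_int_cmult[OF u_loc_int(3), of "2 * charge t"]] by (simp add: mult_ac)
  have lF: "loc_int (mass_flux u ux t)" for t
    unfolding mass_flux_def using u_loc_int(1)[of t 1] by (intro loc_int_diff loc_int_add loc_int_cmult u_loc_int) simp
  have u2: "(u t x)\<^sup>2 \<le> K\<^sup>2" if "0 \<le> t" "t \<notin> N" for t x
    using power_mono[OF K(2)[OF that, of x] abs_ge_zero, of 2] by simp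
  have bF: "sint (\<lambda>x. \<bar>(u t x)\<^sup>2 * (ux t x)\<^sup>2\<bar>) \<le> K\<^sup>2 * K" if t: "0 \<le> t" "t \<notin> N" for t
  proof -
    have "sint (\<lambda>x. \<bar>(u t x)\<^sup>2 * (ux t x)\<^sup>2\<bar>) \<le> sint (\<lambda>x. K\<^sup>2 * (ux t x)\<^sup>2)"
      by (intro sint_mono loc_int_abs loc_int_cmult u_loc_int) (simp add: abs_mult mult_right_mono u2[OF t])
    also have "\<dots> \<le> K\<^sup>2 * K" unfolding sint_cmult using K(3)[OF t] by (simp add: mult_left_mono)
    finally show ?thesis .
  qed
  have "AE t in lborel. 0 \<le> t \<longrightarrow> sint (\<lambda>x. (ux t x)\<^sup>2) = h + (LBINT s:{0..t}. 0) \<and> (\<exists>c. AE y in lborel. pr (\<lambda>x. (ux t x)\<^sup>2) y =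
      pr (\<lambda>x. (u0' x)\<^sup>2) y + y * (LBINT s:{0..t}. 0) + (LBINT s:{0..t}. mass_flux u ux s y) + c)"
  proof (rule potential[OF u_loc_int(2) _ H1_per_loc_int(1)[OF ini.H1] _ mass_flux_measurable[OF u_measurable] lF _ N, where K = B])
    fix t :: real and x
    show "(ux t (x + 1))\<^sup>2 = (ux t x)\<^sup>2" "(u0' (x + 1))\<^sup>2 = (u0' x)\<^sup>2" "mass_flux u ux t (x + 1) = mass_flux u ux t x"
      by (simp_all add: H1_per_periodic[OF u_H1] ini.g_periodic mass_flux_def)
    show "set_integrable lborel {0..t} (\<lambda>s. 0 :: real)" by simp
  next
    fix t :: real assume t: "0 \<le> t" "t \<notin> N"
    have "sint (\<lambda>x. \<bar>mass_flux u ux t x\<bar>) \<le> sint (\<lambda>x. \<bar>(u t x)\<^sup>2 * (ux t x)\<^sup>2\<bar> + (K\<^sup>2 + 2 * \<bar>charge 0\<bar> * K))"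
    proof (rule sint_mono[OF loc_int_abs[OF lF] loc_int_add[OF loc_int_abs[OF u_loc_int(4)] loc_int_const]])
      fix x
      have "\<bar>2 * charge t * u t x\<bar> = 2 * \<bar>charge 0\<bar> * \<bar>u t x\<bar>" by (simp only: u_const[OF t(1)] abs_mult abs_numeral)
      also have "\<dots> \<le> 2 * \<bar>charge 0\<bar> * K" by (rule mult_left_mono[OF K(2)[OF t]]) simp
      finally show "\<bar>mass_flux u ux t x\<bar> \<le> \<bar>(u t x)\<^sup>2 * (ux t x)\<^sup>2\<bar> + (K\<^sup>2 + 2 * \<bar>charge 0\<bar> * K)"
        unfolding mass_flux_def using u2[OF t, of x] zero_le_power2[of "u t x"] by linarith
    qed
    also have "\<dots> \<le> B" using bF[OF t] B(4) by (simp add: sint_add loc_int_abs loc_int_const u_loc_int sint_const)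
    finally show "sint (\<lambda>x. \<bar>mass_flux u ux t x\<bar>) \<le> B" .
  next
    fix g assume g: "smooth g" "\<And>x. g (x + 1) = g x"
    have "AE t in lborel. 0 \<le> t \<longrightarrow> sint (\<lambda>x. (ux t x)\<^sup>2 * g x) = sint (\<lambda>x. (u0' x)\<^sup>2 * g x)
      + (LBINT s:{0..t}. sint (\<lambda>x. (2 * u s x * ux s x - 2 * ux s x * charge s) * g x) - sint (\<lambda>x. (u s x)\<^sup>2 * (ux s x)\<^sup>2 * deriv g x))"
    proof (rule localize[where K = B, OF _ _ _ u_loc_int(2) u_loc_int(4) lS N _ _ _ u_weak(2) g])
      fix t :: real assume t: "0 \<le> t" "t \<notin> N"
      show "sint (\<lambda>x. \<bar>(ux t x)\<^sup>2\<bar>) \<le> B" "sint (\<lambda>x. \<bar>(u t x)\<^sup>2 * (ux t x)\<^sup>2\<bar>) \<le> B" using K(3)[OF t] bF[OF t] B by simp_all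
      have "sint (\<lambda>z. \<bar>2 * u t z * ux t z - 2 * ux t z * charge t\<bar>) \<le> sint (\<lambda>z. (K + \<bar>charge 0\<bar>) * (1 + (ux t z)\<^sup>2))"
      proof (rule sint_mono[OF loc_int_abs[OF lS]])
        fix z
        have "\<bar>2 * u t z * ux t z - 2 * ux t z * charge t\<bar> = \<bar>u t z - charge 0\<bar> * (2 * \<bar>ux t z\<bar>)"
        proof -
          have "2 * u t z * ux t z - 2 * ux t z * charge t = (u t z - charge 0) * (2 * ux t z)"
            unfolding u_const[OF t(1)] by (simp add: algebra_simps)
          then show ?thesis by (simp only: abs_mult abs_numeral)
        qed
        also have "\<dots> \<le> (K + \<bar>charge 0\<bar>) * (1 + (ux t z)\<^sup>2)"
        proof (rule mult_mono)
          show "2 * \<bar>ux t z\<bar> \<le> 1 + (ux t z)\<^sup>2" using sum_squares_bound[of 1 "\<bar>ux t z\<bar>"] by simp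
          show "\<bar>u t z - charge 0\<bar> \<le> K + \<bar>charge 0\<bar>" using K(2)[OF t, of z] by linarith
        qed (use K(1) in auto)
        finally show "\<bar>2 * u t z * ux t z - 2 * ux t z * charge t\<bar> \<le> (K + \<bar>charge 0\<bar>) * (1 + (ux t z)\<^sup>2)" .
      qed (intro loc_int_cmult loc_int_add loc_int_const u_loc_int)
      also have "\<dots> \<le> (K + \<bar>charge 0\<bar>) * (1 + K)"
        unfolding sint_cmult using K(3)[OF t] K(1) by (simp add: sint_add loc_int_const u_loc_int sint_const mult_left_mono)
      finally show "sint (\<lambda>z. \<bar>2 * u t z * ux t z - 2 * ux t z * charge t\<bar>) \<le> B" using B(3) by linarith
    qed (rule m | assumption)+
    then show "AE t in lborel. 0 \<le> t \<longrightarrow> sint (\<lambda>x. (ux t x)\<^sup>2 * g x) = sint (\<lambda>x. (u0' x)\<^sup>2 * g x)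
      + (LBINT s:{0..t}. 0 * sint g - sint (\<lambda>x. mass_flux u ux s x * deriv g x))"
    proof eventually_elim
      case (elim t)
      note pg = prim_of_DERIV[OF smoothD(1)[OF g(1)] smoothD(3)[OF smoothD(2)[OF g(1)]]]
      note g'c = smoothD(3)[OF smoothD(2)[OF g(1)], of UNIV]
      have "sint (\<lambda>x. (2 * u s x * ux s x - 2 * ux s x * charge s) * g x) - sint (\<lambda>x. (u s x)\<^sup>2 * (ux s x)\<^sup>2 * deriv g x)
        = 0 * sint g - sint (\<lambda>x. mass_flux u ux s x * deriv g x)" for s
      proof -
        note pu = H1_per_prim[OF u_H1, of s]
        define E where "E x = (u s x)\<^sup>2 - 2 * charge s * u s x" for x
        have pE: "prim E (\<lambda>x. 2 * u s x * ux s x - 2 * ux s x * charge s)"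
          by (rule prim_cong[OF prim_diff[OF prim_mult[OF pu pu] prim_cmult[OF pu, of "2 * charge s"]]]) (simp_all add: E_def power2_eq_square)
        have "sint (\<lambda>x. E x * deriv g x) = - sint (\<lambda>x. (2 * u s x * ux s x - 2 * ux s x * charge s) * g x)"
          by (rule sint_by_parts[OF pE _ pg g(2)]) (simp add: E_def H1_per_periodic[OF u_H1])
        moreover have "sint (\<lambda>x. mass_flux u ux s x * deriv g x) = sint (\<lambda>x. (u s x)\<^sup>2 * (ux s x)\<^sup>2 * deriv g x + E x * deriv g x)"
          by (rule arg_cong[of _ _ sint]) (simp add: fun_eq_iff mass_flux_def E_def algebra_simps)
        moreover have "\<dots> = sint (\<lambda>x. (u s x)\<^sup>2 * (ux s x)\<^sup>2 * deriv g x) + sint (\<lambda>x. E x * deriv g x)"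
          by (intro sint_add loc_int_mult_right u_loc_int g'c loc_int_continuous prim_continuous[OF pE])
        ultimately show ?thesis by linarith
      qed
      with elim show ?case by simp
    qed
  qed
  then show ?thesis by eventually_elim simp
qed

text \<open>The source is split into its mean \<sigma> and the derivative of a periodic D, which
  joins u^3/3 in the flux \<Psi>. Both sides of the potential identity are continuous in y, so it
  holds for every y, and the difference between y + k and y eliminates the unknown constant.\<close>

lemma velocity_identity:
  "AE t in lborel. 0 \<le> t \<longrightarrow> (\<forall>y k. 0 \<le> k \<longrightarrow>
     (LBINT x:{y..y+k}. u t x) = (LBINT x:{y..y+k}. u0 x) + (LBINT s:{0..t}. flux h u ux k s y))"
proof -
  obtain N K where N: "N \<in> null_sets lborel" and K: "1 \<le> K" "\<And>t x. 0 \<le> t \<Longrightarrow> t \<notin> N \<Longrightarrow> \<bar>u t x\<bar> \<le> K"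
    "\<And>t. 0 \<le> t \<Longrightarrow> t \<notin> N \<Longrightarrow> sint (\<lambda>x. (ux t x)\<^sup>2) \<le> K" by (rule u_bounds) blast
  define C where "C = 2 * K * (1 + K) * (1 + \<bar>1 / (1 - h)\<bar> * (1 + K))"
  have C: "\<bar>src t x\<bar> \<le> C" if "0 \<le> t" "t \<notin> N" for t x
    unfolding C_def by (rule source_bound[of u t ux K, OF u_H1 K(2)[OF that] K(3)[OF that]])
  have C0: "0 \<le> C" using K(1) unfolding C_def by simp
  define B where "B = K ^ 3 + 2 * C + K"
  have K3: "0 \<le> K ^ 3" using K(1) by simp
  define \<sigma> where "\<sigma> s = sint (src s)" for s
  define D where "D s = dxinv (src s)" for s
  define \<Psi> where "\<Psi> s y = 1/3 * (u s y)^3 + D s y" for s y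
  note [measurable] = u_measurable borel_fst_snd
  note sm [measurable] = source_measurable[OF u_measurable u_H1, of h]
  have Dm [measurable]: "joint_measurable D"
    unfolding D_def by (rule dxinv_measurable[OF sm u_loc_int(6)])
  have \<Psi>m [measurable]: "joint_measurable \<Psi>" unfolding \<Psi>_def by measurable
  have \<sigma>m: "\<sigma> \<in> borel_measurable borel" unfolding \<sigma>_def[abs_def] by (rule borel_measurable_sint[OF sm])
  have pD: "prim (D s) (\<lambda>x. src s x - \<sigma> s)" for s unfolding D_def \<sigma>_def by (rule prim_dxinv[OF u_loc_int(6)])
  have Dp: "D s (x + 1) = D s x" for s x unfolding D_def by (rule dxinv_periodic[OF u_loc_int(6)]) (rule source_periodic[OF u_H1])
  have sa: "sint (\<lambda>x. \<bar>src s x\<bar>) \<le> C" if s: "0 \<le> s" "s \<notin> N" for s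
    using sint_mono[OF loc_int_abs[OF u_loc_int(6)] loc_int_const C[OF s]] by (simp add: sint_const)
  have \<sigma>b: "\<bar>\<sigma> s\<bar> \<le> C" if s: "0 \<le> s" "s \<notin> N" for s
    using abs_sint_le[OF u_loc_int(6)[of s]] sa[OF s] unfolding \<sigma>_def by linarith
  have Db: "\<bar>D s x\<bar> \<le> 2 * C" if s: "0 \<le> s" "s \<notin> N" for s x
  proof -
    obtain y where y: "0 \<le> y" "y < 1" "D s x = D s y" using periodic_floor[of "D s" 1 x] Dp by (metis zero_less_one)
    have "\<bar>D s y - D s 0\<bar> \<le> 2 * C * \<bar>y - 0\<bar>"
    proof (rule prim_lipschitz[OF pD])
      show "\<bar>src s x - \<sigma> s\<bar> \<le> 2 * C" for x using C[OF s, of x] \<sigma>b[OF s] by linarith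
    qed
    also have "\<dots> \<le> 2 * C * 1" using y C0 by (intro mult_left_mono) auto
    finally show ?thesis using y(3) by (simp add: D_def dxinv_0)
  qed
  have u3: "\<bar>1/3 * (u s x)^3\<bar> \<le> K^3" if s: "0 \<le> s" "s \<notin> N" for s x
  proof -
    have "\<bar>u s x\<bar>^3 \<le> K^3" by (rule power_mono[OF K(2)[OF s, of x] abs_ge_zero])
    then have "1/3 * \<bar>u s x\<bar>^3 \<le> K^3" using K3 by linarith
    then show ?thesis by (simp add: power_abs abs_mult)
  qed
  have \<Psi>b: "\<bar>\<Psi> s x\<bar> \<le> B" if s: "0 \<le> s" "s \<notin> N" for s x
    using u3[OF s, of x] Db[OF s, of x] K(1) unfolding \<Psi>_def B_def by linarith
  have \<Psi>c: "continuous_on UNIV (\<Psi> s)" for s unfolding \<Psi>_def[abs_def]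
    by (intro continuous_intros u_loc_int(7) prim_continuous[OF pD])
  have sF: "loc_int (\<lambda>x. 1/3 * (u t x)^3)" for t by (rule loc_int_cmult[OF u_loc_int(1)])
  have bd: "sint (\<lambda>x. \<bar>w x\<bar>) \<le> B" if "loc_int w" "\<And>x. \<bar>w x\<bar> \<le> B" for w
    using sint_mono[OF loc_int_abs[OF that(1)] loc_int_const that(2)] by (simp add: sint_const)
  have \<sigma>i: "set_integrable lborel {0..t} \<sigma>" for t
    by (rule set_integrable_off_null[OF \<sigma>m N \<sigma>b])
  have um: "(\<lambda>p. 1/3 * (u (fst p) (snd p))^3) \<in> borel_measurable borel" by measurable
  have lu: "loc_int (u t)" for t using u_loc_int(1)[of t 1] by simp
  have lu0: "loc_int u0" by (rule loc_int_continuous[OF H1_per_continuous[OF ini.H1]])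
  have l\<Psi>: "loc_int (\<Psi> t)" for t by (rule loc_int_continuous[OF \<Psi>c])
  have "AE t in lborel. 0 \<le> t \<longrightarrow> sint (u t) = sint u0 + (LBINT s:{0..t}. \<sigma> s) \<and> (\<exists>c. AE y in lborel. pr (u t) y =
      pr u0 y + y * (LBINT s:{0..t}. \<sigma> s) + (LBINT s:{0..t}. \<Psi> s y) + c)"
  proof (rule potential[OF lu H1_per_periodic(1)[OF u_H1] lu0 ini.f_periodic \<Psi>m l\<Psi> _ N bd[OF l\<Psi> \<Psi>b] \<sigma>i])
    show "\<Psi> s (x + 1) = \<Psi> s x" for s x by (simp add: \<Psi>_def Dp H1_per_periodic[OF u_H1])
    fix g assume g: "smooth g" "\<And>x. g (x + 1) = g x"
    have "AE t in lborel. 0 \<le> t \<longrightarrow> sint (\<lambda>x. u t x * g x) = sint (\<lambda>x. u0 x * g x)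
      + (LBINT s:{0..t}. sint (\<lambda>x. src s x * g x) - sint (\<lambda>x. 1/3 * (u s x)^3 * deriv g x))"
    proof (rule localize[where K = B, OF u_measurable(1) um sm lu sF u_loc_int(6) N _ _ _ u_weak(1) g])
      fix t assume t: "0 \<le> t" "t \<notin> N"
      show "sint (\<lambda>x. \<bar>u t x\<bar>) \<le> B"
      proof (rule bd[OF lu])
        show "\<bar>u t x\<bar> \<le> B" for x using K(2)[OF t, of x] K3 C0 unfolding B_def by linarith
      qed
      show "sint (\<lambda>x. \<bar>1/3 * (u t x)^3\<bar>) \<le> B"
      proof (rule bd[OF sF])
        show "\<bar>1/3 * (u t x)^3\<bar> \<le> B" for x using u3[OF t, of x] K(1) C0 unfolding B_def by linarith
      qed
      show "sint (\<lambda>x. \<bar>src t x\<bar>) \<le> B" using sa[OF t] K(1) C0 K3 unfolding B_def by linarith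
    qed
    then show "AE t in lborel. 0 \<le> t \<longrightarrow> sint (\<lambda>x. u t x * g x) = sint (\<lambda>x. u0 x * g x)
      + (LBINT s:{0..t}. \<sigma> s * sint g - sint (\<lambda>x. \<Psi> s x * deriv g x))"
    proof eventually_elim
      case (elim t)
      note pg = prim_of_DERIV[OF smoothD(1)[OF g(1)] smoothD(3)[OF smoothD(2)[OF g(1)]]]
      note gc = smoothD(3)[OF g(1), of UNIV] and g'c = smoothD(3)[OF smoothD(2)[OF g(1)], of UNIV]
      have "sint (\<lambda>x. src s x * g x) - sint (\<lambda>x. 1/3 * (u s x)^3 * deriv g x) = \<sigma> s * sint g - sint (\<lambda>x. \<Psi> s x * deriv g x)" for s
      proof -
        have "sint (\<lambda>x. D s x * deriv g x) = - sint (\<lambda>x. (src s x - \<sigma> s) * g x)"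
          by (rule sint_by_parts[OF pD Dp pg g(2)])
        moreover have "sint (\<lambda>x. (src s x - \<sigma> s) * g x) = sint (\<lambda>x. src s x * g x) - \<sigma> s * sint g"
          unfolding left_diff_distrib by (simp add: sint_diff sint_cmult loc_int_mult_right[OF u_loc_int(6) gc] loc_int_cmult loc_int_continuous[OF gc])
        moreover have "sint (\<lambda>x. \<Psi> s x * deriv g x) = sint (\<lambda>x. 1/3 * (u s x)^3 * deriv g x) + sint (\<lambda>x. D s x * deriv g x)"
          unfolding \<Psi>_def distrib_right by (intro sint_add loc_int_mult_right[OF _ g'c] sF loc_int_continuous[OF prim_continuous[OF pD]])
        ultimately show ?thesis by linarith
      qed
      with elim show ?case by simp
    qed
  qed
  then show ?thesis
  proof eventually_elim
    case (elim t)
    show ?case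
    proof (intro impI allI)
      fix y k :: real assume t: "0 \<le> t" and k: "0 \<le> k"
      from elim t obtain c where c: "AE y in lborel. pr (u t) y = pr u0 y + y * (LBINT s:{0..t}. \<sigma> s) + (LBINT s:{0..t}. \<Psi> s y) + c"
        by blast
      have all: "pr (u t) y = pr u0 y + y * (LBINT s:{0..t}. \<sigma> s) + (LBINT s:{0..t}. \<Psi> s y) + c" for y
        by (rule AE_continuous_eq[OF c]) (intro continuous_intros prim_continuous[OF prim_pr] lu lu0 time_integral_continuous[OF \<Psi>m N \<Psi>c \<Psi>b])+
      have \<Psi>i: "set_integrable lborel {0..t} (\<lambda>s. \<Psi> s y)" for y
        by (rule set_integrable_off_null[OF measurable_slice[OF \<Psi>m] N \<Psi>b])
      have "(LBINT x:{y..y+k}. u t x) = (LBINT x:{y..y+k}. u0 x) +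
         (k * (LBINT s:{0..t}. \<sigma> s) + ((LBINT s:{0..t}. \<Psi> s (y + k)) - (LBINT s:{0..t}. \<Psi> s y)))"
        using k all[of y] all[of "y + k"] by (simp add: prim_integral[OF prim_pr[OF lu]] prim_integral[OF prim_pr[OF lu0]] algebra_simps)
      also have "k * (LBINT s:{0..t}. \<sigma> s) + ((LBINT s:{0..t}. \<Psi> s (y + k)) - (LBINT s:{0..t}. \<Psi> s y))
        = (LBINT s:{0..t}. k * \<sigma> s + (\<Psi> s (y + k) - \<Psi> s y))"
        by (simp add: set_integral_add(2) set_integral_diff \<Psi>i \<sigma>i)
      also have "\<dots> = (LBINT s:{0..t}. flux h u ux k s y)"
      proof -
        have "k * \<sigma> s + (\<Psi> s (y + k) - \<Psi> s y) = flux h u ux k s y" for s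
        proof -
          have "(LBINT x:{y..y+k}. src s x - \<sigma> s) = D s (y + k) - D s y" using k by (intro prim_integral[OF pD]) simp
          moreover have "(LBINT x:{y..y+k}. src s x - \<sigma> s) = (LBINT x:{y..y+k}. src s x) - k * \<sigma> s"
            using k by (subst set_integral_diff(2)) (auto intro!: loc_int_integrable[OF u_loc_int(6)] simp: set_lebesgue_integral_def)
          ultimately show ?thesis by (simp add: \<Psi>_def flux_def)
        qed
        then show ?thesis by simp
      qed
      finally show "(LBINT x:{y..y+k}. u t x) = (LBINT x:{y..y+k}. u0 x) + (LBINT s:{0..t}. flux h u ux k s y)" .
    qed
  qed
qed

lemma regular_representative:
  obtains v vx G K q where "regular_solution u0 u0' v vx G K q" "\<And>t. t \<in> G \<Longrightarrow> v t = u t"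
proof -
  obtain N K where N: "N \<in> null_sets lborel" and K: "1 \<le> K" "\<And>t x. 0 \<le> t \<Longrightarrow> t \<notin> N \<Longrightarrow> \<bar>u t x\<bar> \<le> K"
    by (rule u_bounds) blast
  obtain B where B: "\<And>x. \<bar>u0 x\<bar> \<le> B" using periodic_bounded[OF H1_per_continuous[OF ini.H1] ini.f_periodic] by blast
  obtain N1 where N1: "N1 \<in> null_sets lborel" and "\<And>t. t \<notin> N1 \<Longrightarrow> 0 \<le> t \<longrightarrow> sint (\<lambda>x. (ux t x)\<^sup>2) = h \<and>
     (\<exists>c. AE y in lborel. pr (\<lambda>x. (ux t x)\<^sup>2) y = pr (\<lambda>x. (u0' x)\<^sup>2) y + (LBINT s:{0..t}. mass_flux u ux s y) + c)"
    by (rule null_set_of_AE[OF mass_identity]) blast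
  then have mass: "\<And>t. t \<notin> N1 \<Longrightarrow> 0 \<le> t \<Longrightarrow> sint (\<lambda>x. (ux t x)\<^sup>2) = h"
    "\<And>t. t \<notin> N1 \<Longrightarrow> 0 \<le> t \<Longrightarrow> (\<exists>c. AE y in lborel. pr (\<lambda>x. (ux t x)\<^sup>2) y = pr (\<lambda>x. (u0' x)\<^sup>2) y + (LBINT s:{0..t}. mass_flux u ux s y) + c)"
    by simp_all
  obtain N2 where N2: "N2 \<in> null_sets lborel" and "\<And>t. t \<notin> N2 \<Longrightarrow> 0 \<le> t \<longrightarrow> (\<forall>y k. 0 \<le> k \<longrightarrow>
     (LBINT x:{y..y+k}. u t x) = (LBINT x:{y..y+k}. u0 x) + (LBINT s:{0..t}. flux h u ux k s y))"
    by (rule null_set_of_AE[OF velocity_identity]) blast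
  then have win: "\<And>t y k. t \<notin> N2 \<Longrightarrow> 0 \<le> t \<Longrightarrow> 0 \<le> k \<Longrightarrow>
     (LBINT x:{y..y+k}. u t x) = (LBINT x:{y..y+k}. u0 x) + (LBINT s:{0..t}. flux h u ux k s y)"
    by simp
  \<comment> \<open>Time 0 is left out as well, so that the representative starts exactly at the
    datum.\<close>
  define G where "G = {0<..} - (N \<union> N1 \<union> N2)"
  define v where "v t = (if t \<in> G then u t else u0)" for t
  define vx where "vx t = (if t \<in> G then ux t else u0')" for t
  have nu: "N \<union> N1 \<union> N2 \<in> null_sets lborel" using N N1 N2 by blast
  then have Gm: "G \<in> sets borel" unfolding G_def using null_setsD2[OF nu] by (intro sets.Diff) simp_all
  have G: "t \<notin> N" "t \<notin> N1" "t \<notin> N2" "0 \<le> t" "0 < t" if "t \<in> G" for t using that unfolding G_def by auto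
  have "AE t in lborel. t \<noteq> (0 :: real)" by (rule AE_lborel_singleton)
  then have GAE: "AE t in lborel. 0 \<le> t \<longrightarrow> t \<in> G"
    using AE_not_in[OF nu] by eventually_elim (auto simp: G_def)
  note [measurable] = u_measurable borel_fst_snd
  have fG: "{p. fst p \<in> G} \<in> sets (borel :: (real \<times> real) measure)"
    using measurable_sets[OF borel_fst_snd(1) Gm] by (simp add: vimage_def)
  have sl: "(\<lambda>p. w (snd p)) \<in> borel_measurable (borel :: (real \<times> real) measure)" if "w \<in> borel_measurable borel" for w :: "real \<Rightarrow> real"
    by (rule measurable_compose[OF borel_fst_snd(2) that])
  have "(\<lambda>p. if fst p \<in> G then u (fst p) (snd p) else u0 (snd p)) \<in> borel_measurable borel"
    "(\<lambda>p. if fst p \<in> G then ux (fst p) (snd p) else u0' (snd p)) \<in> borel_measurable borel"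
    using fG by (auto intro!: measurable_If u_measurable sl ini.g_measurable prim_measurable[OF ini.prim_f])
  then have vm: "joint_measurable v" "joint_measurable vx"
    by (auto simp: v_def vx_def if_distrib[of "\<lambda>f. f _"] cong: if_cong)
  have vH: "H1_per (v t) (vx t)" for t by (simp add: v_def vx_def u_H1 ini.H1)
  have "flux h v vx k s y = flux h u ux k s y \<and> mass_flux v vx s y = mass_flux u ux s y" if "s \<in> G" for s k y
    using that by (simp add: flux_def mass_flux_def source_def[abs_def] fterm_def v_def vx_def)
  then have fl: "flux h v vx k s y = flux h u ux k s y" "mass_flux v vx s y = mass_flux u ux s y" if "s \<in> G" for s k y using that by blast+
  have i1: "(LBINT s:{0..t}. flux h v vx k s y) = (LBINT s:{0..t}. flux h u ux k s y)" for t k y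
    by (rule set_integral_AE_cong)
      (use GAE flux_measurable[OF u_measurable u_H1] flux_measurable[OF vm vH] in \<open>auto elim!: eventually_mono simp: fl set_borel_measurable_def\<close>)
  have i2: "(LBINT s:{0..t}. mass_flux v vx s y) = (LBINT s:{0..t}. mass_flux u ux s y)" for t y
    by (rule set_integral_AE_cong)
      (use GAE measurable_slice[OF mass_flux_measurable[OF u_measurable]] measurable_slice[OF mass_flux_measurable[OF vm]]
        in \<open>auto elim!: eventually_mono simp: fl set_borel_measurable_def\<close>)
  have "regular_solution u0 u0' v vx G (max K B) (charge 0)"
  proof
    fix t x y k :: real
    show "sint (\<lambda>x. (vx t x)\<^sup>2) = h" using mass(1) G by (simp add: vx_def)
    show "\<bar>v t x\<bar> \<le> max K B" using K(2)[of t x] B[of x] G[of t] by (auto simp: v_def)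
    show "v t = u0" "vx t = u0'" if "t \<notin> G" using that by (simp_all add: v_def vx_def)
    show "sint (\<lambda>y. v t y - v t y * (vx t y)\<^sup>2) = charge 0" if "t \<in> G" using that u_const[OF G(4)[OF that]] by (simp add: v_def vx_def)
    show "(LBINT x:{y..y+k}. v t x) = (LBINT x:{y..y+k}. u0 x) + (LBINT s:{0..t}. flux h v vx k s y)" if "t \<in> G" "0 \<le> k"
      unfolding i1 using win[OF G(3,4)] that by (simp add: v_def)
    show "\<exists>c. AE y in lborel. pr (\<lambda>x. (vx t x)\<^sup>2) y = pr (\<lambda>x. (u0' x)\<^sup>2) y + (LBINT s:{0..t}. mass_flux v vx s y) + c" if "t \<in> G"
      unfolding i2 using mass(2)[OF G(2,4)] that by (simp add: vx_def)
  qed (use vm vH G GAE in auto)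
  then show thesis by (rule that) (simp add: v_def)
qed

end

section \<open>Uniform continuity in time, and the proof that the charge is zero\<close>

section \<open>Continuity in time and vanishing charge\<close>

lemma sint_AE_cong:
  assumes "AE x in lborel. v x = w x" "v \<in> borel_measurable borel" "w \<in> borel_measurable borel" shows "sint v = sint w"
  unfolding sint_def by (rule set_integral_AE_cong) (use assms in \<open>auto elim!: eventually_mono simp: set_borel_measurable_def\<close>)

lemma average_osc:
  assumes w: "loc_int w" and k: "0 \<le> k" and e: "\<And>x. y \<le> x \<Longrightarrow> x \<le> y + k \<Longrightarrow> \<bar>w x - c\<bar> \<le> e"
  shows "\<bar>(LBINT x:{y..y+k}. w x) - k * c\<bar> \<le> k * e"
proof -
  have "(LBINT x:{y..y+k}. w x) - k * c = (LBINT x:{y..y+k}. w x - c)"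
    using k by (subst set_integral_diff(2)) (auto intro!: loc_int_integrable[OF w] simp: set_lebesgue_integral_def)
  moreover have "norm (LBINT x:{y..y+k}. w x - c) \<le> e * (y + k - y)"
    by (rule set_integral_norm_le) (use k e in auto)
  ultimately show ?thesis by (simp add: mult.commute)
qed

lemma set_integral_singleton [simp]: "(LBINT s:{a::real}. f s) = (0 :: real)"
  unfolding set_lebesgue_integral_def
proof (rule integral_eq_zero_AE)
  show "AE s in lborel. indicat_real {a} s *\<^sub>R f s = 0" using AE_lborel_singleton[of a] by eventually_elim auto
qed

context regular_solution
begin

abbreviation "src \<equiv> source h v vx"
abbreviation "G\<^sub>0 \<equiv> insert 0 G"

definition "Cs = 2 * max K h * (1 + max K h) * (1 + \<bar>1 / (1 - h)\<bar> * (1 + max K h))"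
definition "CF = K ^ 3 + Cs"

lemma K_nonneg: "0 \<le> K" and h_nonneg: "0 \<le> h"
  using v_bound[of 0 0] abs_ge_zero[of "v 0 0"] by (linarith, simp add: sint_def set_lebesgue_integral_def)

lemma Cs_nonneg: "0 \<le> Cs" and CF_nonneg: "0 \<le> CF"
  using K_nonneg by (simp_all add: Cs_def CF_def)

lemma v_continuous: "continuous_on A (v t)" and prim_v: "prim (v t) (vx t)" and loc_int_v: "loc_int (v t)"
  and loc_int_vx2: "loc_int (\<lambda>x. (vx t x)\<^sup>2)" and v_periodic: "v t (x + 1) = v t x" "vx t (x + 1) = vx t x"
  using H1_per_continuous[OF v_H1] H1_per_prim[OF v_H1] H1_per_loc_int(1)[OF v_H1] H1_per_periodic[OF v_H1] loc_int_continuous[OF H1_per_continuous[OF v_H1]]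
  by blast+

lemma src_bound: "\<bar>src t x\<bar> \<le> Cs"
  unfolding Cs_def
proof (rule source_bound[of v t vx "max K h", OF v_H1])
  show "\<bar>v t x\<bar> \<le> max K h" for x using v_bound[of t x] by linarith
qed (simp add: v_energy)

lemma src_continuous: "continuous_on A (src t)" and loc_int_src: "loc_int (src t)"
proof -
  note p = prim_source[of v t vx h, OF v_H1]
  show "continuous_on A (src t)" "loc_int (src t)" by (rule prim_continuous[OF p], rule loc_int_continuous[OF prim_continuous[OF p]])
qed

lemma v_0: "v 0 = u0" "vx 0 = u0'"
  using G_pos[of 0] v_off vx_off by auto

lemma v_Holder: "0 \<le> k \<Longrightarrow> k \<le> 1 \<Longrightarrow> \<bar>v t (x + k) - v t x\<bar> \<le> sqrt (k * h)"
  by (rule H1_Holder[OF v_H1]) (simp_all add: v_energy)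

lemma charge_cases: "sint (\<lambda>y. v t y - v t y * (vx t y)\<^sup>2) = (if t \<in> G then q else 0)"
  using v_charge mean_zero by (simp add: v_off vx_off)

lemma cube_bound: "\<bar>(v t x)^3\<bar> \<le> K^3"
  unfolding power_abs by (rule power_mono[OF v_bound abs_ge_zero])

lemma flux_bound: assumes k: "0 \<le> k" "k \<le> 1" shows "\<bar>flux h v vx k s y\<bar> \<le> CF"
proof -
  have "\<bar>LBINT x:{y..y+k}. src s x\<bar> \<le> Cs * (y + k - y)"
    using set_integral_norm_le[of y "y + k" "src s" Cs] k src_bound by simp
  also have "\<dots> \<le> Cs" using mult_left_mono[OF k(2) Cs_nonneg] by simp
  finally show ?thesis unfolding flux_def CF_def using cube_bound[of s y] cube_bound[of s "y + k"] by linarith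
qed

lemma flux_integrable: "0 \<le> k \<Longrightarrow> k \<le> 1 \<Longrightarrow> set_integrable lborel {a..b} (\<lambda>s. flux h v vx k s y)"
  by (rule set_integrable_bounded_Icc[where C = CF])
    (use flux_bound flux_measurable[OF v_measurable vx_measurable v_H1] in \<open>auto simp: set_borel_measurable_def\<close>)

lemma G0_nonneg: "t \<in> G\<^sub>0 \<Longrightarrow> 0 \<le> t" using G_pos[of t] by auto

lemma window0:
  assumes t: "t \<in> G\<^sub>0" and k: "0 \<le> k"
  shows "(LBINT x:{y..y+k}. v t x) = (LBINT x:{y..y+k}. u0 x) + (LBINT s:{0..t}. flux h v vx k s y)"
  using assms window[of t k y] by (auto simp: v_0)

lemma window_diff:
  assumes t: "t1 \<in> G\<^sub>0" "t2 \<in> G\<^sub>0" "t1 \<le> t2" and k: "0 \<le> k" "k \<le> 1"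
  shows "(LBINT x:{y..y+k}. v t2 x) - (LBINT x:{y..y+k}. v t1 x) = (LBINT s:{t1..t2}. flux h v vx k s y)"
  using window0[OF t(1) k(1), of y] window0[OF t(2) k(1), of y] set_integral_Icc_split[OF G0_nonneg[OF t(1)] t(3) flux_integrable[OF k]] by simp

text \<open>The integral over a window of width k changes at a rate at most \<open>CF\<close>, while
  inside the window v deviates from v(y) by at most sqrt(k h), uniformly in time. Balancing the two
  gives continuity in time.\<close>

lemma time_estimate:
  assumes t: "t1 \<in> G\<^sub>0" "t2 \<in> G\<^sub>0" "t1 \<le> t2" and k: "0 \<le> k" "k \<le> 1"
  shows "k * \<bar>v t2 y - v t1 y\<bar> \<le> CF * (t2 - t1) + 2 * (k * sqrt (k * h))"
proof -
  have osc: "\<bar>(LBINT x:{y..y+k}. v t x) - k * v t y\<bar> \<le> k * sqrt (k * h)" for t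
  proof (rule average_osc[OF loc_int_v k(1)])
    fix x assume x: "y \<le> x" "x \<le> y + k"
    then have "\<bar>v t x - v t y\<bar> \<le> sqrt ((x - y) * h)" using v_Holder[of "x - y" t y] k by simp
    also have "\<dots> \<le> sqrt (k * h)" using x h_nonneg by (simp add: mult_right_mono)
    finally show "\<bar>v t x - v t y\<bar> \<le> sqrt (k * h)" .
  qed
  have "\<bar>LBINT s:{t1..t2}. flux h v vx k s y\<bar> \<le> CF * (t2 - t1)"
    using set_integral_norm_le[OF t(3), of "\<lambda>s. flux h v vx k s y" CF] flux_bound[OF k] by simp
  then have "\<bar>k * v t2 y - k * v t1 y\<bar> \<le> CF * (t2 - t1) + 2 * (k * sqrt (k * h))"
    using window_diff[OF t k, of y] osc[of t1] osc[of t2] by linarith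
  moreover have "\<bar>k * v t2 y - k * v t1 y\<bar> = k * \<bar>v t2 y - v t1 y\<bar>" using k by (simp add: abs_mult flip: right_diff_distrib)
  ultimately show ?thesis by simp
qed

lemma time_modulus:
  assumes e: "0 < e"
  obtains d where "0 < d" "\<And>t1 t2 y. t1 \<in> G\<^sub>0 \<Longrightarrow> t2 \<in> G\<^sub>0 \<Longrightarrow> \<bar>t2 - t1\<bar> < d \<Longrightarrow> \<bar>v t2 y - v t1 y\<bar> < e"
proof -
  \<comment> \<open>This width makes sqrt(k h) at most e/4, so the two oscillation terms use k e/2;
    \<open>d\<close> below lets the flux use the other half.\<close>
  define k where "k = min 1 (e\<^sup>2 / (16 * (1 + h)))"
  have k: "0 < k" "k \<le> 1" using e h_nonneg by (auto simp: k_def add_pos_nonneg)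
  have "k * h \<le> e\<^sup>2 / (16 * (1 + h)) * (1 + h)" using h_nonneg e by (intro mult_mono) (auto simp: k_def)
  also have "\<dots> = (e / 4)\<^sup>2"
  proof -
    have "e\<^sup>2 / (16 * b) * b = (e / 4)\<^sup>2" if "0 < b" for b using that by (simp add: power_divide)
    from this[of "1 + h"] show ?thesis using h_nonneg by simp
  qed
  finally have s: "sqrt (k * h) \<le> e / 4" using e by (intro real_le_lsqrt) auto
  define d where "d = k * e / (2 * (1 + CF))"
  have d: "0 < d" using k e CF_nonneg by (simp add: d_def)
  have main: "\<bar>v t2 y - v t1 y\<bar> < e" if t: "t1 \<in> G\<^sub>0" "t2 \<in> G\<^sub>0" "t1 \<le> t2" "t2 - t1 < d" for t1 t2 y
  proof -
    have "CF * (t2 - t1) \<le> (1 + CF) * (t2 - t1)" using t(3) by (intro mult_right_mono) auto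
    also have "\<dots> < (1 + CF) * d" using t(4) CF_nonneg by (intro mult_strict_left_mono) auto
    also have "\<dots> = k * (e / 2)"
    proof -
      have "b * (k * e / (2 * b)) = k * (e / 2)" if "0 < b" for b using that by simp
      from this[of "1 + CF"] show ?thesis using CF_nonneg by (simp add: d_def)
    qed
    finally have 1: "CF * (t2 - t1) < k * (e / 2)" .
    have "k * sqrt (k * h) \<le> k * (e / 4)" using s k by (intro mult_left_mono) auto
    then have "k * \<bar>v t2 y - v t1 y\<bar> < k * e"
      using time_estimate[OF t(1-3) less_imp_le[OF k(1)] k(2), of y] 1 by linarith
    then show ?thesis using k by simp
  qed
  show thesis
  proof (rule that[OF d])
    fix t1 t2 y assume t: "t1 \<in> G\<^sub>0" "t2 \<in> G\<^sub>0" "\<bar>t2 - t1\<bar> < d"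
    show "\<bar>v t2 y - v t1 y\<bar> < e"
    proof (cases "t1 \<le> t2")
      case True then show ?thesis using main[OF t(1,2)] t(3) by simp
    next
      case False then show ?thesis using main[OF t(2,1)] t(3) by (simp add: abs_minus_commute)
    qed
  qed
qed

lemma G_dense: assumes "0 \<le> a" "a < b" obtains t where "t \<in> G" "a < t" "t < b"
proof -
  obtain t where "a < t" "t < b" "0 \<le> t \<longrightarrow> t \<in> G" by (rule AE_dense[OF G_AE assms(2)])
  then show thesis using assms(1) by (intro that[of t]) auto
qed

definition "Bm = K\<^sup>2 * h + K\<^sup>2 + 2 * \<bar>q\<bar> * K"

lemma v_sq_le: "(v t x)\<^sup>2 \<le> K\<^sup>2"
  using power_mono[OF v_bound[of t x] abs_ge_zero, of 2] by simp

lemma loc_int_mass_flux: "loc_int (mass_flux v vx t)"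
  unfolding mass_flux_def
  by (intro loc_int_diff loc_int_add loc_int_cmult loc_int_v loc_int_mult_continuous loc_int_vx2 loc_int_continuous continuous_intros v_continuous)

lemma mass_flux_periodic: "mass_flux v vx t (x + 1) = mass_flux v vx t x"
  by (simp add: mass_flux_def v_periodic)

lemma mass_flux_L1: "sint (\<lambda>x. \<bar>mass_flux v vx t x\<bar>) \<le> Bm"
proof -
  have "sint (\<lambda>x. \<bar>mass_flux v vx t x\<bar>) \<le> sint (\<lambda>x. K\<^sup>2 * (vx t x)\<^sup>2 + (K\<^sup>2 + 2 * \<bar>q\<bar> * K))"
  proof (rule sint_mono[OF loc_int_abs[OF loc_int_mass_flux] loc_int_add[OF loc_int_cmult[OF loc_int_vx2] loc_int_const]])
    fix x
    have "\<bar>2 * (if t \<in> G then q else 0) * v t x\<bar> \<le> 2 * \<bar>q\<bar> * \<bar>v t x\<bar>" by (simp add: abs_mult)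
    also have "\<dots> \<le> 2 * \<bar>q\<bar> * K" by (rule mult_left_mono[OF v_bound]) simp
    finally have 1: "\<bar>2 * (if t \<in> G then q else 0) * v t x\<bar> \<le> 2 * \<bar>q\<bar> * K" .
    have 2: "(v t x)\<^sup>2 * (vx t x)\<^sup>2 \<le> K\<^sup>2 * (vx t x)\<^sup>2" by (rule mult_right_mono[OF v_sq_le]) simp
    have 3: "0 \<le> (v t x)\<^sup>2 * (vx t x)\<^sup>2" "0 \<le> (v t x)\<^sup>2" by simp_all
    show "\<bar>mass_flux v vx t x\<bar> \<le> K\<^sup>2 * (vx t x)\<^sup>2 + (K\<^sup>2 + 2 * \<bar>q\<bar> * K)"
      unfolding mass_flux_def charge_cases using 1 2 3 v_sq_le[of t x] by linarith
  qed
  also have "\<dots> = Bm" by (simp add: Bm_def sint_add loc_int_cmult loc_int_vx2 loc_int_const sint_cmult sint_const v_energy)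
  finally show ?thesis .
qed

lemma mass_flux_time_integral:
  shows "loc_int (\<lambda>y. LBINT s:{0..t}. mass_flux v vx s y)"
    "0 \<le> t \<Longrightarrow> sint (\<lambda>y. \<bar>LBINT s:{0..t}. mass_flux v vx s y\<bar>) \<le> Bm * t"
    "AE y in lborel. set_integrable lborel {0..t} (\<lambda>s. mass_flux v vx s y)"
proof -
  note m = mass_flux_measurable[OF v_measurable vx_measurable]
  have ma: "(\<lambda>p. \<bar>mass_flux v vx (fst p) (snd p)\<bar>) \<in> borel_measurable borel" using m by measurable
  show l: "loc_int (\<lambda>y. LBINT s:{0..t}. mass_flux v vx s y)"
    by (rule time_integral_loc_int[OF m loc_int_mass_flux mass_flux_periodic null_sets.empty_sets mass_flux_L1])
  show AE: "AE y in lborel. set_integrable lborel {0..t} (\<lambda>s. mass_flux v vx s y)"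
    by (rule time_integral_AE[OF m loc_int_mass_flux mass_flux_periodic null_sets.empty_sets mass_flux_L1])
  have ab: "sint (\<lambda>x. \<bar>\<bar>mass_flux v vx s x\<bar>\<bar>) \<le> Bm" for s using mass_flux_L1 by simp
  have pa: "\<bar>mass_flux v vx s (x + 1)\<bar> = \<bar>mass_flux v vx s x\<bar>" for s x by (simp add: mass_flux_periodic)
  have la: "loc_int (\<lambda>y. LBINT s:{0..t}. \<bar>mass_flux v vx s y\<bar>)"
    by (rule time_integral_loc_int[OF ma loc_int_abs[OF loc_int_mass_flux] pa null_sets.empty_sets ab])
  have sw: "(LBINT s:{0..t}. sint (\<lambda>y. \<bar>mass_flux v vx s y\<bar> * 1)) = sint (\<lambda>y. (LBINT s:{0..t}. \<bar>mass_flux v vx s y\<bar>) * 1)"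
    by (rule time_integral_swap[OF ma loc_int_abs[OF loc_int_mass_flux] pa null_sets.empty_sets ab, where G = 1]) auto
  assume t: "0 \<le> t"
  have "sint (\<lambda>y. \<bar>LBINT s:{0..t}. mass_flux v vx s y\<bar>) \<le> sint (\<lambda>y. LBINT s:{0..t}. \<bar>mass_flux v vx s y\<bar>)"
  proof (rule sint_mono[OF loc_int_abs[OF l] la])
    show "\<bar>LBINT s:{0..t}. mass_flux v vx s y\<bar> \<le> (LBINT s:{0..t}. \<bar>mass_flux v vx s y\<bar>)" for y
    proof -
      have "\<bar>integral\<^sup>L lborel (\<lambda>s. indicat_real {0..t} s *\<^sub>R mass_flux v vx s y)\<bar> \<le> (\<integral>s. \<bar>indicat_real {0..t} s *\<^sub>R mass_flux v vx s y\<bar> \<partial>lborel)"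
        by (rule integral_abs_bound)
      also have "\<dots> = (LBINT s:{0..t}. \<bar>mass_flux v vx s y\<bar>)"
        unfolding set_lebesgue_integral_def by (intro Bochner_Integration.integral_cong) (auto simp: abs_mult)
      finally show ?thesis unfolding set_lebesgue_integral_def .
    qed
  qed
  also have "\<dots> = (LBINT s:{0..t}. sint (\<lambda>y. \<bar>mass_flux v vx s y\<bar>))" using sw by simp
  also have "\<dots> \<le> Bm * (t - 0)"
    using set_integral_norm_le[OF t, of "\<lambda>s. sint (\<lambda>y. \<bar>mass_flux v vx s y\<bar>)" Bm] mass_flux_L1
    by (auto simp: sint_def set_lebesgue_integral_def)
  finally show "sint (\<lambda>y. \<bar>LBINT s:{0..t}. mass_flux v vx s y\<bar>) \<le> Bm * t" by simp
qed

text \<open>The charge of the datum is 0, so q is the difference of the charges of v(t) and u0. The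
  part (1 - v_x^2)(v - u0) is small by closeness. The part u0 (v_x^2 - u0'^2) is integrated by parts
  onto the potential D of v_x^2 - u0'^2, whose L^1 norm is at most Bm t by the mass
  identity.\<close>

lemma charge_estimate:
  assumes t: "t \<in> G" "t \<le> 1" and e: "0 < e" and close: "\<And>x. \<bar>v t x - u0 x\<bar> \<le> e"
  shows "\<bar>q\<bar> \<le> e * (1 + 2 * h) + (Bm + 2 * h) / (4 * e) * (Bm * t)"
proof -
  have t0: "0 \<le> t" using G_pos[OF t(1)] by simp
  have Bm0: "0 \<le> Bm" using K_nonneg h_nonneg by (simp add: Bm_def)
  obtain c where c: "AE y in lborel. pr (\<lambda>x. (vx t x)\<^sup>2) y = pr (\<lambda>x. (u0' x)\<^sup>2) y + (LBINT s:{0..t}. mass_flux v vx s y) + c"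
    using mass[OF t(1)] by blast
  note l0 = H1_per_loc_int[OF ini.H1]
  define D where "D y = pr (\<lambda>x. (vx t x)\<^sup>2) y - pr (\<lambda>x. (u0' x)\<^sup>2) y - c" for y
  have pD: "prim D (\<lambda>x. (vx t x)\<^sup>2 - (u0' x)\<^sup>2)"
    by (rule prim_cong[OF prim_diff[OF prim_diff[OF prim_pr[OF loc_int_vx2[of t]] prim_pr[OF l0(1)]] prim_const[of c]]]) (simp_all add: D_def)
  have fp: "(vx t (x + 1))\<^sup>2 - (u0' (x + 1))\<^sup>2 = (vx t x)\<^sup>2 - (u0' x)\<^sup>2" for x by (simp add: v_periodic ini.g_periodic)
  have Dp: "D (x + 1) = D x" for x
  proof -
    have "D (x + 1) - D x = D (0 + 1) - D 0" by (rule prim_period_increment[OF pD fp])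
    also have "\<dots> = sint (\<lambda>x. (vx t x)\<^sup>2 - (u0' x)\<^sup>2)" using sint_prim[OF pD] by simp
    also have "\<dots> = 0" by (simp add: sint_diff loc_int_vx2 l0 v_energy)
    finally show ?thesis by simp
  qed
  have Dm: "D \<in> borel_measurable borel" by (rule prim_measurable[OF pD])
  have lD: "loc_int (\<lambda>y. \<bar>D y\<bar>)" by (intro loc_int_continuous continuous_intros prim_continuous[OF pD])
  have "sint (\<lambda>y. \<bar>D y\<bar>) = sint (\<lambda>y. \<bar>LBINT s:{0..t}. mass_flux v vx s y\<bar>)"
  proof (rule sint_AE_cong)
    show "AE y in lborel. \<bar>D y\<bar> = \<bar>LBINT s:{0..t}. mass_flux v vx s y\<bar>" using c by eventually_elim (simp add: D_def)
  qed (use Dm loc_int_measurable[OF mass_flux_time_integral(1)] in measurable)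
  then have D1: "sint (\<lambda>y. \<bar>D y\<bar>) \<le> Bm * t" using mass_flux_time_integral(2)[OF t0] by simp
  have "sint (\<lambda>x. \<bar>(vx t x)\<^sup>2 - (u0' x)\<^sup>2\<bar>) \<le> sint (\<lambda>x. (vx t x)\<^sup>2 + (u0' x)\<^sup>2)"
  proof (rule sint_mono[OF loc_int_abs[OF prim_loc_int[OF pD]] loc_int_add[OF loc_int_vx2 l0(1)]])
    show "\<bar>(vx t x)\<^sup>2 - (u0' x)\<^sup>2\<bar> \<le> (vx t x)\<^sup>2 + (u0' x)\<^sup>2" for x
      using zero_le_power2[of "vx t x"] zero_le_power2[of "u0' x"] by linarith
  qed
  also have "\<dots> = 2 * h" by (simp add: sint_add loc_int_vx2 l0 v_energy)
  finally have D2: "sint (\<lambda>x. \<bar>(vx t x)\<^sup>2 - (u0' x)\<^sup>2\<bar>) \<le> 2 * h" .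
  have "Bm * t \<le> Bm" using mult_left_mono[OF t(2) Bm0] by simp
  then have Db: "\<bar>D x\<bar> \<le> Bm + 2 * h" for x using sup_bound_of_L1[OF pD Dp fp D2 D1, of x] by linarith
  have luD: "loc_int (\<lambda>x. u0' x * D x)" by (rule loc_int_mult_right[OF l0(2) prim_continuous[OF pD]])
  have "\<bar>sint (\<lambda>x. u0' x * D x)\<bar> \<le> sint (\<lambda>x. \<bar>u0' x * D x\<bar>)" by (rule abs_sint_le[OF luD])
  also have "\<dots> \<le> sint (\<lambda>x. e * (u0' x)\<^sup>2 + (Bm + 2 * h) / (4 * e) * \<bar>D x\<bar>)"
  proof (rule sint_mono[OF loc_int_abs[OF luD] loc_int_add[OF loc_int_cmult[OF l0(1)] loc_int_cmult[OF lD]]])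
    fix x
    \<comment> \<open>Young's inequality with weight e: u0' is only square integrable, whereas D is
      small in L^1 and bounded.\<close>
    have "0 \<le> (2 * e * \<bar>u0' x\<bar> - \<bar>D x\<bar>)\<^sup>2" by simp
    then have "4 * e * \<bar>u0' x\<bar> * \<bar>D x\<bar> \<le> 4 * e\<^sup>2 * (u0' x)\<^sup>2 + \<bar>D x\<bar> * \<bar>D x\<bar>"
      by (simp add: power2_diff power_mult_distrib power2_eq_square[of "D x"] algebra_simps)
    also have "\<bar>D x\<bar> * \<bar>D x\<bar> \<le> (Bm + 2 * h) * \<bar>D x\<bar>" by (rule mult_right_mono[OF Db]) simp
    finally have "\<bar>u0' x\<bar> * \<bar>D x\<bar> \<le> (4 * e\<^sup>2 * (u0' x)\<^sup>2 + (Bm + 2 * h) * \<bar>D x\<bar>) / (4 * e)"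
      using e by (simp add: pos_le_divide_eq algebra_simps)
    also have "\<dots> = e * (u0' x)\<^sup>2 + (Bm + 2 * h) / (4 * e) * \<bar>D x\<bar>"
    proof -
      have "(4 * e\<^sup>2 * a + B * b) / (4 * e) = e * a + B / (4 * e) * b" for a b B
        using e by (simp add: add_divide_distrib power2_eq_square[of e])
      then show ?thesis .
    qed
    finally show "\<bar>u0' x * D x\<bar> \<le> e * (u0' x)\<^sup>2 + (Bm + 2 * h) / (4 * e) * \<bar>D x\<bar>" by (simp add: abs_mult)
  qed
  also have "\<dots> = e * h + (Bm + 2 * h) / (4 * e) * sint (\<lambda>x. \<bar>D x\<bar>)"
    by (simp only: sint_add[OF loc_int_cmult[OF l0(1)] loc_int_cmult[OF lD]] sint_cmult)
  also have "\<dots> \<le> e * h + (Bm + 2 * h) / (4 * e) * (Bm * t)"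
    using D1 e Bm0 h_nonneg by (intro add_left_mono mult_left_mono) auto
  finally have 1: "\<bar>sint (\<lambda>x. u0' x * D x)\<bar> \<le> e * h + (Bm + 2 * h) / (4 * e) * (Bm * t)" .
  have 2: "sint (\<lambda>x. u0 x * ((vx t x)\<^sup>2 - (u0' x)\<^sup>2)) = - sint (\<lambda>x. u0' x * D x)"
    by (rule sint_by_parts[OF ini.prim_f ini.f_periodic pD Dp])
  define w where "w x = v t x - u0 x" for x
  have wc: "continuous_on UNIV w" unfolding w_def[abs_def] by (intro continuous_intros v_continuous H1_per_continuous[OF ini.H1])
  have lq: "loc_int (\<lambda>y. 1 - (vx t y)\<^sup>2)" by (intro loc_int_diff loc_int_const loc_int_vx2)
  have "sint (\<lambda>y. \<bar>1 - (vx t y)\<^sup>2\<bar>) \<le> 1 + h" using sint_one_minus_sq[OF v_H1] v_energy by simp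
  then have 3: "\<bar>sint (\<lambda>y. (1 - (vx t y)\<^sup>2) * w y)\<bar> \<le> e * (1 + h)"
    using close by (intro sint_mult_bound lq wc) (auto simp: w_def)
  note fc = H1_per_continuous[OF ini.H1, of UNIV]
  have "q = q - sint (\<lambda>x. u0 x - u0 x * (u0' x)\<^sup>2)" by (simp add: mean_zero)
  also have "\<dots> = sint (\<lambda>y. v t y - v t y * (vx t y)\<^sup>2) - sint (\<lambda>x. u0 x - u0 x * (u0' x)\<^sup>2)" by (simp only: v_charge[OF t(1)])
  also have "\<dots> = sint (\<lambda>x. (v t x - v t x * (vx t x)\<^sup>2) - (u0 x - u0 x * (u0' x)\<^sup>2))"
    by (rule sint_diff[symmetric]) (rule loc_int_charge[OF v_H1] loc_int_charge[OF ini.H1])+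
  also have "\<dots> = sint (\<lambda>y. (1 - (vx t y)\<^sup>2) * w y - u0 y * ((vx t y)\<^sup>2 - (u0' y)\<^sup>2))"
    by (rule arg_cong[of _ _ sint]) (simp add: fun_eq_iff w_def algebra_simps)
  also have "\<dots> = sint (\<lambda>y. (1 - (vx t y)\<^sup>2) * w y) - sint (\<lambda>y. u0 y * ((vx t y)\<^sup>2 - (u0' y)\<^sup>2))"
    by (rule sint_diff[OF loc_int_mult_right[OF lq wc] loc_int_mult_continuous[OF fc prim_loc_int[OF pD]]])
  finally have "\<bar>q\<bar> \<le> e * (1 + h) + (e * h + (Bm + 2 * h) / (4 * e) * (Bm * t))" using 1 2 3 by linarith
  then show ?thesis by (simp add: algebra_simps)
qed

text \<open>Condition (iii) makes the charge constant without linking its value to the datum. The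
  link is the limit t \<rightarrow> 0 through retained times in
  \<open>charge_estimate\<close>.\<close>

lemma q_zero: "q = 0"
proof (rule ccontr)
  assume "q \<noteq> 0"
  \<comment> \<open>Chosen so that e (1 + 2 h) plus one more e for the term growing with t is
    |q|/2.\<close>
  define e where "e = \<bar>q\<bar> / (2 * (2 + 2 * h))"
  have e: "0 < e" using \<open>q \<noteq> 0\<close> h_nonneg by (simp add: e_def)
  obtain d where d: "0 < d" "\<And>t1 t2 y. t1 \<in> G\<^sub>0 \<Longrightarrow> t2 \<in> G\<^sub>0 \<Longrightarrow> \<bar>t2 - t1\<bar> < d \<Longrightarrow> \<bar>v t2 y - v t1 y\<bar> < e"
    using time_modulus[OF e] by blast
  define A where "A = (Bm + 2 * h) / (4 * e) * Bm"
  have A: "0 \<le> A" using e K_nonneg h_nonneg by (simp add: A_def Bm_def)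
  obtain t where t: "t \<in> G" "0 < t" "t < min (min 1 d) (e / (1 + A))"
    using G_dense[of 0 "min (min 1 d) (e / (1 + A))"] d e A by auto
  have "\<bar>v t x - u0 x\<bar> \<le> e" for x using d(2)[of 0 t x] t by (simp add: v_0)
  from charge_estimate[OF t(1) _ e this] have "\<bar>q\<bar> \<le> e * (1 + 2 * h) + A * t" using t by (simp add: A_def)
  also have "A * t \<le> (1 + A) * (e / (1 + A))" using t A by (intro mult_mono) auto
  also have "\<dots> = e" using A by simp
  finally have "\<bar>q\<bar> \<le> e * (2 + 2 * h)" by (simp add: algebra_simps)
  also have "\<dots> = \<bar>q\<bar> / 2" using h_nonneg unfolding e_def by (simp add: field_simps)
  finally show False using \<open>q \<noteq> 0\<close> by simp
qed

lemma charge_zero: "sint (\<lambda>y. v t y - v t y * (vx t y)\<^sup>2) = 0"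
  using charge_cases q_zero by simp

lemma mass_flux_eq: "mass_flux v vx t y = (v t y)\<^sup>2 * (1 + (vx t y)\<^sup>2)"
  unfolding mass_flux_def charge_zero by (simp add: algebra_simps)

end

section \<open>Characteristics as level sets of the mass function\<close>

section \<open>Characteristics in the mass coordinate\<close>

lemma pr_eq_dxinv: "loc_int w \<Longrightarrow> pr w y = dxinv w y + y * sint w"
proof -
  assume w: "loc_int w"
  have "prim (\<lambda>y. dxinv w y + y * sint w) w"
    by (rule prim_cong[OF prim_add[OF prim_dxinv[OF w] prim_of_DERIV[of "\<lambda>y. y * sint w" "\<lambda>_. sint w"]]])
      (auto intro!: derivative_eq_intros)
  from prim_unique[OF prim_pr[OF w] this, of y 0] show ?thesis by (simp add: pr_0 dxinv_0)
qed

lemma borel_measurable_integral_upto: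
  fixes f :: "real \<Rightarrow> real \<Rightarrow> real"
  assumes "joint_measurable f"
  shows "(\<lambda>p. LBINT s:{0..fst p}. f s (snd p)) \<in> borel_measurable borel"
proof -
  note [measurable] = borel_fst_snd
  have p [measurable]: "(fst :: (real \<times> real) \<times> real \<Rightarrow> _) \<in> borel_measurable (borel \<Otimes>\<^sub>M lborel)"
    "(snd :: (real \<times> real) \<times> real \<Rightarrow> _) \<in> borel_measurable (borel \<Otimes>\<^sub>M lborel)"
    using measurable_fst[of borel lborel] measurable_snd[of borel lborel] by simp_all
  have "(\<lambda>x :: (real \<times> real) \<times> real. (snd x, snd (fst x))) \<in> borel_measurable (borel \<Otimes>\<^sub>M lborel)"
    by (intro borel_measurable_Pair measurable_compose[OF p(1) borel_fst_snd(2)] p)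
  from measurable_compose[OF this assms]
  have [measurable]: "(\<lambda>x :: (real \<times> real) \<times> real. f (snd x) (snd (fst x))) \<in> borel_measurable (borel \<Otimes>\<^sub>M lborel)" by simp
  have [measurable]: "(\<lambda>x :: (real \<times> real) \<times> real. fst (fst x)) \<in> borel_measurable (borel \<Otimes>\<^sub>M lborel)"
    by (rule measurable_compose[OF p(1) borel_fst_snd(1)])
  have "(\<lambda>x :: (real \<times> real) \<times> real. (if 0 \<le> snd x \<and> snd x \<le> fst (fst x) then f (snd x) (snd (fst x)) else 0)) \<in> borel_measurable (borel \<Otimes>\<^sub>M lborel)"
    by measurable
  then have "(\<lambda>(p, s). indicator {0..fst p} s *\<^sub>R f s (snd p)) \<in> borel_measurable (borel \<Otimes>\<^sub>M lborel)"
    by (rule measurable_cong[THEN iffD1, rotated]) (auto simp: indicator_def)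
  from lborel.borel_measurable_lebesgue_integral[OF this] show ?thesis by (simp add: set_lebesgue_integral_def)
qed

lemma (in lagrangian_coords) R_eq_pr: "R y = y + pr (\<lambda>x. (g x)\<^sup>2) y - c"
proof -
  have "prim (\<lambda>y. y + pr (\<lambda>x. (g x)\<^sup>2) y) \<rho>"
    by (rule prim_cong[OF prim_add[OF prim_of_DERIV[of "\<lambda>y. y" "\<lambda>_. 1"] prim_pr[OF H1_per_loc_int(1)[OF H1]]]])
      (auto intro!: derivative_eq_intros simp: \<rho>_def)
  from prim_unique[OF prim_R this, of y 0] show ?thesis by (simp add: pr_0 R_0)
qed

context regular_solution
begin

definition "N t y = (LBINT s:{0..t}. (v s y)\<^sup>2 * (1 + (vx s y)\<^sup>2))"
text \<open>At retained times this is the unknown constant of the mass identity. Writing it as a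
  mean over a period makes it measurable in t and normalises the mass coordinates of different times
  consistently.\<close>

definition "shift t = sint (\<lambda>y. y + pr (\<lambda>x. (vx t x)\<^sup>2) y - ini.R y - N t y)"

sublocale lc: lagrangian_coords "v t" "vx t" "shift t" for t
  by unfold_locales (rule v_H1)

abbreviation "\<rho> t \<equiv> lagrangian_coords.\<rho> (vx t)"
abbreviation "\<Xi> t \<equiv> lagrangian_coords.R (vx t) (shift t)"
abbreviation "X t \<equiv> lagrangian_coords.X (vx t) (shift t)"
definition "U t \<xi> = v t (X t \<xi>)"

lemma N_eq: "N t y = (LBINT s:{0..t}. mass_flux v vx s y)"
  by (simp add: N_def mass_flux_eq)

lemma \<Xi>_eq: assumes "t \<in> G\<^sub>0" shows "AE y in lborel. \<Xi> t y = ini.R y + N t y"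
proof -
  have loc: "loc_int (\<lambda>y. y + pr (\<lambda>x. (vx t x)\<^sup>2) y - ini.R y - N t y)" unfolding N_eq
    by (intro loc_int_diff loc_int_continuous mass_flux_time_integral continuous_intros prim_continuous[OF prim_pr[OF loc_int_vx2]] prim_continuous[OF ini.prim_R])
  have "\<exists>c. AE y in lborel. y + pr (\<lambda>x. (vx t x)\<^sup>2) y - ini.R y - N t y = c"
  proof (cases "t = 0")
    case True
    have "AE y in lborel. y + pr (\<lambda>x. (vx t x)\<^sup>2) y - ini.R y - N t y = 0"
      by (simp add: True v_0 ini.R_eq_pr N_def)
    then show ?thesis by blast
  next
    case False
    with assms mass obtain c where "AE y in lborel. pr (\<lambda>x. (vx t x)\<^sup>2) y = pr (\<lambda>x. (u0' x)\<^sup>2) y + N t y + c" unfolding N_eq by blast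
    then have "AE y in lborel. y + pr (\<lambda>x. (vx t x)\<^sup>2) y - ini.R y - N t y = c" by eventually_elim (simp add: ini.R_eq_pr)
    then show ?thesis by blast
  qed
  then obtain c where c: "AE y in lborel. y + pr (\<lambda>x. (vx t x)\<^sup>2) y - ini.R y - N t y = c" by blast
  have "shift t = sint (\<lambda>y. c)" unfolding shift_def
    by (rule sint_AE_cong[OF c]) (use loc_int_measurable[OF loc] in simp_all)
  then have "shift t = c" by (simp add: sint_const)
  with c show ?thesis by (auto elim!: eventually_mono simp: lc.R_eq_pr)
qed

lemma \<Xi>_measurable: "joint_measurable \<Xi>"
proof -
  note [measurable] = v_measurable vx_measurable borel_fst_snd
  have sq: "(\<lambda>p. (vx (fst p) (snd p))\<^sup>2) \<in> borel_measurable borel" by measurable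
  note d [measurable] = dxinv_measurable[OF sq loc_int_vx2]
  have P [measurable]: "(\<lambda>p. pr (\<lambda>x. (vx (fst p) x)\<^sup>2) (snd p)) \<in> borel_measurable borel"
    unfolding pr_eq_dxinv[OF loc_int_vx2] v_energy by measurable
  have "(\<lambda>p. (v (fst p) (snd p))\<^sup>2 * (1 + (vx (fst p) (snd p))\<^sup>2)) \<in> borel_measurable borel" by measurable
  from borel_measurable_integral_upto[OF this] have [measurable]: "joint_measurable N" by (simp add: N_def)
  have [measurable]: "(\<lambda>p. ini.R (snd p)) \<in> borel_measurable (borel :: (real \<times> real) measure)"
    by (rule measurable_compose[OF borel_fst_snd(2) prim_measurable[OF ini.prim_R]])
  have "(\<lambda>p. snd p + pr (\<lambda>x. (vx (fst p) x)\<^sup>2) (snd p) - ini.R (snd p) - N (fst p) (snd p)) \<in> borel_measurable borel" by measurable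
  from borel_measurable_sint[OF this] have "shift \<in> borel_measurable borel" by (simp add: shift_def[abs_def])
  note [measurable] = measurable_compose[OF borel_fst_snd(1) this]
  show ?thesis unfolding lc.R_eq_pr by measurable
qed

lemma X_continuous: "continuous_on A (X t)"
  by (rule prim_continuous[OF lc.prim_X])

lemma X_measurable: "joint_measurable X"
proof -
  have "(\<lambda>p. (\<lambda>\<xi> t. X t \<xi>) (fst p) (snd p)) \<in> borel_measurable borel"
  proof (rule borel_measurable_Caratheodory)
    show "isCont (\<lambda>\<xi>. X t \<xi>) \<xi>" for \<xi> t using X_continuous[of UNIV t] by (simp add: continuous_on_eq_continuous_at)
    fix \<xi>
    have "{t \<in> space borel. X t \<xi> \<le> x} \<in> sets borel" for x
    proof -
      note [measurable] = measurable_slice[OF \<Xi>_measurable, of x]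
      have "{t \<in> space borel. \<xi> \<le> \<Xi> t x} \<in> sets borel" by measurable
      then show ?thesis by (simp add: lc.X_le_iff)
    qed
    then show "(\<lambda>t. X t \<xi>) \<in> borel_measurable borel" by (simp add: borel_measurable_iff_le)
  qed
  from swap_measurable_borel[OF this] show ?thesis by simp
qed

lemma along_X_measurable:
  assumes "joint_measurable w"
  shows "(\<lambda>p. w (fst p) (X (fst p) (snd p))) \<in> borel_measurable borel"
proof -
  note [measurable] = X_measurable borel_fst_snd
  have "(\<lambda>p :: real \<times> real. (fst p, X (fst p) (snd p))) \<in> borel_measurable borel" by (intro borel_measurable_Pair) measurable
  from measurable_compose[OF this assms] show ?thesis by simp
qed

lemma U_measurable: "joint_measurable U"
  unfolding U_def by (rule along_X_measurable[OF v_measurable])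

lemma U_bound: "\<bar>U t \<xi>\<bar> \<le> K" unfolding U_def by (rule v_bound)

lemma prim_U: "prim (U t) (\<lambda>\<xi>. vx t (X t \<xi>) / \<rho> t (X t \<xi>))"
  unfolding U_def[abs_def] by (rule lc.prim_f_X)

lemma U_sq_bound: "\<bar>(U t \<xi>)\<^sup>2\<bar> \<le> K\<^sup>2"
  unfolding U_def using v_sq_le by simp

lemma time_integrable:
  fixes w :: "real \<Rightarrow> real \<Rightarrow> real"
  assumes "joint_measurable w" "\<And>s. \<bar>w s \<xi>\<bar> \<le> C"
  shows "set_integrable lborel {a..b} (\<lambda>s. w s \<xi>)"
  by (rule set_integrable_bounded_Icc[where C = C]) (use assms measurable_slice[OF assms(1)] in \<open>auto simp: set_borel_measurable_def\<close>)

lemma U_sq_measurable: "(\<lambda>p. (U (fst p) (snd p))\<^sup>2) \<in> borel_measurable borel"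
  using U_measurable by measurable

text \<open>For almost every fixed \<open>y\<close> the mass to the left of \<open>y\<close> grows with the density \<open>v\<^sup>2 \<rho>\<close>;
  substituting it in \<open>s\<close> and integrating over \<open>y\<close> compares \<open>X\<close> at the times \<open>0\<close> and \<open>t\<close>.\<close>

lemma mass_swept:
  assumes t: "t \<in> G\<^sub>0" and [measurable]: "w \<in> borel_measurable borel"
  shows "AE y in lborel. (\<integral>\<^sup>+s. ennreal ((v s y)\<^sup>2 * \<rho> s y * indicator {0..t} s) * w (\<Xi> s y) \<partial>lborel)
    = (\<integral>\<^sup>+z. indicator {ini.R y..\<Xi> t y} z * w z \<partial>lborel)"
proof -
  note [measurable] = v_measurable vx_measurable borel_fst_snd \<Xi>_measurable
  define f where "f s y = (v s y)\<^sup>2 * (1 + (vx s y)\<^sup>2)" for s y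
  have fm: "joint_measurable f" unfolding f_def by measurable
  have f0: "0 \<le> f s y" for s y by (simp add: f_def)
  have "{p :: real \<times> real. 0 \<le> fst p \<longrightarrow> \<Xi> (fst p) (snd p) = ini.R (snd p) + N (fst p) (snd p)} \<in> sets borel"
  proof -
    note [measurable] = borel_measurable_integral_upto[OF fm, unfolded f_def, folded N_def] measurable_compose[OF borel_fst_snd(2) prim_measurable[OF ini.prim_R]]
    have "{p \<in> space (borel :: (real \<times> real) measure). 0 \<le> fst p \<longrightarrow> \<Xi> (fst p) (snd p) = ini.R (snd p) + N (fst p) (snd p)} \<in> sets borel" by measurable
    then show ?thesis by simp
  qed
  then have meas: "{p \<in> space (lborel \<Otimes>\<^sub>M lborel). 0 \<le> fst p \<longrightarrow> \<Xi> (fst p) (snd p) = ini.R (snd p) + N (fst p) (snd p)} \<in> sets (lborel \<Otimes>\<^sub>M lborel)"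
    unfolding lborel_prod by simp
  have "AE s in lborel. AE y in lborel. 0 \<le> s \<longrightarrow> \<Xi> s y = ini.R y + N s y"
    using G_AE
  proof eventually_elim
    case (elim s)
    show ?case
    proof (cases "0 \<le> s")
      case True
      from \<Xi>_eq[of s] True elim show ?thesis by (auto elim: eventually_mono)
    qed simp
  qed
  \<comment> \<open>Fubini: from almost every y at almost every time to almost every time at almost
    every y, so that y can be fixed while s varies.\<close>
  then have "AE y in lborel. AE s in lborel. 0 \<le> s \<longrightarrow> \<Xi> s y = ini.R y + N s y"
    using lborel_pair.AE_commute[OF meas] by simp
  with mass_flux_time_integral(3)[of t] \<Xi>_eq[OF t] show ?thesis
  proof eventually_elim
    case (elim y)
    define g where "g s = f s y * indicator {0..t} s" for s
    have gi: "set_integrable lborel {0..t} (\<lambda>s. f s y)" using elim(1) by (simp add: f_def mass_flux_eq)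
    then have "integrable lborel g" unfolding set_integrable_def g_def by (simp add: mult.commute)
    then have lg: "loc_int g" unfolding loc_int_def set_integrable_def by (intro conjI allI integrable_mult_indicator) auto
    have g0: "0 \<le> g s" for s using f0 by (simp add: g_def)
    have t0: "0 \<le> t" by (rule G0_nonneg[OF t])
    define F where "F s = ini.R y + pr g s" for s
    have pF: "prim F g" by (rule prim_cong[OF prim_add[OF prim_const[of "ini.R y"] prim_pr[OF lg]]]) (simp_all add: F_def)
    have F: "F s = ini.R y + N s y" if s: "0 \<le> s" "s \<le> t" for s
    proof -
      have "pr g s = (LBINT r:{0..s}. g r)" using prim_integral[OF prim_pr[OF lg] s(1)] by (simp add: pr_0)
      also have "\<dots> = N s y" unfolding N_def f_def[symmetric] by (rule set_lebesgue_integral_cong) (use s in \<open>auto simp: g_def\<close>)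
      finally show ?thesis by (simp add: F_def)
    qed
    have "(\<integral>\<^sup>+s. ennreal ((v s y)\<^sup>2 * \<rho> s y * indicator {0..t} s) * w (\<Xi> s y) \<partial>lborel) = (\<integral>\<^sup>+s. ennreal (g s * indicator {0..t} s) * w (F s) \<partial>lborel)"
    proof (rule nn_integral_cong_AE)
      show "AE s in lborel. ennreal ((v s y)\<^sup>2 * \<rho> s y * indicator {0..t} s) * w (\<Xi> s y) = ennreal (g s * indicator {0..t} s) * w (F s)"
        using elim(3)
      proof eventually_elim
        case (elim s)
        show ?case using elim F[of s] by (cases "s \<in> {0..t}") (auto simp: g_def f_def lc.\<rho>_def)
      qed
    qed
    also have "\<dots> = (\<integral>\<^sup>+z. indicator {F 0..F t} z * w z \<partial>lborel)"
      by (rule nn_integral_substitution_prim[OF pF g0 t0]) simp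
    also have "F 0 = ini.R y" by (simp add: F_def pr_0)
    also have "F t = \<Xi> t y" using F[OF t0 order_refl] elim(2) by simp
    finally show ?case .
  qed
qed

text \<open>The accumulated flux N is nonnegative, so the mass coordinate of a fixed point grows and
  level sets move left. The inequality for almost every y extends to all y by continuity.\<close>

lemma X_antimono: assumes t: "t \<in> G\<^sub>0" shows "X t \<xi> \<le> ini.X \<xi>"
proof -
  have ae: "AE y in lborel. max (ini.R y) (\<Xi> t y) = \<Xi> t y" using \<Xi>_eq[OF t]
  proof eventually_elim
    case (elim y)
    have "0 \<le> N t y" by (simp add: N_def set_lebesgue_integral_def)
    with elim show ?case by simp
  qed
  have "max (ini.R (ini.X \<xi>)) (\<Xi> t (ini.X \<xi>)) = \<Xi> t (ini.X \<xi>)"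
    by (rule AE_continuous_eq[OF ae]) (intro continuous_intros prim_continuous[OF lc.prim_R] prim_continuous[OF ini.prim_R])+
  then have "\<xi> \<le> \<Xi> t (ini.X \<xi>)" by (simp add: ini.R_X)
  then show ?thesis by (simp add: lc.X_le_iff)
qed

text \<open>The region between the graphs of the mass coordinate at times 0 and t is measured in two
  ways. Slices at constant label z have length ini.X z - X t z. Slices at constant y are swept by
  the mass growing at rate v^2 \<rho> (\<open>mass_swept\<close>); exchanging the integrals and
  substituting the label for y at each time s turns them into the time integral of U^2.\<close>

lemma X_gap_integral:
  assumes t: "t \<in> G\<^sub>0" and ab: "a \<le> b"
  shows "(\<integral>\<^sup>+z. indicator {a..b} z * ennreal (ini.X z - X t z) \<partial>lborel)
    = (\<integral>\<^sup>+z. indicator {a..b} z * ennreal (LBINT s:{0..t}. (U s z)\<^sup>2) \<partial>lborel)"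
proof -
  note [measurable] = v_measurable vx_measurable borel_fst_snd \<Xi>_measurable U_measurable
  define w :: "real \<Rightarrow> ennreal" where "w = indicator {a..b}"
  have wm [measurable]: "w \<in> borel_measurable borel" by (simp add: w_def)
  define F where "F s y = ennreal ((v s y)\<^sup>2 * (1 + (vx s y)\<^sup>2) * indicator {0..t} s) * w (\<Xi> s y)" for s y
  have im [measurable]: "(\<lambda>p :: real \<times> real. indicat_real {0..t} (fst p)) \<in> borel_measurable borel"
    by (rule measurable_compose[OF borel_fst_snd(1)]) simp
  have Fm: "joint_measurable F" unfolding F_def by measurable
  have rm [measurable]: "(\<lambda>p. ini.R (fst p)) \<in> borel_measurable (borel :: (real \<times> real) measure)"
    by (rule measurable_compose[OF borel_fst_snd(1) prim_measurable[OF ini.prim_R]])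
  have Rtm [measurable]: "(\<lambda>p. \<Xi> t (fst p)) \<in> borel_measurable (borel :: (real \<times> real) measure)"
    by (rule measurable_compose[OF borel_fst_snd(1) prim_measurable[OF lc.prim_R]])
  define H where "H y z = indicator {ini.R y..\<Xi> t y} z * w z" for y z
  have Hm: "joint_measurable H"
  proof -
    have "(\<lambda>p. (if ini.R (fst p) \<le> snd p \<and> snd p \<le> \<Xi> t (fst p) then w (snd p) else 0)) \<in> borel_measurable (borel :: (real \<times> real) measure)" by measurable
    then show ?thesis by (rule measurable_cong[THEN iffD1, rotated]) (auto simp: H_def indicator_def)
  qed
  have pm: "case_prod E \<in> borel_measurable (lborel \<Otimes>\<^sub>M lborel)" if "joint_measurable E"
    for E :: "real \<Rightarrow> real \<Rightarrow> ennreal"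
    using that by (simp add: lborel_prod case_prod_beta')
  have "(\<integral>\<^sup>+z. indicator {a..b} z * ennreal (ini.X z - X t z) \<partial>lborel) = (\<integral>\<^sup>+z. \<integral>\<^sup>+y. H y z \<partial>lborel \<partial>lborel)"
  proof (rule nn_integral_cong)
    fix z
    have "H y z = w z * indicator {X t z..ini.X z} y" for y
      unfolding H_def by (auto simp: indicator_def lc.X_le_iff ini.le_X_iff)
    then have "(\<integral>\<^sup>+y. H y z \<partial>lborel) = w z * emeasure lborel {X t z..ini.X z}" by (simp add: nn_integral_cmult)
    then show "indicator {a..b} z * ennreal (ini.X z - X t z) = (\<integral>\<^sup>+y. H y z \<partial>lborel)"
      using X_antimono[OF t, of z] by (simp add: w_def)
  qed
  also have "\<dots> = (\<integral>\<^sup>+y. \<integral>\<^sup>+z. H y z \<partial>lborel \<partial>lborel)" by (rule lborel_pair.Fubini'[OF pm[OF Hm]])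
  also have "\<dots> = (\<integral>\<^sup>+y. \<integral>\<^sup>+s. F s y \<partial>lborel \<partial>lborel)"
  proof (rule nn_integral_cong_AE)
    show "AE y in lborel. (\<integral>\<^sup>+z. H y z \<partial>lborel) = (\<integral>\<^sup>+s. F s y \<partial>lborel)"
      using mass_swept[OF t wm] by eventually_elim (simp add: H_def F_def lc.\<rho>_def)
  qed
  also have "\<dots> = (\<integral>\<^sup>+s. \<integral>\<^sup>+y. F s y \<partial>lborel \<partial>lborel)" by (rule lborel_pair.Fubini'[OF pm[OF Fm]])
  also have "\<dots> = (\<integral>\<^sup>+s. \<integral>\<^sup>+z. indicator {0..t} s * (indicator {a..b} z * ennreal ((U s z)\<^sup>2)) \<partial>lborel \<partial>lborel)"
  proof (rule nn_integral_cong)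
    fix s
    have vm: "(\<lambda>y. ennreal ((v s y)\<^sup>2)) \<in> borel_measurable borel" using loc_int_measurable[OF loc_int_v] by measurable
    have "F s y = indicator {0..t} s * (ennreal (\<rho> s y * indicator {X s a..X s b} y) * ennreal ((v s y)\<^sup>2))" for y
      unfolding F_def w_def using lc.\<rho>_pos[of s y]
      by (auto simp: indicator_def lc.X_le_iff lc.le_X_iff lc.\<rho>_def mult.commute simp flip: ennreal_mult)
    then have "(\<integral>\<^sup>+y. F s y \<partial>lborel) = (\<integral>\<^sup>+y. indicator {0..t} s * (ennreal (\<rho> s y * indicator {X s a..X s b} y) * ennreal ((v s y)\<^sup>2)) \<partial>lborel)" by simp
    also have "\<dots> = indicator {0..t} s * (\<integral>\<^sup>+y. ennreal (\<rho> s y * indicator {X s a..X s b} y) * ennreal ((v s y)\<^sup>2) \<partial>lborel)"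
      using lc.\<rho>_measurable vm loc_int_measurable[OF loc_int_v] by (intro nn_integral_cmult) measurable
    also have "\<dots> = indicator {0..t} s * (\<integral>\<^sup>+z. indicator {a..b} z * ennreal ((U s z)\<^sup>2) \<partial>lborel)"
      using lc.nn_integral_X[OF vm ab] by (simp add: U_def)
    also have "\<dots> = (\<integral>\<^sup>+z. indicator {0..t} s * (indicator {a..b} z * ennreal ((U s z)\<^sup>2)) \<partial>lborel)"
      using prim_measurable[OF prim_U] by (intro nn_integral_cmult[symmetric]) measurable
    finally show "(\<integral>\<^sup>+y. F s y \<partial>lborel) = (\<integral>\<^sup>+z. indicator {0..t} s * (indicator {a..b} z * ennreal ((U s z)\<^sup>2)) \<partial>lborel)" .
  qed
  also have "\<dots> = (\<integral>\<^sup>+z. \<integral>\<^sup>+s. indicator {0..t} s * (indicator {a..b} z * ennreal ((U s z)\<^sup>2)) \<partial>lborel \<partial>lborel)"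
  proof (rule lborel_pair.Fubini'[symmetric])
    have "(\<lambda>p :: real \<times> real. indicator {0..t} (fst p) * (indicator {a..b} (snd p) * ennreal ((U (fst p) (snd p))\<^sup>2)) :: ennreal) \<in> borel_measurable borel"
      by (intro borel_measurable_times_ennreal measurable_compose[OF borel_fst_snd(1)] measurable_compose[OF borel_fst_snd(2)])
        (use U_sq_measurable in measurable)
    from pm[OF this] show "(\<lambda>(s, z). indicator {0..t} s * (indicator {a..b} z * ennreal ((U s z)\<^sup>2))) \<in> borel_measurable (lborel \<Otimes>\<^sub>M lborel)" by simp
  qed
  also have "\<dots> = (\<integral>\<^sup>+z. indicator {a..b} z * ennreal (LBINT s:{0..t}. (U s z)\<^sup>2) \<partial>lborel)"
  proof (rule nn_integral_cong)
    fix z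
    note sm = measurable_slice[OF U_measurable, of z]
    have i: "set_integrable lborel {0..t} (\<lambda>s. (U s z)\<^sup>2)" by (rule time_integrable[OF U_sq_measurable U_sq_bound])
    have "(\<integral>\<^sup>+s. indicator {0..t} s * (indicator {a..b} z * ennreal ((U s z)\<^sup>2)) \<partial>lborel)
      = (\<integral>\<^sup>+s. indicator {a..b} z * ennreal (indicator {0..t} s *\<^sub>R (U s z)\<^sup>2) \<partial>lborel)"
      by (intro nn_integral_cong) (auto simp: indicator_def)
    also have "\<dots> = indicator {a..b} z * (\<integral>\<^sup>+s. ennreal (indicator {0..t} s *\<^sub>R (U s z)\<^sup>2) \<partial>lborel)"
      using sm by (intro nn_integral_cmult) measurable
    also have "(\<integral>\<^sup>+s. ennreal (indicator {0..t} s *\<^sub>R (U s z)\<^sup>2) \<partial>lborel) = ennreal (LBINT s:{0..t}. (U s z)\<^sup>2)"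
      unfolding set_lebesgue_integral_def using i by (intro nn_integral_eq_integral) (auto simp: set_integrable_def)
    finally show "(\<integral>\<^sup>+s. indicator {0..t} s * (indicator {a..b} z * ennreal ((U s z)\<^sup>2)) \<partial>lborel)
      = indicator {a..b} z * ennreal (LBINT s:{0..t}. (U s z)\<^sup>2)" .
  qed
  finally show ?thesis .
qed

text \<open>\<open>X_gap_integral\<close> equates the integrals of both displacements over every
  label interval, and both are continuous in the label. The equation X' = -U^2 is thus obtained in
  integrated form although its right-hand side is only Hoelder continuous in x.\<close>

lemma X_characteristic:
  assumes t: "t \<in> G\<^sub>0" shows "X t \<xi> = ini.X \<xi> - (LBINT s:{0..t}. (U s \<xi>)\<^sup>2)"
proof -
  define J where "J z = (LBINT s:{0..t}. (U s z)\<^sup>2)" for z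
  have Jc: "continuous_on UNIV J" unfolding J_def[abs_def]
    by (rule time_integral_continuous[OF U_sq_measurable null_sets.empty_sets _ U_sq_bound]) (intro continuous_intros prim_continuous[OF prim_U])
  define D where "D z = ini.X z - X t z" for z
  have Dc: "continuous_on UNIV D" unfolding D_def[abs_def] by (intro continuous_intros X_continuous prim_continuous[OF ini.prim_X])
  have lJ: "loc_int J" and lD: "loc_int D" by (rule loc_int_continuous[OF Jc], rule loc_int_continuous[OF Dc])
  have nn: "0 \<le> J z" "0 \<le> D z" for z
    using X_antimono[OF t, of z] by (simp_all add: J_def D_def set_lebesgue_integral_def)
  have gap: "(LBINT z:{a..b}. D z - J z) = 0" if ab: "a \<le> b" for a b
  proof -
    have e: "(\<integral>\<^sup>+z. indicator {a..b} z * ennreal (w z) \<partial>lborel) = ennreal (LBINT z:{a..b}. w z)" if w: "loc_int w" "\<And>z. 0 \<le> w z" for w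
    proof -
      have "(\<integral>\<^sup>+z. indicator {a..b} z * ennreal (w z) \<partial>lborel) = (\<integral>\<^sup>+z. ennreal (indicator {a..b} z *\<^sub>R w z) \<partial>lborel)"
        by (intro nn_integral_cong) (auto simp: indicator_def)
      also have "\<dots> = ennreal (LBINT z:{a..b}. w z)"
        unfolding set_lebesgue_integral_def using loc_int_integrable[OF w(1), of a b] w(2) by (intro nn_integral_eq_integral) (auto simp: set_integrable_def)
      finally show ?thesis .
    qed
    have "0 \<le> (LBINT z:{a..b}. w z)" if "\<And>z. 0 \<le> w z" for w :: "real \<Rightarrow> real" using that by (simp add: set_lebesgue_integral_def)
    then have "(LBINT z:{a..b}. D z) = (LBINT z:{a..b}. J z)"
      using X_gap_integral[OF t ab] nn unfolding D_def[symmetric] J_def[symmetric] e[OF lD nn(2)] e[OF lJ nn(1)] by simp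
    then show ?thesis by (simp add: set_integral_diff(2) loc_int_integrable lD lJ)
  qed
  have "AE z in lborel. D z - J z = 0" by (rule AE_eq_0_of_prim_0[OF loc_int_diff[OF lD lJ]]) (rule gap)
  then have "AE z in lborel. D z = J z" by eventually_elim simp
  from AE_continuous_eq[OF this Dc Jc, of \<xi>] show ?thesis by (simp add: D_def J_def)
qed

end

section \<open>Evolution of the velocity along characteristics\<close>

section \<open>The velocity along characteristics\<close>

lemma abs_quotient_le: "0 < c \<Longrightarrow> \<bar>a\<bar> \<le> c * b \<Longrightarrow> \<bar>a / c\<bar> \<le> (b :: real)"
  by (simp add: pos_divide_le_eq mult.commute)

lemma set_integral_AE_bound:
  assumes ab: "a \<le> b" and m: "g \<in> borel_measurable borel" and C: "AE s in lborel. a \<le> s \<longrightarrow> s \<le> b \<longrightarrow> \<bar>g s\<bar> \<le> C" and "0 \<le> C"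
  shows "\<bar>LBINT s:{a..b}. g s :: real\<bar> \<le> C * (b - a)"
proof -
  have "(LBINT s:{a..b}. g s) = (LBINT s:{a..b}. max (- C) (min C (g s)))"
  proof (rule set_integral_AE_cong)
    show "AE s in lborel. s \<in> {a..b} \<longrightarrow> g s = max (- C) (min C (g s))"
      using C by eventually_elim (auto simp: max_def min_def)
  qed (use m in \<open>simp_all add: set_borel_measurable_def\<close>)
  then show ?thesis using set_integral_norm_le[OF ab, of "\<lambda>s. max (- C) (min C (g s))" C] \<open>0 \<le> C\<close> by (simp add: abs_le_iff)
qed

context regular_solution
begin

lemma src_measurable: "joint_measurable src"
  by (rule source_measurable[OF v_measurable vx_measurable v_H1])

lemma v_space: assumes "\<bar>x - y\<bar> \<le> \<eta>" "\<eta> \<le> 1" shows "\<bar>v t x - v t y\<bar> \<le> sqrt (\<eta> * h)"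
proof -
  have "\<bar>v t x - v t y\<bar> \<le> sqrt (\<bar>x - y\<bar> * h)"
  proof (cases "x \<le> y")
    case True then show ?thesis using v_Holder[of "y - x" t x] assms by (simp add: abs_minus_commute)
  next
    case False then show ?thesis using v_Holder[of "x - y" t y] assms by simp
  qed
  also have "\<dots> \<le> sqrt (\<eta> * h)" using assms(1) h_nonneg by (simp add: mult_right_mono)
  finally show ?thesis .
qed

lemma X_increment:
  assumes t: "t1 \<in> G\<^sub>0" "t2 \<in> G\<^sub>0" "t1 \<le> t2"
  shows "X t2 \<xi> - X t1 \<xi> = - (LBINT s:{t1..t2}. (U s \<xi>)\<^sup>2)" "\<bar>X t2 \<xi> - X t1 \<xi>\<bar> \<le> K\<^sup>2 * (t2 - t1)"
proof -
  show e: "X t2 \<xi> - X t1 \<xi> = - (LBINT s:{t1..t2}. (U s \<xi>)\<^sup>2)"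
    using X_characteristic[OF t(1), of \<xi>] X_characteristic[OF t(2), of \<xi>]
      set_integral_Icc_split[OF G0_nonneg[OF t(1)] t(3) time_integrable[OF U_sq_measurable U_sq_bound]] by simp
  show "\<bar>X t2 \<xi> - X t1 \<xi>\<bar> \<le> K\<^sup>2 * (t2 - t1)"
    unfolding e using set_integral_norm_le[OF t(3), of "\<lambda>s. (U s \<xi>)\<^sup>2" "K\<^sup>2"] U_sq_bound by simp
qed

definition "win k t y = (LBINT x:{y..y+k}. v t x)"
definition "slope k t y = v t (y + k) - v t y"
text \<open>The formal time derivative of the integral of v over [X, X + k]: the flux through the
  window plus X' = -U^2 times the difference of the end values.\<close>

definition "drift k \<xi> s = flux h v vx k s (X s \<xi>) - slope k s (X s \<xi>) * (U s \<xi>)\<^sup>2"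

lemma drift_measurable: "0 \<le> k \<Longrightarrow> drift k \<xi> \<in> borel_measurable borel"
proof -
  assume k: "0 \<le> k"
  note [measurable] = v_measurable borel_fst_snd measurable_shift[OF v_measurable, of k]
  note d [measurable] = dxinv_measurable[OF src_measurable loc_int_src] measurable_compose[OF borel_fst_snd(1) borel_measurable_sint[OF src_measurable]]
  have P [measurable]: "(\<lambda>p. pr (src (fst p)) (snd p)) \<in> borel_measurable borel" unfolding pr_eq_dxinv[OF loc_int_src] by measurable
  note [measurable] = measurable_shift[OF P, of k]
  have f: "flux h v vx k s y = (v s (y + k))^3 / 3 - (v s y)^3 / 3 + (pr (src s) (y + k) - pr (src s) y)" for s y
    using k by (simp add: flux_def prim_integral[OF prim_pr[OF loc_int_src]])
  have "(\<lambda>p. flux h v vx k (fst p) (snd p) - slope k (fst p) (snd p) * (v (fst p) (snd p))\<^sup>2) \<in> borel_measurable borel"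
    unfolding f slope_def by measurable
  from measurable_slice[OF along_X_measurable[OF this], of \<xi>] show ?thesis by (simp add: drift_def[abs_def] U_def)
qed

lemma slope_bound: "\<bar>slope k t y\<bar> \<le> 2 * K"
  using v_bound[of t "y + k"] v_bound[of t y] unfolding slope_def by linarith

lemma drift_integrable: assumes "0 \<le> k" "k \<le> 1" shows "set_integrable lborel {a..b} (drift k \<xi>)"
proof (rule set_integrable_bounded_Icc[where C = "CF + 2 * K * K\<^sup>2"])
  fix s
  have "\<bar>slope k s (X s \<xi>) * (U s \<xi>)\<^sup>2\<bar> \<le> 2 * K * K\<^sup>2"
    unfolding abs_mult using slope_bound U_sq_bound K_nonneg by (intro mult_mono) auto
  then show "norm (drift k \<xi> s) \<le> CF + 2 * K * K\<^sup>2"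
    using flux_bound[OF assms, of s "X s \<xi>"] unfolding drift_def real_norm_def by linarith
qed (use drift_measurable[OF assms(1)] in \<open>simp add: set_borel_measurable_def\<close>)

lemma cube_diff: "\<bar>a\<bar> \<le> K \<Longrightarrow> \<bar>b\<bar> \<le> K \<Longrightarrow> \<bar>a - b\<bar> \<le> e \<Longrightarrow> \<bar>a^3 / 3 - b^3 / 3\<bar> \<le> K\<^sup>2 * e" for a b :: real
proof -
  assume a: "\<bar>a\<bar> \<le> K" "\<bar>b\<bar> \<le> K" "\<bar>a - b\<bar> \<le> e"
  have q: "\<bar>x * y\<bar> \<le> K\<^sup>2" if "\<bar>x\<bar> \<le> K" "\<bar>y\<bar> \<le> K" for x y
    unfolding abs_mult power2_eq_square[of K] using that by (intro mult_mono) auto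
  have "\<bar>a * a + a * b + b * b\<bar> \<le> 3 * K\<^sup>2" using q[OF a(1) a(1)] q[OF a(1) a(2)] q[OF a(2) a(2)] by linarith
  then have "\<bar>a * a + a * b + b * b\<bar> * \<bar>a - b\<bar> \<le> 3 * K\<^sup>2 * e" using a by (intro mult_mono) auto
  moreover have "a^3 / 3 - b^3 / 3 = (a * a + a * b + b * b) * (a - b) / 3" by (simp add: power3_eq_cube field_simps)
  then have "\<bar>a^3 / 3 - b^3 / 3\<bar> = \<bar>a * a + a * b + b * b\<bar> * \<bar>a - b\<bar> / 3" by (simp only: abs_mult abs_divide abs_numeral)
  ultimately show ?thesis by linarith
qed

text \<open>To first order the increment of \<open>win k t (X t \<xi>)\<close> over a short time is the drift; the exponents of the two moduli of continuity do not matter.\<close>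

lemma window_along_characteristic_local:
  assumes k: "0 \<le> k" "k \<le> 1" and e: "0 < e"
  obtains d where "0 < d" "\<And>t1 t2. t1 \<in> G\<^sub>0 \<Longrightarrow> t2 \<in> G\<^sub>0 \<Longrightarrow> t1 \<le> t2 \<Longrightarrow> t2 - t1 < d \<Longrightarrow>
    \<bar>win k t2 (X t2 \<xi>) - win k t1 (X t1 \<xi>) - (LBINT s:{t1..t2}. drift k \<xi> s)\<bar> \<le> e * (8 * K\<^sup>2 + 2 * Cs) * (t2 - t1)"
proof -
  obtain d0 where d0: "0 < d0" "\<And>t1 t2 y. t1 \<in> G\<^sub>0 \<Longrightarrow> t2 \<in> G\<^sub>0 \<Longrightarrow> \<bar>t2 - t1\<bar> < d0 \<Longrightarrow> \<bar>v t2 y - v t1 y\<bar> < e"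
    using time_modulus[OF e] by blast
  \<comment> \<open>A spatial scale on which v oscillates by at most e; \<open>d\<close> is so short
    that the characteristic moves by at most \<eta> and v changes by less than e in time.\<close>
  define \<eta> where "\<eta> = min (min 1 e) (e\<^sup>2 / (1 + h))"
  have \<eta>: "0 < \<eta>" "\<eta> \<le> 1" "\<eta> \<le> e" using e h_nonneg by (auto simp: \<eta>_def add_pos_nonneg)
  have "\<eta> * h \<le> e\<^sup>2 / (1 + h) * (1 + h)" using h_nonneg e by (intro mult_mono) (auto simp: \<eta>_def)
  also have "\<dots> = e\<^sup>2" using h_nonneg by simp
  finally have s\<eta>: "sqrt (\<eta> * h) \<le> e" using e by (intro real_le_lsqrt) auto
  define d where "d = min d0 (\<eta> / (1 + K\<^sup>2))"
  have K1: "0 < 1 + K\<^sup>2" by (simp add: add_pos_nonneg)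
  have d: "0 < d" using d0 \<eta> K1 by (simp add: d_def)
  show thesis
  proof (rule that[OF d])
    fix t1 t2 assume t: "t1 \<in> G\<^sub>0" "t2 \<in> G\<^sub>0" "t1 \<le> t2" and td: "t2 - t1 < d"
    define x where "x = X t1 \<xi>"
    have "K\<^sup>2 * (t2 - t1) \<le> (1 + K\<^sup>2) * (t2 - t1)" using t by (intro mult_right_mono) auto
    also have "\<dots> \<le> (1 + K\<^sup>2) * (\<eta> / (1 + K\<^sup>2))" using td K1 by (intro mult_left_mono) (auto simp: d_def)
    also have "\<dots> = \<eta>" using K1 by simp
    finally have Kd: "K\<^sup>2 * (t2 - t1) \<le> \<eta>" .
    have near: "\<bar>X s \<xi> - x\<bar> \<le> \<eta>" if s: "s \<in> G\<^sub>0" "t1 \<le> s" "s \<le> t2" for s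
    proof -
      have "\<bar>X s \<xi> - X t1 \<xi>\<bar> \<le> K\<^sup>2 * (s - t1)" by (rule X_increment(2)[OF t(1) s(1,2)])
      also have "\<dots> \<le> K\<^sup>2 * (t2 - t1)" using s by (intro mult_left_mono) auto
      finally show ?thesis using Kd by (simp add: x_def)
    qed
    have vs: "\<bar>v r y - v r z\<bar> \<le> e" if "\<bar>y - z\<bar> \<le> \<eta>" for r y z using v_space[OF that \<eta>(2), of r] s\<eta> by linarith
    have sl: "\<bar>slope k r y - slope k r z\<bar> \<le> 2 * e" if "\<bar>y - z\<bar> \<le> \<eta>" for r y z
      using vs[of y z r] vs[of "y + k" "z + k" r] that unfolding slope_def by simp
    have 1: "win k t2 x - win k t1 x = (LBINT s:{t1..t2}. flux h v vx k s x)" unfolding win_def by (rule window_diff[OF t k])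
    have pw: "prim (\<lambda>y. win k t2 y) (\<lambda>y. slope k t2 y)"
    proof -
      have c: "continuous_on UNIV (\<lambda>y. slope k t2 y)" unfolding slope_def
        by (intro continuous_intros v_continuous continuous_on_compose2[OF v_continuous]) auto
      note P = prim_pr[OF loc_int_v, of t2]
      show ?thesis
        by (rule prim_cong[OF prim_diff[OF prim_shift[OF P, of k] P]]) (use k in \<open>simp_all add: win_def slope_def prim_integral[OF P]\<close>)
    qed
    have Xle: "X t2 \<xi> \<le> x"
    proof -
      have "0 \<le> (LBINT s:{t1..t2}. (U s \<xi>)\<^sup>2)" by (simp add: set_lebesgue_integral_def)
      with X_increment(1)[OF t, of \<xi>] show ?thesis by (simp add: x_def)
    qed
    have 2: "\<bar>win k t2 x - win k t2 (X t2 \<xi>) - (x - X t2 \<xi>) * slope k t2 x\<bar> \<le> (x - X t2 \<xi>) * (2 * e)"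
    proof -
      have "win k t2 x - win k t2 (X t2 \<xi>) = (LBINT y:{X t2 \<xi>..X t2 \<xi> + (x - X t2 \<xi>)}. slope k t2 y)"
        using prim_integral[OF pw Xle] by simp
      moreover have "\<bar>(LBINT y:{X t2 \<xi>..X t2 \<xi> + (x - X t2 \<xi>)}. slope k t2 y) - (x - X t2 \<xi>) * slope k t2 x\<bar> \<le> (x - X t2 \<xi>) * (2 * e)"
      proof (rule average_osc[OF prim_loc_int[OF pw]])
        fix y assume "X t2 \<xi> \<le> y" "y \<le> X t2 \<xi> + (x - X t2 \<xi>)"
        then have "\<bar>y - x\<bar> \<le> \<eta>" using near[OF t(2,3)] by simp
        then show "\<bar>slope k t2 y - slope k t2 x\<bar> \<le> 2 * e" by (rule sl)
      qed (use Xle in simp)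
      ultimately show ?thesis by simp
    qed
    have 3: "x - X t2 \<xi> = (LBINT s:{t1..t2}. (U s \<xi>)\<^sup>2)" using X_increment(1)[OF t, of \<xi>] by (simp add: x_def)
    have "x - X t2 \<xi> \<le> K\<^sup>2 * (t2 - t1)" using X_increment(2)[OF t, of \<xi>] by (simp add: x_def)
    then have 4: "(x - X t2 \<xi>) * (2 * e) \<le> e * (2 * K\<^sup>2) * (t2 - t1)"
      using mult_right_mono[of "x - X t2 \<xi>" "K\<^sup>2 * (t2 - t1)" "2 * e"] e by (simp add: mult_ac)
    \<comment> \<open>The error in the drift from freezing the position at time t1 and the slope at
      time t2.\<close>
    define g where "g s = drift k \<xi> s - (flux h v vx k s x - slope k t2 x * (U s \<xi>)\<^sup>2)" for s
    note fm = flux_measurable[OF v_measurable vx_measurable v_H1, of h k x] and um = measurable_slice[OF U_measurable, of \<xi>]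
    have gm: "g \<in> borel_measurable borel" unfolding g_def[abs_def] using drift_measurable[OF k(1), of \<xi>] fm um by measurable
    have gb: "\<bar>g s\<bar> \<le> e * (6 * K\<^sup>2 + 2 * Cs)" if s: "s \<in> G\<^sub>0" "t1 \<le> s" "s \<le> t2" for s
    proof -
      define y where "y = X s \<xi>"
      have yx: "\<bar>y - x\<bar> \<le> \<eta>" unfolding y_def by (rule near[OF s])
      have c: "\<bar>(v s a)^3 / 3 - (v s b)^3 / 3\<bar> \<le> K\<^sup>2 * e" if "\<bar>a - b\<bar> \<le> \<eta>" for a b by (intro cube_diff v_bound vs that)
      note P = prim_pr[OF loc_int_src, of s]
      have p: "\<bar>pr (src s) a - pr (src s) b\<bar> \<le> Cs * e" if "\<bar>a - b\<bar> \<le> \<eta>" for a b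
      proof -
        have "\<bar>pr (src s) a - pr (src s) b\<bar> \<le> Cs * \<bar>a - b\<bar>" by (rule prim_lipschitz[OF P src_bound])
        also have "\<dots> \<le> Cs * e" using that \<eta> Cs_nonneg by (intro mult_left_mono) auto
        finally show ?thesis .
      qed
      have yx': "\<bar>y + k - (x + k)\<bar> \<le> \<eta>" using yx by simp
      have F: "\<bar>flux h v vx k s y - flux h v vx k s x\<bar> \<le> 2 * (K\<^sup>2 * e) + 2 * (Cs * e)"
        using c[OF yx] c[OF yx'] p[OF yx] p[OF yx'] k unfolding flux_def by (simp add: prim_integral[OF P])
      have ts: "\<bar>v s z - v t2 z\<bar> \<le> e" for z using d0(2)[OF t(2) s(1), of z] s td by (auto simp: d_def)
      have "\<bar>slope k s y - slope k t2 x\<bar> \<le> 4 * e"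
        using sl[OF yx, of s] ts[of "x + k"] ts[of x] unfolding slope_def by linarith
      then have "\<bar>(slope k s y - slope k t2 x) * (U s \<xi>)\<^sup>2\<bar> \<le> 4 * e * K\<^sup>2"
        unfolding abs_mult by (intro mult_mono U_sq_bound) (use e in auto)
      moreover have "g s = (flux h v vx k s y - flux h v vx k s x) - (slope k s y - slope k t2 x) * (U s \<xi>)\<^sup>2"
        unfolding g_def drift_def y_def by (simp add: algebra_simps)
      ultimately have "\<bar>g s\<bar> \<le> 2 * (K\<^sup>2 * e) + 2 * (Cs * e) + 4 * e * K\<^sup>2" using F by linarith
      then show ?thesis by (simp add: algebra_simps)
    qed
    have 5: "\<bar>LBINT s:{t1..t2}. g s\<bar> \<le> e * (6 * K\<^sup>2 + 2 * Cs) * (t2 - t1)"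
    proof (rule set_integral_AE_bound[OF t(3) gm])
      show "AE s in lborel. t1 \<le> s \<longrightarrow> s \<le> t2 \<longrightarrow> \<bar>g s\<bar> \<le> e * (6 * K\<^sup>2 + 2 * Cs)"
        using G_AE by eventually_elim (use gb G0_nonneg[OF t(1)] in auto)
    qed (use e Cs_nonneg in simp)
    have i: "set_integrable lborel {t1..t2} (\<lambda>s. flux h v vx k s x)" "set_integrable lborel {t1..t2} (\<lambda>s. slope k t2 x * (U s \<xi>)\<^sup>2)"
      by (rule flux_integrable[OF k], rule set_integrable_mult_right, rule time_integrable[OF U_sq_measurable U_sq_bound])
    have 6: "(LBINT s:{t1..t2}. g s) = (LBINT s:{t1..t2}. drift k \<xi> s) - ((LBINT s:{t1..t2}. flux h v vx k s x) - slope k t2 x * (x - X t2 \<xi>))"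
      unfolding g_def 3 using i drift_integrable[OF k] by (simp add: set_integral_diff)
    have "\<bar>win k t2 (X t2 \<xi>) - win k t1 x - (LBINT s:{t1..t2}. drift k \<xi> s)\<bar> \<le> e * (2 * K\<^sup>2) * (t2 - t1) + e * (6 * K\<^sup>2 + 2 * Cs) * (t2 - t1)"
      using 1 2 4 5 6 by (simp add: mult.commute[of "slope k t2 x"])
    also have "\<dots> = e * (8 * K\<^sup>2 + 2 * Cs) * (t2 - t1)" by (simp add: algebra_simps)
    finally show "\<bar>win k t2 (X t2 \<xi>) - win k t1 (X t1 \<xi>) - (LBINT s:{t1..t2}. drift k \<xi> s)\<bar> \<le> e * (8 * K\<^sup>2 + 2 * Cs) * (t2 - t1)"
      by (simp add: x_def)
  qed
qed

text \<open>The retained times are dense but do not form an interval, so the subdivision points are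
  picked among them: each step back has length between d/2 and d, and finitely many steps reach
  0.\<close>

lemma telescope:
  fixes D :: "real \<Rightarrow> real"
  assumes d: "0 < d" and D: "\<And>t1 t2. t1 \<in> G\<^sub>0 \<Longrightarrow> t2 \<in> G\<^sub>0 \<Longrightarrow> t1 \<le> t2 \<Longrightarrow> t2 - t1 < d \<Longrightarrow> \<bar>D t2 - D t1\<bar> \<le> C * (t2 - t1)" and t: "t \<in> G\<^sub>0"
  shows "\<bar>D t - D 0\<bar> \<le> C * t"
proof -
  obtain n :: nat where "t < real n * (d / 2)" using reals_Archimedean3[of "d / 2"] d by auto
  with t show ?thesis
  proof (induction n arbitrary: t)
    case 0 then show ?case using G0_nonneg[of t] by simp
  next
    case (Suc n)
    show ?case
    proof (cases "t < d")
      case True then show ?thesis using D[of 0 t] Suc.prems(1) G0_nonneg[of t] by simp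
    next
      case False
      obtain r where r: "r \<in> G" "t - d < r" "r < t - d / 2" using G_dense[of "t - d" "t - d / 2"] False d by auto
      then have "\<bar>D r - D 0\<bar> \<le> C * r" using Suc.prems(2) by (intro Suc.IH) (auto simp: algebra_simps)
      moreover have "\<bar>D t - D r\<bar> \<le> C * (t - r)" using r Suc.prems(1) d by (intro D) auto
      ultimately show ?thesis by (simp add: algebra_simps)
    qed
  qed
qed

text \<open>The local error is e times the length of the time step, so it adds up to a multiple of e
  t, and e is arbitrary.\<close>

lemma window_along_characteristic:
  assumes t: "t \<in> G\<^sub>0" and k: "0 \<le> k" "k \<le> 1"
  shows "win k t (X t \<xi>) = win k 0 (X 0 \<xi>) + (LBINT s:{0..t}. drift k \<xi> s)"
proof -
  define D where "D t = win k t (X t \<xi>) - (LBINT s:{0..t}. drift k \<xi> s)" for t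
  define C where "C = 8 * K\<^sup>2 + 2 * Cs"
  have C: "0 \<le> C" using Cs_nonneg by (simp add: C_def)
  have "\<bar>D t - D 0\<bar> \<le> 0 + e" if e: "0 < e" for e
  proof -
    define e' where "e' = e / ((1 + C) * (1 + t))"
    have pos: "0 < (1 + C) * (1 + t)" using C G0_nonneg[OF t] by (intro mult_pos_pos) auto
    have e': "0 < e'" using e pos by (simp add: e'_def)
    obtain d where d: "0 < d" "\<And>t1 t2. t1 \<in> G\<^sub>0 \<Longrightarrow> t2 \<in> G\<^sub>0 \<Longrightarrow> t1 \<le> t2 \<Longrightarrow> t2 - t1 < d \<Longrightarrow>
      \<bar>win k t2 (X t2 \<xi>) - win k t1 (X t1 \<xi>) - (LBINT s:{t1..t2}. drift k \<xi> s)\<bar> \<le> e' * (8 * K\<^sup>2 + 2 * Cs) * (t2 - t1)"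
      using window_along_characteristic_local[OF k e', of \<xi>] by blast
    have "\<bar>D t - D 0\<bar> \<le> e' * C * t"
    proof (rule telescope[OF d(1) _ t])
      fix t1 t2 assume tt: "t1 \<in> G\<^sub>0" "t2 \<in> G\<^sub>0" "t1 \<le> t2" "t2 - t1 < d"
      show "\<bar>D t2 - D t1\<bar> \<le> e' * C * (t2 - t1)"
        using d(2)[OF tt] set_integral_Icc_split[OF G0_nonneg[OF tt(1)] tt(3) drift_integrable[OF k]] by (simp add: D_def C_def)
    qed
    also have "\<dots> \<le> e' * ((1 + C) * (1 + t))"
      using e' C G0_nonneg[OF t] by (simp only: mult.assoc, intro mult_left_mono mult_mono) auto
    also have "\<dots> = e"
    proof -
      have "e / p * p = e" if "0 < p" for p using that by simp
      from this[OF pos] show ?thesis by (simp only: e'_def)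
    qed
    finally show ?thesis by simp
  qed
  then have "\<bar>D t - D 0\<bar> \<le> 0" by (rule field_le_epsilon)
  then show ?thesis by (simp add: D_def)
qed

text \<open>Divide the window identity by k and let k tend to 0. Window means tend to v(X) and the
  mean of the source to its value. What remains of the drift is quadratic in the increment of v over
  the window, and Cauchy-Schwarz bounds it by k times the energy in the window, which tends to 0.
  The total energy h provides the dominating function.\<close>

lemma U_characteristic:
  assumes t: "t \<in> G\<^sub>0" shows "U t \<xi> = u0 (ini.X \<xi>) + (LBINT s:{0..t}. src s (X s \<xi>))"
proof -
  define k where "k n = 1 / real (Suc n)" for n
  have k: "0 < k n" "k n \<le> 1" for n by (simp_all add: k_def)
  have k0: "k \<longlonglongrightarrow> 0" unfolding k_def[abs_def] by (rule LIMSEQ_inverse_real_of_nat[unfolded inverse_eq_divide])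
  have win_lim: "(\<lambda>n. win (k n) s y / k n) \<longlonglongrightarrow> v s y" for s y
  proof (rule LIM_zero_cancel, rule Lim_null_comparison)
    have "(\<lambda>n. sqrt (k n * h)) \<longlonglongrightarrow> sqrt (0 * h)" by (intro tendsto_intros k0)
    then show "(\<lambda>n. sqrt (k n * h)) \<longlonglongrightarrow> 0" by simp
    show "\<forall>\<^sub>F n in sequentially. norm (win (k n) s y / k n - v s y) \<le> sqrt (k n * h)"
    proof (intro always_eventually allI)
      fix n
      have "\<bar>win (k n) s y - k n * v s y\<bar> \<le> k n * sqrt (k n * h)" unfolding win_def
        by (rule average_osc[OF loc_int_v less_imp_le[OF k(1)]]) (auto intro!: v_space k)
      moreover have "win (k n) s y / k n - v s y = (win (k n) s y - k n * v s y) / k n" using k(1)[of n] by (simp add: diff_divide_distrib)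
      ultimately show "norm (win (k n) s y / k n - v s y) \<le> sqrt (k n * h)"
        unfolding real_norm_def by (simp only: abs_quotient_le[OF k(1)])
    qed
  qed
  \<comment> \<open>With a = v(X + k) and b = v(X): a^3/3 - b^3/3 - (a - b) b^2 = (a - b)^2 (a + 2
    b)/3.\<close>
  define r where "r n s = (v s (X s \<xi> + k n) - U s \<xi>)\<^sup>2 * (v s (X s \<xi> + k n) + 2 * U s \<xi>) / 3" for n s
  have dr: "drift (k n) \<xi> s = r n s + (LBINT x:{X s \<xi>..X s \<xi> + k n}. src s x)" for n s
    unfolding drift_def flux_def slope_def r_def U_def by (simp add: power2_eq_square power3_eq_cube field_simps)
  define m where "m n s = (LBINT x:{X s \<xi>..X s \<xi> + k n}. (vx s x)\<^sup>2)" for n s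
  have rb: "\<bar>r n s / k n\<bar> \<le> K * m n s" for n s
  proof -
    have 1: "(v s (X s \<xi> + k n) - U s \<xi>)\<^sup>2 \<le> k n * m n s" unfolding U_def m_def by (rule H1_osc[OF v_H1 less_imp_le[OF k(1)]])
    have "\<bar>v s (X s \<xi> + k n) + 2 * U s \<xi>\<bar> / 3 \<le> K" using v_bound[of s "X s \<xi> + k n"] U_bound[of s \<xi>] by simp
    from mult_mono[OF 1 this] have "\<bar>r n s\<bar> \<le> k n * m n s * K"
      using order_trans[OF zero_le_power2 1] by (simp add: r_def abs_mult)
    then show ?thesis by (intro abs_quotient_le[OF k(1)]) (simp only: mult_ac)
  qed
  have P: "prim (pr (\<lambda>x. (vx s x)\<^sup>2)) (\<lambda>x. (vx s x)\<^sup>2)" for s by (rule prim_pr[OF loc_int_vx2])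
  have m_eq: "m n s = pr (\<lambda>x. (vx s x)\<^sup>2) (X s \<xi> + k n) - pr (\<lambda>x. (vx s x)\<^sup>2) (X s \<xi>)" for n s
    unfolding m_def using k(1)[of n] by (intro prim_integral[OF P]) simp
  have mh: "m n s \<le> h" for n s
    using prim_bound[OF P, of s h "X s \<xi>" "X s \<xi> + k n"] k[of n] by (simp add: m_eq v_periodic v_energy)
  have m0: "(\<lambda>n. m n s) \<longlonglongrightarrow> 0" for s
  proof -
    have c: "isCont (pr (\<lambda>x. (vx s x)\<^sup>2)) (X s \<xi>)" using prim_continuous[OF P[of s], of UNIV] by (simp add: continuous_on_eq_continuous_at)
    have "(\<lambda>n. X s \<xi> + k n) \<longlonglongrightarrow> X s \<xi> + 0" by (intro tendsto_intros k0)
    then have "(\<lambda>n. X s \<xi> + k n) \<longlonglongrightarrow> X s \<xi>" by simp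
    from tendsto_diff[OF isCont_tendsto_compose[OF c this] tendsto_const[of "pr (\<lambda>x. (vx s x)\<^sup>2) (X s \<xi>)"]] show ?thesis unfolding m_eq by simp
  qed
  have sl: "(\<lambda>n. (LBINT x:{X s \<xi>..X s \<xi> + k n}. src s x) / k n) \<longlonglongrightarrow> src s (X s \<xi>)" for s
  proof -
    have "(pr (src s) has_real_derivative src s (X s \<xi>)) (at (X s \<xi>))" by (rule prim_DERIV[OF prim_pr[OF loc_int_src] src_continuous])
    then have "((\<lambda>h. (pr (src s) (X s \<xi> + h) - pr (src s) (X s \<xi>)) / h) \<longlongrightarrow> src s (X s \<xi>)) (at 0)" by (simp add: DERIV_def)
    moreover have "filterlim k (at 0) sequentially" using k0 k(1) by (auto simp: filterlim_at less_imp_neq[symmetric])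
    ultimately have "(\<lambda>n. (pr (src s) (X s \<xi> + k n) - pr (src s) (X s \<xi>)) / k n) \<longlonglongrightarrow> src s (X s \<xi>)"
      by (rule filterlim_compose)
    then show ?thesis using k(1) by (simp add: prim_integral[OF prim_pr[OF loc_int_src]] less_imp_le)
  qed
  have sb: "\<bar>(LBINT x:{X s \<xi>..X s \<xi> + k n}. src s x) / k n\<bar> \<le> Cs" for n s
  proof (rule abs_quotient_le[OF k(1)])
    show "\<bar>LBINT x:{X s \<xi>..X s \<xi> + k n}. src s x\<bar> \<le> k n * Cs"
      using set_integral_norm_le[of "X s \<xi>" "X s \<xi> + k n" "src s" Cs] k(1)[of n] src_bound by (simp add: mult.commute)
  qed
  have "(\<lambda>n. LBINT s:{0..t}. drift (k n) \<xi> s / k n) \<longlonglongrightarrow> (LBINT s:{0..t}. src s (X s \<xi>))"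
    unfolding set_lebesgue_integral_def
  proof (rule integral_dominated_convergence[where w = "\<lambda>s. indicator {0..t} s *\<^sub>R (K * h + Cs)"])
    show "integrable lborel (\<lambda>s. indicat_real {0..t} s *\<^sub>R (K * h + Cs))"
      using set_integrable_const_Icc[of 0 t "K * h + Cs"] by (simp add: set_integrable_def)
    show "(\<lambda>s. indicat_real {0..t} s *\<^sub>R src s (X s \<xi>)) \<in> borel_measurable lborel"
      using measurable_slice[OF along_X_measurable[OF src_measurable], of \<xi>] by simp
    show "(\<lambda>s. indicat_real {0..t} s *\<^sub>R (drift (k n) \<xi> s / k n)) \<in> borel_measurable lborel" for n
      using drift_measurable[OF less_imp_le[OF k(1)], of n \<xi>] by simp
    show "AE s in lborel. (\<lambda>n. indicat_real {0..t} s *\<^sub>R (drift (k n) \<xi> s / k n)) \<longlonglongrightarrow> indicat_real {0..t} s *\<^sub>R src s (X s \<xi>)"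
    proof (intro always_eventually allI tendsto_scaleR tendsto_const)
      fix s
      have Km: "(\<lambda>n. K * m n s) \<longlonglongrightarrow> 0" using tendsto_mult_left[OF m0[of s], of K] by simp
      have "(\<lambda>n. r n s / k n) \<longlonglongrightarrow> 0"
        by (rule Lim_null_comparison[OF _ Km]) (use rb in simp)
      from tendsto_add[OF this sl[of s]] show "(\<lambda>n. drift (k n) \<xi> s / k n) \<longlonglongrightarrow> src s (X s \<xi>)"
        by (simp add: dr add_divide_distrib)
    qed
    show "AE s in lborel. norm (indicat_real {0..t} s *\<^sub>R (drift (k n) \<xi> s / k n)) \<le> indicat_real {0..t} s *\<^sub>R (K * h + Cs)" for n
    proof (intro always_eventually allI)
      fix s
      have "K * m n s \<le> K * h" by (rule mult_left_mono[OF mh K_nonneg])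
      then have "\<bar>drift (k n) \<xi> s / k n\<bar> \<le> K * h + Cs" using rb[of n s] sb[of s n] unfolding dr add_divide_distrib by linarith
      then show "norm (indicat_real {0..t} s *\<^sub>R (drift (k n) \<xi> s / k n)) \<le> indicat_real {0..t} s *\<^sub>R (K * h + Cs)"
        by (simp add: indicator_def)
    qed
  qed
  then have "(\<lambda>n. win (k n) 0 (X 0 \<xi>) / k n + (LBINT s:{0..t}. drift (k n) \<xi> s / k n)) \<longlonglongrightarrow> v 0 (X 0 \<xi>) + (LBINT s:{0..t}. src s (X s \<xi>))"
    by (intro tendsto_add win_lim)
  moreover have "win (k n) 0 (X 0 \<xi>) / k n + (LBINT s:{0..t}. drift (k n) \<xi> s / k n) = win (k n) t (X t \<xi>) / k n" for n
    unfolding window_along_characteristic[OF t less_imp_le[OF k(1)] k(2)] by (simp add: add_divide_distrib)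
  ultimately have "(\<lambda>n. win (k n) t (X t \<xi>) / k n) \<longlonglongrightarrow> v 0 (X 0 \<xi>) + (LBINT s:{0..t}. src s (X s \<xi>))" by simp
  from LIMSEQ_unique[OF win_lim this] show ?thesis
    using X_characteristic[of 0 \<xi>] by (simp add: U_def v_0)
qed

end

section \<open>The closed system for (X, U) and its contraction estimate\<close>

section \<open>Contraction and uniqueness\<close>

context regular_solution
begin

text \<open>This is X_\<xi> = cos^2 \<theta>, so 2 p - 1 stands for cos(2 \<theta>). In these terms
  the angle is avoided and the source depends on X through its derivative alone.\<close>

definition "p s \<xi> = 1 / \<rho> s (X s \<xi>)"

lemma prim_X: "prim (X s) (p s)"
  unfolding p_def[abs_def] by (rule lc.prim_X)

lemma p_bounds: "\<bar>2 * p s \<xi> - 1\<bar> \<le> 1"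
proof -
  have "0 \<le> p s \<xi>" "p s \<xi> \<le> 1" using lc.\<rho>_ge_1[of s "X s \<xi>"] by (simp_all add: p_def)
  then show ?thesis by linarith
qed

lemma p_continuous_mult: "loc_int (\<lambda>\<xi>. 2 * p s \<xi> - 1)"
  by (intro loc_int_diff loc_int_cmult loc_int_const prim_loc_int[OF prim_X])

lemma L_eq: "lagrangian_coords.L (vx s) = 1 + h"
  by (simp add: lc.L_def v_energy)

lemma X_period: "X s (1 + h) = X s 0 + 1"
  using lc.X_periodic[of s 0] by (simp add: L_eq)

lemma p_integral: "(LBINT \<xi>:{0..1 + h}. 2 * p s \<xi> - 1) = 1 - h"
proof -
  have P: "prim (\<lambda>\<xi>. 2 * X s \<xi> - \<xi>) (\<lambda>\<xi>. 2 * p s \<xi> - 1)"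
    by (intro prim_diff prim_cmult prim_X prim_of_DERIV) (auto intro!: derivative_eq_intros)
  show ?thesis using prim_integral[OF P, of 0 "1 + h"] h_nonneg by (simp add: X_period)
qed

lemma prim_src_X: "prim (\<lambda>\<xi>. src s (X s \<xi>)) (\<lambda>\<xi>. U s \<xi> * (2 * p s \<xi> - 1))"
proof -
  define w where "w x = v s x * (2 * (1 / \<rho> s x) - 1)" for x
  have wm: "w \<in> borel_measurable borel" unfolding w_def[abs_def]
    using loc_int_measurable[OF loc_int_v] lc.\<rho>_measurable by measurable
  have "prim (src s) (\<lambda>x. w x * \<rho> s x)"
  proof (rule prim_cong[OF prim_source[of v s vx, OF v_H1]])
    show "v s x - v s x * (vx s x)\<^sup>2 - sint (\<lambda>z. v s z - v s z * (vx s z)\<^sup>2) = w x * \<rho> s x" for x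
    proof -
      have "w x * \<rho> s x = v s x * (2 - \<rho> s x)" using lc.\<rho>_pos[of s x] by (simp add: w_def left_diff_distrib right_diff_distrib)
      then show ?thesis unfolding charge_zero by (simp add: lc.\<rho>_def algebra_simps)
    qed
  qed simp
  from lc.prim_compose_X[OF this wm] show ?thesis by (simp add: w_def U_def p_def)
qed

text \<open>f(t) is the constant that makes the source orthogonal to 1 - u_x^2 over a period. In
  labels the weight becomes 2 p - 1. With the \<xi>-derivative from \<open>prim_src_X\<close> this
  determines the source from (X, U).\<close>

lemma src_balance: "(LBINT \<xi>:{0..1 + h}. src s (X s \<xi>) * (2 * p s \<xi> - 1)) = 0"
proof -
  define w where "w x = src s x * (2 * (1 / \<rho> s x) - 1)" for x
  have [measurable]: "w \<in> borel_measurable borel" unfolding w_def[abs_def]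
    using loc_int_measurable[OF loc_int_src] lc.\<rho>_measurable by measurable
  have lq: "loc_int (\<lambda>y. 1 - (vx s y)\<^sup>2)" by (intro loc_int_diff loc_int_const loc_int_vx2)
  define D where "D = dxinv (\<lambda>z. v s z - v s z * (vx s z)\<^sup>2)"
  have Dc: "continuous_on UNIV D" unfolding D_def by (rule prim_continuous[OF prim_dxinv[OF loc_int_charge[OF v_H1]]])
  have "(LBINT \<xi>:{0..1 + h}. w (X s \<xi>)) = (LBINT x:{X s 0..X s 0 + 1}. w x * \<rho> s x)"
    using lc.integral_X(1)[of w 0 "1 + h" s] h_nonneg by (simp add: X_period)
  also have "(\<lambda>x. w x * \<rho> s x) = (\<lambda>x. (1 - (vx s x)\<^sup>2) * src s x)"
  proof
    fix x
    have "w x * \<rho> s x = src s x * (2 - \<rho> s x)" using lc.\<rho>_pos[of s x] by (simp add: w_def left_diff_distrib right_diff_distrib)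
    then show "w x * \<rho> s x = (1 - (vx s x)\<^sup>2) * src s x" by (simp add: lc.\<rho>_def)
  qed
  also have "(LBINT x:{X s 0..X s 0 + 1}. (1 - (vx s x)\<^sup>2) * src s x) = sint (\<lambda>x. (1 - (vx s x)\<^sup>2) * src s x)"
    by (rule sint_period[OF loc_int_mult_right[OF lq src_continuous]]) (simp add: v_periodic source_periodic[of v s vx, OF v_H1])
  also have "\<dots> = sint (\<lambda>x. (1 - (vx s x)\<^sup>2) * D x - fterm h v vx s * (1 - (vx s x)\<^sup>2))"
    by (rule arg_cong[of _ _ sint]) (simp add: fun_eq_iff source_def D_def algebra_simps)
  also have "\<dots> = sint (\<lambda>x. (1 - (vx s x)\<^sup>2) * D x) - fterm h v vx s * sint (\<lambda>x. 1 - (vx s x)\<^sup>2)"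
    by (simp only: sint_diff[OF loc_int_mult_right[OF lq Dc] loc_int_cmult[OF lq]] sint_cmult)
  also have "sint (\<lambda>x. 1 - (vx s x)\<^sup>2) = 1 - h" by (simp add: sint_diff loc_int_const loc_int_vx2 sint_const v_energy)
  also have "fterm h v vx s * (1 - h) = sint (\<lambda>x. (1 - (vx s x)\<^sup>2) * D x)" using h_ne_1 by (simp add: fterm_def D_def)
  finally show ?thesis by (simp add: w_def p_def)
qed

end

lemma exp_integral_le: "0 < l \<Longrightarrow> 0 \<le> t \<Longrightarrow> (LBINT s:{0..t}. exp (l * s)) \<le> exp (l * t) / (l :: real)"
proof -
  assume l: "0 < l" and t: "0 \<le> t"
  have P: "prim (\<lambda>s. exp (l * s) / l) (\<lambda>s. exp (l * s))"
    by (rule prim_of_DERIV) (use l in \<open>auto intro!: derivative_eq_intros continuous_intros\<close>)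
  show ?thesis using prim_integral[OF P t] l by simp
qed

locale two_solutions = A: regular_solution u0 u0' v\<^sub>1 vx\<^sub>1 G\<^sub>1 K\<^sub>1 q\<^sub>1 + B: regular_solution u0 u0' v\<^sub>2 vx\<^sub>2 G\<^sub>2 K\<^sub>2 q\<^sub>2
  for u0 u0' v\<^sub>1 vx\<^sub>1 G\<^sub>1 K\<^sub>1 q\<^sub>1 v\<^sub>2 vx\<^sub>2 G\<^sub>2 K\<^sub>2 q\<^sub>2
begin

abbreviation "\<D>\<^sub>1 s \<xi> \<equiv> A.src s (A.X s \<xi>)"
abbreviation "\<D>\<^sub>2 s \<xi> \<equiv> B.src s (B.X s \<xi>)"

definition "C1 = 2 * (1 + A.h) + 4 * K\<^sub>2"
definition "C2 = C1 + (C1 * (1 + A.h) + 4 * B.Cs + 2 * K\<^sub>2 * (1 + A.h)) / \<bar>1 - A.h\<bar>"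

text \<open>The source depends on \<open>X\<close> through its derivative, but only linearly, so integration by parts bounds the difference of the sources by \<open>X\<close> and \<open>U\<close> alone.\<close>

lemma source_difference:
  assumes D: "\<And>\<xi>. 0 \<le> \<xi> \<Longrightarrow> \<xi> \<le> 1 + A.h \<Longrightarrow> \<bar>A.X s \<xi> - B.X s \<xi>\<bar> \<le> D" "\<And>\<xi>. 0 \<le> \<xi> \<Longrightarrow> \<xi> \<le> 1 + A.h \<Longrightarrow> \<bar>A.U s \<xi> - B.U s \<xi>\<bar> \<le> D"
    and \<xi>: "0 \<le> \<xi>" "\<xi> \<le> 1 + A.h"
  shows "\<bar>\<D>\<^sub>1 s \<xi> - \<D>\<^sub>2 s \<xi>\<bar> \<le> C2 * D"
proof -
  have L: "0 \<le> 1 + A.h" using A.h_nonneg by simp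
  have D0: "0 \<le> D" using D(1)[of 0] L abs_ge_zero[of "A.X s 0 - B.X s 0"] by linarith
  note K0 = B.K_nonneg
  define E where "E \<eta> = A.X s \<eta> - B.X s \<eta>" for \<eta>
  define M where "M \<eta> = A.U s \<eta> - B.U s \<eta>" for \<eta>
  define Q where "Q \<eta> = \<D>\<^sub>1 s \<eta> - \<D>\<^sub>2 s \<eta>" for \<eta>
  define a where "a \<eta> = 2 * A.p s \<eta> - 1" for \<eta>
  define b where "b \<eta> = 2 * B.p s \<eta> - 1" for \<eta>
  define du where "du \<eta> = vx\<^sub>2 s (B.X s \<eta>) / B.\<rho> s (B.X s \<eta>)" for \<eta>
  have du: "\<bar>du \<eta>\<bar> \<le> 1 / 2" for \<eta> unfolding du_def by (rule B.lc.deriv_f_X_bound)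
  have ab: "\<bar>a \<eta>\<bar> \<le> 1" "\<bar>b \<eta>\<bar> \<le> 1" for \<eta> unfolding a_def b_def by (rule A.p_bounds, rule B.p_bounds)
  have E: "\<bar>E \<eta>\<bar> \<le> D" and M: "\<bar>M \<eta>\<bar> \<le> D" if "0 \<le> \<eta>" "\<eta> \<le> 1 + A.h" for \<eta> using D[OF that] by (simp_all add: E_def M_def)
  have pE: "prim E (\<lambda>\<eta>. (a \<eta> - b \<eta>) / 2)"
    by (rule prim_cong[OF prim_diff[OF A.prim_X[of s] B.prim_X[of s]]]) (simp_all add: E_def a_def b_def mult.commute)
  have pU: "prim (B.U s) du" unfolding du_def[abs_def] by (rule B.prim_U)
  have p2: "prim (\<D>\<^sub>2 s) (\<lambda>\<eta>. B.U s \<eta> * b \<eta>)" unfolding b_def by (rule B.prim_src_X)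
  have pQ: "prim Q (\<lambda>\<eta>. A.U s \<eta> * a \<eta> - B.U s \<eta> * b \<eta>)"
    unfolding a_def b_def Q_def[abs_def] by (rule prim_diff[OF A.prim_src_X B.prim_src_X])
  have prod: "\<bar>x * y\<bar> \<le> X * Y" if "\<bar>x\<bar> \<le> X" "\<bar>y\<bar> \<le> Y" for x y X Y :: real
    unfolding abs_mult using that by (intro mult_mono) auto
  have UE: "\<bar>B.U s \<eta> * E \<eta>\<bar> \<le> K\<^sub>2 * D" if "0 \<le> \<eta>" "\<eta> \<le> 1 + A.h" for \<eta> by (rule prod[OF B.U_bound E[OF that]])
  have var: "\<bar>Q \<eta> - Q 0\<bar> \<le> C1 * D" if \<eta>: "0 \<le> \<eta>" "\<eta> \<le> 1 + A.h" for \<eta>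
  proof -
    \<comment> \<open>Q' equals M a + 2 U E' with U the second velocity; subtracting 2 U E removes
      E', over which there is no control.\<close>
    have P: "prim (\<lambda>\<eta>. Q \<eta> - 2 * (B.U s \<eta> * E \<eta>)) (\<lambda>\<eta>. M \<eta> * a \<eta> - 2 * (du \<eta> * E \<eta>))"
      by (rule prim_cong[OF prim_diff[OF pQ prim_cmult[OF prim_mult[OF pU pE], of 2]]]) (simp_all add: M_def field_simps)
    have "norm (LBINT x:{0..\<eta>}. M x * a x - 2 * (du x * E x)) \<le> 2 * D * (\<eta> - 0)"
    proof (rule set_integral_norm_le[OF \<eta>(1)])
      fix x assume x: "x \<in> {0..\<eta>}"
      then have x': "0 \<le> x" "x \<le> 1 + A.h" using \<eta> by auto
      from prod[OF M[OF x'] ab(1)[of x]] prod[OF du[of x] E[OF x']] show "norm (M x * a x - 2 * (du x * E x)) \<le> 2 * D" unfolding real_norm_def by linarith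
    qed
    also have "2 * D * (\<eta> - 0) \<le> 2 * D * (1 + A.h)" using \<eta> D0 by (intro mult_left_mono) auto
    finally have "\<bar>Q \<eta> - 2 * (B.U s \<eta> * E \<eta>) - (Q 0 - 2 * (B.U s 0 * E 0))\<bar> \<le> 2 * D * (1 + A.h)"
      using prim_integral[OF P \<eta>(1)] by simp
    then have "\<bar>Q \<eta> - Q 0\<bar> \<le> 2 * D * (1 + A.h) + 4 * (K\<^sub>2 * D)" using UE[OF \<eta>] UE[of 0] L by linarith
    also have "\<dots> = C1 * D" by (simp add: C1_def algebra_simps)
    finally show ?thesis .
  qed
  have c: "continuous_on UNIV Q" "continuous_on UNIV (\<D>\<^sub>2 s)" "continuous_on UNIV (\<D>\<^sub>1 s)" "continuous_on UNIV E"
    by (rule prim_continuous[OF pQ] prim_continuous[OF p2] prim_continuous[OF A.prim_src_X] prim_continuous[OF pE])+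
  have la: "loc_int a" "loc_int b" unfolding a_def[abs_def] b_def[abs_def] by (rule A.p_continuous_mult, rule B.p_continuous_mult)
  let ?I = "\<lambda>f. LBINT x:{0..1 + A.h}. f x"
  note li = loc_int_integrable[of _ 0 "1 + A.h"]
  have l: "loc_int (\<lambda>x. Q 0 * a x)" "loc_int (\<lambda>x. (Q x - Q 0) * a x)" "loc_int (\<lambda>x. \<D>\<^sub>2 s x * (a x - b x))"
    "loc_int (\<lambda>x. \<D>\<^sub>1 s x * a x)" "loc_int (\<lambda>x. \<D>\<^sub>2 s x * b x)"
    by (intro loc_int_cmult loc_int_mult_continuous loc_int_diff continuous_intros c la)+
  have z: "?I (\<lambda>x. \<D>\<^sub>1 s x * a x) = 0" "?I (\<lambda>x. \<D>\<^sub>2 s x * b x) = 0" unfolding a_def b_def by (rule A.src_balance, rule B.src_balance)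
  \<comment> \<open>The two balance conditions determine Q(0), because the weight a has integral 1 -
    h \<noteq> 0.\<close>
  have "0 = ?I (\<lambda>x. \<D>\<^sub>1 s x * a x - \<D>\<^sub>2 s x * b x)" using z by (simp add: set_integral_diff(2)[OF li[OF l(4)] li[OF l(5)]])
  also have "\<dots> = ?I (\<lambda>x. Q 0 * a x + (Q x - Q 0) * a x + \<D>\<^sub>2 s x * (a x - b x))"
    by (rule arg_cong[of _ _ ?I]) (simp add: fun_eq_iff Q_def algebra_simps)
  also have "\<dots> = ?I (\<lambda>x. Q 0 * a x) + ?I (\<lambda>x. (Q x - Q 0) * a x) + ?I (\<lambda>x. \<D>\<^sub>2 s x * (a x - b x))"
    by (simp only: set_integral_add(2)[OF li[OF loc_int_add[OF l(1,2)]] li[OF l(3)]] set_integral_add(2)[OF li[OF l(1)] li[OF l(2)]])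
  also have "?I (\<lambda>x. Q 0 * a x) = Q 0 * (1 - A.h)" using A.p_integral[of s] by (simp add: a_def)
  finally have e: "Q 0 * (1 - A.h) = - ?I (\<lambda>x. (Q x - Q 0) * a x) - ?I (\<lambda>x. \<D>\<^sub>2 s x * (a x - b x))" by linarith
  have b1: "\<bar>?I (\<lambda>x. (Q x - Q 0) * a x)\<bar> \<le> C1 * D * (1 + A.h)"
  proof -
    have "norm (?I (\<lambda>x. (Q x - Q 0) * a x)) \<le> C1 * D * (1 + A.h - 0)"
    proof (rule set_integral_norm_le[OF L])
      fix x assume "x \<in> {0..1 + A.h}"
      then have "0 \<le> x" "x \<le> 1 + A.h" by auto
      from prod[OF var[OF this] ab(1)[of x]] show "norm ((Q x - Q 0) * a x) \<le> C1 * D" by simp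
    qed
    then show ?thesis by simp
  qed
  have b2: "\<bar>?I (\<lambda>x. \<D>\<^sub>2 s x * (a x - b x))\<bar> \<le> 4 * B.Cs * D + 2 * K\<^sub>2 * D * (1 + A.h)"
  proof -
    \<comment> \<open>Since a - b = 2 E', integration by parts again trades E' for E, at the price
      of boundary terms.\<close>
    have P: "prim (\<lambda>x. 2 * (\<D>\<^sub>2 s x * E x)) (\<lambda>x. \<D>\<^sub>2 s x * (a x - b x) + 2 * (B.U s x * b x * E x))"
      by (rule prim_cong[OF prim_cmult[OF prim_mult[OF p2 pE], of 2]]) (simp_all add: field_simps)
    have lb: "loc_int (\<lambda>x. 2 * (B.U s x * b x * E x))"
      by (intro loc_int_cmult loc_int_mult_right[OF _ c(4)] loc_int_mult_continuous la prim_continuous[OF pU])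
    have "?I (\<lambda>x. \<D>\<^sub>2 s x * (a x - b x)) + ?I (\<lambda>x. 2 * (B.U s x * b x * E x)) = 2 * (\<D>\<^sub>2 s (1 + A.h) * E (1 + A.h)) - 2 * (\<D>\<^sub>2 s 0 * E 0)"
      using prim_integral[OF P L] set_integral_add(2)[OF li[OF l(3)] li[OF lb]] by simp
    moreover have "\<bar>\<D>\<^sub>2 s x * E x\<bar> \<le> B.Cs * D" if "0 \<le> x" "x \<le> 1 + A.h" for x by (rule prod[OF B.src_bound E[OF that]])
    from this[of 0] this[of "1 + A.h"] L have "\<bar>2 * (\<D>\<^sub>2 s (1 + A.h) * E (1 + A.h)) - 2 * (\<D>\<^sub>2 s 0 * E 0)\<bar> \<le> 4 * (B.Cs * D)" by linarith
    moreover have "norm (?I (\<lambda>x. 2 * (B.U s x * b x * E x))) \<le> 2 * K\<^sub>2 * D * (1 + A.h - 0)"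
    proof (rule set_integral_norm_le[OF L])
      fix x assume x: "x \<in> {0..1 + A.h}"
      then have "0 \<le> x" "x \<le> 1 + A.h" by auto
      from prod[OF prod[OF B.U_bound[of s x] ab(2)[of x]] E[OF this]] show "norm (2 * (B.U s x * b x * E x)) \<le> 2 * K\<^sub>2 * D"
        unfolding real_norm_def by (simp only: abs_mult[of 2] abs_numeral)
    qed
    ultimately show ?thesis by simp
  qed
  have "\<bar>Q 0\<bar> * \<bar>1 - A.h\<bar> \<le> (C1 * (1 + A.h) + 4 * B.Cs + 2 * K\<^sub>2 * (1 + A.h)) * D"
    unfolding abs_mult[symmetric] e using b1 b2 by (simp add: algebra_simps abs_le_iff)
  then have "\<bar>Q 0\<bar> \<le> (C1 * (1 + A.h) + 4 * B.Cs + 2 * K\<^sub>2 * (1 + A.h)) * D / \<bar>1 - A.h\<bar>"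
    using A.h_ne_1 by (simp add: pos_le_divide_eq)
  then have "\<bar>Q \<xi>\<bar> \<le> C1 * D + (C1 * (1 + A.h) + 4 * B.Cs + 2 * K\<^sub>2 * (1 + A.h)) * D / \<bar>1 - A.h\<bar>" using var[OF \<xi>] by linarith
  also have "\<dots> = C2 * D" by (simp add: C2_def distrib_right)
  finally show ?thesis by (simp add: Q_def)
qed

definition "\<mu> = 2 * (K\<^sub>1 + K\<^sub>2 + C2) + 1"

abbreviation "close c \<equiv> \<forall>t\<in>A.G\<^sub>0 \<inter> B.G\<^sub>0. \<forall>\<xi>\<in>{0..1 + A.h}. \<bar>A.X t \<xi> - B.X t \<xi>\<bar> \<le> c * exp (\<mu> * t) \<and> \<bar>A.U t \<xi> - B.U t \<xi>\<bar> \<le> c * exp (\<mu> * t)"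

lemma C2_nonneg: "0 \<le> C2" and rate: "1 \<le> \<mu>" "2 * (K\<^sub>1 + K\<^sub>2) \<le> \<mu>" "2 * C2 \<le> \<mu>"
proof -
  show c: "0 \<le> C2" using A.h_nonneg B.K_nonneg B.Cs_nonneg by (simp add: C2_def C1_def)
  show "1 \<le> \<mu>" "2 * (K\<^sub>1 + K\<^sub>2) \<le> \<mu>" "2 * C2 \<le> \<mu>" using c A.K_nonneg B.K_nonneg by (simp_all add: \<mu>_def)
qed

lemma integrated_bound:
  assumes t: "0 \<le> t" and g: "set_integrable lborel {0..t} g" and C: "2 * C \<le> \<mu>" "0 \<le> C" "0 \<le> c"
    and b: "AE s in lborel. s \<in> {0..t} \<longrightarrow> \<bar>g s\<bar> \<le> C * (c * exp (\<mu> * s))"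
  shows "\<bar>LBINT s:{0..t}. g s\<bar> \<le> c / 2 * exp (\<mu> * t)"
proof -
  have l0: "0 < \<mu>" using rate(1) by simp
  have e: "set_integrable lborel {0..t} (\<lambda>s. C * c * exp (\<mu> * s))"
    by (intro loc_int_integrable loc_int_continuous continuous_intros)
  have "\<bar>LBINT s:{0..t}. g s\<bar> \<le> (LBINT s:{0..t}. \<bar>g s\<bar>)" using set_integral_norm_bound[OF g] by simp
  also have "\<dots> \<le> (LBINT s:{0..t}. C * c * exp (\<mu> * s))"
    using b by (intro set_integral_mono_AE set_integrable_abs g e) (auto elim!: eventually_mono simp: mult.assoc)
  also have "\<dots> = C * c * (LBINT s:{0..t}. exp (\<mu> * s))" by simp
  also have "\<dots> \<le> C * c * (exp (\<mu> * t) / \<mu>)" using C exp_integral_le[OF l0 t] by (intro mult_left_mono) auto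
  also have "\<dots> = (2 * C) * (c / 2 * exp (\<mu> * t)) / \<mu>" by simp
  also have "\<dots> \<le> \<mu> * (c / 2 * exp (\<mu> * t)) / \<mu>" using C l0 by (intro divide_right_mono mult_right_mono) auto
  also have "\<dots> = c / 2 * exp (\<mu> * t)" using l0 by simp
  finally show ?thesis .
qed

lemma contraction:
  assumes c: "close c" "0 \<le> c" shows "close (c / 2)"
proof (intro ballI conjI)
  fix t \<xi> assume t: "t \<in> A.G\<^sub>0 \<inter> B.G\<^sub>0" and \<xi>: "\<xi> \<in> {0..1 + A.h}"
  then have tA: "t \<in> A.G\<^sub>0" and tB: "t \<in> B.G\<^sub>0" by blast+
  have t0: "0 \<le> t" by (rule A.G0_nonneg[OF tA])
  have AE: "AE s in lborel. s \<in> {0..t} \<longrightarrow> s \<in> A.G\<^sub>0 \<inter> B.G\<^sub>0" using A.G_AE B.G_AE by eventually_elim auto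
  note iA = A.time_integrable[OF A.U_sq_measurable A.U_sq_bound] and iB = B.time_integrable[OF B.U_sq_measurable B.U_sq_bound]
  have eX: "A.X t \<xi> - B.X t \<xi> = (LBINT s:{0..t}. (B.U s \<xi>)\<^sup>2 - (A.U s \<xi>)\<^sup>2)"
    unfolding A.X_characteristic[OF tA] B.X_characteristic[OF tB] by (simp add: set_integral_diff(2)[OF iB iA])
  show "\<bar>A.X t \<xi> - B.X t \<xi>\<bar> \<le> c / 2 * exp (\<mu> * t)"
    unfolding eX
  proof (rule integrated_bound[OF t0 set_integral_diff(1)[OF iB iA] rate(2) _ c(2)])
    show "AE s in lborel. s \<in> {0..t} \<longrightarrow> \<bar>(B.U s \<xi>)\<^sup>2 - (A.U s \<xi>)\<^sup>2\<bar> \<le> (K\<^sub>1 + K\<^sub>2) * (c * exp (\<mu> * s))"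
      using AE
    proof eventually_elim
      case (elim s)
      show ?case
      proof
        assume "s \<in> {0..t}"
        then have U: "\<bar>A.U s \<xi> - B.U s \<xi>\<bar> \<le> c * exp (\<mu> * s)" using elim c(1) \<xi> by blast
        have "(B.U s \<xi>)\<^sup>2 - (A.U s \<xi>)\<^sup>2 = - ((A.U s \<xi> + B.U s \<xi>) * (A.U s \<xi> - B.U s \<xi>))" by (simp add: power2_eq_square algebra_simps)
        then have "\<bar>(B.U s \<xi>)\<^sup>2 - (A.U s \<xi>)\<^sup>2\<bar> = \<bar>A.U s \<xi> + B.U s \<xi>\<bar> * \<bar>A.U s \<xi> - B.U s \<xi>\<bar>" by (simp only: abs_minus_cancel abs_mult)
        also have "\<dots> \<le> (K\<^sub>1 + K\<^sub>2) * (c * exp (\<mu> * s))"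
        proof (rule mult_mono[OF _ U])
          show "\<bar>A.U s \<xi> + B.U s \<xi>\<bar> \<le> K\<^sub>1 + K\<^sub>2" using A.U_bound[of s \<xi>] B.U_bound[of s \<xi>] by linarith
        qed (use A.K_nonneg B.K_nonneg in auto)
        finally show "\<bar>(B.U s \<xi>)\<^sup>2 - (A.U s \<xi>)\<^sup>2\<bar> \<le> (K\<^sub>1 + K\<^sub>2) * (c * exp (\<mu> * s))" .
      qed
    qed
  qed (use A.K_nonneg B.K_nonneg in auto)
  note jA = A.time_integrable[OF A.along_X_measurable[OF A.src_measurable] A.src_bound]
    and jB = B.time_integrable[OF B.along_X_measurable[OF B.src_measurable] B.src_bound]
  have eU: "A.U t \<xi> - B.U t \<xi> = (LBINT s:{0..t}. \<D>\<^sub>1 s \<xi> - \<D>\<^sub>2 s \<xi>)"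
    unfolding A.U_characteristic[OF tA] B.U_characteristic[OF tB] by (simp add: set_integral_diff(2)[OF jA jB])
  show "\<bar>A.U t \<xi> - B.U t \<xi>\<bar> \<le> c / 2 * exp (\<mu> * t)"
    unfolding eU
  proof (rule integrated_bound[OF t0 set_integral_diff(1)[OF jA jB] rate(3) C2_nonneg c(2)])
    show "AE s in lborel. s \<in> {0..t} \<longrightarrow> \<bar>\<D>\<^sub>1 s \<xi> - \<D>\<^sub>2 s \<xi>\<bar> \<le> C2 * (c * exp (\<mu> * s))"
      using AE
    proof eventually_elim
      case (elim s)
      then show ?case using c(1) \<xi> by (auto intro!: source_difference)
    qed
  qed
qed

lemma close_initial: "close (K\<^sub>1\<^sup>2 + K\<^sub>2\<^sup>2 + K\<^sub>1 + K\<^sub>2)"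
proof (intro ballI conjI)
  fix t \<xi> assume t: "t \<in> A.G\<^sub>0 \<inter> B.G\<^sub>0"
  then have tA: "t \<in> A.G\<^sub>0" and tB: "t \<in> B.G\<^sub>0" by blast+
  have t0: "0 \<le> t" by (rule A.G0_nonneg[OF tA])
  have "1 * t \<le> \<mu> * t" by (rule mult_right_mono[OF rate(1) t0])
  \<comment> \<open>The exponential absorbs the linear growth of the displacement, so the crude a
    priori bounds start the iteration.\<close>
  then have et: "1 + t \<le> exp (\<mu> * t)" using exp_ge_add_one_self[of "\<mu> * t"] by linarith
  have mt: "0 \<le> \<mu> * t" using rate(1) t0 by simp
  have x0: "A.X 0 \<xi> = B.X 0 \<xi>"
    using A.X_characteristic[of 0 \<xi>] B.X_characteristic[of 0 \<xi>] by simp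
  have "\<bar>A.X t \<xi> - B.X t \<xi>\<bar> \<le> K\<^sub>1\<^sup>2 * (t - 0) + K\<^sub>2\<^sup>2 * (t - 0)"
    using A.X_increment(2)[OF _ tA t0, of \<xi>] B.X_increment(2)[OF _ tB t0, of \<xi>] x0 by simp
  also have "\<dots> = (K\<^sub>1\<^sup>2 + K\<^sub>2\<^sup>2) * t" by (simp add: distrib_right)
  also have "\<dots> \<le> (K\<^sub>1\<^sup>2 + K\<^sub>2\<^sup>2 + K\<^sub>1 + K\<^sub>2) * exp (\<mu> * t)" using A.K_nonneg B.K_nonneg t0 et mt by (intro mult_mono) auto
  finally show "\<bar>A.X t \<xi> - B.X t \<xi>\<bar> \<le> (K\<^sub>1\<^sup>2 + K\<^sub>2\<^sup>2 + K\<^sub>1 + K\<^sub>2) * exp (\<mu> * t)" .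
  have "\<bar>A.U t \<xi> - B.U t \<xi>\<bar> \<le> (K\<^sub>1 + K\<^sub>2) * 1"
    using order_trans[OF abs_triangle_ineq4 add_mono[OF A.U_bound[of t \<xi>] B.U_bound[of t \<xi>]]] by simp
  also have "\<dots> \<le> (K\<^sub>1\<^sup>2 + K\<^sub>2\<^sup>2 + K\<^sub>1 + K\<^sub>2) * exp (\<mu> * t)" using A.K_nonneg B.K_nonneg t0 et mt by (intro mult_mono) auto
  finally show "\<bar>A.U t \<xi> - B.U t \<xi>\<bar> \<le> (K\<^sub>1\<^sup>2 + K\<^sub>2\<^sup>2 + K\<^sub>1 + K\<^sub>2) * exp (\<mu> * t)" .
qed

lemma solutions_agree:
  assumes t: "t \<in> G\<^sub>1" "t \<in> G\<^sub>2" shows "v\<^sub>1 t = v\<^sub>2 t"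
proof
  fix x
  define c where "c n = (K\<^sub>1\<^sup>2 + K\<^sub>2\<^sup>2 + K\<^sub>1 + K\<^sub>2) * (1 / 2) ^ n" for n :: nat
  have c0: "0 \<le> c n" for n using A.K_nonneg B.K_nonneg by (simp add: c_def)
  have cln: "close (c n)" for n
    proof (induction n)
      case 0 show ?case using close_initial by (simp add: c_def)
    next
      case (Suc n)
      have cS: "c (Suc n) = c n / 2" by (simp add: c_def)
      show ?case unfolding cS by (rule contraction[OF Suc c0])
    qed
  have "t \<in> A.G\<^sub>0 \<inter> B.G\<^sub>0" using t by simp
  note cl = cln[rule_format, OF this, THEN conjunct1] cln[rule_format, OF this, THEN conjunct2]
  have "(\<lambda>n. c n * exp (\<mu> * t)) \<longlonglongrightarrow> (K\<^sub>1\<^sup>2 + K\<^sub>2\<^sup>2 + K\<^sub>1 + K\<^sub>2) * 0 * exp (\<mu> * t)"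
    unfolding c_def by (intro tendsto_intros LIMSEQ_power_zero) simp
  then have lim: "(\<lambda>n. c n * exp (\<mu> * t)) \<longlonglongrightarrow> 0" by simp
  have eq: "A.X t \<xi> = B.X t \<xi>" "A.U t \<xi> = B.U t \<xi>" if \<xi>: "\<xi> \<in> {0..1 + A.h}" for \<xi>
    using LIMSEQ_le_const[OF lim, of "\<bar>A.X t \<xi> - B.X t \<xi>\<bar>"] LIMSEQ_le_const[OF lim, of "\<bar>A.U t \<xi> - B.U t \<xi>\<bar>"] cl[OF \<xi>] by auto
  \<comment> \<open>The labels from 0 to 1 + h cover one period of x starting at the position
    \<open>a\<close> of label 0. Pairing the two solutions in \<open>f\<close> reduces x to that
    period for both at once.\<close>
  define a where "a = A.X t 0"
  define f where "f z = (v\<^sub>1 t (z + a), v\<^sub>2 t (z + a))" for z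
  have "f (z + 1) = f z" for z using A.v_periodic(1)[of t "z + a"] B.v_periodic(1)[of t "z + a"] by (simp add: f_def add_ac)
  then obtain y where y: "0 \<le> y" "y < 1" "f (x - a) = f y" by (rule periodic_floor[of f 1 "x - a"]) auto
  define \<xi> where "\<xi> = A.\<Xi> t (y + a)"
  have Xy: "A.X t \<xi> = y + a" by (simp add: \<xi>_def A.lc.X_R)
  have "0 \<le> \<xi>" unfolding \<xi>_def using y(1) by (simp add: a_def flip: A.lc.X_le_iff)
  moreover have "\<xi> \<le> 1 + A.h" unfolding \<xi>_def using y(2) A.X_period[of t] by (simp add: a_def flip: A.lc.le_X_iff)
  ultimately have "\<xi> \<in> {0..1 + A.h}" by simp
  from eq[OF this] have "v\<^sub>1 t (y + a) = v\<^sub>2 t (y + a)" by (simp add: A.U_def B.U_def Xy flip: Xy)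
  then show "v\<^sub>1 t x = v\<^sub>2 t x" using y(3) by (simp add: f_def)
qed

end

lemma (in pulse_datum) uniqueness:
  assumes "cons_weak_sol u0 u0' u ux" "cons_weak_sol u0 u0' v vx"
  shows "AE t in lborel. 0 \<le> t \<longrightarrow> u t = v t"
proof -
  have rep: "\<exists>w wx G K q. regular_solution u0 u0' w wx G K q \<and> (\<forall>t\<in>G. w t = u t)" if u: "cons_weak_sol u0 u0' u ux" for u ux
  proof -
    interpret weak_solution u0 u0' "\<lambda>t. u (max 0 t)" "\<lambda>t. ux (max 0 t)"
    proof
      show "cons_weak_sol u0 u0' (\<lambda>t. u (max 0 t)) (\<lambda>t. ux (max 0 t))" by (rule cons_weak_sol_max[OF u])
      show "H1_per (u (max 0 t)) (ux (max 0 t))" for t using u unfolding cons_weak_sol_def by simp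
    qed
    obtain w wx G K q where r: "regular_solution u0 u0' w wx G K q" and w: "\<And>t. t \<in> G \<Longrightarrow> w t = u (max 0 t)"
      by (rule regular_representative) blast
    have "w t = u t" if "t \<in> G" for t using w[OF that] regular_solution.G_pos[OF r that] by (simp add: max_def)
    with r show ?thesis by blast
  qed
  obtain w1 wx1 G1 K1 q1 where 1: "regular_solution u0 u0' w1 wx1 G1 K1 q1" "\<forall>t\<in>G1. w1 t = u t" using rep[OF assms(1)] by blast
  obtain w2 wx2 G2 K2 q2 where 2: "regular_solution u0 u0' w2 wx2 G2 K2 q2" "\<forall>t\<in>G2. w2 t = v t" using rep[OF assms(2)] by blast
  have two: "two_solutions u0 u0' w1 wx1 G1 K1 q1 w2 wx2 G2 K2 q2" by (intro two_solutions.intro 1 2)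
  show ?thesis using regular_solution.G_AE[OF 1(1)] regular_solution.G_AE[OF 2(1)]
  proof eventually_elim
    case (elim t)
    show ?case
    proof
      assume "0 \<le> t"
      with elim have "t \<in> G1" "t \<in> G2" by blast+
      with two_solutions.solutions_agree[OF two this] 1(2) 2(2) show "u t = v t" by simp
    qed
  qed
qed

theorem theorem2p1:
  fixes u0 u0' :: "real \<Rightarrow> real"
  assumes "H1_per u0 u0'"
    and "sint (\<lambda>x. (u0' x)\<^sup>2) \<noteq> 1"
    and "sint (\<lambda>x. u0 x - u0 x * (u0' x)\<^sup>2) = 0"
  shows "(\<exists>u ux. cons_weak_sol u0 u0' u ux) \<and>
         (\<forall>u ux v vx. cons_weak_sol u0 u0' u ux \<longrightarrow> cons_weak_sol u0 u0' v vx \<longrightarrow>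
            (AE t in lborel. t \<ge> 0 \<longrightarrow> u t = v t))"
proof -
  interpret pulse_datum u0 u0'
    by unfold_locales (rule assms)+
  show ?thesis using existence uniqueness by blast
qed

end
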